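(* Let $\mathbb{P}\,\mathrm{Cat}(2,3)$ be the projective space of catalecticant matrices of ternary quartics, and let $A\in\mathbb{P}\,\mathrm{Cat}(2,3)$ be a point of rank $r$. Then the image $\phi(A)\subset\mathbb{P}(\hat{\mathbb{S}}^6)\simeq\mathbb{P}^{20}$ of $A$ under the inversion map $\phi$ is: - a (linear) $\mathbb{P}^5$ if $r=3$, a (linear) $\mathbb{P}^2$ if $r=4$, and a point if $r=5$; - a cubic hypersurface in a (linear) $\mathbb{P}^9\subset\mathbb{P}(\hat{\mathbb{S}}^6)$ if $r=2$; - an $11$-dimensional variety contained in a (linear) $\mathbb{P}^{14}\subset\mathbb{P}(\hat{\mathbb{S}}^6)$ if $r=1$. Moreover, for each rank-$2$ point $A$, the associated cubic hypersurface $\phi(A)\subset\mathbb{P}^9$ is defined by the cubic Pfaffian of a $6\times 6$ skew-symmetric matrix (whose entries are linear forms).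
   Context: All matrices are over $\mathbb{C}$. $\mathbb{S}^6$ is the space of $6\times 6$ symmetric matrices, with rows and columns indexed by the exponent vectors $\alpha\in\mathbb{Z}_{\ge 0}^3$ with $|\alpha|=2$. $\mathrm{Cat}(2,3)\subset\mathbb{S}^6$ is the $15$-dimensional linear subspace of matrices $(a_{\alpha+\beta})_{\alpha,\beta}$ with $a_\gamma\in\mathbb{C}$ arbitrary for $\gamma\in\mathbb{Z}_{\ge0}^3$, $|\gamma|=4$, and $\mathbb{P}\,\mathrm{Cat}(2,3)\simeq\mathbb{P}^{14}$ is its projectivization. The inversion map is the rational map $\phi:\mathbb{P}(\mathbb{S}^6)\dashrightarrow\mathbb{P}(\hat{\mathbb{S}}^6)$, $[A]\mapsto[\mathrm{Adj}(A)]$ (adjugate), where $\hat{\mathbb{S}}^6$ is another copy of the space of $6\times6$ symmetric matrices. Let $\Gamma\subset\mathbb{P}\,\mathrm{Cat}(2,3)\times\mathbb{P}(\hat{\mathbb{S}}^6)$ be the Zariski closure of the graph of $\phi$ restricted to $\mathbb{P}\,\mathrm{Cat}(2,3)$, with projections $\pi_1,\pi_2$. The image of a point $A\in\mathbb{P}\,\mathrm{Cat}(2,3)$ (possibly in the indeterminacy locus of $\phi$) is the closed set $\phi(A):=\pi_2(\pi_1^{-1}(A)\cap\Gamma)\subset\mathbb{P}(\hat{\mathbb{S}}^6)$. *)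

theory Defs
  imports "HOL-Analysis.Analysis"
begin

section \<open>Symmetric matrices indexed by ternary quadratic monomials\<close>

typedef quad_exp = "{\<alpha> :: nat^3. (\<Sum>i\<in>UNIV. \<alpha> $ i) = 2}"
  by (rule exI[of _ "\<chi> i. if i = 1 then 2 else 0"]) (simp add: sum_3)

lemma eq_vector3_iff: "(\<alpha>::nat^3) = vector [a,b,c] \<longleftrightarrow> \<alpha> $ 1 = a \<and> \<alpha> $ 2 = b \<and> \<alpha> $ 3 = c"
  by (simp add: vec_eq_iff forall_3)

lemma vector3_eq_iff: "vector [x,y,z] = (vector [a,b,c] :: nat^3) \<longleftrightarrow> x = a \<and> y = b \<and> z = c"
  by (simp add: vec_eq_iff forall_3)

lemma quad_exp_set_eq:
  "{\<alpha> :: nat^3. (\<Sum>i\<in>UNIV. \<alpha> $ i) = 2} =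
     {vector [2,0,0], vector [0,2,0], vector [0,0,2], vector [1,1,0], vector [1,0,1], vector [0,1,1]}"
proof (rule set_eqI)
  fix \<alpha> :: "nat^3"
  have "a + b + c = 2 \<longleftrightarrow> (a = 2 \<and> b = 0 \<and> c = 0) \<or> (a = 0 \<and> b = 2 \<and> c = 0) \<or> (a = 0 \<and> b = 0 \<and> c = 2) \<or>
     (a = 1 \<and> b = 1 \<and> c = 0) \<or> (a = 1 \<and> b = 0 \<and> c = 1) \<or> (a = 0 \<and> b = 1 \<and> c = 1)" for a b c :: nat
    by presburger
  then show "\<alpha> \<in> {\<alpha> :: nat^3. (\<Sum>i\<in>UNIV. \<alpha> $ i) = 2} \<longleftrightarrow>
     \<alpha> \<in> {vector [2,0,0], vector [0,2,0], vector [0,0,2], vector [1,1,0], vector [1,0,1], vector [0,1,1]}"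
    by (simp only: mem_Collect_eq sum_3 insert_iff empty_iff eq_vector3_iff simp_thms)
qed

instance quad_exp :: finite
proof
  have "finite (Abs_quad_exp ` {\<alpha> :: nat^3. (\<Sum>i\<in>UNIV. \<alpha> $ i) = 2})"
    unfolding quad_exp_set_eq by simp
  then show "finite (UNIV :: quad_exp set)"
    by (simp only: type_definition.Abs_image[OF type_definition_quad_exp])
qed

lemma card_quad_exp: "CARD(quad_exp) = 6"
proof -
  have "CARD(quad_exp) = card {\<alpha> :: nat^3. (\<Sum>i\<in>UNIV. \<alpha> $ i) = 2}"
    by (rule type_definition.card[OF type_definition_quad_exp])
  also have "\<dots> = 6"
    unfolding quad_exp_set_eq by (simp add: vector3_eq_iff)
  finally show ?thesis .
qed

type_synonym mat6 = "complex^quad_exp^quad_exp"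

definition cscale :: "complex \<Rightarrow> mat6 \<Rightarrow> mat6" where
  "cscale c A = (\<chi> i j. c * A $ i $ j)"

text \<open>The complex vector space structure; the unqualified constants \<open>subspace\<close>,
  \<open>span\<close> and \<open>dim\<close> of the library are the real ones.\<close>

interpretation cmat: vector_space cscale
  by unfold_locales (auto simp: cscale_def vec_eq_iff algebra_simps)

definition Sym6 :: "mat6 set" where
  "Sym6 = {A. transpose A = A}"

definition Cat :: "mat6 set" where
  "Cat = {A. \<exists>a :: nat^3 \<Rightarrow> complex. \<forall>\<alpha> \<beta>. A $ \<alpha> $ \<beta> = a (Rep_quad_exp \<alpha> + Rep_quad_exp \<beta>)}"

text \<open>The \<open>(i,j)\<close> entry is the \<open>(j,i)\<close> cofactor: the determinant of \<open>A\<close> with row \<open>j\<close>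
  and column \<open>i\<close> replaced by unit vectors.\<close>

definition adjugate :: "mat6 \<Rightarrow> mat6" where
  "adjugate A = (\<chi> i j. det (\<chi> k l. if k = j then (if l = i then 1 else 0)
                                    else if l = i then 0 else A $ k $ l))"


section \<open>Projective spaces and their Zariski topology\<close>

definition proj_pt :: "mat6 \<Rightarrow> mat6 set" where
  "proj_pt A = cmat.span {A}"

definition proj_space :: "mat6 set \<Rightarrow> mat6 set set" where
  "proj_space V = proj_pt ` (V - {0})"

text \<open>The algebra of functions generated by the constants and a set \<open>X\<close> of coordinate functions.
  Over the infinite field of complex numbers, polynomials and polynomial functions are the same,
  and a polynomial function is a form of degree \<open>d\<close> iff it scales with the power \<open>d\<close>.\<close>

inductive_set poly_funs :: "('v \<Rightarrow> complex) set \<Rightarrow> ('v \<Rightarrow> complex) set"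
  for X :: "('v \<Rightarrow> complex) set" where
  const: "(\<lambda>_. c) \<in> poly_funs X"
| coord: "x \<in> X \<Longrightarrow> x \<in> poly_funs X"
| add: "f \<in> poly_funs X \<Longrightarrow> g \<in> poly_funs X \<Longrightarrow> (\<lambda>v. f v + g v) \<in> poly_funs X"
| mult: "f \<in> poly_funs X \<Longrightarrow> g \<in> poly_funs X \<Longrightarrow> (\<lambda>v. f v * g v) \<in> poly_funs X"

definition mat_polys :: "(mat6 \<Rightarrow> complex) set" where
  "mat_polys = poly_funs {\<lambda>A. A $ i $ j | i j. True}"

definition mat_forms :: "nat \<Rightarrow> (mat6 \<Rightarrow> complex) set" where
  "mat_forms d = {f \<in> mat_polys. \<forall>c A. f (cscale c A) = c ^ d * f A}"

definition bi_polys :: "(mat6 \<times> mat6 \<Rightarrow> complex) set" where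
  "bi_polys = poly_funs ({\<lambda>(A, B). A $ i $ j | i j. True} \<union> {\<lambda>(A, B). B $ i $ j | i j. True})"

definition bi_forms :: "nat \<Rightarrow> nat \<Rightarrow> (mat6 \<times> mat6 \<Rightarrow> complex) set" where
  "bi_forms d e = {f \<in> bi_polys. \<forall>b c A B. f (cscale b A, cscale c B) = b ^ d * c ^ e * f (A, B)}"

text \<open>For linear subspaces \<open>V\<close> and \<open>W\<close>: the Zariski topologies on \<open>\<P>(V)\<close> and on
  \<open>\<P>(V) \<times> \<P>(W)\<close>, given by their bases of nonvanishing loci of (bihomogeneous) forms.\<close>

definition zariski :: "mat6 set \<Rightarrow> mat6 set topology" where
  "zariski V = topology_generated_by
     {{proj_pt A | A. A \<in> V - {0} \<and> f A \<noteq> 0} | f d. f \<in> mat_forms d}"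

definition zariski_prod :: "mat6 set \<Rightarrow> mat6 set \<Rightarrow> (mat6 set \<times> mat6 set) topology" where
  "zariski_prod V W = topology_generated_by
     {{(proj_pt A, proj_pt B) | A B. A \<in> V - {0} \<and> B \<in> W - {0} \<and> f (A, B) \<noteq> 0} | f d e.
        f \<in> bi_forms d e}"

definition irreducible_in :: "'a topology \<Rightarrow> 'a set \<Rightarrow> bool" where
  "irreducible_in T X \<longleftrightarrow> X \<subseteq> topspace T \<and> X \<noteq> {} \<and>
     (\<forall>C D. closedin T C \<and> closedin T D \<and> X \<subseteq> C \<union> D \<longrightarrow> X \<subseteq> C \<or> X \<subseteq> D)"

text \<open>The Krull dimension of a closed set, with the convention that the empty set gets \<open>0\<close>.\<close>

definition krull_dim :: "'a topology \<Rightarrow> 'a set \<Rightarrow> enat" where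
  "krull_dim T X = Sup {enat n | n. \<exists>Z :: nat \<Rightarrow> 'a set.
     (\<forall>i\<le>n. closedin T (Z i) \<and> irreducible_in T (Z i) \<and> Z i \<subseteq> X) \<and>
     (\<forall>i<n. Z i \<subset> Z (Suc i))}"


section \<open>The inversion map on catalecticants\<close>

definition inv_graph :: "(mat6 set \<times> mat6 set) set" where
  "inv_graph = {(proj_pt A, proj_pt (adjugate A)) | A. A \<in> Cat - {0} \<and> adjugate A \<noteq> 0}"

definition Gamma_Cat :: "(mat6 set \<times> mat6 set) set" where
  "Gamma_Cat = zariski_prod Cat Sym6 closure_of inv_graph"

definition phi :: "mat6 set \<Rightarrow> mat6 set set" where
  "phi p = snd ` (fst -` {p} \<inter> Gamma_Cat)"


section \<open>Linear subspaces, cubic hypersurfaces, Pfaffians\<close>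

text \<open>\<open>\<P>(W)\<close> is a linear \<open>\<P>\<^sup>k\<close> in \<open>\<P>(Sym6)\<close>.\<close>

definition linear_P :: "nat \<Rightarrow> mat6 set \<Rightarrow> bool" where
  "linear_P k W \<longleftrightarrow> W \<subseteq> Sym6 \<and> cmat.subspace W \<and> cmat.dim W = k + 1"

text \<open>\<open>X\<close> is the hypersurface of degree \<open>3\<close> in \<open>\<P>(W)\<close> with equation \<open>F\<close>. Squarefreeness of
  \<open>F\<close> on \<open>W\<close> ensures that the reduced closed set \<open>X\<close> really has degree \<open>3\<close>.\<close>

definition cubic_hypersurface :: "mat6 set \<Rightarrow> (mat6 \<Rightarrow> complex) \<Rightarrow> mat6 set set \<Rightarrow> bool" where
  "cubic_hypersurface W F X \<longleftrightarrow>
     F \<in> mat_forms 3 \<and> (\<exists>B\<in>W. F B \<noteq> 0) \<and>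
     (\<forall>G\<in>mat_polys. \<forall>H\<in>mat_polys. (\<forall>B\<in>W. F B = (G B)\<^sup>2 * H B) \<longrightarrow> (\<exists>c. \<forall>B\<in>W. G B = c)) \<and>
     X = {proj_pt B | B. B \<in> W - {0} \<and> F B = 0}"

text \<open>The Pfaffian of a skew-symmetric \<open>2n \<times> 2n\<close> matrix, with indices \<open>0, \<dots>, 2n - 1\<close>.\<close>

definition pfaffian :: "nat \<Rightarrow> (nat \<Rightarrow> nat \<Rightarrow> complex) \<Rightarrow> complex" where
  "pfaffian n a = (\<Sum>\<sigma> | \<sigma> permutes {..<2*n}.
      of_int (sign \<sigma>) * (\<Prod>i<n. a (\<sigma> (2*i)) (\<sigma> (2*i + 1)))) / (2 ^ n * fact n)"

end

theory Submission
  imports Defs "HOL-Computational_Algebra.Fundamental_Theorem_Algebra"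
begin

text \<open>
A point of the image \<open>\<phi>(A)\<close> is the class of a symmetric matrix \<open>B\<close> such that every bihomogeneous form that
vanishes at all pairs \<open>(C, adjugate C)\<close>, \<open>C\<close> an invertible catalecticant, vanishes at \<open>(A, B)\<close>: \<open>limit_pair\<close>
and \<open>phi_eq\<close>. For a singular \<open>A\<close> this forces \<open>A B = 0\<close>, so in a basis adapted to the kernel of \<open>A\<close> the
matrix \<open>B\<close> is supported on the block of the kernel (\<open>limit_pair_in_kernel\<close>). In the other direction, along the
line \<open>A + t D\<close> the inverse is \<open>1 / t\<close> times a matrix that tends to the inverse of the restriction of \<open>D\<close> to
the kernel (\<open>limit_pair_on_kernel\<close>). So \<open>\<phi>(A)\<close> contains the closure of the set of inverses of those
symmetric forms on the kernel that are restrictions of catalecticants, and the theorem comes down to two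
questions: which forms are restrictions, and are there other limits?

Restrictions. A catalecticant is a bilinear form on ternary quadrics whose value only depends on the product of
its arguments, so the obstructions are the quadratic relations between the quadrics in the kernel. A relation
that involves only quadrics in the kernel forces the rank to be at most two (\<open>perp_kernel_two_terms\<close>). Hence in
rank at least three all symmetric forms on the kernel are restrictions, their inverses are dense, and
\<open>\<phi>(A)\<close> is the projective space of all symmetric forms on a space of dimension \<open>6 - r\<close>.

Rank two. All products of some linear form \<open>z\<close> with linear forms lie in the kernel, and in suitable coordinates the kernel is spanned by \<open>x z\<close>, \<open>y z\<close>, \<open>z\<^sup>2\<close> and \<open>y\<^sup>2 + k x y\<close> with \<open>k = 0\<close> or \<open>k = 1\<close>
(\<open>rank2_normal_form\<close>). There is one relation, \<open>(y\<^sup>2 + k x y) z\<^sup>2 = (y z)\<^sup>2 + k (x z) (y z)\<close>. It is a linear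
equation for the restriction, and so a cubic equation, in terms of cofactors, for the inverse. The same cubic
vanishes at all limits, because the Schur complement of the nondegenerate block of a nearby catalecticant
satisfies the relation up to terms that tend to zero (\<open>limit_pair_rank2_cubic\<close>). Along symmetric matrices of
rank one the cubic is linear, which yields both the density of its invertible points and the absence of square
factors. Expanding a Pfaffian shows that it is one.

Rank one. Here \<open>A\<close> is the fourth power of a linear form, the kernel consists of the five monomials other than
\<open>x\<^sup>2\<close>, and there are three relations, so the restrictions form a linear space \<open>blocks\<close> of dimension
\<open>12\<close>. Inversion is generically injective on it, so the closure of the image has projective dimension
\<open>11\<close> (\<open>krull_dim_inverse_cone\<close>): images of a flag of subspaces give a chain of length \<open>11\<close>, and
longer chains would carry more independent forms of high degree than polynomials in eleven variables can
provide. That there are no other limits is less clear than in rank two, since the defect of the Schur complement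
tends to zero but its inverse need not be controlled. The defect can be removed exactly by a unipotent change
of basis that tends to the identity (\<open>small_solution\<close>, \<open>limit_pair_rank1_inverse_cone\<close>).

Limits. A point of a Zariski closure need not be the limit of a given sequence of points, so limits are taken along a
place of the ring of all functions on the graph: a ring homomorphism defined on a subring such that every function or its
inverse lies in the subring, with \<open>0\<close> as the value of the inverse in the second case. By Zorn's lemma each point
of the closure is the value of the coordinate functions at some place (\<open>place_exists\<close>, \<open>limit_pair_place\<close>).
\<close>

section \<open>Polynomial functions\<close>

lemma poly_funs_sum:
  "finite I \<Longrightarrow> (\<And>i. i \<in> I \<Longrightarrow> f i \<in> poly_funs X) \<Longrightarrow> (\<lambda>v. \<Sum>i\<in>I. f i v) \<in> poly_funs X"
  by (induction I rule: finite_induct) (auto intro: poly_funs.intros)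

lemma poly_funs_prod:
  "finite I \<Longrightarrow> (\<And>i. i \<in> I \<Longrightarrow> f i \<in> poly_funs X) \<Longrightarrow> (\<lambda>v. \<Prod>i\<in>I. f i v) \<in> poly_funs X"
  by (induction I rule: finite_induct) (auto intro: poly_funs.intros)

lemma poly_funs_cmult: "f \<in> poly_funs X \<Longrightarrow> (\<lambda>v. c * f v) \<in> poly_funs X"
  by (rule poly_funs.mult[OF poly_funs.const])

lemma poly_funs_minus: "f \<in> poly_funs X \<Longrightarrow> (\<lambda>v. - f v) \<in> poly_funs X"
  using poly_funs_cmult[of f X "-1"] by simp

lemma poly_funs_diff:
  "f \<in> poly_funs X \<Longrightarrow> g \<in> poly_funs X \<Longrightarrow> (\<lambda>v. f v - g v) \<in> poly_funs X"
  using poly_funs.add[OF _ poly_funs_minus, of f X g] by simp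

lemma poly_funs_power: "f \<in> poly_funs X \<Longrightarrow> (\<lambda>v. f v ^ n) \<in> poly_funs X"
  by (induction n) (auto intro: poly_funs.intros)

lemma poly_funs_det:
  fixes M :: "'v \<Rightarrow> complex^'n^'n"
  assumes "\<And>i j. (\<lambda>v. M v $ i $ j) \<in> poly_funs X"
  shows "(\<lambda>v. det (M v)) \<in> poly_funs X"
  unfolding det_def
  by (intro poly_funs_sum poly_funs_cmult poly_funs_prod assms) auto

lemma poly_funs_if:
  "(P \<Longrightarrow> f \<in> poly_funs X) \<Longrightarrow> (\<not> P \<Longrightarrow> g \<in> poly_funs X) \<Longrightarrow> (\<lambda>v. if P then f v else g v) \<in> poly_funs X"
  by (cases P) auto

lemmas poly_funs_intros = poly_funs.const poly_funs.add poly_funs.mult poly_funs_sum poly_funs_prod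
  poly_funs_cmult poly_funs_minus poly_funs_diff poly_funs_power poly_funs_det poly_funs_if

lemma poly_funs_comp:
  assumes "f \<in> poly_funs X" and "\<And>x. x \<in> X \<Longrightarrow> (\<lambda>w. x (h w)) \<in> poly_funs Y"
  shows "(\<lambda>w. f (h w)) \<in> poly_funs Y"
  using assms(1) by induction (auto intro: poly_funs.intros assms(2))

text \<open>Restricting a polynomial function to a polynomial curve reduces questions about it to
  polynomials in one variable.\<close>

lemma poly_funs_on_curve:
  assumes "f \<in> poly_funs X" and "\<And>x. x \<in> X \<Longrightarrow> \<exists>p :: complex poly. \<forall>t. x (\<gamma> t) = poly p t"
  shows "\<exists>p :: complex poly. \<forall>t. f (\<gamma> t) = poly p t"
  using assms(1)
proof induction
  case (const c)
  show ?case by (rule exI[of _ "[:c:]"]) simp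
next
  case (coord x)
  then show ?case by (rule assms(2))
next
  case (add f g)
  then obtain p q where "\<forall>t. f (\<gamma> t) = poly p t" "\<forall>t. g (\<gamma> t) = poly q t" by blast
  then show ?case by (intro exI[of _ "p + q"]) simp
next
  case (mult f g)
  then obtain p q where "\<forall>t. f (\<gamma> t) = poly p t" "\<forall>t. g (\<gamma> t) = poly q t" by blast
  then show ?case by (intro exI[of _ "p * q"]) simp
qed

lemma mat_polys_entry: "(\<lambda>A. A $ i $ j) \<in> mat_polys"
  unfolding mat_polys_def by (rule poly_funs.coord) auto

lemma bi_polys_fst: "(\<lambda>p. fst p $ i $ j) \<in> bi_polys"
  and bi_polys_snd: "(\<lambda>p. snd p $ i $ j) \<in> bi_polys"
  unfolding bi_polys_def by (auto intro!: poly_funs.coord simp: case_prod_unfold)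

lemma mat_polys_comp:
  assumes "f \<in> mat_polys" "\<And>i j. (\<lambda>w. h w $ i $ j) \<in> poly_funs Y"
  shows "(\<lambda>w. f (h w)) \<in> poly_funs Y"
  using assms(1) unfolding mat_polys_def by (rule poly_funs_comp) (use assms(2) in auto)

lemma bi_polys_comp:
  assumes "f \<in> bi_polys" "\<And>i j. (\<lambda>w. g w $ i $ j) \<in> poly_funs Y" "\<And>i j. (\<lambda>w. h w $ i $ j) \<in> poly_funs Y"
  shows "(\<lambda>w. f (g w, h w)) \<in> poly_funs Y"
  using assms(1) unfolding bi_polys_def by (rule poly_funs_comp) (use assms(2,3) in auto)

lemma mat_polys_on_curve:
  assumes "f \<in> mat_polys" "\<And>i j. \<exists>p. \<forall>t. \<gamma> t $ i $ j = poly p t"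
  shows "\<exists>p. \<forall>t. f (\<gamma> t) = poly p t"
  using assms(1) unfolding mat_polys_def by (rule poly_funs_on_curve) (use assms(2) in auto)

lemma cscale_nth [simp]: "cscale c A $ i $ j = c * A $ i $ j"
  by (simp add: cscale_def)

lemma mat_polys_on_line:
  assumes "f \<in> mat_polys"
  shows "\<exists>p. \<forall>t. f (C + cscale t D) = poly p t"
proof (rule mat_polys_on_curve[OF assms])
  show "\<exists>p. \<forall>t. (C + cscale t D) $ i $ j = poly p t" for i j
    by (rule exI[of _ "[:C $ i $ j, D $ i $ j:]"]) (simp add: algebra_simps)
qed

text \<open>A linear space is irreducible: restrict both functions to the line joining the two points.\<close>

lemma mat_polys_nonzero_common:
  assumes "f \<in> mat_polys" "g \<in> mat_polys" "cmat.subspace V"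
    and "C \<in> V" "f C \<noteq> 0" "D \<in> V" "g D \<noteq> 0"
  shows "\<exists>E\<in>V. f E \<noteq> 0 \<and> g E \<noteq> 0"
proof -
  obtain p where p: "\<And>t. f (C + cscale t (D - C)) = poly p t"
    using mat_polys_on_line[OF assms(1)] by blast
  obtain q where q: "\<And>t. g (C + cscale t (D - C)) = poly q t"
    using mat_polys_on_line[OF assms(2)] by blast
  have "p \<noteq> 0" using p[of 0] assms(5) by auto
  moreover have "q \<noteq> 0"
  proof -
    have "C + cscale 1 (D - C) = D" by simp
    then show ?thesis using q[of 1] assms(7) by (metis poly_0)
  qed
  ultimately have "p * q \<noteq> 0" by simp
  then have "finite {t. poly (p * q) t = 0}" by (rule poly_roots_finite)
  then obtain t where "poly (p * q) t \<noteq> 0"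
    using ex_new_if_finite[OF infinite_UNIV_char_0] by blast
  moreover have "C + cscale t (D - C) \<in> V"
    using assms by (intro cmat.subspace_add cmat.subspace_scale cmat.subspace_diff)
  ultimately show ?thesis
    by (intro bexI[of _ "C + cscale t (D - C)"]) (auto simp: p q)
qed

lemma mat_polys_zero_if_prod_zero:
  assumes "f \<in> mat_polys" "g \<in> mat_polys" "cmat.subspace V"
    and "\<And>E. E \<in> V \<Longrightarrow> g E \<noteq> 0 \<Longrightarrow> f E = 0" and "D \<in> V" "g D \<noteq> 0" and "C \<in> V"
  shows "f C = 0"
  using mat_polys_nonzero_common[OF assms(1-3,7) _ assms(5,6)] assms(4) by blast

lemma poly_zero_if_cofinite:
  fixes p q :: "complex poly"
  assumes "q \<noteq> 0" "\<And>t. poly q t \<noteq> 0 \<Longrightarrow> poly p t = 0"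
  shows "p = 0"
proof (rule ccontr)
  assume "p \<noteq> 0"
  then have "finite {t. poly (p * q) t = 0}" using assms(1) by (intro poly_roots_finite) simp
  then obtain t where "poly (p * q) t \<noteq> 0"
    using ex_new_if_finite[OF infinite_UNIV_char_0] by blast
  then show False using assms(2) by auto
qed

text \<open>Grading. An action of the scalars that multiplies each generator by \<open>c\<close> or by \<open>1\<close> grades the
  polynomial functions.\<close>

lemma poly_funs_graded:
  fixes act :: "complex \<Rightarrow> 'v \<Rightarrow> 'v"
  assumes "f \<in> poly_funs X"
    and gen: "\<And>x. x \<in> X \<Longrightarrow> (\<forall>c v. x (act c v) = c * x v) \<or> (\<forall>c v. x (act c v) = x v)"
  shows "\<exists>N u. (\<forall>d. u d \<in> poly_funs X \<and> (\<forall>c v. u d (act c v) = c ^ d * u d v)) \<and>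
            (\<forall>v. f v = (\<Sum>d\<le>N. u d v))"
  using assms(1)
proof induction
  case (const k)
  show ?case
    by (intro exI[of _ 0] exI[of _ "\<lambda>d v. if d = 0 then k else 0"])
       (auto intro!: poly_funs_if poly_funs.const)
next
  case (coord x)
  show ?case
  proof (cases "\<forall>c v. x (act c v) = c * x v")
    case True
    show ?thesis
      by (intro exI[of _ 1] exI[of _ "\<lambda>d v. if d = 1 then x v else 0"])
         (auto intro!: poly_funs_if poly_funs.const poly_funs.coord[OF coord] simp: True)
  next
    case False
    then have *: "\<forall>c v. x (act c v) = x v" using gen coord by blast
    show ?thesis
      by (intro exI[of _ 0] exI[of _ "\<lambda>d v. if d = 0 then x v else 0"])
         (auto intro!: poly_funs_if poly_funs.const poly_funs.coord[OF coord] simp: *)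
  qed
next
  case (add f g)
  then obtain N u M w where
    u: "\<And>d. u d \<in> poly_funs X" "\<And>d c v. u d (act c v) = c ^ d * u d v" "\<And>v. f v = (\<Sum>d\<le>N. u d v)" and
    w: "\<And>d. w d \<in> poly_funs X" "\<And>d c v. w d (act c v) = c ^ d * w d v" "\<And>v. g v = (\<Sum>d\<le>M. w d v)"
    by blast
  let ?u = "\<lambda>d v. (if d \<le> N then u d v else 0) + (if d \<le> M then w d v else 0)"
  have "f v + g v = (\<Sum>d\<le>max N M. ?u d v)" for v
  proof -
    have "(\<Sum>d\<le>max N M. if d \<le> N then u d v else 0) = (\<Sum>d\<le>N. u d v)"
      by (rule sum.mono_neutral_cong_right) auto
    moreover have "(\<Sum>d\<le>max N M. if d \<le> M then w d v else 0) = (\<Sum>d\<le>M. w d v)"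
      by (rule sum.mono_neutral_cong_right) auto
    ultimately show ?thesis by (simp add: u w sum.distrib)
  qed
  moreover have "?u d \<in> poly_funs X \<and> (\<forall>c v. ?u d (act c v) = c ^ d * ?u d v)" for d
    by (auto intro!: poly_funs.add poly_funs_if poly_funs.const u w simp: u(2) w(2) algebra_simps)
  ultimately show ?case by (intro exI[of _ "max N M"] exI[of _ ?u]) blast
next
  case (mult f g)
  then obtain N u M w where
    u: "\<And>d. u d \<in> poly_funs X" "\<And>d c v. u d (act c v) = c ^ d * u d v" "\<And>v. f v = (\<Sum>d\<le>N. u d v)" and
    w: "\<And>d. w d \<in> poly_funs X" "\<And>d c v. w d (act c v) = c ^ d * w d v" "\<And>v. g v = (\<Sum>d\<le>M. w d v)"
    by blast
  let ?u = "\<lambda>d v. \<Sum>i\<le>N. \<Sum>j\<le>M. if i + j = d then u i v * w j v else 0"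
  have "f v * g v = (\<Sum>d\<le>N + M. ?u d v)" for v
  proof -
    have "(\<Sum>d\<le>N + M. ?u d v) = (\<Sum>i\<le>N. \<Sum>d\<le>N + M. \<Sum>j\<le>M. if i + j = d then u i v * w j v else 0)"
      by (rule sum.swap)
    also have "\<dots> = (\<Sum>i\<le>N. \<Sum>j\<le>M. \<Sum>d\<le>N + M. if i + j = d then u i v * w j v else 0)"
      by (intro sum.cong refl sum.swap)
    also have "\<dots> = (\<Sum>i\<le>N. \<Sum>j\<le>M. u i v * w j v)"
      by (intro sum.cong refl) (simp add: sum.delta)
    finally show ?thesis by (simp add: u w sum_product)
  qed
  moreover have "?u d \<in> poly_funs X" for d
    by (intro poly_funs_sum poly_funs_if poly_funs.mult poly_funs.const u w) auto
  moreover have "?u d (act c v) = c ^ d * ?u d v" for d c v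
    unfolding sum_distrib_left
    by (intro sum.cong refl) (auto simp: u(2) w(2) power_add)
  ultimately show ?case by (intro exI[of _ "N + M"] exI[of _ ?u]) blast
qed

lemma power_sum_zero_coeffs:
  fixes a :: "nat \<Rightarrow> complex"
  assumes "\<And>c. c \<noteq> 0 \<Longrightarrow> (\<Sum>d\<le>N. c ^ d * a d) = 0" "d \<le> N"
  shows "a d = 0"
proof -
  define p where "p = (\<Sum>d\<le>N. monom (a d) d)"
  have "poly p c = (\<Sum>d\<le>N. c ^ d * a d)" for c
    by (simp add: p_def poly_sum poly_monom mult.commute)
  then have "p = 0" using assms(1) by (intro poly_zero_if_cofinite[of "[:0,1:]"]) auto
  moreover have "coeff p d = a d" using assms(2) by (simp add: p_def coeff_sum)
  ultimately show ?thesis by simp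
qed

text \<open>Grading first by the degree in \<open>A\<close> and then by the degree in \<open>B\<close>: the second step keeps the
  degree in \<open>A\<close>, because the components of a function are unique.\<close>

lemma bi_forms_decomposition:
  assumes "f \<in> bi_polys"
  shows "\<exists>N M u. (\<forall>d e. u d e \<in> bi_forms d e) \<and> (\<forall>p. f p = (\<Sum>d\<le>N. \<Sum>e\<le>M d. u d e p))"
proof -
  let ?X = "{\<lambda>(A, B). A $ i $ j | i j. True} \<union> {\<lambda>(A, B). B $ i $ j | i j. True} :: (mat6 \<times> mat6 \<Rightarrow> complex) set"
  have "\<exists>N u. (\<forall>d. u d \<in> poly_funs ?X \<and> (\<forall>c v. u d ((\<lambda>c (A, B). (cscale c A, B)) c v) = c ^ d * u d v)) \<and>
            (\<forall>v. f v = (\<Sum>d\<le>N. u d v))"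
    using assms unfolding bi_polys_def by (rule poly_funs_graded) auto
  then obtain N u where u: "\<And>d. u d \<in> poly_funs ?X" "\<And>d c A B. u d (cscale c A, B) = c ^ d * u d (A, B)"
    "\<And>p. f p = (\<Sum>d\<le>N. u d p)"
    by fastforce
  define Q where "Q d M w \<longleftrightarrow> (\<forall>e. w e \<in> poly_funs ?X \<and> (\<forall>c A B. w e (A, cscale c B) = c ^ e * w e (A, B))) \<and>
            (\<forall>v. u d v = (\<Sum>e\<le>M. w e v))" for d M and w :: "nat \<Rightarrow> mat6 \<times> mat6 \<Rightarrow> complex"
  have "\<exists>M w. (\<forall>e. w e \<in> poly_funs ?X \<and> (\<forall>c v. w e ((\<lambda>c (A, B). (A, cscale c B)) c v) = c ^ e * w e v)) \<and>
            (\<forall>v. u d v = (\<Sum>e\<le>M. w e v))" for d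
    using u(1) by (rule poly_funs_graded) auto
  then have "\<exists>M w. Q d M w" for d
    unfolding Q_def by simp
  then obtain M w where "\<And>d. Q d (M d) (w d)"
    by metis
  then have w: "\<And>d e. w d e \<in> poly_funs ?X" "\<And>d e c A B. w d e (A, cscale c B) = c ^ e * w d e (A, B)"
    "\<And>d p. u d p = (\<Sum>e\<le>M d. w d e p)"
    unfolding Q_def by blast+
  have hom: "w d e (cscale c A, B) = c ^ d * w d e (A, B)" if "e \<le> M d" for d e c A B
  proof -
    have "(\<Sum>i\<le>M d. k ^ i * (w d i (cscale c A, B) - c ^ d * w d i (A, B))) = 0" for k
    proof -
      have "u d (cscale c A, cscale k B) = c ^ d * u d (A, cscale k B)" by (rule u(2))
      then show ?thesis
        by (simp add: w(2,3) sum_distrib_left right_diff_distrib sum_subtractf ac_simps)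
    qed
    from power_sum_zero_coeffs[OF this that] show ?thesis by simp
  qed
  let ?w = "\<lambda>d e p. if e \<le> M d then w d e p else 0"
  have "?w d e \<in> bi_forms d e" for d e
    unfolding bi_forms_def bi_polys_def mem_Collect_eq
    by (intro conjI poly_funs_if w(1) poly_funs.const) (auto simp: hom w(2))
  moreover have "f p = (\<Sum>d\<le>N. \<Sum>e\<le>M d. ?w d e p)" for p
    by (simp add: u(3) w(3))
  ultimately show ?thesis by (intro exI[of _ N] exI[of _ M] exI[of _ ?w]) blast
qed

section \<open>Projective points and the Zariski topology\<close>

lemma proj_pt_range: "proj_pt A = range (\<lambda>c. cscale c A)"
  unfolding proj_pt_def by (rule cmat.span_singleton)

lemma proj_pt_eq_iff:
  assumes "A \<noteq> 0"
  shows "proj_pt A = proj_pt B \<longleftrightarrow> (\<exists>c. c \<noteq> 0 \<and> B = cscale c A)"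
proof
  assume *: "proj_pt A = proj_pt B"
  have "B \<in> proj_pt B" "A \<in> proj_pt A"
    unfolding proj_pt_def by (auto intro: cmat.span_base)
  with * obtain c d where c: "B = cscale c A" and d: "A = cscale d B"
    unfolding proj_pt_range by blast
  have "c \<noteq> 0" using c d assms by auto
  with c show "\<exists>c. c \<noteq> 0 \<and> B = cscale c A" by blast
next
  assume "\<exists>c. c \<noteq> 0 \<and> B = cscale c A"
  then obtain c where c: "c \<noteq> 0" "B = cscale c A" by blast
  have "cscale e A = cscale (e / c) B" for e using c by simp
  moreover have "cscale e B = cscale (e * c) A" for e using c by simp
  ultimately show "proj_pt A = proj_pt B" unfolding proj_pt_range by blast
qed

lemma proj_pt_eqE:
  assumes "proj_pt A = proj_pt B" "A \<noteq> 0"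
  obtains c where "c \<noteq> 0" "B = cscale c A"
  using assms proj_pt_eq_iff by blast

lemma proj_pt_eqE':
  assumes "A \<in> V - {0}" "proj_pt A = proj_pt B"
  obtains c where "c \<noteq> 0" "B = cscale c A"
  using assms proj_pt_eq_iff by blast

lemma mat_forms_scale: "f \<in> mat_forms d \<Longrightarrow> f (cscale c A) = c ^ d * f A"
  unfolding mat_forms_def by blast

lemma bi_forms_scale: "f \<in> bi_forms d e \<Longrightarrow> f (cscale b A, cscale c B) = b ^ d * c ^ e * f (A, B)"
  unfolding bi_forms_def by blast

lemma mat_forms_polys: "f \<in> mat_forms d \<Longrightarrow> f \<in> mat_polys"
  unfolding mat_forms_def by blast

lemma mat_forms_mult: "f \<in> mat_forms d \<Longrightarrow> g \<in> mat_forms e \<Longrightarrow> (\<lambda>A. f A * g A) \<in> mat_forms (d + e)"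
  unfolding mat_forms_def mat_polys_def by (auto intro: poly_funs.intros simp: power_add)

lemma bi_forms_mult: "f \<in> bi_forms d e \<Longrightarrow> g \<in> bi_forms d' e' \<Longrightarrow> (\<lambda>A. f A * g A) \<in> bi_forms (d + d') (e + e')"
  unfolding bi_forms_def bi_polys_def by (auto intro: poly_funs.intros simp: power_add)

lemma topology_generated_by_base:
  assumes "\<And>a b. a \<in> S \<Longrightarrow> b \<in> S \<Longrightarrow> a \<inter> b \<in> S" and "openin (topology_generated_by S) U" "p \<in> U"
  shows "\<exists>s\<in>S. p \<in> s \<and> s \<subseteq> U"
proof -
  have "generate_topology_on S U" using assms(2) by (simp add: openin_topology_generated_by_iff)
  then show ?thesis using assms(3)
  proof induction
    case (Int a b)
    then obtain s t where "s \<in> S" "p \<in> s" "s \<subseteq> a" "t \<in> S" "p \<in> t" "t \<subseteq> b" by blast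
    then show ?case using assms(1) by (intro bexI[of _ "s \<inter> t"]) auto
  next
    case (UN K)
    then show ?case by (meson UnionE Union_upper order_trans)
  qed auto
qed

lemma mat_forms_const: "(\<lambda>_. c) \<in> mat_forms 0"
  unfolding mat_forms_def mat_polys_def by (auto intro: poly_funs.const)

lemma zariski_basic_Int:
  assumes "f \<in> mat_forms d" "g \<in> mat_forms e"
  shows "{proj_pt A | A. A \<in> V - {0} \<and> f A \<noteq> 0} \<inter> {proj_pt A | A. A \<in> V - {0} \<and> g A \<noteq> 0}
    = {proj_pt A | A. A \<in> V - {0} \<and> f A * g A \<noteq> 0}"
proof (intro equalityI subsetI)
  fix p assume "p \<in> {proj_pt A | A. A \<in> V - {0} \<and> f A \<noteq> 0} \<inter> {proj_pt A | A. A \<in> V - {0} \<and> g A \<noteq> 0}"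
  then obtain A B where AB: "p = proj_pt A" "A \<in> V - {0}" "f A \<noteq> 0" "p = proj_pt B" "g B \<noteq> 0" by blast
  then obtain c where "c \<noteq> 0" "B = cscale c A" by (metis proj_pt_eqE')
  then have "g A \<noteq> 0" using AB assms(2) by (auto simp: mat_forms_scale)
  then show "p \<in> {proj_pt A | A. A \<in> V - {0} \<and> f A * g A \<noteq> 0}" using AB by auto
qed auto

lemma zariski_open_nbhd:
  assumes "openin (zariski V) U" "p \<in> U"
  shows "\<exists>A d f. A \<in> V - {0} \<and> p = proj_pt A \<and> f \<in> mat_forms d \<and> f A \<noteq> 0 \<and>
     (\<forall>B\<in>V - {0}. f B \<noteq> 0 \<longrightarrow> proj_pt B \<in> U)"
proof -
  let ?S = "{{proj_pt A | A. A \<in> V - {0} \<and> f A \<noteq> 0} | f d. f \<in> mat_forms d}"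
  have "\<exists>s\<in>?S. p \<in> s \<and> s \<subseteq> U"
  proof (rule topology_generated_by_base)
    fix a b assume "a \<in> ?S" "b \<in> ?S"
    then obtain f d g e where "f \<in> mat_forms d" "g \<in> mat_forms e"
      "a = {proj_pt A | A. A \<in> V - {0} \<and> f A \<noteq> 0}" "b = {proj_pt A | A. A \<in> V - {0} \<and> g A \<noteq> 0}" by blast
    then have "a \<inter> b = {proj_pt A | A. A \<in> V - {0} \<and> f A * g A \<noteq> 0} \<and> (\<lambda>A. f A * g A) \<in> mat_forms (d + e)"
      using zariski_basic_Int[of f d g e V] mat_forms_mult[of f d g e] by simp
    then show "a \<inter> b \<in> ?S" by (intro CollectI exI)
  qed (use assms in \<open>auto simp: zariski_def\<close>)
  then obtain f d where "f \<in> mat_forms d" "p \<in> {proj_pt A | A. A \<in> V - {0} \<and> f A \<noteq> 0}"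
    "{proj_pt A | A. A \<in> V - {0} \<and> f A \<noteq> 0} \<subseteq> U" by blast
  then show ?thesis by blast
qed

lemma openin_zariski_basic:
  "f \<in> mat_forms d \<Longrightarrow> openin (zariski V) {proj_pt A | A. A \<in> V - {0} \<and> f A \<noteq> 0}"
  unfolding zariski_def by (rule topology_generated_by_Basis) blast

lemma topspace_zariski: "topspace (zariski V) = proj_space V"
proof
  show "topspace (zariski V) \<subseteq> proj_space V"
    unfolding zariski_def topology_generated_by_topspace proj_space_def by blast
  have "openin (zariski V) {proj_pt A | A. A \<in> V - {0} \<and> (1::complex) \<noteq> 0}"
    using mat_forms_const by (rule openin_zariski_basic)
  from openin_subset[OF this] show "proj_space V \<subseteq> topspace (zariski V)"
    unfolding proj_space_def by auto
qed

lemma closedin_zariski_zero_set: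
  assumes "\<And>f. f \<in> F \<Longrightarrow> \<exists>d. f \<in> mat_forms d"
  shows "closedin (zariski V) (proj_pt ` {B \<in> V - {0}. \<forall>f\<in>F. f B = 0})"
proof -
  have "topspace (zariski V) - proj_pt ` {B \<in> V - {0}. \<forall>f\<in>F. f B = 0}
    = (\<Union>f\<in>F. {proj_pt A | A. A \<in> V - {0} \<and> f A \<noteq> 0})" (is "?L = ?R")
  proof
    show "?L \<subseteq> ?R" unfolding topspace_zariski proj_space_def by blast
    have "False" if asm: "f \<in> F" "A \<in> V - {0}" "f A \<noteq> 0" "proj_pt A = proj_pt B" "\<forall>f\<in>F. f B = 0" for f A B
    proof -
      obtain c where "c \<noteq> 0" "B = cscale c A" using asm(2,4) by (rule proj_pt_eqE')
      moreover obtain d where "f \<in> mat_forms d" using assms[OF asm(1)] by blast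
      ultimately show False using asm by (auto simp: mat_forms_scale)
    qed
    then show "?R \<subseteq> ?L" unfolding topspace_zariski proj_space_def by blast
  qed
  moreover have "openin (zariski V) ?R"
  proof (rule openin_Union)
    show "openin (zariski V) U" if "U \<in> (\<lambda>f. {proj_pt A | A. A \<in> V - {0} \<and> f A \<noteq> 0}) ` F" for U
      using that assms openin_zariski_basic by blast
  qed
  ultimately show ?thesis
    unfolding closedin_def topspace_zariski proj_space_def by auto
qed

lemma zariski_prod_open_nbhd:
  assumes "openin (zariski_prod V W) U" "p \<in> U"
  shows "\<exists>A B d e f. A \<in> V - {0} \<and> B \<in> W - {0} \<and> p = (proj_pt A, proj_pt B) \<and> f \<in> bi_forms d e \<and> f (A, B) \<noteq> 0 \<and>
     (\<forall>A\<in>V - {0}. \<forall>B\<in>W - {0}. f (A, B) \<noteq> 0 \<longrightarrow> (proj_pt A, proj_pt B) \<in> U)"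
proof -
  let ?N = "\<lambda>f. {(proj_pt A, proj_pt B) | A B. A \<in> V - {0} \<and> B \<in> W - {0} \<and> f (A, B) \<noteq> (0::complex)}"
  let ?S = "{?N f | f d e. f \<in> bi_forms d e}"
  have "\<exists>s\<in>?S. p \<in> s \<and> s \<subseteq> U"
  proof (rule topology_generated_by_base)
    fix a b assume "a \<in> ?S" "b \<in> ?S"
    then obtain f d e g d' e' where fg: "f \<in> bi_forms d e" "g \<in> bi_forms d' e'" "a = ?N f" "b = ?N g" by blast
    have "?N f \<inter> ?N g = ?N (\<lambda>p. f p * g p)"
    proof (intro equalityI subsetI)
      fix p assume "p \<in> ?N f \<inter> ?N g"
      then obtain A B A' B' where AB: "p = (proj_pt A, proj_pt B)" "A \<in> V - {0}" "B \<in> W - {0}" "f (A, B) \<noteq> 0"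
        "proj_pt A = proj_pt A'" "proj_pt B = proj_pt B'" "g (A', B') \<noteq> 0" by auto
      obtain b where "A' = cscale b A" using AB(2,5) by (rule proj_pt_eqE')
      moreover obtain c where "B' = cscale c B" using AB(3,6) by (rule proj_pt_eqE')
      ultimately have "g (A, B) \<noteq> 0" using AB(7) fg(2) by (auto simp: bi_forms_scale)
      then show "p \<in> ?N (\<lambda>p. f p * g p)" using AB by auto
    qed auto
    moreover have "(\<lambda>p. f p * g p) \<in> bi_forms (d + d') (e + e')" using fg bi_forms_mult by blast
    ultimately have "a \<inter> b = ?N (\<lambda>p. f p * g p) \<and> (\<lambda>p. f p * g p) \<in> bi_forms (d + d') (e + e')"
      unfolding fg by blast
    then show "a \<inter> b \<in> ?S" by (intro CollectI exI)
  qed (use assms in \<open>auto simp: zariski_prod_def\<close>)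
  then obtain f d e where "f \<in> bi_forms d e" "p \<in> ?N f" "?N f \<subseteq> U" by blast
  then show ?thesis by blast
qed

lemma openin_zariski_prod_basic:
  "f \<in> bi_forms d e \<Longrightarrow>
    openin (zariski_prod V W) {(proj_pt A, proj_pt B) | A B. A \<in> V - {0} \<and> B \<in> W - {0} \<and> f (A, B) \<noteq> 0}"
  unfolding zariski_prod_def by (rule topology_generated_by_Basis) blast

lemma topspace_zariski_prod: "topspace (zariski_prod V W) \<subseteq> {(proj_pt A, proj_pt B) | A B. A \<in> V - {0} \<and> B \<in> W - {0}}"
  unfolding zariski_prod_def topology_generated_by_topspace by blast


section \<open>The adjugate and the closure of the graph\<close>

lemma mat_nth: "mat k $ i $ j = (if i = j then k else 0)"
  by (simp add: mat_def)

lemma matrix_mult_nth: "(A ** B) $ i $ j = (\<Sum>k\<in>UNIV. A $ i $ k * B $ k $ j)"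
  by (simp add: matrix_matrix_mult_def)

lemma det_replace_row_axis:
  fixes A :: mat6
  shows "det (\<chi> r. if r = j then axis k 1 else A $ r)
    = det (\<chi> r l. if r = j then (if l = k then 1 else 0) else if l = k then 0 else A $ r $ l)"
proof -
  define M where "M S = (\<chi> r. if r = j then axis k 1 else if r \<in> S then A $ r - A $ r $ k *s axis k 1 else A $ r)" for S
  have "det (M S) = det (M {})" if "finite S" for S
    using that
  proof induction
    case (insert i S)
    show ?case
    proof (cases "i = j")
      case True
      then have "M (insert i S) = M S" unfolding M_def by (simp add: vec_eq_iff)
      then show ?thesis using insert by simp
    next
      case False
      have "M (insert i S) = (\<chi> r. if r = i then row i (M S) + (- A $ i $ k) *s row j (M S) else row r (M S))"
        using False insert by (auto simp: M_def vec_eq_iff row_def)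
      then show ?thesis using insert det_row_operation[OF False, of "M S"] by simp
    qed
  qed simp
  then have "det (M UNIV) = det (M {})" by simp
  moreover have "M UNIV = (\<chi> r l. if r = j then (if l = k then 1 else 0) else if l = k then 0 else A $ r $ l)"
    by (auto simp: M_def vec_eq_iff axis_def)
  moreover have "M {} = (\<chi> r. if r = j then axis k 1 else A $ r)"
    by (auto simp: M_def vec_eq_iff)
  ultimately show ?thesis by simp
qed

lemma mult_adjugate: "A ** adjugate A = mat (det A)"
proof -
  have "(A ** adjugate A) $ i $ j = mat (det A) $ i $ j" for i j
  proof -
    have "(A ** adjugate A) $ i $ j = (\<Sum>k\<in>UNIV. A $ i $ k * det (\<chi> r. if r = j then axis k 1 else A $ r))"
      by (simp add: matrix_mult_nth adjugate_def det_replace_row_axis)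
    also have "\<dots> = (\<Sum>k\<in>UNIV. det (\<chi> r. if r = j then A $ i $ k *s axis k 1 else A $ r))"
      by (simp add: det_row_mul)
    also have "\<dots> = det (\<chi> r. if r = j then (\<Sum>k\<in>UNIV. A $ i $ k *s axis k 1) else A $ r)"
      by (rule det_linear_row_sum[symmetric]) simp
    also have "(\<Sum>k\<in>UNIV. A $ i $ k *s axis k 1) = A $ i"
      by (rule basis_expansion)
    also have "det (\<chi> r. if r = j then A $ i else A $ r) = mat (det A) $ i $ j"
    proof (cases "i = j")
      case True
      then have "(\<chi> r. if r = j then A $ i else A $ r) = A" by (auto simp: vec_eq_iff)
      then show ?thesis using True by (simp add: mat_nth)
    next
      case False
      then show ?thesis
        by (subst det_identical_rows[OF False]) (auto simp: row_def mat_nth vec_eq_iff)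
    qed
    finally show ?thesis .
  qed
  then show ?thesis by (simp add: vec_eq_iff)
qed

lemma mult_mat_right: "(A :: mat6) ** mat c = cscale c A"
  and mult_mat_left: "mat c ** (A :: mat6) = cscale c A"
  by (simp_all add: vec_eq_iff matrix_mult_nth mat_nth if_distrib[of "\<lambda>x. _ * x"] if_distrib[of "\<lambda>x. x * _"]
      sum.delta sum.delta' mult.commute[of c] cong: if_cong)

lemma cscale_mult_left: "cscale c A ** B = cscale c (A ** B)"
  and cscale_mult_right: "A ** cscale c B = cscale c (A ** B)"
  by (auto simp: vec_eq_iff matrix_mult_nth sum_distrib_left ac_simps)

lemma cscale_mat: "cscale c (mat d) = mat (c * d)"
  by (auto simp: vec_eq_iff mat_nth)

lemma mult_scalar_commute:
  fixes A B :: mat6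
  assumes "A ** B = mat s" "s \<noteq> 0"
  shows "B ** A = mat s"
proof -
  have "A ** cscale (1/s) B = mat 1" using assms by (simp add: cscale_mult_right cscale_mat)
  then have "cscale (1/s) B ** A = mat 1" by (simp add: matrix_left_right_inverse)
  then have "cscale s (cscale (1/s) B ** A) = mat s" by (simp add: cscale_mat)
  then show ?thesis using assms(2) by (simp add: cscale_mult_left)
qed

lemma det_nonzero_if_scalar:
  fixes A B :: mat6
  assumes "A ** B = mat s" "s \<noteq> 0"
  shows "det A \<noteq> 0" "det B \<noteq> 0"
proof -
  have "A ** cscale (1/s) B = mat 1" using assms by (simp add: cscale_mult_right cscale_mat)
  then have "det A * det (cscale (1/s) B) = 1" by (metis det_mul det_I)
  then show "det A \<noteq> 0" by auto
  have "cscale (1/s) A ** B = mat 1" using assms by (simp add: cscale_mult_left cscale_mat)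
  then have "det (cscale (1/s) A) * det B = 1" by (metis det_mul det_I)
  then show "det B \<noteq> 0" by auto
qed

lemma scalar_inverse_is_adjugate:
  assumes "A ** B = mat s" "det A \<noteq> 0"
  shows "B = cscale (s / det A) (adjugate A)"
proof -
  have "adjugate A ** A = mat (det A)" using mult_scalar_commute[OF mult_adjugate assms(2)] .
  then have "cscale (det A) B = adjugate A ** A ** B" by (simp add: mult_mat_left)
  also have "\<dots> = cscale s (adjugate A)" using assms by (simp add: matrix_mul_assoc[symmetric] mult_mat_right)
  finally have "cscale (1 / det A) (cscale (det A) B) = cscale (1 / det A) (cscale s (adjugate A))" by simp
  then show ?thesis using assms by simp
qed

lemma symmetric_scalar_inverse:
  fixes A B :: mat6
  assumes "A ** B = mat s" "s \<noteq> 0" "A \<in> Sym6"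
  shows "B \<in> Sym6"
proof -
  have "transpose B ** A = mat s"
    using assms matrix_transpose_mul[of A B] by (simp add: Sym6_def transpose_mat)
  then have "transpose B ** (A ** B) = cscale s B"
    by (simp add: matrix_mul_assoc mult_mat_left)
  then have "cscale s (transpose B) = cscale s B" using assms by (simp add: mult_mat_right)
  then have "cscale (1/s) (cscale s (transpose B)) = cscale (1/s) (cscale s B)" by (rule arg_cong)
  then have "transpose B = B" using assms(2) by (simp only: cmat.scale_scale) simp
  then show ?thesis by (simp add: Sym6_def)
qed

lemma Cat_subset_Sym6: "Cat \<subseteq> Sym6"
  unfolding Cat_def Sym6_def by (auto simp: vec_eq_iff transpose_def add.commute)

lemma adjugate_Sym6:
  assumes "A \<in> Cat" "det A \<noteq> 0"
  shows "adjugate A \<in> Sym6 - {0}"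
proof -
  have "adjugate A \<in> Sym6"
    using symmetric_scalar_inverse[OF mult_adjugate assms(2)] assms Cat_subset_Sym6 by blast
  moreover have "adjugate A \<noteq> 0"
    using det_nonzero_if_scalar(2)[OF mult_adjugate assms(2)] det_0[where ?'n = quad_exp and ?'a = complex]
    by (metis mat_0)
  ultimately show ?thesis by simp
qed

lemma subspace_Cat: "cmat.subspace Cat"
proof (rule cmat.subspaceI)
  show "0 \<in> Cat" unfolding Cat_def by (auto intro!: exI[of _ "\<lambda>_. 0"])
  show "A + B \<in> Cat" if "A \<in> Cat" "B \<in> Cat" for A B
  proof -
    from that obtain a b where "\<forall>\<alpha> \<beta>. A $ \<alpha> $ \<beta> = a (Rep_quad_exp \<alpha> + Rep_quad_exp \<beta>)"
      "\<forall>\<alpha> \<beta>. B $ \<alpha> $ \<beta> = b (Rep_quad_exp \<alpha> + Rep_quad_exp \<beta>)" unfolding Cat_def by blast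
    then show ?thesis unfolding Cat_def by (auto intro!: exI[of _ "\<lambda>x. a x + b x"])
  qed
  show "cscale c A \<in> Cat" if "A \<in> Cat" for c A
  proof -
    from that obtain a where "\<forall>\<alpha> \<beta>. A $ \<alpha> $ \<beta> = a (Rep_quad_exp \<alpha> + Rep_quad_exp \<beta>)"
      unfolding Cat_def by blast
    then show ?thesis unfolding Cat_def by (auto intro!: exI[of _ "\<lambda>x. c * a x"])
  qed
qed

text \<open>The points of the closure of the graph, in terms of representatives.\<close>

definition limit_pair :: "mat6 \<Rightarrow> mat6 \<Rightarrow> bool" where
  "limit_pair A B \<longleftrightarrow> A \<in> Cat - {0} \<and> B \<in> Sym6 - {0} \<and>
     (\<forall>d e. \<forall>f\<in>bi_forms d e. (\<forall>C\<in>Cat. det C \<noteq> 0 \<longrightarrow> f (C, adjugate C) = 0) \<longrightarrow> f (A, B) = 0)"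

lemma det_mat_polys: "det \<in> mat_polys"
  unfolding mat_polys_def
  by (rule poly_funs_det) (rule mat_polys_entry[unfolded mat_polys_def])

lemma adjugate_mat_polys: "(\<lambda>A. adjugate A $ i $ j) \<in> mat_polys"
proof -
  have "(\<lambda>A. det (\<chi> k l. if k = j then (if l = i then 1 else 0)
      else if l = i then 0 else A $ k $ l)) \<in> mat_polys"
    unfolding mat_polys_def
  proof (rule poly_funs_det)
    show "(\<lambda>A. (\<chi> k l. if k = j then (if l = i then 1 else 0) else if l = i then 0 else A $ k $ l) $ r $ s)
      \<in> poly_funs {\<lambda>A. A $ i $ j | i j. True}" for r s
      using mat_polys_entry[of r s, unfolded mat_polys_def] by (simp add: poly_funs.const poly_funs_if)
  qed
  then show ?thesis by (simp add: adjugate_def)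
qed

lemma vanish_on_graph:
  assumes "f \<in> bi_polys" "\<And>C. C \<in> Cat \<Longrightarrow> det C \<noteq> 0 \<Longrightarrow> f (C, adjugate C) = 0"
    and "A \<in> Cat" "\<exists>C\<in>Cat. det C \<noteq> 0"
  shows "f (A, adjugate A) = 0"
proof -
  have "(\<lambda>C. f (C, adjugate C)) \<in> mat_polys"
    using assms(1) mat_polys_entry adjugate_mat_polys unfolding mat_polys_def
    by (rule bi_polys_comp)
  then show ?thesis
    using mat_polys_zero_if_prod_zero[OF _ det_mat_polys subspace_Cat] assms by blast
qed

text \<open>A pair \<open>(A, B)\<close> with \<open>A B\<close> a nonzero scalar is a point of the graph up to scaling.\<close>

lemma vanish_at_inverse_pair:
  assumes "f \<in> bi_forms d e" "\<And>C. C \<in> Cat \<Longrightarrow> det C \<noteq> 0 \<Longrightarrow> f (C, adjugate C) = 0"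
    and "A \<in> Cat" "A ** B = mat s" "s \<noteq> 0"
  shows "f (A, B) = 0"
proof -
  have "det A \<noteq> 0" using det_nonzero_if_scalar assms by blast
  moreover have "f (cscale 1 A, cscale (s / det A) (adjugate A)) = 1 ^ d * (s / det A) ^ e * f (A, adjugate A)"
    using assms(1) by (rule bi_forms_scale)
  ultimately show ?thesis
    using scalar_inverse_is_adjugate[OF assms(4)] assms(2,3) by simp
qed

lemma Gamma_Cat_iff:
  assumes A: "A \<in> Cat - {0}" and inv: "\<exists>C\<in>Cat. det C \<noteq> 0"
  shows "(proj_pt A, q) \<in> Gamma_Cat \<longleftrightarrow> (\<exists>B. q = proj_pt B \<and> limit_pair A B)"
proof
  assume *: "(proj_pt A, q) \<in> Gamma_Cat"
  then have "(proj_pt A, q) \<in> topspace (zariski_prod Cat Sym6)"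
    unfolding Gamma_Cat_def by (simp add: in_closure_of)
  then obtain B where B: "q = proj_pt B" "B \<in> Sym6 - {0}"
    using topspace_zariski_prod by blast
  have "f (A, B) = 0" if f: "f \<in> bi_forms d e" and van: "\<And>C. C \<in> Cat \<Longrightarrow> det C \<noteq> 0 \<Longrightarrow> f (C, adjugate C) = 0" for f d e
  proof (rule ccontr)
    assume nz: "f (A, B) \<noteq> 0"
    define U where "U = {(proj_pt A, proj_pt B) | A B. A \<in> Cat - {0} \<and> B \<in> Sym6 - {0} \<and> f (A, B) \<noteq> 0}"
    have "openin (zariski_prod Cat Sym6) U" unfolding U_def using f by (rule openin_zariski_prod_basic)
    moreover have "(proj_pt A, q) \<in> U" unfolding U_def using A B nz by blast
    moreover have "\<forall>T. (proj_pt A, q) \<in> T \<and> openin (zariski_prod Cat Sym6) T \<longrightarrow> (\<exists>y. y \<in> inv_graph \<and> y \<in> T)"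
      using * unfolding Gamma_Cat_def in_closure_of by (rule conjunct2)
    ultimately obtain y where "y \<in> inv_graph" "y \<in> U" by blast
    from \<open>y \<in> inv_graph\<close> obtain C where y: "y = (proj_pt C, proj_pt (adjugate C))"
      and C': "C \<in> Cat - {0}" "adjugate C \<noteq> 0"
      unfolding inv_graph_def by blast
    from \<open>y \<in> U\<close>[unfolded U_def] obtain A' B' where y': "y = (proj_pt A', proj_pt B')" "f (A', B') \<noteq> 0"
      by blast
    note C = C' y'(1)[unfolded y prod.inject, THEN conjunct1] y'(1)[unfolded y prod.inject, THEN conjunct2] y'(2)
    obtain b where "A' = cscale b C" using C(1,3) by (rule proj_pt_eqE')
    moreover obtain c where "B' = cscale c (adjugate C)" using C(4,2) by (rule proj_pt_eqE)
    ultimately have "f (C, adjugate C) \<noteq> 0" using C(5) f by (auto simp: bi_forms_scale)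
    moreover have "f (C, adjugate C) = 0"
      by (rule vanish_on_graph) (use van inv C(1) f in \<open>auto simp: bi_forms_def\<close>)
    ultimately show False by blast
  qed
  then show "\<exists>B. q = proj_pt B \<and> limit_pair A B"
    unfolding limit_pair_def using A B by blast
next
  assume "\<exists>B. q = proj_pt B \<and> limit_pair A B"
  then obtain B where B: "q = proj_pt B" "limit_pair A B" by blast
  have mem: "B \<in> Sym6 - {0}" using B(2) unfolding limit_pair_def by blast
  have "(\<lambda>_. 1) \<in> bi_forms 0 0" unfolding bi_forms_def bi_polys_def by (auto intro: poly_funs.const)
  from openin_subset[OF openin_zariski_prod_basic[OF this, of Cat Sym6]]
  have "(proj_pt A, q) \<in> topspace (zariski_prod Cat Sym6)" using A B(1) mem by auto
  moreover have "\<exists>y. y \<in> inv_graph \<and> y \<in> U"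
    if asm: "(proj_pt A, q) \<in> U" "openin (zariski_prod Cat Sym6) U" for U
  proof -
    obtain A' B' d e f where *: "A' \<in> Cat - {0}" "B' \<in> Sym6 - {0}" "proj_pt A = proj_pt A'" "q = proj_pt B'"
      "f \<in> bi_forms d e" "f (A', B') \<noteq> 0"
      and U: "\<And>A B. A \<in> Cat - {0} \<Longrightarrow> B \<in> Sym6 - {0} \<Longrightarrow> f (A, B) \<noteq> 0 \<Longrightarrow> (proj_pt A, proj_pt B) \<in> U"
      using zariski_prod_open_nbhd[OF asm(2,1), unfolded prod.inject] by blast
    obtain b where "A' = cscale b A" using A *(3) by (rule proj_pt_eqE')
    moreover obtain c where "B' = cscale c B" using mem *(4)[unfolded B(1)] by (rule proj_pt_eqE')
    ultimately have "f (A, B) \<noteq> 0" using *(5,6) by (auto simp: bi_forms_scale)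
    then obtain C where C: "C \<in> Cat" "det C \<noteq> 0" "f (C, adjugate C) \<noteq> 0"
      using B(2) *(5) unfolding limit_pair_def by blast
    have "C \<noteq> 0" using C(2) det_0[where ?'n = quad_exp and ?'a = complex] by (metis mat_0)
    then show ?thesis
      using U[of C "adjugate C"] adjugate_Sym6 C unfolding inv_graph_def by blast
  qed
  ultimately show "(proj_pt A, q) \<in> Gamma_Cat"
    unfolding Gamma_Cat_def in_closure_of by blast
qed

lemma phi_eq:
  assumes "A \<in> Cat - {0}" "\<exists>C\<in>Cat. det C \<noteq> 0"
  shows "phi (proj_pt A) = proj_pt ` {B. limit_pair A B}"
proof -
  have "phi (proj_pt A) = {q. (proj_pt A, q) \<in> Gamma_Cat}" unfolding phi_def by force
  then show ?thesis unfolding Gamma_Cat_iff[OF assms] by blast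
qed

lemma limit_pair_scalar:
  assumes "limit_pair A B" "\<exists>C\<in>Cat. det C \<noteq> 0"
  shows "\<exists>s. A ** B = mat s"
proof -
  let ?g = "\<lambda>i j (p :: mat6 \<times> mat6). (fst p ** snd p) $ i $ j"
  have poly: "?g i j \<in> bi_polys" for i j
    unfolding matrix_mult_nth
    by (unfold bi_polys_def) (intro poly_funs_intros bi_polys_fst[unfolded bi_polys_def]
        bi_polys_snd[unfolded bi_polys_def] finite)
  have sc: "?g i j (cscale b A, cscale c B) = b ^ 1 * c ^ 1 * ?g i j (A, B)" for i j b c A B
    by (simp add: cscale_mult_left cscale_mult_right)
  have "?g i j \<in> bi_forms 1 1" for i j
    unfolding bi_forms_def using poly sc by blast
  moreover have "(\<lambda>p. ?g i i p - ?g j j p) \<in> bi_forms 1 1" for i j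
  proof -
    have "(\<lambda>p. ?g i i p - ?g j j p) \<in> bi_polys"
      using poly unfolding bi_polys_def by (intro poly_funs_diff)
    moreover have "?g i i (cscale b A, cscale c B) - ?g j j (cscale b A, cscale c B)
        = b ^ 1 * c ^ 1 * (?g i i (A, B) - ?g j j (A, B))" for b c A B
      unfolding sc by (simp add: algebra_simps)
    ultimately show ?thesis unfolding bi_forms_def by blast
  qed
  moreover have "?g i j (C, adjugate C) = (if i = j then det C else 0)" for C i j
    by (simp add: mult_adjugate mat_nth)
  moreover have van: "f (A, B) = 0"
    if "f \<in> bi_forms 1 1" "\<And>C. f (C, adjugate C) = 0" for f
    using assms(1) that unfolding limit_pair_def by blast
  ultimately have "i \<noteq> j \<Longrightarrow> ?g i j (A, B) = 0" "?g i i (A, B) - ?g j j (A, B) = 0" for i j :: quad_exp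
    using van[of "?g i j"] van[of "\<lambda>p. ?g i i p - ?g j j p"] by simp_all
  then have "A ** B = mat (?g undefined undefined (A, B))"
    by (simp add: vec_eq_iff mat_nth)
  then show ?thesis by blast
qed

text \<open>On the graph the product is a scalar matrix, hence also on its closure; over a singular \<open>A\<close> the scalar is
  \<open>0\<close>.\<close>

lemma limit_pair_mult_zero:
  assumes "limit_pair A B" "\<exists>C\<in>Cat. det C \<noteq> 0" "det A = 0"
  shows "A ** B = 0"
  using limit_pair_scalar[OF assms(1,2)] det_nonzero_if_scalar(1) assms(3) by (metis mat_0)

section \<open>Symmetric matrices supported on the kernel\<close>

definition congr :: "mat6 \<Rightarrow> mat6 \<Rightarrow> mat6" where
  "congr T X = T ** X ** transpose T"

definition Sym_on :: "quad_exp set \<Rightarrow> mat6 set" where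
  "Sym_on I = {X \<in> Sym6. \<forall>i j. i \<notin> I \<or> j \<notin> I \<longrightarrow> X $ i $ j = 0}"

definition id_on :: "quad_exp set \<Rightarrow> mat6" where
  "id_on I = (\<chi> i j. if i = j \<and> i \<in> I then 1 else 0)"

text \<open>The columns of \<open>T\<close> with index in \<open>I\<close> form a basis of the kernel of \<open>A\<close>; \<open>S\<close> is the
  inverse of \<open>T\<close>.\<close>

definition ker_frame :: "mat6 \<Rightarrow> mat6 \<Rightarrow> quad_exp set \<Rightarrow> mat6 \<Rightarrow> bool" where
  "ker_frame T S I A \<longleftrightarrow> T ** S = mat 1 \<and> S ** T = mat 1 \<and>
     (\<forall>k. A *v k = 0 \<longleftrightarrow> (\<forall>j. j \<notin> I \<longrightarrow> (S *v k) $ j = 0))"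

lemma Sym6_iff: "A \<in> Sym6 \<longleftrightarrow> (\<forall>i j. A $ i $ j = A $ j $ i)"
  unfolding Sym6_def by (auto simp: vec_eq_iff transpose_def)

lemma subspace_Sym6: "cmat.subspace Sym6"
  by (rule cmat.subspaceI) (auto simp: Sym6_iff)

lemma subspace_Sym_on: "cmat.subspace (Sym_on I)"
  by (rule cmat.subspaceI) (auto simp: Sym_on_def Sym6_iff)

lemma congr_nth: "congr T X $ i $ j = (\<Sum>k\<in>UNIV. \<Sum>l\<in>UNIV. T $ i $ k * X $ k $ l * T $ j $ l)"
  by (simp add: congr_def matrix_mult_nth transpose_def sum_distrib_right) (rule sum.swap)

lemma congr_add: "congr T (X + Y) = congr T X + congr T Y"
  by (simp add: vec_eq_iff congr_nth algebra_simps sum.distrib)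

lemma congr_cscale: "congr T (cscale c X) = cscale c (congr T X)"
  by (simp add: congr_def cscale_mult_left cscale_mult_right)

lemma congr_diff: "congr T (X - Y) = congr T X - congr T Y"
  using congr_add[of T X "cscale (-1) Y"] congr_cscale[of T "-1" Y]
  by (simp add: vec_eq_iff)

lemma congr_0 [simp]: "congr T 0 = 0"
  using congr_cscale[of T 0 0] by simp

lemma congr_mult: "congr T (congr S X) = congr (T ** S) X"
  by (simp add: congr_def matrix_mul_assoc matrix_transpose_mul)

lemma congr_1 [simp]: "congr (mat 1) X = X"
  by (simp add: congr_def transpose_mat)

lemma congr_inverse: "S ** T = mat 1 \<Longrightarrow> congr S (congr T X) = X"
  by (simp add: congr_mult)

lemma congr_Sym6: "X \<in> Sym6 \<Longrightarrow> congr T X \<in> Sym6"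
  by (simp add: congr_def Sym6_def matrix_transpose_mul matrix_mul_assoc)

lemma congr_eq_0_iff: "S ** T = mat 1 \<Longrightarrow> congr T X = 0 \<longleftrightarrow> X = 0"
  by (metis congr_0 congr_inverse)

lemma congr_entry_polys: "(\<lambda>X. congr T X $ i $ j) \<in> mat_polys"
  unfolding congr_nth mat_polys_def
  by (intro poly_funs_intros finite mat_polys_entry[unfolded mat_polys_def])

lemma mat_polys_congr: "f \<in> mat_polys \<Longrightarrow> (\<lambda>X. f (congr T X)) \<in> mat_polys"
  using mat_polys_comp[of f "congr T" "{\<lambda>A. A $ i $ j | i j. True}"] congr_entry_polys
  by (simp add: mat_polys_def)

lemma mat_forms_congr: "f \<in> mat_forms d \<Longrightarrow> (\<lambda>X. f (congr T X)) \<in> mat_forms d"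
  unfolding mat_forms_def using mat_polys_congr by (auto simp: congr_cscale)

lemma subspace_congr_Sym_on: "cmat.subspace (congr T ` Sym_on I)"
proof (rule cmat.subspaceI)
  show "0 \<in> congr T ` Sym_on I"
    using cmat.subspace_0[OF subspace_Sym_on] congr_0 by (metis imageI)
  show "x + y \<in> congr T ` Sym_on I" if "x \<in> congr T ` Sym_on I" "y \<in> congr T ` Sym_on I" for x y
    using that cmat.subspace_add[OF subspace_Sym_on] congr_add by (smt (verit) imageE imageI)
  show "cscale c x \<in> congr T ` Sym_on I" if "x \<in> congr T ` Sym_on I" for c x
    using that cmat.subspace_scale[OF subspace_Sym_on] congr_cscale by (smt (verit) imageE imageI)
qed

lemma congr_Sym_on_subset: "congr T ` Sym_on I \<subseteq> Sym6"
  using congr_Sym6 by (auto simp: Sym_on_def)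

text \<open>A basis of the symmetric matrices supported on \<open>I\<close> is indexed by the unordered pairs in \<open>I\<close>.\<close>

definition pair_mat :: "quad_exp set \<Rightarrow> mat6" where
  "pair_mat p = (\<chi> i j. if p = {i, j} then 1 else 0)"

lemma pair_expansion:
  assumes X: "X \<in> Sym_on I"
  shows "X = (\<Sum>p\<in>{{i, j} | i j. i \<in> I \<and> j \<in> I}. cscale (\<Sum>(i, j)\<in>{(i, j). p = {i, j}}. X $ i $ j / of_nat (card {(i, j). p = {i, j}})) (pair_mat p))"
proof -
  let ?P = "{{i, j} | i j. i \<in> I \<and> j \<in> I}"
  have fin: "finite ?P" by (rule finite_subset[of _ "Pow UNIV"]) auto
  have "X $ k $ l = (\<Sum>p\<in>?P. cscale (\<Sum>(i, j)\<in>{(i, j). p = {i, j}}. X $ i $ j / of_nat (card {(i, j). p = {i, j}})) (pair_mat p)) $ k $ l" for k l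
  proof -
    let ?Q = "{(i, j). {k, l} = {i, j}}"
    have Q: "?Q = {(k, l), (l, k)}" by (auto simp: doubleton_eq_iff)
    have "(\<Sum>(i, j)\<in>?Q. X $ i $ j / of_nat (card ?Q)) = (\<Sum>(i, j)\<in>?Q. X $ k $ l / of_nat (card ?Q))"
      using X by (intro sum.cong refl) (auto simp: Q Sym_on_def Sym6_iff)
    also have "\<dots> = X $ k $ l"
      using Q by (simp add: card_gt_0_iff)
    finally have v: "(\<Sum>(i, j)\<in>?Q. X $ i $ j / of_nat (card ?Q)) = X $ k $ l" .
    show ?thesis
    proof (cases "{k, l} \<in> ?P")
      case True
      have "(\<Sum>p\<in>?P. cscale (\<Sum>(i, j)\<in>{(i, j). p = {i, j}}. X $ i $ j / of_nat (card {(i, j). p = {i, j}})) (pair_mat p)) $ k $ l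
        = (\<Sum>p\<in>?P. if p = {k, l} then \<Sum>(i, j)\<in>?Q. X $ i $ j / of_nat (card ?Q) else 0)"
        unfolding sum_component by (intro sum.cong refl) (auto simp: pair_mat_def)
      then show ?thesis using True fin v by (simp add: sum.delta)
    next
      case False
      then have "k \<notin> I \<or> l \<notin> I" by blast
      then have "X $ k $ l = 0" using X by (auto simp: Sym_on_def)
      moreover have "(\<Sum>p\<in>?P. cscale (\<Sum>(i, j)\<in>{(i, j). p = {i, j}}. X $ i $ j / of_nat (card {(i, j). p = {i, j}})) (pair_mat p)) $ k $ l
        = (\<Sum>p\<in>?P. 0)"
        unfolding sum_component
      proof (intro sum.cong refl)
        fix p assume "p \<in> ?P"
        then have "p \<noteq> {k, l}" using False by metis
        then show "cscale (\<Sum>(i, j)\<in>{(i, j). p = {i, j}}. X $ i $ j / of_nat (card {(i, j). p = {i, j}})) (pair_mat p) $ k $ l = 0"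
          by (simp add: pair_mat_def)
      qed
      ultimately show ?thesis by (simp only: sum.neutral_const)
    qed
  qed
  then show ?thesis unfolding vec_eq_iff by blast
qed

lemma card_unordered_pairs:
  assumes "finite I"
  shows "card {{i, j} | i j. i \<in> I \<and> j \<in> I} = card I * (card I + 1) div 2"
  using assms
proof induction
  case (insert x F)
  have "{{i, j} | i j. i \<in> insert x F \<and> j \<in> insert x F}
    = (\<lambda>y. {x, y}) ` insert x F \<union> {{i, j} | i j. i \<in> F \<and> j \<in> F}" by blast
  moreover have "(\<lambda>y. {x, y}) ` insert x F \<inter> {{i, j} | i j. i \<in> F \<and> j \<in> F} = {}"
    using insert(2) by (auto simp: doubleton_eq_iff)
  moreover have "finite {{i, j} | i j. i \<in> F \<and> j \<in> F}"
    by (rule finite_subset[of _ "Pow F"]) (use insert(1) in auto)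
  moreover have "card ((\<lambda>y. {x, y}) ` insert x F) = Suc (card F)"
    using insert by (subst card_image) (auto simp: inj_on_def doubleton_eq_iff)
  ultimately have "card {{i, j} | i j. i \<in> insert x F \<and> j \<in> insert x F} = Suc (card F) + card {{i, j} | i j. i \<in> F \<and> j \<in> F}"
    using insert(1) card_Un_disjoint[of "(\<lambda>y. {x, y}) ` insert x F" "{{i, j} | i j. i \<in> F \<and> j \<in> F}"] by simp
  also have "\<dots> = Suc (card F) + card F * (card F + 1) div 2" using insert by simp
  also have "\<dots> = card (insert x F) * (card (insert x F) + 1) div 2"
    using insert by simp
  finally show ?case .
qed simp

lemma dim_congr_Sym_on:
  assumes "S ** T = mat 1"
  shows "cmat.dim (congr T ` Sym_on I) = card I * (card I + 1) div 2"
proof -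
  let ?P = "{{i, j} | i j. i \<in> I \<and> j \<in> I}"
  let ?b = "\<lambda>p. congr T (pair_mat p)"
  have mem: "pair_mat p \<in> Sym_on I" if p: "p \<in> ?P" for p
  proof -
    have "p \<noteq> {i, j}" if "i \<notin> I \<or> j \<notin> I" for i j using p that by (auto simp: doubleton_eq_iff)
    then show ?thesis by (auto simp: pair_mat_def Sym_on_def Sym6_iff insert_commute)
  qed
  have inj: "inj_on ?b ?P"
  proof (rule inj_onI)
    fix p q assume p: "p \<in> ?P" and "q \<in> ?P" and "?b p = ?b q"
    then have eq: "pair_mat p = pair_mat q" using congr_inverse[OF assms] by metis
    obtain i j where "p = {i, j}" using p by blast
    moreover have "pair_mat p $ i $ j = pair_mat q $ i $ j" using eq by simp
    ultimately show "p = q" by (simp add: pair_mat_def split: if_splits)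
  qed
  have fin: "finite ?P" by (rule finite_subset[of _ "Pow UNIV"]) auto
  have sum_congr: "congr T (\<Sum>p\<in>?P. f p) = (\<Sum>p\<in>?P. congr T (f p))" for f
    using fin by (induction rule: finite_induct) (auto simp: congr_add)
  have "cmat.independent (?b ` ?P)"
  proof (rule cmat.independent_if_scalars_zero)
    show "finite (?b ` ?P)" using fin by simp
    fix f x assume *: "(\<Sum>x\<in>?b ` ?P. cscale (f x) x) = 0" and x: "x \<in> ?b ` ?P"
    then obtain q where q: "q \<in> ?P" "x = ?b q" by blast
    have "congr T (\<Sum>p\<in>?P. cscale (f (?b p)) (pair_mat p)) = 0"
      using * by (simp add: sum.reindex[OF inj] sum_congr congr_cscale)
    then have z: "(\<Sum>p\<in>?P. cscale (f (?b p)) (pair_mat p)) = 0" using congr_eq_0_iff[OF assms] by blast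
    obtain i j where ij: "q = {i, j}" using q by blast
    have "(\<Sum>p\<in>?P. cscale (f (?b p)) (pair_mat p)) $ i $ j = (\<Sum>p\<in>?P. if p = q then f (?b p) else 0)"
      unfolding sum_component ij by (intro sum.cong refl) (auto simp: pair_mat_def)
    then show "f x = 0" using z q fin by (simp add: sum.delta)
  qed
  moreover have "?b ` ?P \<subseteq> congr T ` Sym_on I" using mem by blast
  moreover have "congr T ` Sym_on I \<subseteq> cmat.span (?b ` ?P)"
  proof
    fix B assume "B \<in> congr T ` Sym_on I"
    then obtain X where X: "X \<in> Sym_on I" "B = congr T X" by blast
    have "B = (\<Sum>p\<in>?P. cscale (\<Sum>(i, j)\<in>{(i, j). p = {i, j}}. X $ i $ j / of_nat (card {(i, j). p = {i, j}})) (?b p))"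
      unfolding X(2) by (subst pair_expansion[OF X(1)]) (simp only: sum_congr congr_cscale)
    also have "\<dots> \<in> cmat.span (?b ` ?P)"
      by (intro cmat.span_sum cmat.span_scale cmat.span_base imageI)
    finally show "B \<in> cmat.span (?b ` ?P)" .
  qed
  ultimately have "cmat.dim (congr T ` Sym_on I) = card (?b ` ?P)"
    by (intro cmat.dim_unique) auto
  also have "\<dots> = card ?P" using inj by (rule card_image)
  also have "\<dots> = card I * (card I + 1) div 2" by (rule card_unordered_pairs) simp
  finally show ?thesis .
qed

lemma linear_P_congr_Sym_on:
  assumes "S ** T = mat 1" "card I * (card I + 1) div 2 = k + 1"
  shows "linear_P k (congr T ` Sym_on I)"
  unfolding linear_P_def
  using congr_Sym_on_subset subspace_congr_Sym_on dim_congr_Sym_on[OF assms(1)] assms(2) by simp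

lemma matrix_mult_vec_nth: "(A *v x) $ i = (\<Sum>j\<in>UNIV. A $ i $ j * x $ j)"
  by (simp add: matrix_vector_mult_def)

lemma mult_zero_iff_Sym_on:
  assumes fr: "ker_frame T S I A" and B: "B \<in> Sym6"
  shows "A ** B = 0 \<longleftrightarrow> B \<in> congr T ` Sym_on I"
proof
  have TS: "T ** S = mat 1" and ST: "S ** T = mat 1"
    and ker: "\<And>k. A *v k = 0 \<longleftrightarrow> (\<forall>j. j \<notin> I \<longrightarrow> (S *v k) $ j = 0)"
    using fr unfolding ker_frame_def by blast+
  have col: "A *v column c B = column c (A ** B)" "S *v column c B = column c (S ** B)" for c and A B S :: mat6
    by (auto simp: vec_eq_iff column_def matrix_mult_vec_nth matrix_mult_nth)
  {
    assume "A ** B = 0"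
    then have "A *v column c B = 0" for c unfolding col by (simp add: column_def vec_eq_iff)
    then have SB: "(S ** B) $ j $ c = 0" if "j \<notin> I" for j c
      using that ker[of "column c B"] unfolding col by (simp add: column_def)
    have "congr S B $ i $ j = 0" if "i \<notin> I" for i j
      using SB[OF that] by (simp add: congr_def matrix_mult_nth[of "S ** B"])
    moreover have "congr S B \<in> Sym6" using B by (rule congr_Sym6)
    ultimately have "congr S B \<in> Sym_on I" unfolding Sym_on_def mem_Collect_eq using Sym6_iff[of "congr S B"] by metis
    moreover have "B = congr T (congr S B)" using congr_inverse[OF TS] by simp
    ultimately show "B \<in> congr T ` Sym_on I" by blast
  next
    assume "B \<in> congr T ` Sym_on I"
    then obtain X where X: "X \<in> Sym_on I" "B = congr T X" by blast
    have "S ** B = X ** transpose T"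
      using X(2) ST by (simp add: congr_def matrix_mul_assoc)
    then have "(S ** B) $ j $ c = 0" if "j \<notin> I" for j c
      using X(1) that by (simp add: matrix_mult_nth[of X] Sym_on_def)
    then have "A *v column c B = 0" for c using ker[of "column c B"] unfolding col(2) by (simp add: column_def)
    then show "A ** B = 0" unfolding col by (simp add: column_def vec_eq_iff)
  }
qed

lemma ker_frame_exists: "\<exists>T S I. ker_frame T S I A"
proof -
  let ?K = "{k. A *v k = 0}"
  have sub: "vec.subspace ?K"
    by (rule vec.subspaceI) (auto simp: matrix_vector_right_distrib vector_scalar_commute)
  obtain Bk where Bk: "Bk \<subseteq> ?K" "vec.independent Bk" "?K \<subseteq> vec.span Bk" using vec.basis_exists by metis
  define E where "E = vec.extend_basis Bk"
  have E: "Bk \<subseteq> E" "vec.independent E" "vec.span E = UNIV"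
    unfolding E_def using Bk(2) vec.extend_basis_superset vec.independent_extend_basis vec.span_extend_basis by auto
  have "finite E" using E(2) by (rule vec.finiteI_independent)
  have "card E = vec.dim (UNIV :: (complex^quad_exp) set)" using E vec.dim_unique[of E UNIV] by simp
  then have "card E = CARD(quad_exp)" unfolding vec_dim_card .
  then obtain h where h: "bij_betw h (UNIV :: quad_exp set) E"
    using \<open>finite E\<close> finite_same_card_bij[of "UNIV :: quad_exp set" E] by auto
  define T :: mat6 where "T = transpose (\<chi> i. h i)"
  have colT: "column i T = h i" for i by (simp add: T_def column_def transpose_def vec_eq_iff)
  have "columns T = E" using h unfolding columns_def colT by (auto simp: bij_betw_def)
  then obtain S where TS: "T ** S = mat 1" using matrix_right_invertible_span_columns[of T] E(3) by auto
  then have ST: "S ** T = mat 1" by (simp add: matrix_left_right_inverse)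
  define I where "I = {i. h i \<in> Bk}"
  have Tu: "T *v u = (\<Sum>i\<in>UNIV. u $ i *s h i)" for u
    by (simp add: matrix_mult_sum colT)
  have "A *v k = 0 \<longleftrightarrow> (\<forall>j. j \<notin> I \<longrightarrow> (S *v k) $ j = 0)" for k
  proof
    have k: "k = T *v (S *v k)" by (simp add: matrix_vector_mul_assoc TS)
    {
      assume "A *v k = 0"
      then have "k \<in> vec.span Bk" using Bk(3) by blast
      also have "Bk = h ` I" using E(1) h unfolding I_def by (auto simp: bij_betw_def)
      finally obtain u where u: "k = (\<Sum>b\<in>h ` I. u b *s b)" using vec.span_finite[of "h ` I"] by auto
      define w :: "complex^quad_exp" where "w = (\<chi> i. if i \<in> I then u (h i) else 0)"
      have "inj_on h I" using h by (auto simp: bij_betw_def inj_on_def)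
      then have "k = (\<Sum>i\<in>I. u (h i) *s h i)" using u by (simp add: sum.reindex)
      also have "\<dots> = (\<Sum>i\<in>UNIV. w $ i *s h i)"
        by (rule sum.mono_neutral_cong_left) (auto simp: w_def)
      finally have "k = T *v w" by (simp add: Tu)
      then have "S *v k = w" by (simp add: matrix_vector_mul_assoc ST)
      then show "\<forall>j. j \<notin> I \<longrightarrow> (S *v k) $ j = 0" by (simp add: w_def)
    next
      assume *: "\<forall>j. j \<notin> I \<longrightarrow> (S *v k) $ j = 0"
      have "(S *v k) $ i *s h i \<in> ?K" for i
      proof (cases "i \<in> I")
        case True
        then have "h i \<in> ?K" using Bk(1) by (auto simp: I_def)
        then show ?thesis by (rule vec.subspace_scale[OF sub])
      next
        case False
        then show ?thesis using * vec.subspace_0[OF sub] by simp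
      qed
      then have "(\<Sum>i\<in>UNIV. (S *v k) $ i *s h i) \<in> ?K" by (intro vec.subspace_sum[OF sub])
      then show "A *v k = 0" using k Tu by simp
    }
  qed
  then show ?thesis using TS ST unfolding ker_frame_def by blast
qed

lemma vec_subspace_range: "vec.subspace (range ((*v) (A :: mat6)))"
proof (rule vec.subspaceI)
  show "0 \<in> range ((*v) A)" by (rule range_eqI[of _ _ 0]) simp
  show "x + y \<in> range ((*v) A)" if "x \<in> range ((*v) A)" "y \<in> range ((*v) A)" for x y
    using that by (auto simp: matrix_vector_right_distrib[symmetric])
  show "c *s x \<in> range ((*v) A)" if "x \<in> range ((*v) A)" for c x
    using that by (auto simp: vector_scalar_commute[symmetric])
qed

lemma ker_frame_rank:
  assumes fr: "ker_frame T S I A" and "A \<in> Sym6"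
  shows "rank A + card I = 6"
proof -
  have TS: "T ** S = mat 1" and ST: "S ** T = mat 1"
    and ker: "\<And>k. A *v k = 0 \<longleftrightarrow> (\<forall>j. j \<notin> I \<longrightarrow> (S *v k) $ j = 0)"
    using fr unfolding ker_frame_def by blast+
  let ?V = "{u :: complex^quad_exp. \<forall>j. j \<notin> -I \<longrightarrow> u $ j = 0}"
  have subV: "vec.subspace ?V" by (rule vec.subspaceI) auto
  have "rows A = columns A" using assms(2) rows_transpose[of A] by (simp add: Sym6_def)
  then have "rank A = vec.dim (columns A)" by (simp add: row_rank_def_gen)
  also have "\<dots> = vec.dim (vec.span (columns A))" by simp
  also have "vec.span (columns A) = range ((*v) A)"
  proof
    show "range ((*v) A) \<subseteq> vec.span (columns A)" using matrix_vector_mult_in_columnspace_gen by blast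
    have "columns A \<subseteq> range ((*v) A)"
    proof
      fix x assume "x \<in> columns A"
      then obtain i where "x = column i A" unfolding columns_def by blast
      also have "column i A = A *v axis i 1"
        by (simp add: vec_eq_iff column_def matrix_mult_vec_nth axis_def if_distrib[of "\<lambda>x. _ * x"] sum.delta cong: if_cong)
      finally have "x = A *v axis i 1" .
      then show "x \<in> range ((*v) A)" by blast
    qed
    then show "vec.span (columns A) \<subseteq> range ((*v) A)" by (intro vec.span_minimal vec_subspace_range)
  qed
  also have "range ((*v) A) = (*v) (A ** T) ` ?V"
  proof
    show "(*v) (A ** T) ` ?V \<subseteq> range ((*v) A)" by (auto simp: matrix_vector_mul_assoc[symmetric])
    show "range ((*v) A) \<subseteq> (*v) (A ** T) ` ?V"
    proof
      fix y assume "y \<in> range ((*v) A)"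
      then obtain x where x: "y = A *v x" by blast
      define u :: "complex^quad_exp" where "u = (\<chi> j. if j \<in> I then 0 else (S *v x) $ j)"
      have "S *v (x - T *v u) = S *v x - u"
        by (simp add: matrix_vector_mult_diff_distrib matrix_vector_mul_assoc ST)
      then have "A *v (x - T *v u) = 0" unfolding ker by (simp add: u_def)
      then have "y = (A ** T) *v u" by (simp add: x matrix_vector_mult_diff_distrib matrix_vector_mul_assoc)
      moreover have "u \<in> ?V" by (simp add: u_def)
      ultimately show "y \<in> (*v) (A ** T) ` ?V" by blast
    qed
  qed
  also have "vec.dim ((*v) (A ** T) ` ?V) = vec.dim ?V"
  proof (rule vec.dim_image_eq)
    show "Vector_Spaces.linear (*s) (*s) ((*v) (A ** T))" by (rule matrix_vector_mul_linear_gen)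
    have "u = v" if "u \<in> ?V" "v \<in> ?V" "(A ** T) *v u = (A ** T) *v v" for u v
    proof -
      have "A *v (T *v (u - v)) = 0" using that(3)
        by (simp add: matrix_vector_mult_diff_distrib matrix_vector_mul_assoc)
      then have "\<forall>j. j \<notin> I \<longrightarrow> (u - v) $ j = 0" unfolding ker by (simp add: matrix_vector_mul_assoc ST)
      moreover have "(u - v) $ j = 0" if "j \<in> I" for j using that \<open>u \<in> ?V\<close> \<open>v \<in> ?V\<close> by auto
      ultimately have "u - v = 0" by (auto simp: vec_eq_iff)
      then show ?thesis by simp
    qed
    then show "inj_on ((*v) (A ** T)) (vec.span ?V)"
      unfolding vec.span_eq_iff[THEN iffD2, OF subV] by (intro inj_onI)
  qed
  also have "vec.dim ?V = card (-I)" by (rule dim_substandard_cart)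
  also have "\<dots> = 6 - card I" by (simp add: Compl_eq_Diff_UNIV card_Diff_subset card_quad_exp)
  finally have "rank A = 6 - card I" .
  moreover have "card I \<le> 6" using card_mono[of UNIV I] by (simp add: card_quad_exp)
  ultimately show ?thesis by simp
qed


section \<open>Limits along lines through a degenerate matrix\<close>

text \<open>The real inner product on complex vectors is the real part of the Hermitian one, so the part of
  \<open>v\<close> orthogonal to the range is the conjugate of a kernel vector.\<close>

lemma symmetric_range:
  fixes v :: "complex^quad_exp"
  assumes A: "A \<in> Sym6" and ker: "\<And>k. A *v k = 0 \<Longrightarrow> (\<Sum>i\<in>UNIV. k $ i * v $ i) = 0"
  shows "\<exists>y. A *v y = v"
proof -
  let ?R = "range ((*v) A)"
  have sub: "subspace ?R"
  proof -
    have "vec.subspace ?R" by (rule vec_subspace_range)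
    moreover have "r *\<^sub>R x = complex_of_real r *s x" for r and x :: "complex^quad_exp"
      by (simp add: vec_eq_iff complex_eq_iff)
    ultimately show ?thesis unfolding subspace_def vec.subspace_def by simp
  qed
  obtain y z where "y \<in> span ?R" and orth: "\<And>w. w \<in> span ?R \<Longrightarrow> orthogonal z w" and v: "v = y + z"
    using orthogonal_subspace_decomp_exists[of ?R v] by metis
  moreover have "span ?R = ?R" using sub by (rule span_eq_iff[THEN iffD2])
  ultimately obtain u where y: "y = A *v u" by blast
  define k :: "complex^quad_exp" where "k = (\<chi> i. cnj (z $ i))"
  have "(A *v k) $ j = 0" for j
  proof -
    let ?c = "(A *v k) $ j"
    have "A *v axis j (cnj ?c) \<in> span ?R" by (intro span_base) blast
    then have "0 = inner z (A *v axis j (cnj ?c))" using orth by (simp add: orthogonal_def)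
    also have "\<dots> = (\<Sum>i\<in>UNIV. inner (z $ i) (A $ i $ j * cnj ?c))"
      by (simp add: inner_vec_def matrix_mult_vec_nth axis_def if_distrib[of "\<lambda>x. _ * x"] sum.delta cong: if_cong)
    also have "\<dots> = Re (\<Sum>i\<in>UNIV. cnj (z $ i) * (A $ i $ j * cnj ?c))"
      by (simp add: Re_sum inner_complex_def)
    also have "(\<Sum>i\<in>UNIV. cnj (z $ i) * (A $ i $ j * cnj ?c)) = (\<Sum>i\<in>UNIV. A $ j $ i * k $ i) * cnj ?c"
      unfolding sum_distrib_right using A by (intro sum.cong refl) (simp add: k_def Sym6_iff)
    also have "\<dots> = ?c * cnj ?c" by (simp add: matrix_mult_vec_nth)
    finally show ?thesis by (simp add: complex_mult_cnj complex_eq_iff sum_power2_eq_zero_iff)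
  qed
  then have Ak: "A *v k = 0" by (simp add: vec_eq_iff)
  have "(\<Sum>i\<in>UNIV. k $ i * y $ i) = (\<Sum>j\<in>UNIV. (\<Sum>i\<in>UNIV. k $ i * A $ i $ j) * u $ j)"
    unfolding y matrix_mult_vec_nth sum_distrib_left sum_distrib_right
    by (subst sum.swap) (simp add: mult.assoc)
  also have "\<dots> = (\<Sum>j\<in>UNIV. (A *v k) $ j * u $ j)"
    using A by (simp add: matrix_mult_vec_nth Sym6_iff mult.commute)
  also have "\<dots> = 0" by (simp add: Ak)
  finally have "(\<Sum>i\<in>UNIV. k $ i * z $ i) = 0"
    using ker[OF Ak] by (simp add: v distrib_left sum.distrib)
  then have "Re (\<Sum>i\<in>UNIV. k $ i * z $ i) = 0" by simp
  then have "(\<Sum>i\<in>UNIV. (norm (z $ i))\<^sup>2) = 0"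
    by (simp add: k_def cmod_power2 power2_eq_square[of "Re _"] power2_eq_square[of "Im _"])
  then have "z = 0" by (simp add: sum_nonneg_eq_0_iff vec_eq_iff)
  then show ?thesis using v y by auto
qed

lemma bi_polys_on_curve:
  assumes "f \<in> bi_polys" "\<And>i j. \<exists>p. \<forall>t. g t $ i $ j = poly p t" "\<And>i j. \<exists>p. \<forall>t. h t $ i $ j = poly p t"
  shows "\<exists>p. \<forall>t. f (g t, h t) = poly p t"
  by (rule poly_funs_on_curve[OF assms(1)[unfolded bi_polys_def], of "\<lambda>t. (g t, h t)"])
    (use assms(2,3) in auto)

text \<open>Along the line \<open>A + t D\<close> the inverse is \<open>t\<inverse>\<close> times a matrix that tends to \<open>C\<close>:
  \<open>(A + t D) (C + t Y) = t (1 + t D Y)\<close>. Its denominators are cleared by the adjugate of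
  \<open>1 + t D Y\<close>.\<close>

lemma limit_pairI:
  assumes A: "A \<in> Cat - {0}" and C: "C \<in> Sym6 - {0}" and D: "D \<in> Cat"
    and AC: "A ** C = 0" and Y: "A ** Y + D ** C = mat 1"
  shows "limit_pair A C"
proof -
  have "f (A, C) = 0" if f: "f \<in> bi_forms d e"
    and van: "\<And>C. C \<in> Cat \<Longrightarrow> det C \<noteq> 0 \<Longrightarrow> f (C, adjugate C) = 0" for d e f
  proof -
    define N where "N t = mat 1 + cscale t (D ** Y)" for t
    define At where "At t = A + cscale t D" for t
    define Bt where "Bt t = (C + cscale t Y) ** adjugate (N t)" for t
    have mult: "At t ** Bt t = mat (t * det (N t))" for t
    proof -
      have "At t ** (C + cscale t Y) = cscale t (A ** Y + D ** C + cscale t (D ** Y)) + A ** C"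
        by (simp add: vec_eq_iff At_def matrix_mult_nth sum.distrib algebra_simps sum_distrib_left)
      also have "\<dots> = cscale t (N t)" by (simp only: Y AC N_def add_0_right)
      finally show ?thesis
        by (simp add: Bt_def matrix_mul_assoc cscale_mult_left mult_adjugate cscale_mat)
    qed
    have At: "At t \<in> Cat" for t
      unfolding At_def using A D subspace_Cat by (intro cmat.subspace_add cmat.subspace_scale) auto
    have zero: "f (At t, Bt t) = 0" if "t * det (N t) \<noteq> 0" for t
      by (rule vanish_at_inverse_pair[OF f _ At mult that]) (use van in blast)
    obtain q where q: "\<And>t. det (N t) = poly q t"
      unfolding N_def using mat_polys_on_line[OF det_mat_polys] by metis
    have "\<exists>p. \<forall>t. adjugate (N t) $ i $ j = poly p t" for i j
      unfolding N_def by (rule mat_polys_on_line[OF adjugate_mat_polys])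
    then obtain p where p: "\<And>i j t. adjugate (N t) $ i $ j = poly (p i j) t" by metis
    have "\<exists>p. \<forall>t. f (At t, Bt t) = poly p t"
    proof (rule bi_polys_on_curve)
      show "f \<in> bi_polys" using f unfolding bi_forms_def by blast
      show "\<exists>p. \<forall>t. At t $ i $ j = poly p t" for i j
        by (intro exI[of _ "[:A $ i $ j, D $ i $ j:]"]) (simp add: At_def)
      have "Bt t $ i $ j = poly (\<Sum>k\<in>UNIV. [:C $ i $ k, Y $ i $ k:] * p k j) t" for t i j
        by (simp add: Bt_def matrix_mult_nth p poly_sum algebra_simps)
      then show "\<exists>p. \<forall>t. Bt t $ i $ j = poly p t" for i j by blast
    qed
    then obtain g where g: "\<And>t. f (At t, Bt t) = poly g t" by blast
    have N0: "N 0 = mat 1" by (simp add: N_def vec_eq_iff)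
    have "q \<noteq> 0" using q[of 0] N0 by auto
    then have "[:0, 1:] * q \<noteq> 0" by simp
    then have "g = 0" by (rule poly_zero_if_cofinite) (use zero q g in auto)
    then have "f (At 0, Bt 0) = 0" using g by simp
    moreover have "adjugate (mat 1) = mat 1"
      using scalar_inverse_is_adjugate[of "mat 1" "mat 1" 1] by simp
    then have "At 0 = A" "Bt 0 = C" by (simp_all add: At_def Bt_def N0)
    ultimately show ?thesis by simp
  qed
  then show ?thesis unfolding limit_pair_def using A C by blast
qed

text \<open>The block \<open>X\<close> of the limit is inverse to the block of \<open>D\<close> on the kernel.\<close>

lemma limit_pair_on_kernel:
  assumes fr: "ker_frame T S I A" and A: "A \<in> Cat - {0}" and D: "D \<in> Cat"
    and X: "X \<in> Sym_on I" "X \<noteq> 0" and P: "P \<in> Sym_on I" "P ** X = cscale c (id_on I)" "c \<noteq> 0"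
    and eq: "\<And>i j. i \<in> I \<Longrightarrow> j \<in> I \<Longrightarrow> congr (transpose T) D $ i $ j = P $ i $ j"
  shows "limit_pair A (congr T X)"
proof -
  have TS: "T ** S = mat 1" and ST: "S ** T = mat 1"
    and ker: "\<And>k. A *v k = 0 \<longleftrightarrow> (\<forall>j. j \<notin> I \<longrightarrow> (S *v k) $ j = 0)"
    using fr unfolding ker_frame_def by blast+
  define C where "C = congr T (cscale (1 / c) X)"
  have X': "cscale (1 / c) X \<in> Sym_on I" using X(1) by (rule cmat.subspace_scale[OF subspace_Sym_on])
  have C: "C \<in> Sym6 - {0}"
    using congr_Sym_on_subset X X' congr_eq_0_iff[OF ST] P(3) unfolding C_def by auto
  have AC: "A ** C = 0"
    using mult_zero_iff_Sym_on[OF fr, of C] C X' unfolding C_def by blast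
  have "\<exists>y. A *v y = column j (mat 1 - D ** C)" for j
  proof (rule symmetric_range)
    show "A \<in> Sym6" using A Cat_subset_Sym6 by blast
    fix k assume "A *v k = 0"
    define u where "u = S *v k"
    have u: "u $ j = 0" if "j \<notin> I" for j using that ker \<open>A *v k = 0\<close> by (simp add: u_def)
    have k: "k = T *v u" by (simp add: u_def matrix_vector_mul_assoc TS)
    have row: "(\<Sum>i\<in>UNIV. k $ i * M $ i $ j) = (\<Sum>i\<in>UNIV. u $ i * (transpose T ** M) $ i $ j)" for M :: mat6
      unfolding k matrix_mult_vec_nth matrix_mult_nth sum_distrib_left sum_distrib_right transpose_def
      by (subst sum.swap) (simp add: ac_simps)
    have "(\<Sum>i\<in>UNIV. u $ i * (transpose T ** (D ** C)) $ i $ j)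
      = (\<Sum>i\<in>UNIV. u $ i * (P ** cscale (1 / c) X ** transpose T) $ i $ j)"
    proof (intro sum.cong refl)
      fix i
      have "transpose T ** (D ** C) = congr (transpose T) D ** cscale (1 / c) X ** transpose T"
        by (simp add: C_def congr_def matrix_mul_assoc transpose_transpose)
      moreover have "(congr (transpose T) D ** cscale (1 / c) X) $ i $ l = (P ** cscale (1 / c) X) $ i $ l" if "i \<in> I" for l
        unfolding matrix_mult_nth
      proof (intro sum.cong refl)
        fix m show "congr (transpose T) D $ i $ m * cscale (1 / c) X $ m $ l = P $ i $ m * cscale (1 / c) X $ m $ l"
          using eq[OF that, of m] X(1) by (cases "m \<in> I") (auto simp: Sym_on_def)
      qed
      ultimately show "u $ i * (transpose T ** (D ** C)) $ i $ j = u $ i * (P ** cscale (1 / c) X ** transpose T) $ i $ j"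
        using u[of i] by (cases "i \<in> I") (simp_all add: matrix_mult_nth[of _ "transpose T"])
    qed
    also have "P ** cscale (1 / c) X = id_on I" using P by (simp add: cscale_mult_right)
    also have "(\<Sum>i\<in>UNIV. u $ i * (id_on I ** transpose T) $ i $ j) = (\<Sum>i\<in>UNIV. u $ i * transpose T $ i $ j)"
    proof (intro sum.cong refl)
      fix i show "u $ i * (id_on I ** transpose T) $ i $ j = u $ i * transpose T $ i $ j"
        using u[of i]
        by (cases "i \<in> I") (simp_all add: id_on_def matrix_mult_nth if_distrib[of "\<lambda>x. x * _"] sum.delta' cong: if_cong)
    qed
    finally have "(\<Sum>i\<in>UNIV. k $ i * (D ** C) $ i $ j) = (\<Sum>i\<in>UNIV. k $ i * (mat 1 :: mat6) $ i $ j)"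
      unfolding row by (simp add: row)
    then show "(\<Sum>i\<in>UNIV. k $ i * column j (mat 1 - D ** C) $ i) = 0"
      by (simp add: column_def right_diff_distrib sum_subtractf)
  qed
  then obtain y where y: "\<And>j. A *v y j = column j (mat 1 - D ** C)" by metis
  define Y :: mat6 where "Y = (\<chi> i j. y j $ i)"
  have "(A ** Y) $ i $ j = (mat 1 - D ** C) $ i $ j" for i j
    using y[of j] by (simp add: vec_eq_iff matrix_mult_nth matrix_mult_vec_nth Y_def column_def)
  then have "A ** Y + D ** C = mat 1" by (simp add: vec_eq_iff)
  from limit_pairI[OF A C D AC this]
  have lim: "limit_pair A C" .
  have B: "congr T X = cscale c C" using P(3) by (simp add: C_def congr_cscale)
  show ?thesis
    unfolding limit_pair_def
  proof (intro conjI A allI ballI impI)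
    show "congr T X \<in> Sym6 - {0}"
      using congr_Sym_on_subset X congr_eq_0_iff[OF ST] by auto
    fix d e f assume f: "f \<in> bi_forms d e" "\<forall>C\<in>Cat. det C \<noteq> 0 \<longrightarrow> f (C, adjugate C) = 0"
    then have "f (A, C) = 0" using lim unfolding limit_pair_def by blast
    moreover have "f (cscale 1 A, cscale c C) = 1 ^ d * c ^ e * f (A, C)"
      using f(1) by (rule bi_forms_scale)
    ultimately show "f (A, congr T X) = 0" by (simp add: B)
  qed
qed

section \<open>Coordinates and changes of variables\<close>

definition XX :: quad_exp where "XX = Abs_quad_exp (vector [2,0,0])"
definition YY :: quad_exp where "YY = Abs_quad_exp (vector [0,2,0])"
definition ZZ :: quad_exp where "ZZ = Abs_quad_exp (vector [0,0,2])"
definition XY :: quad_exp where "XY = Abs_quad_exp (vector [1,1,0])"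
definition XZ :: quad_exp where "XZ = Abs_quad_exp (vector [1,0,1])"
definition YZ :: quad_exp where "YZ = Abs_quad_exp (vector [0,1,1])"

lemma Rep_quads:
  "Rep_quad_exp XX = vector [2,0,0]" "Rep_quad_exp YY = vector [0,2,0]" "Rep_quad_exp ZZ = vector [0,0,2]"
  "Rep_quad_exp XY = vector [1,1,0]" "Rep_quad_exp XZ = vector [1,0,1]" "Rep_quad_exp YZ = vector [0,1,1]"
  unfolding XX_def YY_def ZZ_def XY_def XZ_def YZ_def
  by (subst Abs_quad_exp_inverse; simp add: sum_3)+

lemma quads_distinct [simp]:
  "XX \<noteq> YY" "XX \<noteq> ZZ" "XX \<noteq> XY" "XX \<noteq> XZ" "XX \<noteq> YZ"
  "YY \<noteq> XX" "YY \<noteq> ZZ" "YY \<noteq> XY" "YY \<noteq> XZ" "YY \<noteq> YZ"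
  "ZZ \<noteq> XX" "ZZ \<noteq> YY" "ZZ \<noteq> XY" "ZZ \<noteq> XZ" "ZZ \<noteq> YZ"
  "XY \<noteq> XX" "XY \<noteq> YY" "XY \<noteq> ZZ" "XY \<noteq> XZ" "XY \<noteq> YZ"
  "XZ \<noteq> XX" "XZ \<noteq> YY" "XZ \<noteq> ZZ" "XZ \<noteq> XY" "XZ \<noteq> YZ"
  "YZ \<noteq> XX" "YZ \<noteq> YY" "YZ \<noteq> ZZ" "YZ \<noteq> XY" "YZ \<noteq> XZ"
  by (simp_all add: Rep_quad_exp_inject[symmetric] Rep_quads vector3_eq_iff)

lemma quad_cases: "q = XX \<or> q = YY \<or> q = ZZ \<or> q = XY \<or> q = XZ \<or> q = YZ"
proof -
  have "Rep_quad_exp q \<in> {vector [2,0,0], vector [0,2,0], vector [0,0,2], vector [1,1,0], vector [1,0,1], vector [0,1,1]}"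
    using Rep_quad_exp[of q] unfolding quad_exp_set_eq .
  then show ?thesis by (simp add: Rep_quad_exp_inject[symmetric] Rep_quads)
qed

lemma UNIV_quad: "(UNIV :: quad_exp set) = {XX, YY, ZZ, XY, XZ, YZ}"
  using quad_cases by auto

lemma forall_quad: "(\<forall>q. P q) \<longleftrightarrow> P XX \<and> P YY \<and> P ZZ \<and> P XY \<and> P XZ \<and> P YZ"
  using quad_cases by metis

lemma sum_quad: "(\<Sum>q\<in>UNIV. f q) = f XX + f YY + f ZZ + f XY + f XZ + (f YZ :: 'a :: comm_monoid_add)"
  by (simp add: UNIV_quad add.assoc)

lemma mat6_eq_iff: "(A :: mat6) = B \<longleftrightarrow> (\<forall>i j. A $ i $ j = B $ i $ j)"
  by (auto simp: vec_eq_iff)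

text \<open>The catalecticants are cut out by the six relations between products of the monomials.\<close>

lemma Cat_iff:
  "A \<in> Cat \<longleftrightarrow> A \<in> Sym6 \<and> A $ XX $ YY = A $ XY $ XY \<and> A $ XX $ ZZ = A $ XZ $ XZ \<and> A $ YY $ ZZ = A $ YZ $ YZ \<and>
     A $ XX $ YZ = A $ XY $ XZ \<and> A $ YY $ XZ = A $ XY $ YZ \<and> A $ ZZ $ XY = A $ XZ $ YZ"
proof
  assume A: "A \<in> Cat"
  then obtain a where a: "\<And>i j. A $ i $ j = a (Rep_quad_exp i + Rep_quad_exp j)" unfolding Cat_def by blast
  have v: "vector [x,y,z] + vector [x',y',z'] = (vector [x+x',y+y',z+z'] :: nat^3)" for x y z x' y' z'
    by (simp add: vec_eq_iff forall_3)
  show "A \<in> Sym6 \<and> A $ XX $ YY = A $ XY $ XY \<and> A $ XX $ ZZ = A $ XZ $ XZ \<and> A $ YY $ ZZ = A $ YZ $ YZ \<and>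
     A $ XX $ YZ = A $ XY $ XZ \<and> A $ YY $ XZ = A $ XY $ YZ \<and> A $ ZZ $ XY = A $ XZ $ YZ"
    using A Cat_subset_Sym6 by (auto simp: a Rep_quads v numeral_2_eq_2)
next
  assume *: "A \<in> Sym6 \<and> A $ XX $ YY = A $ XY $ XY \<and> A $ XX $ ZZ = A $ XZ $ XZ \<and> A $ YY $ ZZ = A $ YZ $ YZ \<and>
     A $ XX $ YZ = A $ XY $ XZ \<and> A $ YY $ XZ = A $ XY $ YZ \<and> A $ ZZ $ XY = A $ XZ $ YZ"
  then have sym: "A $ i $ j = A $ j $ i" for i j by (simp add: Sym6_iff)
  define a :: "nat^3 \<Rightarrow> complex" where "a v =
    (if v = vector [4,0,0] then A $ XX $ XX else if v = vector [0,4,0] then A $ YY $ YY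
     else if v = vector [0,0,4] then A $ ZZ $ ZZ else if v = vector [3,1,0] then A $ XX $ XY
     else if v = vector [3,0,1] then A $ XX $ XZ else if v = vector [1,3,0] then A $ YY $ XY
     else if v = vector [0,3,1] then A $ YY $ YZ else if v = vector [1,0,3] then A $ ZZ $ XZ
     else if v = vector [0,1,3] then A $ ZZ $ YZ else if v = vector [2,2,0] then A $ XY $ XY
     else if v = vector [2,0,2] then A $ XZ $ XZ else if v = vector [0,2,2] then A $ YZ $ YZ
     else if v = vector [2,1,1] then A $ XY $ XZ else if v = vector [1,2,1] then A $ XY $ YZ
     else A $ XZ $ YZ)" for v
  have v: "vector [x,y,z] + vector [x',y',z'] = (vector [x+x',y+y',z+z'] :: nat^3)" for x y z x' y' z'
    by (simp add: vec_eq_iff forall_3)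
  have "\<forall>i j. A $ i $ j = a (Rep_quad_exp i + Rep_quad_exp j)"
    unfolding forall_quad Rep_quads v a_def vector3_eq_iff
    using * sym[of YY XX] sym[of ZZ XX] sym[of ZZ YY] sym[of XY XX] sym[of XZ XX] sym[of YZ XX]
      sym[of XY YY] sym[of XZ YY] sym[of YZ YY] sym[of XY ZZ] sym[of XZ ZZ] sym[of YZ ZZ]
      sym[of XZ XY] sym[of YZ XY] sym[of YZ XZ]
    by simp
  then show "A \<in> Cat" unfolding Cat_def by blast
qed

text \<open>An invertible catalecticant: the quartic \<open>x\<^sup>4 + y\<^sup>4 + z\<^sup>4 + 12 (x\<^sup>2 y\<^sup>2 + x\<^sup>2 z\<^sup>2 + y\<^sup>2 z\<^sup>2)\<close> in suitable
  normalization.\<close>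

lemma invertible_Cat_exists: "\<exists>C\<in>Cat. det C \<noteq> 0"
proof -
  define C :: mat6 where "C = (\<chi> i j. if i = j then (if i = XX \<or> i = YY \<or> i = ZZ then 1 else 2)
    else if (i = XX \<or> i = YY \<or> i = ZZ) \<and> (j = XX \<or> j = YY \<or> j = ZZ) then 2 else 0)"
  define D :: mat6 where "D = (\<chi> i j. if i = j then (if i = XX \<or> i = YY \<or> i = ZZ then - 3/5 else 1/2)
    else if (i = XX \<or> i = YY \<or> i = ZZ) \<and> (j = XX \<or> j = YY \<or> j = ZZ) then 2/5 else 0)"
  have "C \<in> Cat" unfolding Cat_iff Sym6_iff by (auto simp: C_def)
  moreover have "C ** D = mat 1"
    unfolding mat6_eq_iff forall_quad matrix_mult_nth sum_quad by (simp add: C_def D_def mat_nth)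
  then have "det C \<noteq> 0" by (rule det_nonzero_if_scalar) simp
  ultimately show ?thesis by blast
qed

definition bil :: "mat6 \<Rightarrow> complex^quad_exp \<Rightarrow> complex^quad_exp \<Rightarrow> complex" where
  "bil A p q = (\<Sum>i\<in>UNIV. \<Sum>j\<in>UNIV. p $ i * A $ i $ j * q $ j)"

text \<open>The product of two linear forms.\<close>

definition qprod :: "complex^3 \<Rightarrow> complex^3 \<Rightarrow> complex^quad_exp" where
  "qprod u v = (\<chi> q. if q = XX then u$1 * v$1 else if q = YY then u$2 * v$2 else if q = ZZ then u$3 * v$3
     else if q = XY then u$1 * v$2 + u$2 * v$1 else if q = XZ then u$1 * v$3 + u$3 * v$1
     else u$2 * v$3 + u$3 * v$2)"

lemma qprod_nth [simp]:
  "qprod u v $ XX = u$1 * v$1" "qprod u v $ YY = u$2 * v$2" "qprod u v $ ZZ = u$3 * v$3"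
  "qprod u v $ XY = u$1 * v$2 + u$2 * v$1" "qprod u v $ XZ = u$1 * v$3 + u$3 * v$1"
  "qprod u v $ YZ = u$2 * v$3 + u$3 * v$2"
  by (simp_all add: qprod_def)

lemma qprod_commute: "qprod u v = qprod v u"
  by (simp add: vec_eq_iff forall_quad algebra_simps)

lemma bil_add_left: "bil A (p + p') q = bil A p q + bil A p' q"
  and bil_scale_left: "bil A (c *s p) q = c * bil A p q"
  by (simp_all add: bil_def sum.distrib algebra_simps sum_distrib_left)

text \<open>A catalecticant is a quartic in disguise: the value on two products of linear forms only
  depends on the product of all four.\<close>

lemma Cat_bil_exchange:
  assumes "A \<in> Cat"
  shows "bil A (qprod u v) (qprod w t) = bil A (qprod u w) (qprod v t)"
proof -
  have sym: "A $ i $ j = A $ j $ i" for i j using assms Cat_subset_Sym6 Sym6_iff by blast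
  note rel = assms[unfolded Cat_iff, THEN conjunct2]
  show ?thesis
    unfolding bil_def sum_quad qprod_nth
    using rel
    by (simp add: sym[of YY XX] sym[of ZZ XX] sym[of ZZ YY] sym[of XY XX] sym[of XZ XX] sym[of YZ XX]
      sym[of XY YY] sym[of XZ YY] sym[of YZ YY] sym[of XY ZZ] sym[of XZ ZZ] sym[of YZ ZZ]
      sym[of XZ XY] sym[of YZ XY] sym[of YZ XZ] algebra_simps)
qed

definition idx1 :: "quad_exp \<Rightarrow> 3" where
  "idx1 q = (if q = XX \<or> q = XY \<or> q = XZ then 1 else if q = YY \<or> q = YZ then 2 else 3)"
definition idx2 :: "quad_exp \<Rightarrow> 3" where
  "idx2 q = (if q = XX then 1 else if q = YY \<or> q = XY then 2 else 3)"

lemma idx_simps [simp]: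
  "idx1 XX = 1" "idx2 XX = 1" "idx1 YY = 2" "idx2 YY = 2" "idx1 ZZ = 3" "idx2 ZZ = 3"
  "idx1 XY = 1" "idx2 XY = 2" "idx1 XZ = 1" "idx2 XZ = 3" "idx1 YZ = 2" "idx2 YZ = 3"
  by (simp_all add: idx1_def idx2_def)

text \<open>The action of a change of variables on quadrics; the columns are the products of the columns
  of \<open>g\<close>.\<close>

definition rho :: "complex^3^3 \<Rightarrow> mat6" where
  "rho g = (\<chi> p q. qprod (column (idx1 q) g) (column (idx2 q) g) $ p)"

lemma column_rho: "column q (rho g) = qprod (column (idx1 q) g) (column (idx2 q) g)"
  by (simp add: column_def rho_def vec_eq_iff)

lemma rho_nth: "rho g $ p $ q = qprod (column (idx1 q) g) (column (idx2 q) g) $ p"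
  by (simp add: rho_def)

lemma column_nth: "column j g $ i = g $ i $ j"
  by (simp add: column_def)

lemma rho_qprod: "rho g *v qprod u v = qprod (g *v u) (g *v v)"
  unfolding vec_eq_iff forall_quad matrix_mult_vec_nth sum_quad rho_nth idx_simps qprod_nth column_nth
  by (simp add: matrix_vector_mult_def sum_3 algebra_simps)

lemma rho_mult: "rho g ** rho h = rho (g ** h)"
proof -
  have "column q (rho g ** rho h) = rho g *v column q (rho h)" for q
    by (auto simp: vec_eq_iff column_def matrix_mult_vec_nth matrix_mult_nth)
  moreover have "column j (g ** h) = g *v column j h" for j
    by (simp add: vec_eq_iff column_def matrix_vector_mult_def matrix_matrix_mult_def)
  ultimately have "column q (rho g ** rho h) = column q (rho (g ** h))" for q
    by (simp add: column_rho rho_qprod)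
  then show ?thesis by (simp add: vec_eq_iff column_def)
qed

lemma rho_1: "rho (mat 1) = mat 1"
  unfolding mat6_eq_iff forall_quad rho_nth idx_simps qprod_nth column_nth
  by (simp add: mat_def)

lemma congr_transpose_nth: "congr (transpose T) A $ i $ j = bil A (column i T) (column j T)"
  by (simp add: congr_nth bil_def transpose_def column_def)

lemma congr_rho_Cat:
  assumes "A \<in> Cat"
  shows "congr (transpose (rho g)) A \<in> Cat"
proof -
  have "congr (transpose (rho g)) A \<in> Sym6" using assms Cat_subset_Sym6 congr_Sym6 by blast
  then show ?thesis
    unfolding Cat_iff congr_transpose_nth column_rho idx_simps
    using Cat_bil_exchange[OF assms] qprod_commute by metis
qed

section \<open>Points of rank at least three\<close>

definition pr :: "mat6 \<Rightarrow> mat6 \<Rightarrow> complex" where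
  "pr B D = (\<Sum>i\<in>UNIV. \<Sum>j\<in>UNIV. B $ i $ j * D $ i $ j)"

lemma pr_trace: "pr B D = trace (B ** transpose D)"
  by (simp add: pr_def trace_def matrix_mult_nth transpose_def)

lemma pr_congr: "pr (congr S B) D = pr B (congr (transpose S) D)"
proof -
  have "pr (congr S B) D = trace ((S ** B) ** (transpose S ** transpose D))"
    by (simp add: pr_trace congr_def matrix_mul_assoc)
  also have "\<dots> = trace ((S ** B ** transpose S) ** transpose D)" by (simp add: matrix_mul_assoc)
  also have "\<dots> = trace (S ** (B ** transpose S ** transpose D))" by (simp add: matrix_mul_assoc)
  also have "\<dots> = trace ((B ** transpose S ** transpose D) ** S)" by (rule trace_mul_sym)
  also have "\<dots> = pr B (congr (transpose S) D)"
    by (simp add: pr_trace congr_def matrix_transpose_mul matrix_mul_assoc)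
  finally show ?thesis .
qed

lemma pr_add_right: "pr B (D + E) = pr B D + pr B E"
  and pr_diff_right: "pr B (D - E) = pr B D - pr B E"
  and pr_scale_right: "pr B (cscale c D) = c * pr B D"
  by (simp_all add: pr_def sum.distrib sum_subtractf algebra_simps sum_distrib_left)

definition unit_Cat :: "nat^3 \<Rightarrow> mat6" where
  "unit_Cat g = (\<chi> i j. if Rep_quad_exp i + Rep_quad_exp j = g then 1 else 0)"

lemma unit_Cat_in_Cat: "unit_Cat g \<in> Cat"
  unfolding Cat_def by (auto simp: unit_Cat_def intro!: exI[of _ "\<lambda>x. if x = g then 1 else 0"])

lemma Cat_perp_relations:
  assumes "B \<in> Sym6" and perp: "\<And>D. D \<in> Cat \<Longrightarrow> pr B D = 0"
  shows "B $ XX $ XX = 0" "B $ YY $ YY = 0" "B $ ZZ $ ZZ = 0"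
    "B $ XX $ XY = 0" "B $ XX $ XZ = 0" "B $ YY $ XY = 0" "B $ YY $ YZ = 0" "B $ ZZ $ XZ = 0" "B $ ZZ $ YZ = 0"
    "B $ XY $ XY = - 2 * B $ XX $ YY" "B $ XZ $ XZ = - 2 * B $ XX $ ZZ" "B $ YZ $ YZ = - 2 * B $ YY $ ZZ"
    "B $ XY $ XZ = - B $ XX $ YZ" "B $ XY $ YZ = - B $ YY $ XZ" "B $ XZ $ YZ = - B $ ZZ $ XY"
proof -
  have sym: "B $ i $ j = B $ j $ i" for i j using assms(1) Sym6_iff by blast
  have v: "vector [x,y,z] + vector [x',y',z'] = (vector [x+x',y+y',z+z'] :: nat^3)" for x y z x' y' z'
    by (simp add: vec_eq_iff forall_3)
  note ev = pr_def sum_quad unit_Cat_def Rep_quads v vector3_eq_iff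
    sym[of YY XX] sym[of ZZ XX] sym[of ZZ YY] sym[of XY XX] sym[of XZ XX] sym[of YZ XX]
    sym[of XY YY] sym[of XZ YY] sym[of YZ YY] sym[of XY ZZ] sym[of XZ ZZ] sym[of YZ ZZ]
    sym[of XZ XY] sym[of YZ XY] sym[of YZ XZ]
  show "B $ XX $ XX = 0" using perp[OF unit_Cat_in_Cat[of "vector [4,0,0]"]] by (simp add: ev)
  show "B $ YY $ YY = 0" using perp[OF unit_Cat_in_Cat[of "vector [0,4,0]"]] by (simp add: ev)
  show "B $ ZZ $ ZZ = 0" using perp[OF unit_Cat_in_Cat[of "vector [0,0,4]"]] by (simp add: ev)
  show "B $ XX $ XY = 0" using perp[OF unit_Cat_in_Cat[of "vector [3,1,0]"]] by (simp add: ev)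
  show "B $ XX $ XZ = 0" using perp[OF unit_Cat_in_Cat[of "vector [3,0,1]"]] by (simp add: ev)
  show "B $ YY $ XY = 0" using perp[OF unit_Cat_in_Cat[of "vector [1,3,0]"]] by (simp add: ev)
  show "B $ YY $ YZ = 0" using perp[OF unit_Cat_in_Cat[of "vector [0,3,1]"]] by (simp add: ev)
  show "B $ ZZ $ XZ = 0" using perp[OF unit_Cat_in_Cat[of "vector [1,0,3]"]] by (simp add: ev)
  show "B $ ZZ $ YZ = 0" using perp[OF unit_Cat_in_Cat[of "vector [0,1,3]"]] by (simp add: ev)
  have "2 * B $ XX $ YY + B $ XY $ XY = 0"
    using perp[OF unit_Cat_in_Cat[of "vector [2,2,0]"]] by (simp add: ev)
  then show "B $ XY $ XY = - 2 * B $ XX $ YY" by algebra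
  have "2 * B $ XX $ ZZ + B $ XZ $ XZ = 0"
    using perp[OF unit_Cat_in_Cat[of "vector [2,0,2]"]] by (simp add: ev)
  then show "B $ XZ $ XZ = - 2 * B $ XX $ ZZ" by algebra
  have "2 * B $ YY $ ZZ + B $ YZ $ YZ = 0"
    using perp[OF unit_Cat_in_Cat[of "vector [0,2,2]"]] by (simp add: ev)
  then show "B $ YZ $ YZ = - 2 * B $ YY $ ZZ" by algebra
  have "2 * B $ XX $ YZ + 2 * B $ XY $ XZ = 0"
    using perp[OF unit_Cat_in_Cat[of "vector [2,1,1]"]] by (simp add: ev)
  then show "B $ XY $ XZ = - B $ XX $ YZ" by algebra
  have "2 * B $ YY $ XZ + 2 * B $ XY $ YZ = 0"
    using perp[OF unit_Cat_in_Cat[of "vector [1,2,1]"]] by (simp add: ev add.commute)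
  then show "B $ XY $ YZ = - B $ YY $ XZ" by algebra
  have "2 * B $ ZZ $ XY + 2 * B $ XZ $ YZ = 0"
    using perp[OF unit_Cat_in_Cat[of "vector [1,1,2]"]] by (simp add: ev add.commute)
  then show "B $ XZ $ YZ = - B $ ZZ $ XY" by algebra
qed

text \<open>Matrices of rank at most two, as sums of two matrices of rank at most one.\<close>

definition two_terms :: "mat6 \<Rightarrow> bool" where
  "two_terms A \<longleftrightarrow> (\<exists>p q r s :: quad_exp \<Rightarrow> complex. \<forall>i j. A $ i $ j = p i * q j + r i * s j)"

lemma two_terms_congr:
  assumes "two_terms A"
  shows "two_terms (congr T A)"
proof -
  obtain p q r s where A: "\<And>i j. A $ i $ j = p i * q j + r i * s j"
    using assms unfolding two_terms_def by blast
  have "congr T A $ i $ j = (\<Sum>k\<in>UNIV. T $ i $ k * p k) * (\<Sum>l\<in>UNIV. T $ j $ l * q l)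
      + (\<Sum>k\<in>UNIV. T $ i $ k * r k) * (\<Sum>l\<in>UNIV. T $ j $ l * s l)" for i j
    unfolding congr_nth sum_product by (simp add: A sum.distrib algebra_simps)
  then show ?thesis unfolding two_terms_def
    by (intro exI[of _ "\<lambda>i. \<Sum>k\<in>UNIV. T $ i $ k * p k"] exI[of _ "\<lambda>j. \<Sum>l\<in>UNIV. T $ j $ l * q l"]
        exI[of _ "\<lambda>i. \<Sum>k\<in>UNIV. T $ i $ k * r k"] exI[of _ "\<lambda>j. \<Sum>l\<in>UNIV. T $ j $ l * s l"]) blast
qed

lemma rank_le_card:
  fixes A :: mat6
  assumes "\<And>i. A $ i \<in> vec.span F" "finite F"
  shows "rank A \<le> card F"
proof -
  have "rows A \<subseteq> vec.span F" using assms(1) by (auto simp: rows_def row_def vec_lambda_eta)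
  then show ?thesis unfolding row_rank_def_gen using assms(2) by (rule vec.dim_le_card)
qed

lemma two_terms_rank:
  assumes "two_terms A"
  shows "rank A \<le> 2"
proof -
  obtain p q r s where A: "\<And>i j. A $ i $ j = p i * q j + r i * s j"
    using assms unfolding two_terms_def by blast
  let ?q = "\<chi> j. q j" and ?s = "\<chi> j. s j"
  have "A $ i = p i *s ?q + r i *s ?s" for i by (simp add: vec_eq_iff A)
  then have "A $ i \<in> vec.span {?q, ?s}" for i
    by (simp only:) (intro vec.span_add vec.span_scale vec.span_base; simp)
  from rank_le_card[OF this] have "rank A \<le> card {?q, ?s}" by simp
  also have "\<dots> \<le> 2" by (simp add: card_insert_if)
  finally show ?thesis .
qed

lemma complete_to_basis:
  fixes n :: "complex^3"
  assumes "n \<noteq> 0"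
  shows "\<exists>g h :: complex^3^3. g ** h = mat 1 \<and> h ** g = mat 1 \<and> column 3 g = n"
proof -
  have "\<exists>g :: complex^3^3. det g \<noteq> 0 \<and> column 3 g = n"
  proof -
    consider "n $ 3 \<noteq> 0" | "n $ 2 \<noteq> 0" | "n $ 1 \<noteq> 0" using assms by (auto simp: vec_eq_iff forall_3)
    then show ?thesis
    proof cases
      case 1
      then show ?thesis
        by (intro exI[of _ "vector [vector [1,0,n$1], vector [0,1,n$2], vector [0,0,n$3]]"])
          (simp add: det_3 column_def vec_eq_iff forall_3)
    next
      case 2
      then show ?thesis
        by (intro exI[of _ "vector [vector [1,0,n$1], vector [0,0,n$2], vector [0,1,n$3]]"])
          (simp add: det_3 column_def vec_eq_iff forall_3)
    next
      case 3
      then show ?thesis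
        by (intro exI[of _ "vector [vector [0,0,n$1], vector [1,0,n$2], vector [0,1,n$3]]"])
          (simp add: det_3 column_def vec_eq_iff forall_3)
    qed
  qed
  then obtain g :: "complex^3^3" where g: "det g \<noteq> 0" "column 3 g = n" by blast
  then obtain h where "g ** h = mat 1" "h ** g = mat 1"
    using invertible_det_nz[of g] unfolding invertible_def by blast
  with g show ?thesis by blast
qed

lemma rho_inverse: "g ** h = mat 1 \<Longrightarrow> rho g ** rho h = mat 1"
  by (simp add: rho_mult rho_1)

text \<open>A symmetric matrix orthogonal to the catalecticants corresponds to a quadratic form \<open>s\<close> on
  \<open>\<Lambda>\<^sup>2\<close>, a space with basis \<open>y \<and> z\<close>, \<open>z \<and> x\<close>, \<open>x \<and> y\<close>. If \<open>s\<close> is nondegenerate then so is the matrix: the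
  entries of its inverse are quadratic in \<open>s\<close> over the discriminant.\<close>

lemma perp_nondegenerate:
  assumes "B \<in> Sym6" and perp: "\<And>D. D \<in> Cat \<Longrightarrow> pr B D = 0"
    and p: "p1 = B $ YY $ ZZ" "p2 = B $ XX $ ZZ" "p3 = B $ XX $ YY"
      "q1 = B $ XX $ YZ" "q2 = B $ YY $ XZ" "q3 = B $ ZZ $ XY"
  shows "\<exists>Q. B ** Q = mat (8*p1*p2*p3 - 2*q1*q2*q3 - 2*p1*q1\<^sup>2 - 2*p2*q2\<^sup>2 - 2*p3*q3\<^sup>2)"
proof -
  have sym: "B $ i $ j = B $ j $ i" for i j using assms(1) Sym6_iff by blast
  define c where "c q = (if q = XX then 0 else if q = YY then 1 else if q = ZZ then 2 else if q = XY then 3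
    else if q = XZ then 4 else (5::nat))" for q
  define L where "L = [[-4*p1*p1, 4*p1*p2 - 2*q3*q3, 4*p1*p3 - 2*q2*q2, 2*p1*q3, 2*p1*q2, -2*p1*q1 - 2*q2*q3],
    [4*p1*p2 - 2*q3*q3, -4*p2*p2, 4*p2*p3 - 2*q1*q1, 2*p2*q3, -2*p2*q2 - 2*q1*q3, 2*p2*q1],
    [4*p1*p3 - 2*q2*q2, 4*p2*p3 - 2*q1*q1, -4*p3*p3, -2*p3*q3 - 2*q1*q2, 2*p3*q2, 2*p3*q1],
    [2*p1*q3, 2*p2*q3, -2*p3*q3 - 2*q1*q2, -4*p1*p2, 2*p1*q1, 2*p2*q2],
    [2*p1*q2, -2*p2*q2 - 2*q1*q3, 2*p3*q2, 2*p1*q1, -4*p1*p3, 2*p3*q3],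
    [-2*p1*q1 - 2*q2*q3, 2*p2*q1, 2*p3*q1, 2*p2*q2, 2*p3*q3, -4*p2*p3]]"
  define Q :: mat6 where "Q = (\<chi> i j. L ! c i ! c j)"
  have "B ** Q = mat (8*p1*p2*p3 - 2*q1*q2*q3 - 2*p1*q1\<^sup>2 - 2*p2*q2\<^sup>2 - 2*p3*q3\<^sup>2)"
    unfolding mat6_eq_iff forall_quad matrix_mult_nth sum_quad
    by (simp add: Q_def L_def c_def mat_nth Cat_perp_relations[OF assms(1,2)] p[symmetric] power2_eq_square
      sym[of YY XX] sym[of ZZ XX] sym[of ZZ YY] sym[of XY XX] sym[of XZ XX] sym[of YZ XX]
      sym[of XY YY] sym[of XZ YY] sym[of YZ YY] sym[of XY ZZ] sym[of XZ ZZ] sym[of YZ ZZ]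
      sym[of XZ XY] sym[of YZ XY] sym[of YZ XZ] algebra_simps)
  then show ?thesis by blast
qed

text \<open>If \<open>s\<close> is degenerate, take the last vector of a new basis in its kernel: then only the
  coefficients of \<open>x\<^sup>2 z\<^sup>2 - (x z)\<^sup>2\<close>, \<open>y\<^sup>2 z\<^sup>2 - (y z)\<^sup>2\<close> and \<open>x y z\<^sup>2 - (x z) (y z)\<close> remain.\<close>

lemma perp_degenerate:
  assumes "B \<in> Sym6" and perp: "\<And>D. D \<in> Cat \<Longrightarrow> pr B D = 0"
    and p: "p1 = B $ YY $ ZZ" "p2 = B $ XX $ ZZ" "p3 = B $ XX $ YY"
      "q1 = B $ XX $ YZ" "q2 = B $ YY $ XZ" "q3 = B $ ZZ $ XY"
    and d: "8*p1*p2*p3 - 2*q1*q2*q3 - 2*p1*q1\<^sup>2 - 2*p2*q2\<^sup>2 - 2*p3*q3\<^sup>2 = 0"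
  shows "\<exists>g h. g ** h = mat 1 \<and> h ** g = mat 1 \<and> congr (rho h) B $ XX $ YY = 0 \<and>
    congr (rho h) B $ XX $ YZ = 0 \<and> congr (rho h) B $ YY $ XZ = 0"
proof -
  have sym: "B $ i $ j = B $ j $ i" for i j using assms(1) Sym6_iff by blast
  define Sm :: "complex^3^3" where
    "Sm = vector [vector [2*p1, -q3, -q2], vector [-q3, 2*p2, -q1], vector [-q2, -q1, 2*p3]]"
  have "det Sm = 0" using d by (simp add: det_3 Sm_def power2_eq_square algebra_simps)
  then have "\<not> inj ((*v) Sm)" using det_nz_iff_inj_gen[of "(*v) Sm"] by simp
  then obtain n where n: "n \<noteq> 0" "Sm *v n = 0"
    unfolding vec.inj_iff_eq_0 by blast
  obtain g h :: "complex^3^3" where gh: "g ** h = mat 1" "h ** g = mat 1" "column 3 g = n"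
    using complete_to_basis[OF n(1)] by blast
  define c :: "complex^3" where "c = vector [h$1$2*h$2$3 - h$1$3*h$2$2, h$1$3*h$2$1 - h$1$1*h$2$3, h$1$1*h$2$2 - h$1$2*h$2$1]"
  have "h *v c = det h *s axis 3 1"
    by (simp add: vec_eq_iff forall_3 matrix_vector_mult_def sum_3 c_def det_3 axis_def algebra_simps)
  then have "g *v (h *v c) = det h *s (g *v axis 3 1)" by (simp add: vector_scalar_commute)
  also have "g *v axis 3 1 = column 3 g"
    by (simp add: vec_eq_iff forall_3 matrix_vector_mult_def sum_3 axis_def column_def)
  finally have "c = det h *s n" by (simp add: matrix_vector_mul_assoc gh)
  then have "Sm *v c = 0" using n by (simp add: vector_scalar_commute)
  then have S: "2*p1*c$1 - q3*c$2 - q2*c$3 = 0" "- q3*c$1 + 2*p2*c$2 - q1*c$3 = 0" "- q2*c$1 - q1*c$2 + 2*p3*c$3 = 0"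
    by (simp_all add: vec_eq_iff forall_3 matrix_vector_mult_def sum_3 Sm_def)
  note ev = congr_nth sum_quad rho_nth idx_simps qprod_nth column_nth Cat_perp_relations[OF assms(1,2)] p[symmetric]
      sym[of YY XX] sym[of ZZ XX] sym[of ZZ YY] sym[of XY XX] sym[of XZ XX] sym[of YZ XX]
      sym[of XY YY] sym[of XZ YY] sym[of YZ YY] sym[of XY ZZ] sym[of XZ ZZ] sym[of YZ ZZ]
      sym[of XZ XY] sym[of YZ XY] sym[of YZ XZ]
  have "2 * congr (rho h) B $ XX $ YY = c$1 * (2*p1*c$1 - q3*c$2 - q2*c$3)
    + c$2 * (- q3*c$1 + 2*p2*c$2 - q1*c$3) + c$3 * (- q2*c$1 - q1*c$2 + 2*p3*c$3)"
    by (simp add: ev c_def algebra_simps)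
  moreover have "congr (rho h) B $ XX $ YZ = (h$1$2*h$3$3 - h$1$3*h$3$2) * (2*p1*c$1 - q3*c$2 - q2*c$3)
    + (h$1$3*h$3$1 - h$1$1*h$3$3) * (- q3*c$1 + 2*p2*c$2 - q1*c$3) + (h$1$1*h$3$2 - h$1$2*h$3$1) * (- q2*c$1 - q1*c$2 + 2*p3*c$3)"
    by (simp add: ev c_def algebra_simps)
  moreover have "congr (rho h) B $ YY $ XZ = - ((h$2$2*h$3$3 - h$2$3*h$3$2) * (2*p1*c$1 - q3*c$2 - q2*c$3)
    + (h$2$3*h$3$1 - h$2$1*h$3$3) * (- q3*c$1 + 2*p2*c$2 - q1*c$3) + (h$2$1*h$3$2 - h$2$2*h$3$1) * (- q2*c$1 - q1*c$2 + 2*p3*c$3))"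
    by (simp add: ev c_def algebra_simps)
  ultimately show ?thesis using gh by (intro exI[of _ g] exI[of _ h]) (simp only: S, simp)
qed

lemma two_termsI:
  "(\<And>i j. A $ i $ j = p i * q j + r i * s j) \<Longrightarrow> two_terms A"
  unfolding two_terms_def by blast

lemma perp_kernel_two_terms_reduced:
  assumes A: "A \<in> Cat" and "B \<in> Sym6" and perp: "\<And>D. D \<in> Cat \<Longrightarrow> pr B D = 0"
    and AB: "A ** B = 0" and "B \<noteq> 0"
    and z: "B $ XX $ YY = 0" "B $ XX $ YZ = 0" "B $ YY $ XZ = 0"
  shows "two_terms A"
proof -
  define p1 p2 q3 where "p1 = B $ YY $ ZZ" and "p2 = B $ XX $ ZZ" and "q3 = B $ ZZ $ XY"
  note rel = Cat_perp_relations[OF assms(2,3)]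
  have sym: "B $ i $ j = B $ j $ i" for i j using assms(2) Sym6_iff by blast
  note ssym = sym[of YY XX] sym[of ZZ XX] sym[of ZZ YY] sym[of XY XX] sym[of XZ XX] sym[of YZ XX]
      sym[of XY YY] sym[of XZ YY] sym[of YZ YY] sym[of XY ZZ] sym[of XZ ZZ] sym[of YZ ZZ]
      sym[of XZ XY] sym[of YZ XY] sym[of YZ XZ]
  have nz: "p1 \<noteq> 0 \<or> p2 \<noteq> 0 \<or> q3 \<noteq> 0"
  proof (rule ccontr)
    assume "\<not> ?thesis"
    then have "B = 0"
      unfolding mat6_eq_iff forall_quad by (simp add: rel ssym z p1_def p2_def q3_def)
    then show False using assms by blast
  qed
  have AB0: "(A ** B) $ i $ j = 0" for i j by (simp add: AB)
  have k1: "p2 * A $ i $ ZZ = 0" "p1 * A $ i $ ZZ = 0" "q3 * A $ i $ ZZ = 0" for i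
    using AB0[of i XX] AB0[of i YY] AB0[of i XY]
    by (simp_all add: matrix_mult_nth sum_quad rel ssym z p1_def p2_def q3_def mult.commute)
  then have zz: "A $ i $ ZZ = 0" for i using nz by auto
  have r: "A $ i $ XX * p2 + A $ i $ YY * p1 + A $ i $ XY * q3 = 0"
    "A $ i $ XZ * (- 2 * p2) + A $ i $ YZ * (- q3) = 0" "A $ i $ XZ * (- q3) + A $ i $ YZ * (- 2 * p1) = 0" for i
    using AB0[of i ZZ] AB0[of i XZ] AB0[of i YZ]
    by (simp_all add: matrix_mult_nth sum_quad rel ssym z p1_def p2_def q3_def)
  have h: "p2 * A $ i $ XX + p1 * A $ i $ YY + q3 * A $ i $ XY = 0" for i using r(1)[of i] by algebra
  have h1: "2 * p2 * A $ i $ XZ + q3 * A $ i $ YZ = 0" for i using r(2)[of i] by algebra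
  have h2: "2 * p1 * A $ i $ YZ + q3 * A $ i $ XZ = 0" for i using r(3)[of i] by algebra
  have symA: "A $ i $ j = A $ j $ i" for i j using A Cat_subset_Sym6 Sym6_iff by blast
  note cat = A[unfolded Cat_iff, THEN conjunct2]
  show ?thesis
  proof (cases "4 * p1 * p2 = q3\<^sup>2")
    case False
    have "(4 * p1 * p2 - q3\<^sup>2) * A $ i $ XZ = 0" "(4 * p1 * p2 - q3\<^sup>2) * A $ i $ YZ = 0" for i
      using h1[of i] h2[of i] by algebra+
    then have xz: "A $ i $ XZ = 0" "A $ i $ YZ = 0" for i using False by simp_all
    then have xz': "A $ XZ $ i = 0" "A $ YZ $ i = 0" "A $ ZZ $ i = 0" for i using symA zz by metis+
    have h': "p2 * A $ XX $ i + p1 * A $ YY $ i + q3 * A $ XY $ i = 0" for i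
      using h[of i] unfolding symA[of i XX] symA[of i YY] symA[of i XY] .
    consider "p1 \<noteq> 0" | "p2 \<noteq> 0" | "q3 \<noteq> 0" using nz by blast
    then show ?thesis
    proof cases
      case 1
      have yy: "A $ YY $ i = (- p2 / p1) * A $ XX $ i + (- q3 / p1) * A $ XY $ i" for i
      proof -
        have "p1 * A $ YY $ i = - p2 * A $ XX $ i - q3 * A $ XY $ i"
          using h'[of i] by algebra
        then show ?thesis using 1 by (simp add: field_simps)
      qed
      show ?thesis
      proof (rule two_termsI[of A "\<lambda>i. if i = XX then 1 else if i = YY then - p2 / p1 else 0" "\<lambda>j. A $ XX $ j"
            "\<lambda>i. if i = XY then 1 else if i = YY then - q3 / p1 else 0" "\<lambda>j. A $ XY $ j"])
        fix i j
        show "A $ i $ j = (if i = XX then 1 else if i = YY then - p2 / p1 else 0) * A $ XX $ j + (if i = XY then 1 else if i = YY then - q3 / p1 else 0) * A $ XY $ j"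
          using quad_cases[of i] yy xz' by auto
      qed
    next
      case 2
      have yy: "A $ XX $ i = (- p1 / p2) * A $ YY $ i + (- q3 / p2) * A $ XY $ i" for i
      proof -
        have "p2 * A $ XX $ i = - p1 * A $ YY $ i - q3 * A $ XY $ i"
          using h'[of i] by algebra
        then show ?thesis using 2 by (simp add: field_simps)
      qed
      show ?thesis
      proof (rule two_termsI[of A "\<lambda>i. if i = YY then 1 else if i = XX then - p1 / p2 else 0" "\<lambda>j. A $ YY $ j"
            "\<lambda>i. if i = XY then 1 else if i = XX then - q3 / p2 else 0" "\<lambda>j. A $ XY $ j"])
        fix i j
        show "A $ i $ j = (if i = YY then 1 else if i = XX then - p1 / p2 else 0) * A $ YY $ j + (if i = XY then 1 else if i = XX then - q3 / p2 else 0) * A $ XY $ j"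
          using quad_cases[of i] yy xz' by auto
      qed
    next
      case 3
      have yy: "A $ XY $ i = (- p1 / q3) * A $ YY $ i + (- p2 / q3) * A $ XX $ i" for i
      proof -
        have "q3 * A $ XY $ i = - p1 * A $ YY $ i - p2 * A $ XX $ i"
          using h'[of i] by algebra
        then show ?thesis using 3 by (simp add: field_simps)
      qed
      show ?thesis
      proof (rule two_termsI[of A "\<lambda>i. if i = YY then 1 else if i = XY then - p1 / q3 else 0" "\<lambda>j. A $ YY $ j"
            "\<lambda>i. if i = XX then 1 else if i = XY then - p2 / q3 else 0" "\<lambda>j. A $ XX $ j"])
        fix i j
        show "A $ i $ j = (if i = YY then 1 else if i = XY then - p1 / q3 else 0) * A $ YY $ j + (if i = XX then 1 else if i = XY then - p2 / q3 else 0) * A $ XX $ j"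
          using quad_cases[of i] yy xz' by auto
      qed
    qed
  next
    case True
    show ?thesis
    proof (cases "p1 = 0")
      case p1: True
      then have "q3 = 0" using True by simp
      then have "p2 \<noteq> 0" using nz p1 by blast
      then have "A $ i $ XX = 0" "A $ i $ XZ = 0" for i using h[of i] h1[of i] p1 \<open>q3 = 0\<close> by simp_all
      then have r: "A $ i $ XX = 0" "A $ i $ XZ = 0" "A $ XX $ i = 0" "A $ XZ $ i = 0" "A $ ZZ $ i = 0" for i
        using symA zz by metis+
      then have "A $ XY $ XY = 0" "A $ XY $ YZ = 0" "A $ YZ $ YZ = 0" using cat zz by metis+
      then have e: "A $ XY $ XY = 0" "A $ XY $ YZ = 0" "A $ YZ $ YZ = 0" "A $ YZ $ XY = 0" using symA by metis+
      have "A $ i $ j = (if i = YY then 1 else 0) * A $ YY $ j + (if i = YY then 0 else A $ i $ YY) * (if j = YY then 1 else 0)" for i j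
        using quad_cases[of i] quad_cases[of j] r e zz by auto
      then show ?thesis by (rule two_termsI)
    next
      case p1: False
      define t where "t = q3 / (2 * p1)"
      have q3: "q3 = 2 * p1 * t" and p2: "p2 = p1 * t\<^sup>2"
        using True p1 by (simp_all add: t_def field_simps power2_eq_square)
      have yy: "A $ i $ YY = - t\<^sup>2 * A $ i $ XX - 2 * t * A $ i $ XY" for i
      proof -
        have "p1 * (A $ i $ YY - (- t\<^sup>2 * A $ i $ XX - 2 * t * A $ i $ XY)) = 0"
          using h[of i] unfolding q3 p2 by algebra
        then show ?thesis using p1 by simp
      qed
      have yz: "A $ i $ YZ = - t * A $ i $ XZ" for i
      proof -
        have "2 * p1 * (A $ i $ YZ - (- t * A $ i $ XZ)) = 0"
          using h2[of i] unfolding q3 by algebra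
        then show ?thesis using p1 by (simp add: eq_neg_iff_add_eq_0)
      qed
      define a b c where "a = A $ XX $ XX" and "b = A $ XX $ XY" and "c = A $ XX $ XZ"
      have e1: "A $ XX $ YY = - t\<^sup>2 * a - 2 * t * b" "A $ XX $ YZ = - t * c" "A $ XX $ ZZ = 0"
        using yy[of XX] yz[of XX] zz[of XX] by (simp_all add: a_def b_def c_def)
      then have e2: "A $ XY $ XY = - t\<^sup>2 * a - 2 * t * b" "A $ XY $ XZ = - t * c" "A $ XZ $ XZ = 0"
        using cat by simp_all
      have e3: "A $ XY $ YY = - t\<^sup>2 * b - 2 * t * (- t\<^sup>2 * a - 2 * t * b)" "A $ XY $ YZ = t\<^sup>2 * c"
        using yy[of XY] yz[of XY] symA[of XY XX] by (simp_all add: e2 b_def power2_eq_square)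
      have e4: "A $ XZ $ YY = t\<^sup>2 * c" "A $ XZ $ YZ = 0"
        using yz[of XZ] cat symA[of XZ YY] e3 e2 by simp_all
      have e5: "A $ YY $ YY = - t\<^sup>2 * (- t\<^sup>2 * a - 2 * t * b) - 2 * t * (- t\<^sup>2 * b - 2 * t * (- t\<^sup>2 * a - 2 * t * b))"
        "A $ YY $ YZ = - t * (t\<^sup>2 * c)"
        using yy[of YY] yz[of YY] symA[of YY XX] symA[of YY XY] symA[of YY XZ] e1 e3 e4 by simp_all
      have e6: "A $ YZ $ YZ = 0" using yz[of YZ] symA[of YZ XZ] e4 by simp
      define f where "f i = (if i = XX then 1 else if i = XY then - t else if i = YY then t\<^sup>2 else 0)" for i
      define s where "s i = (if i = XY then b + t * a else if i = XZ then c else if i = YY then - 2 * t * (b + t * a)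
        else if i = YZ then - t * c else 0)" for i
      have "\<forall>i j. A $ i $ j = f i * A $ XX $ j + s i * f j"
        unfolding forall_quad
        by (simp add: f_def s_def e1 e2 e3 e4 e5 e6 zz symA[of YY XX] symA[of ZZ _] symA[of XY XX]
            symA[of XZ XX] symA[of YZ XX] symA[of YY XY] symA[of YY XZ] symA[of YZ YY] symA[of XZ XY]
            symA[of YZ XY] symA[of YZ XZ] a_def[symmetric] b_def[symmetric] c_def[symmetric]
            power2_eq_square algebra_simps)
      then show ?thesis by (intro two_termsI[of A f _ s f]) blast
    qed
  qed
qed

text \<open>A quadratic relation between quadrics in the kernel forces rank at most two.\<close>

lemma perp_kernel_two_terms:
  assumes A: "A \<in> Cat" and B: "B \<in> Sym6" and perp: "\<And>D. D \<in> Cat \<Longrightarrow> pr B D = 0"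
    and AB: "A ** B = 0" and "B \<noteq> 0"
  shows "two_terms A"
proof -
  define p1 p2 p3 q1 q2 q3 where p: "p1 = B $ YY $ ZZ" "p2 = B $ XX $ ZZ" "p3 = B $ XX $ YY"
      "q1 = B $ XX $ YZ" "q2 = B $ YY $ XZ" "q3 = B $ ZZ $ XY"
  let ?d = "8*p1*p2*p3 - 2*q1*q2*q3 - 2*p1*q1\<^sup>2 - 2*p2*q2\<^sup>2 - 2*p3*q3\<^sup>2"
  show ?thesis
  proof (cases "?d = 0")
    case False
    obtain Q where "B ** Q = mat ?d" using perp_nondegenerate[OF B perp p] by blast
    then have "cscale ?d A = A ** B ** Q" by (simp add: matrix_mul_assoc[symmetric] mult_mat_right)
    also have "\<dots> = 0" by (simp add: AB mat6_eq_iff matrix_mult_nth)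
    finally have "A = 0" using False by (simp add: mat6_eq_iff)
    then show ?thesis by (intro two_termsI[of A "\<lambda>_. 0" "\<lambda>_. 0" "\<lambda>_. 0" "\<lambda>_. 0"]) simp
  next
    case True
    then obtain g h where gh: "g ** h = mat 1" "h ** g = mat 1" and
      z: "congr (rho h) B $ XX $ YY = 0" "congr (rho h) B $ XX $ YZ = 0" "congr (rho h) B $ YY $ XZ = 0"
      using perp_degenerate[OF B perp p] by blast
    let ?A = "congr (transpose (rho g)) A" and ?B = "congr (rho h) B"
    have R: "rho g ** rho h = mat 1" "rho h ** rho g = mat 1" using gh by (simp_all add: rho_inverse)
    have "?A ** ?B = transpose (rho g) ** A ** (rho g ** rho h) ** B ** transpose (rho h)"
      by (simp add: congr_def matrix_mul_assoc transpose_transpose)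
    also have "\<dots> = transpose (rho g) ** (A ** B) ** transpose (rho h)"
      by (simp add: R matrix_mul_assoc)
    also have "\<dots> = 0" by (simp add: AB mat6_eq_iff matrix_mult_nth)
    finally have "?A ** ?B = 0" .
    moreover have "pr ?B D = 0" if "D \<in> Cat" for D
      unfolding pr_congr using perp congr_rho_Cat[OF that] by blast
    moreover have "?B \<noteq> 0" using assms(5) congr_eq_0_iff[OF R(1)] by blast
    ultimately have "two_terms ?A"
      using perp_kernel_two_terms_reduced[OF congr_rho_Cat[OF A] congr_Sym6[OF B]] z by blast
    then have "two_terms (congr (transpose (rho h)) ?A)" by (rule two_terms_congr)
    moreover have "transpose (rho h) ** transpose (rho g) = mat 1"
      by (simp add: matrix_transpose_mul[symmetric] R transpose_mat)
    ultimately show ?thesis by (simp add: congr_inverse)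
  qed
qed


text \<open>Hence catalecticants restrict onto all symmetric forms on the kernel. The orthogonal complement
  of \<open>Cat\<close> and of the matrices that restrict to zero consists of conjugates of matrices \<open>B\<close> as
  above.\<close>

lemma Cat_restricts_onto:
  assumes A: "A \<in> Cat" "rank A \<ge> 3" and fr: "ker_frame T S I A" and P: "P \<in> Sym_on I"
  shows "\<exists>D\<in>Cat. \<forall>i\<in>I. \<forall>j\<in>I. congr (transpose T) D $ i $ j = P $ i $ j"
proof -
  have TS: "T ** S = mat 1" and ST: "S ** T = mat 1" using fr unfolding ker_frame_def by blast+
  define D0 where "D0 = congr (transpose S) P"
  define W where "W = congr T ` Sym_on I"
  define N where "N = {M. \<forall>B\<in>W. pr B M = 0}"
  have scaleR: "r *\<^sub>R X = cscale (complex_of_real r) X" for r and X :: mat6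
    by (simp add: mat6_eq_iff complex_eq_iff)
  define R where "R = {x + y | x y. x \<in> Cat \<and> y \<in> N}"
  have sub: "subspace R"
  proof -
    have "subspace Cat" "subspace N"
      using subspace_Cat unfolding subspace_def cmat.subspace_def N_def scaleR
      by (auto simp: pr_add_right pr_scale_right) (simp_all add: pr_def)
    then show ?thesis unfolding R_def by (rule subspace_sums)
  qed
  obtain y z where "y \<in> span R" and orth: "\<And>w. w \<in> span R \<Longrightarrow> orthogonal z w" and D0: "D0 = y + z"
    using orthogonal_subspace_decomp_exists[of R D0] by metis
  moreover have spanR: "span R = R" using sub by (rule span_eq_iff[THEN iffD2])
  ultimately obtain D M where D: "D \<in> Cat" and M: "M \<in> N" and y: "y = D + M" unfolding R_def by blast
  define B :: mat6 where "B = (\<chi> i j. cnj (z $ i $ j))"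
  have herm: "pr B w = 0" if w: "\<And>c. cscale c w \<in> R" for w
  proof -
    let ?c = "cnj (pr B w)"
    have "0 = inner z (cscale ?c w)" using orth w spanR by (simp add: orthogonal_def)
    also have "\<dots> = Re (\<Sum>i\<in>UNIV. \<Sum>j\<in>UNIV. cnj (z $ i $ j) * (?c * w $ i $ j))"
      by (simp add: inner_vec_def inner_complex_def)
    also have "(\<Sum>i\<in>UNIV. \<Sum>j\<in>UNIV. cnj (z $ i $ j) * (d * w $ i $ j)) = pr B w * d" for d
      by (simp add: pr_def B_def sum_distrib_left sum_distrib_right ac_simps)
    finally show ?thesis by (simp add: complex_mult_cnj complex_eq_iff sum_power2_eq_zero_iff)
  qed
  have "0 \<in> Cat" using cmat.subspace_0[OF subspace_Cat] .
  have N0: "0 \<in> N" by (simp add: N_def pr_def)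
  have perp: "pr B w = 0" if "w \<in> Cat" for w
  proof (rule herm)
    fix c
    have "cscale c w \<in> Cat" using that cmat.subspace_scale[OF subspace_Cat] by blast
    moreover have "cscale c w = cscale c w + 0" by simp
    ultimately show "cscale c w \<in> R" unfolding R_def using N0 by blast
  qed
  have perpN: "pr B w = 0" if "w \<in> N" for w
  proof (rule herm)
    fix c
    have "cscale c w \<in> N" using that by (simp add: N_def pr_scale_right)
    moreover have "cscale c w = 0 + cscale c w" by simp
    ultimately show "cscale c w \<in> R" unfolding R_def using \<open>0 \<in> Cat\<close> by blast
  qed
  define E :: "quad_exp \<Rightarrow> quad_exp \<Rightarrow> mat6" where "E i j = (\<chi> k l. if k = i \<and> l = j then 1 else 0)" for i j
  have prE: "pr X (E i j) = X $ i $ j" for X i j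
  proof -
    have "pr X (E i j) = (\<Sum>k\<in>UNIV. if k = i then \<Sum>l\<in>UNIV. if l = j then X $ k $ l else 0 else 0)"
      unfolding pr_def
    proof (intro sum.cong refl)
      fix k
      show "(\<Sum>l\<in>UNIV. X $ k $ l * E i j $ k $ l) = (if k = i then \<Sum>l\<in>UNIV. if l = j then X $ k $ l else 0 else 0)"
        by (cases "k = i") (simp_all add: E_def if_distrib[of "\<lambda>x. _ * x"] sum.delta cong: if_cong)
    qed
    then show ?thesis by (simp add: sum.delta)
  qed
  have Bsym: "B \<in> Sym6"
  proof -
    have "E i j - E j i \<in> N" for i j
      unfolding N_def W_def using congr_Sym_on_subset[of T I] by (auto simp: pr_diff_right prE Sym6_iff)
    then have "pr B (E i j - E j i) = 0" for i j by (rule perpN)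
    then show ?thesis by (simp add: pr_diff_right prE Sym6_iff)
  qed
  have symA: "A $ i $ j = A $ j $ i" for i j using A(1) Cat_subset_Sym6 Sym6_iff by blast
  have AB: "A ** B = 0"
  proof -
    define F :: "quad_exp \<Rightarrow> quad_exp \<Rightarrow> mat6" where "F i j = (\<chi> k l. if l = j then A $ i $ k else 0)" for i j
    have prF: "pr X (F i j) = (A ** X) $ i $ j" for X i j
      by (simp add: pr_def F_def matrix_mult_nth if_distrib[of "\<lambda>x. _ * x"] sum.delta' mult.commute cong: if_cong)
    have "A ** X = 0" if "X \<in> W" for X
      using that mult_zero_iff_Sym_on[OF fr] congr_Sym_on_subset[of T I] unfolding W_def by blast
    then have "F i j \<in> N" for i j unfolding N_def by (simp add: prF)
    then have "pr B (F i j) = 0" for i j by (rule perpN)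
    then show ?thesis by (simp add: prF mat6_eq_iff)
  qed
  have "B = 0"
  proof (rule ccontr)
    assume "B \<noteq> 0"
    then have "two_terms A" using perp_kernel_two_terms[OF A(1) Bsym perp AB] by blast
    then show False using two_terms_rank A(2) by fastforce
  qed
  then have "z = 0" by (simp add: B_def mat6_eq_iff)
  then have "D = D0 - M" using D0 y by simp
  have "congr (transpose T) D $ i $ j = P $ i $ j" if "i \<in> I" "j \<in> I" for i j
  proof -
    have "pair_mat {i, j} \<in> Sym_on I"
      using that by (auto simp: pair_mat_def Sym_on_def Sym6_iff insert_commute doubleton_eq_iff)
    then have "pr (congr T (pair_mat {i, j})) M = 0" using M unfolding N_def W_def by blast
    then have "pr (pair_mat {i, j}) (congr (transpose T) M) = 0" by (simp add: pr_congr)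
    moreover have "congr (transpose T) D = P - congr (transpose T) M"
    proof -
      have "transpose T ** transpose S = mat 1" by (simp add: matrix_transpose_mul[symmetric] ST transpose_mat)
      then show ?thesis unfolding \<open>D = D0 - M\<close> congr_diff D0_def by (simp add: congr_inverse)
    qed
    ultimately have z: "pr (pair_mat {i, j}) (P - congr (transpose T) D) = 0" by simp
    define G where "G = P - congr (transpose T) D"
    have "G \<in> Sym6"
      using P D Cat_subset_Sym6 congr_Sym6[of D "transpose T"] cmat.subspace_diff[OF subspace_Sym6]
      unfolding G_def Sym_on_def by blast
    then have "pr (pair_mat {i, j}) G = (\<Sum>p\<in>{(i, j), (j, i)}. G $ i $ j)"
      unfolding pr_def sum.cartesian_product
      by (intro sum.mono_neutral_cong_right) (auto simp: pair_mat_def doubleton_eq_iff Sym6_iff split: if_splits)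
    also have "\<dots> = of_nat (card {(i, j), (j, i)}) * G $ i $ j" by simp
    finally have "of_nat (card {(i, j), (j, i)}) * G $ i $ j = 0" using z unfolding G_def by (simp only:)
    moreover have "card {(i, j), (j, i)} \<noteq> 0" by (subst card_0_eq) auto
    ultimately have "G $ i $ j = 0" unfolding mult_eq_0_iff of_nat_eq_0_iff by blast
    then show ?thesis by (simp add: G_def)
  qed
  then show ?thesis using D by blast
qed

text \<open>The inverse on the block \<open>I\<close>, up to a scalar, as a polynomial map.\<close>

definition block_adj :: "quad_exp set \<Rightarrow> mat6 \<Rightarrow> mat6" where
  "block_adj I X = congr (id_on I) (adjugate (X + id_on (- I)))"

lemma id_on_nth: "id_on I $ i $ j = (if i = j then (if i \<in> I then 1 else 0) else 0)"
  by (simp add: id_on_def)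

lemma id_on_mult_nth: "(id_on I ** X) $ i $ j = (if i \<in> I then X $ i $ j else 0)"
  and mult_id_on_nth: "(X ** id_on I) $ i $ j = (if j \<in> I then X $ i $ j else 0)"
proof -
  have "(id_on I ** X) $ i $ j = (\<Sum>k\<in>UNIV. if k = i then (if i \<in> I then X $ k $ j else 0) else 0)"
    unfolding matrix_mult_nth by (intro sum.cong refl) (simp add: id_on_nth)
  then show "(id_on I ** X) $ i $ j = (if i \<in> I then X $ i $ j else 0)" by (simp add: sum.delta)
  have "(X ** id_on I) $ i $ j = (\<Sum>k\<in>UNIV. if k = j then (if j \<in> I then X $ i $ k else 0) else 0)"
    unfolding matrix_mult_nth by (intro sum.cong refl) (simp add: id_on_nth)
  then show "(X ** id_on I) $ i $ j = (if j \<in> I then X $ i $ j else 0)" by (simp add: sum.delta)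
qed

lemma transpose_id_on [simp]: "transpose (id_on I) = id_on I"
  by (auto simp: transpose_def id_on_def mat6_eq_iff)

lemma block_adj_nth: "block_adj I X $ i $ j = (if i \<in> I \<and> j \<in> I then adjugate (X + id_on (- I)) $ i $ j else 0)"
  by (simp add: block_adj_def congr_def id_on_mult_nth mult_id_on_nth)

lemma block_adj_Sym_on:
  assumes X: "X \<in> Sym_on I" and "det (X + id_on (- I)) \<noteq> 0"
  shows "block_adj I X \<in> Sym_on I"
proof -
  have "X + id_on (- I) \<in> Sym6" using X by (auto simp: Sym_on_def Sym6_iff id_on_def)
  then have "adjugate (X + id_on (- I)) \<in> Sym6"
    using symmetric_scalar_inverse[OF mult_adjugate assms(2)] by blast
  then show ?thesis by (auto simp: Sym_on_def Sym6_iff block_adj_nth)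
qed

lemma mult_block_adj:
  assumes X: "X \<in> Sym_on I"
  shows "X ** block_adj I X = cscale (det (X + id_on (- I))) (id_on I)"
proof -
  let ?M = "X + id_on (- I)"
  have 1: "X ** id_on I = X" "id_on I ** ?M = X"
    using X by (auto simp: mat6_eq_iff id_on_mult_nth mult_id_on_nth Sym_on_def id_on_nth)
  have "X ** block_adj I X = X ** id_on I ** adjugate ?M ** id_on I"
    by (simp add: block_adj_def congr_def matrix_mul_assoc)
  also have "\<dots> = id_on I ** (?M ** adjugate ?M) ** id_on I"
    unfolding 1 matrix_mul_assoc by (simp only: 1)
  also have "\<dots> = cscale (det ?M) (id_on I)"
    unfolding mult_adjugate mult_mat_right cscale_mult_left
    by (auto simp: mat6_eq_iff id_on_mult_nth id_on_nth)
  finally show ?thesis .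
qed

lemma block_adj_mult:
  assumes X: "X \<in> Sym_on I" and "det (X + id_on (- I)) \<noteq> 0"
  shows "block_adj I X ** X = cscale (det (X + id_on (- I))) (id_on I)"
proof -
  have "transpose (X ** block_adj I X) = block_adj I X ** X"
    using X block_adj_Sym_on[OF assms] by (simp add: matrix_transpose_mul Sym_on_def Sym6_def)
  moreover have "transpose (cscale c (id_on I)) = cscale c (id_on I)" for c
    by (auto simp: transpose_def id_on_def mat6_eq_iff)
  ultimately show ?thesis using mult_block_adj[OF X] by metis
qed

lemma id_on_in_Sym_on: "id_on I \<in> Sym_on I"
  by (auto simp: id_on_def Sym_on_def Sym6_iff)

lemma det_id_on_sum: "det (id_on I + id_on (- I)) = 1"
proof -
  have "id_on I + id_on (- I) = mat 1" by (auto simp: mat6_eq_iff id_on_def mat_nth)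
  then show ?thesis by simp
qed

lemma limit_pair_in_kernel:
  assumes fr: "ker_frame T S I A" and "I \<noteq> {}" and lim: "limit_pair A B"
  shows "B \<in> congr T ` Sym_on I - {0}"
proof -
  have TS: "T ** S = mat 1" and ST: "S ** T = mat 1" using fr unfolding ker_frame_def by blast+
  have det0: "det A = 0"
  proof (rule ccontr)
    assume "det A \<noteq> 0"
    obtain i where i: "i \<in> I" using \<open>I \<noteq> {}\<close> by blast
    let ?k = "T *v axis i 1"
    have "S *v ?k = axis i 1" by (simp add: matrix_vector_mul_assoc ST)
    then have "A *v ?k = 0" using fr i unfolding ker_frame_def by (auto simp: axis_def)
    then have "adjugate A ** A *v ?k = 0" by (simp add: matrix_vector_mul_assoc[symmetric])
    moreover have "adjugate A ** A = mat (det A)" using mult_scalar_commute[OF mult_adjugate \<open>det A \<noteq> 0\<close>] .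
    ultimately have *: "mat (det A) *v ?k = 0" by simp
    have "mat (det A) *v ?k = det A *s ?k"
      by (simp add: vec_eq_iff matrix_mult_vec_nth[of "mat _"] mat_nth if_distrib[of "\<lambda>x. x * _"] sum.delta' cong: if_cong)
    then have "det A *s ?k = 0" using * by (simp only:)
    then have "S *v (det A *s ?k) = 0" by (simp only: matrix_vector_mult_0_right)
    then have "det A *s axis i 1 = (0 :: complex^quad_exp)"
      unfolding vector_scalar_commute \<open>S *v ?k = axis i 1\<close> .
    then show False using \<open>det A \<noteq> 0\<close> by (auto simp: vec_eq_iff axis_def dest: spec[of _ i])
  qed
  have "A ** B = 0" using limit_pair_mult_zero[OF lim invertible_Cat_exists det0] .
  then show ?thesis using lim mult_zero_iff_Sym_on[OF fr] unfolding limit_pair_def by blast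
qed

text \<open>All symmetric forms on the kernel are restrictions of catalecticants, and the invertible ones are dense.\<close>

lemma limit_pairs_rank_ge_3:
  assumes A: "A \<in> Cat" "A \<noteq> 0" "rank A \<ge> 3" "rank A \<le> 5" and fr: "ker_frame T S I A"
  shows "{B. limit_pair A B} = congr T ` Sym_on I - {0}"
proof (intro equalityI subsetI)
  have ST: "S ** T = mat 1" using fr unfolding ker_frame_def by blast
  have symA: "A \<in> Sym6" using A(1) Cat_subset_Sym6 by blast
  have "I \<noteq> {}" using ker_frame_rank[OF fr symA] A(4) by auto
  {
    fix B assume "B \<in> {B. limit_pair A B}"
    then show "B \<in> congr T ` Sym_on I - {0}" using limit_pair_in_kernel[OF fr \<open>I \<noteq> {}\<close>] by simp
  next
    fix B assume "B \<in> congr T ` Sym_on I - {0}"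
    then obtain X where X: "X \<in> Sym_on I" "B = congr T X" "B \<noteq> 0" by blast
    have "f (A, congr T X) = 0" if f: "f \<in> bi_forms d e"
      and van: "\<forall>C\<in>Cat. det C \<noteq> 0 \<longrightarrow> f (C, adjugate C) = 0" for f d e
    proof (rule mat_polys_zero_if_prod_zero[where f = "\<lambda>X. f (A, congr T X)" and g = "\<lambda>X. det (X + id_on (- I))"])
      show "(\<lambda>X. f (A, congr T X)) \<in> mat_polys"
        unfolding mat_polys_def
        by (rule bi_polys_comp) (use f congr_entry_polys in \<open>auto simp: bi_forms_def mat_polys_def intro: poly_funs.const\<close>)
      show "(\<lambda>X. det (X + id_on (- I))) \<in> mat_polys"
        unfolding mat_polys_def
        by (rule poly_funs_det, unfold vector_add_component)
          (intro poly_funs.add poly_funs.const mat_polys_entry[unfolded mat_polys_def])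
      show "cmat.subspace (Sym_on I)" by (rule subspace_Sym_on)
      show "id_on I \<in> Sym_on I" by (rule id_on_in_Sym_on)
      show "det (id_on I + id_on (- I)) \<noteq> 0" by (simp add: det_id_on_sum)
      show "X \<in> Sym_on I" by (rule X)
    next
      fix Y assume Y: "Y \<in> Sym_on I" "det (Y + id_on (- I)) \<noteq> 0"
      obtain D where D: "D \<in> Cat" "\<And>i j. i \<in> I \<Longrightarrow> j \<in> I \<Longrightarrow> congr (transpose T) D $ i $ j = block_adj I Y $ i $ j"
        using Cat_restricts_onto[OF A(1,3) fr block_adj_Sym_on[OF Y]] by blast
      have "Y \<noteq> 0"
      proof
        assume "Y = 0"
        then have "(0 :: mat6) = cscale (det (Y + id_on (- I))) (id_on I)"
          using mult_block_adj[OF Y(1)] by (simp add: mat6_eq_iff matrix_mult_nth)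
        then have "cscale (det (Y + id_on (- I))) (id_on I) $ i $ i = 0" for i by (metis zero_index)
        moreover obtain i where "i \<in> I" using \<open>I \<noteq> {}\<close> by blast
        ultimately have "cscale (det (Y + id_on (- I))) (id_on I) $ i $ i = 0" by blast
        then show False using Y(2) \<open>i \<in> I\<close> by (simp add: id_on_nth)
      qed
      have "limit_pair A (congr T Y)"
        by (rule limit_pair_on_kernel[OF fr _ D(1) Y(1) \<open>Y \<noteq> 0\<close> block_adj_Sym_on[OF Y] block_adj_mult[OF Y] Y(2) D(2)])
          (use A in auto)
      then show "f (A, congr T Y) = 0" using f van unfolding limit_pair_def by blast
    qed
    then show "B \<in> {B. limit_pair A B}"
      unfolding limit_pair_def using A X congr_Sym_on_subset by blast
  }
qed

section \<open>Places\<close>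

text \<open>The role of convergent sequences is played by places. A place assigns values to some of the
  complex functions on a set \<open>X\<close> such that sums and products are respected, and such that every
  function has a value or has an inverse with the value zero.\<close>

locale place =
  fixes X :: "'x set" and lim :: "('x \<Rightarrow> complex) \<Rightarrow> complex \<Rightarrow> bool"
  assumes lim_const: "lim (\<lambda>_. c) c"
    and lim_add: "lim f a \<Longrightarrow> lim g b \<Longrightarrow> lim (\<lambda>x. f x + g x) (a + b)"
    and lim_mult: "lim f a \<Longrightarrow> lim g b \<Longrightarrow> lim (\<lambda>x. f x * g x) (a * b)"
    and lim_zero_unique: "lim f a \<Longrightarrow> (\<And>x. x \<in> X \<Longrightarrow> f x = 0) \<Longrightarrow> a = 0"
    and lim_zero: "(\<And>x. x \<in> X \<Longrightarrow> f x = 0) \<Longrightarrow> lim f 0"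
    and lim_or_inverse: "(\<exists>a. lim f a) \<or> lim (\<lambda>x. inverse (f x)) 0"
begin

lemma lim_cong:
  assumes "lim f a" "\<And>x. x \<in> X \<Longrightarrow> g x = f x"
  shows "lim g a"
proof -
  have "lim (\<lambda>x. f x + (g x - f x)) (a + 0)" using assms by (intro lim_add lim_zero) auto
  then show ?thesis by simp
qed

lemma lim_cmult: "lim f a \<Longrightarrow> lim (\<lambda>x. c * f x) (c * a)"
  by (rule lim_mult[OF lim_const])

lemma lim_minus: "lim f a \<Longrightarrow> lim (\<lambda>x. - f x) (- a)"
  using lim_cmult[of f a "-1"] by simp

lemma lim_diff: "lim f a \<Longrightarrow> lim g b \<Longrightarrow> lim (\<lambda>x. f x - g x) (a - b)"
  using lim_add[OF _ lim_minus] by fastforce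

lemma lim_sum: "finite I \<Longrightarrow> (\<And>i. i \<in> I \<Longrightarrow> lim (f i) (a i)) \<Longrightarrow> lim (\<lambda>x. \<Sum>i\<in>I. f i x) (\<Sum>i\<in>I. a i)"
  by (induction I rule: finite_induct) (auto intro: lim_const lim_add)

lemma lim_unique: "lim f a \<Longrightarrow> lim f b \<Longrightarrow> a = b"
  using lim_zero_unique[of "\<lambda>x. f x - f x" "a - b"] lim_diff[of f a f b] by simp

lemma lim_poly_funs:
  assumes "f \<in> poly_funs Y" and "\<And>y. y \<in> Y \<Longrightarrow> lim (\<lambda>x. y (h x)) (y v)"
  shows "lim (\<lambda>x. f (h x)) (f v)"
  using assms(1) by induction (auto intro: lim_const lim_add lim_mult assms(2))

lemma lim_mat_polys:
  assumes "f \<in> mat_polys" and "\<And>i j. lim (\<lambda>x. M x $ i $ j) (B $ i $ j)"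
  shows "lim (\<lambda>x. f (M x)) (f B)"
  by (rule lim_poly_funs[OF assms(1)[unfolded mat_polys_def]]) (use assms(2) in auto)

lemma lim_inverse:
  assumes "lim f a" "a \<noteq> 0"
  shows "lim (\<lambda>x. inverse (f x)) (inverse a)"
  using lim_or_inverse[of "\<lambda>x. inverse (f x)"]
proof
  assume "\<exists>b. lim (\<lambda>x. inverse (f x)) b"
  then obtain b where b: "lim (\<lambda>x. inverse (f x)) b" by blast
  have "lim (\<lambda>x. (1 - f x * inverse (f x)) * f x) ((1 - a * b) * a)"
    by (intro lim_mult lim_diff lim_const assms b)
  then have "(1 - a * b) * a = 0" by (rule lim_zero_unique) auto
  then have "b = inverse a" using assms(2) by (auto simp: field_simps)
  then show ?thesis using b by simp
next
  assume "lim (\<lambda>x. inverse (inverse (f x))) 0"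
  then have "lim f 0" by simp
  then show ?thesis using lim_unique assms by blast
qed

lemma lim_divide: "lim f a \<Longrightarrow> lim g b \<Longrightarrow> b \<noteq> 0 \<Longrightarrow> lim (\<lambda>x. f x / g x) (a / b)"
  unfolding divide_inverse by (intro lim_mult lim_inverse)

text \<open>Either the equation \<open>f = 0\<close> or its negation holds at the generic point.\<close>

lemma lim_indicator: "lim (\<lambda>x. if P x then 1 else 0) 0 \<or> lim (\<lambda>x. if P x then 1 else 0) 1"
proof -
  let ?e = "\<lambda>x. if P x then 1 else 0 :: complex"
  have e: "inverse (?e x) = ?e x" for x by simp
  have "\<exists>a. lim ?e a" using lim_or_inverse[of ?e] unfolding e by blast
  then obtain a where a: "lim ?e a" by blast
  have "lim (\<lambda>x. ?e x * ?e x - ?e x) (a * a - a)" by (intro lim_diff lim_mult a)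
  then have "a * a - a = 0" by (rule lim_zero_unique) auto
  then have "a = 0 \<or> a = 1" by simp
  then show ?thesis using a by blast
qed

text \<open>A square root of a function with the value zero has the value zero.\<close>

lemma lim_sqrt_zero:
  assumes "lim (\<lambda>x. f x * f x) 0"
  shows "lim f 0"
  using lim_or_inverse[of f]
proof
  assume "\<exists>a. lim f a"
  then obtain a where a: "lim f a" by blast
  have "a * a = 0" using lim_unique[OF lim_mult[OF a a] assms] .
  then show ?thesis using a by simp
next
  assume i: "lim (\<lambda>x. inverse (f x)) 0"
  have "lim (\<lambda>x. (f x * f x) * inverse (f x)) (0 * 0)" by (intro lim_mult assms i)
  moreover have "f x * f x * inverse (f x) = f x" for x by (cases "f x = 0") simp_all
  ultimately show ?thesis by simp
qed

end

subsection \<open>Existence\<close>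

text \<open>Pairs of a function and its value. The pairs form a ring, and the zero function has no other
  value than zero.\<close>

definition value_ring :: "'x set \<Rightarrow> (('x \<Rightarrow> complex) \<times> complex) set \<Rightarrow> bool" where
  "value_ring X \<Phi> \<longleftrightarrow> (\<forall>c. (\<lambda>_. c, c) \<in> \<Phi>) \<and>
     (\<forall>f a g b. (f, a) \<in> \<Phi> \<longrightarrow> (g, b) \<in> \<Phi> \<longrightarrow> (\<lambda>x. f x + g x, a + b) \<in> \<Phi> \<and> (\<lambda>x. f x * g x, a * b) \<in> \<Phi>) \<and>
     (\<forall>f a. (f, a) \<in> \<Phi> \<longrightarrow> (\<forall>x\<in>X. f x = 0) \<longrightarrow> a = 0)"

locale max_value_ring =
  fixes X :: "'x set" and \<Phi> :: "(('x \<Rightarrow> complex) \<times> complex) set"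
  assumes ring: "value_ring X \<Phi>" and max: "\<And>\<Psi>. value_ring X \<Psi> \<Longrightarrow> \<Phi> \<subseteq> \<Psi> \<Longrightarrow> \<Psi> = \<Phi>"
begin

lemma const: "(\<lambda>_. c, c) \<in> \<Phi>"
  and add: "(f, a) \<in> \<Phi> \<Longrightarrow> (g, b) \<in> \<Phi> \<Longrightarrow> (\<lambda>x. f x + g x, a + b) \<in> \<Phi>"
  and mult: "(f, a) \<in> \<Phi> \<Longrightarrow> (g, b) \<in> \<Phi> \<Longrightarrow> (\<lambda>x. f x * g x, a * b) \<in> \<Phi>"
  and zero: "(f, a) \<in> \<Phi> \<Longrightarrow> (\<And>x. x \<in> X \<Longrightarrow> f x = 0) \<Longrightarrow> a = 0"
  using ring unfolding value_ring_def by blast+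

lemma diff: "(f, a) \<in> \<Phi> \<Longrightarrow> (g, b) \<in> \<Phi> \<Longrightarrow> (\<lambda>x. f x - g x, a - b) \<in> \<Phi>"
  using add[OF _ mult[OF const[of "-1"]], of f a g b] by simp

lemma sum: "finite I \<Longrightarrow> (\<And>i. i \<in> I \<Longrightarrow> (f i, a i) \<in> \<Phi>) \<Longrightarrow> (\<lambda>x. \<Sum>i\<in>I. f i x, \<Sum>i\<in>I. a i) \<in> \<Phi>"
  by (induction I rule: finite_induct) (auto intro: const add)

text \<open>A polynomial over the ring, together with the polynomial of the values.\<close>

definition rel :: "nat \<Rightarrow> ('x \<Rightarrow> complex poly) \<Rightarrow> complex poly \<Rightarrow> bool" where
  "rel n P Q \<longleftrightarrow> (\<forall>x. degree (P x) \<le> n) \<and> (\<forall>i. (\<lambda>x. coeff (P x) i, coeff Q i) \<in> \<Phi>)"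

lemma rel_mono: "rel n P Q \<Longrightarrow> n \<le> m \<Longrightarrow> rel m P Q"
  unfolding rel_def by (meson order_trans)

lemma rel_add: "rel n P Q \<Longrightarrow> rel n P' Q' \<Longrightarrow> rel n (\<lambda>x. P x + P' x) (Q + Q')"
  unfolding rel_def by (auto intro: degree_add_le add)

lemma rel_diff: "rel n P Q \<Longrightarrow> rel n P' Q' \<Longrightarrow> rel n (\<lambda>x. P x - P' x) (Q - Q')"
  unfolding rel_def by (auto intro: degree_diff_le diff)

lemma rel_mult:
  assumes "rel n P Q" "rel m P' Q'"
  shows "rel (n + m) (\<lambda>x. P x * P' x) (Q * Q')"
proof -
  have "degree (P x * P' x) \<le> n + m" for x
    using degree_mult_le[of "P x" "P' x"] assms unfolding rel_def by (meson add_mono order_trans)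
  then show ?thesis using assms unfolding rel_def coeff_mult by (auto intro!: sum mult)
qed

lemma rel_const: "(f, a) \<in> \<Phi> \<Longrightarrow> rel 0 (\<lambda>x. [:f x:]) [:a:]"
  unfolding rel_def using const[of 0] by (auto simp: coeff_pCons split: nat.split)

lemma rel_poly: "rel (degree Q) (\<lambda>_. Q) Q"
  unfolding rel_def using const by auto

lemma extend:
  assumes cons: "\<And>n P Q. rel n P Q \<Longrightarrow> (\<And>x. x \<in> X \<Longrightarrow> poly (P x) (f x) = 0) \<Longrightarrow> poly Q c = 0"
  shows "(f, c) \<in> \<Phi>"
proof -
  define \<Psi> where "\<Psi> = {(\<lambda>x. poly (P x) (f x), poly Q c) | n P Q. rel n P Q}"
  have I: "(\<lambda>x. poly (P x) (f x), poly Q c) \<in> \<Psi>" if "rel n P Q" for n P Q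
    unfolding \<Psi>_def using that by blast
  have sub: "\<Phi> \<subseteq> \<Psi>"
  proof
    fix p assume "p \<in> \<Phi>"
    then show "p \<in> \<Psi>" using I[OF rel_const, of "fst p" "snd p"] by simp
  qed
  have "value_ring X \<Psi>"
    unfolding value_ring_def
  proof (intro conjI allI impI)
    show "(\<lambda>_. k, k) \<in> \<Psi>" for k using sub const by blast
  next
    fix g a h b assume "(g, a) \<in> \<Psi>" "(h, b) \<in> \<Psi>"
    then obtain n P Q m P' Q' where *: "rel n P Q" "rel m P' Q'"
      "g = (\<lambda>x. poly (P x) (f x))" "a = poly Q c" "h = (\<lambda>x. poly (P' x) (f x))" "b = poly Q' c"
      unfolding \<Psi>_def by blast
    have "rel (max n m) (\<lambda>x. P x + P' x) (Q + Q')"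
      using * by (intro rel_add) (auto elim: rel_mono)
    from I[OF this] show "(\<lambda>x. g x + h x, a + b) \<in> \<Psi>" by (simp add: *)
    from I[OF rel_mult[OF *(1,2)]] show "(\<lambda>x. g x * h x, a * b) \<in> \<Psi>" by (simp add: *)
  next
    fix g a assume "(g, a) \<in> \<Psi>" "\<forall>x\<in>X. g x = 0"
    then show "a = 0" unfolding \<Psi>_def using cons by fastforce
  qed
  then have "\<Psi> = \<Phi>" using max sub by blast
  moreover have "rel 1 (\<lambda>_. [:0, 1:]) [:0, 1:]" using rel_poly[of "[:0, 1:]"] by simp
  from I[OF this] have "(f, c) \<in> \<Psi>" by simp
  ultimately show ?thesis by simp
qed

lemma rel_degree:
  assumes "rel n P Q"
  shows "degree Q \<le> n"
proof (rule degree_le, intro allI impI)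
  fix i assume "n < i"
  moreover have "(\<lambda>x. coeff (P x) i, coeff Q i) \<in> \<Phi>" and d: "\<And>x. degree (P x) \<le> n"
    using assms unfolding rel_def by blast+
  ultimately show "coeff Q i = 0"
    using zero[of "\<lambda>x. coeff (P x) i"] coeff_eq_0 le_less_trans[OF d] by blast
qed

lemma poly_sum_le: "degree p \<le> n \<Longrightarrow> poly p x = (\<Sum>i\<le>n. coeff p i * x ^ i)" for p :: "complex poly"
  unfolding poly_altdef by (rule sum.mono_neutral_left) (auto simp: coeff_eq_0)

lemma indicator:
  fixes e :: "'x \<Rightarrow> complex"
  assumes e: "\<And>x. e x = 0 \<or> e x = 1"
  shows "(e, 0) \<in> \<Phi> \<or> (e, 1) \<in> \<Phi>"
proof (rule ccontr)
  assume *: "\<not> ?thesis"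
  then have "(e, 0) \<notin> \<Phi>" "(e, 1) \<notin> \<Phi>" by blast+
  then obtain n P Q m P' Q' where P: "rel n P Q" "\<And>x. x \<in> X \<Longrightarrow> poly (P x) (e x) = 0" "poly Q 0 \<noteq> 0"
    and P': "rel m P' Q'" "\<And>x. x \<in> X \<Longrightarrow> poly (P' x) (e x) = 0" "poly Q' 1 \<noteq> 0"
    using extend[of e 0] extend[of e 1] by meson
  have "(\<lambda>x. \<Sum>i\<le>m. coeff (P' x) i, \<Sum>i\<le>m. coeff Q' i) \<in> \<Phi>"
    using P'(1) unfolding rel_def by (intro sum) auto
  moreover have "(\<Sum>i\<le>m. coeff (P' x) i) = poly (P' x) 1" for x
    using P'(1) poly_sum_le[of "P' x" m 1] unfolding rel_def by simp
  moreover have "(\<Sum>i\<le>m. coeff Q' i) = poly Q' 1"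
    using rel_degree[OF P'(1)] poly_sum_le[of Q' m 1] by simp
  ultimately have 1: "(\<lambda>x. poly (P' x) 1, poly Q' 1) \<in> \<Phi>" by simp
  have "(\<lambda>x. coeff (P x) 0, coeff Q 0) \<in> \<Phi>" using P(1) unfolding rel_def by blast
  then have "(\<lambda>x. coeff (P x) 0 * poly (P' x) 1, coeff Q 0 * poly Q' 1) \<in> \<Phi>" using 1 by (rule mult)
  moreover have "coeff (P x) 0 * poly (P' x) 1 = 0" if "x \<in> X" for x
    using e[of x] P(2)[OF that] P'(2)[OF that] by (auto simp: poly_0_coeff_0)
  ultimately have "coeff Q 0 * poly Q' 1 = 0" by (rule zero)
  then show False using P(3) P'(3) by (simp add: poly_0_coeff_0)
qed

definition rev_poly :: "nat \<Rightarrow> complex poly \<Rightarrow> complex poly" where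
  "rev_poly m p = (\<Sum>i\<le>m. monom (coeff p (m - i)) i)"

lemma coeff_rev_poly: "coeff (rev_poly m p) i = (if i \<le> m then coeff p (m - i) else 0)"
  by (simp add: rev_poly_def coeff_sum)

lemma poly_rev_poly:
  assumes "degree p \<le> m" "a \<noteq> 0"
  shows "poly (rev_poly m p) (inverse a) = inverse a ^ m * poly p a"
proof -
  have "poly (rev_poly m p) (inverse a) = (\<Sum>i\<le>m. coeff p (m - i) * inverse a ^ i)"
    by (simp add: rev_poly_def poly_sum poly_monom)
  also have "\<dots> = (\<Sum>i\<le>m. coeff p i * inverse a ^ (m - i))"
    by (rule sum.reindex_bij_witness[of _ "\<lambda>i. m - i" "\<lambda>i. m - i"]) auto
  also have "\<dots> = (\<Sum>i\<le>m. inverse a ^ m * (coeff p i * a ^ i))"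
    using assms(2) by (intro sum.cong refl) (simp add: power_diff field_simps)
  also have "\<dots> = inverse a ^ m * poly p a"
    unfolding poly_sum_le[OF assms(1), of a] by (rule sum_distrib_left[symmetric])
  finally show ?thesis .
qed

text \<open>One step of the Euclidean algorithm between a relation for \<open>h\<close> and one for its inverse. The
  factor \<open>u\<close> removes the points where \<open>h\<close> vanishes.\<close>

lemma reduce:
  assumes P: "rel n P Q" "\<And>x. x \<in> X \<Longrightarrow> poly (P x) (h x) = 0"
    and R: "rel m R S" "\<And>x. x \<in> X \<Longrightarrow> poly (R x) (inverse (h x)) = 0"
    and mn: "m \<le> n" and u: "(u, 1) \<in> \<Phi>" "\<And>x. h x = 0 \<Longrightarrow> u x = 0"
    and n: "0 < n"
  shows "\<exists>P' Q'. rel (n - 1) P' Q' \<and> (\<forall>x\<in>X. poly (P' x) (h x) = 0) \<and>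
     (\<forall>i\<le>n. coeff Q' i = coeff S 0 * coeff Q i - coeff Q n * (if n - m \<le> i then coeff S (n - i) else 0))"
proof -
  define P' where "P' x = smult (u x) (smult (coeff (R x) 0) (P x) - smult (coeff (P x) n) (monom 1 (n - m) * rev_poly m (R x)))" for x
  define Q' where "Q' = smult (coeff S 0) Q - smult (coeff Q n) (monom 1 (n - m) * rev_poly m S)"
  have shift: "coeff (monom 1 (n - m) * rev_poly m p) i = (if n - m \<le> i then if i \<le> n then coeff p (n - i) else 0 else 0)" for p i
    using mn by (auto simp: coeff_monom_mult coeff_rev_poly)
  have cP: "coeff (P' x) i = u x * (coeff (R x) 0 * coeff (P x) i - coeff (P x) n * (if n - m \<le> i then if i \<le> n then coeff (R x) (n - i) else 0 else 0))" for x i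
    unfolding P'_def by (simp add: shift)
  have cQ: "coeff Q' i = coeff S 0 * coeff Q i - coeff Q n * (if n - m \<le> i then if i \<le> n then coeff S (n - i) else 0 else 0)" for i
    unfolding Q'_def by (simp add: shift)
  have coeffs: "(\<lambda>x. coeff (P x) i, coeff Q i) \<in> \<Phi>" "(\<lambda>x. coeff (R x) i, coeff S i) \<in> \<Phi>" for i
    using P(1) R(1) unfolding rel_def by blast+
  have "rel (n - 1) P' Q'"
    unfolding rel_def
  proof (intro conjI allI)
    fix x
    show "degree (P' x) \<le> n - 1"
    proof (rule degree_le, intro allI impI)
      fix i assume "n - 1 < i"
      then consider "i = n" | "n < i" by linarith
      then show "coeff (P' x) i = 0"
      proof cases
        case 1 then show ?thesis by (simp add: cP)
      next
        case 2
        then have "coeff (P x) i = 0" using P(1) unfolding rel_def by (meson coeff_eq_0 le_less_trans)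
        then show ?thesis using 2 by (simp add: cP)
      qed
    qed
  next
    fix i
    have "(\<lambda>x. if n - m \<le> i then if i \<le> n then coeff (R x) (n - i) else 0 else 0,
        if n - m \<le> i then if i \<le> n then coeff S (n - i) else 0 else 0) \<in> \<Phi>"
      using coeffs(2) const[of 0] by auto
    then have "(\<lambda>x. u x * (coeff (R x) 0 * coeff (P x) i - coeff (P x) n * (if n - m \<le> i then if i \<le> n then coeff (R x) (n - i) else 0 else 0)),
        1 * (coeff S 0 * coeff Q i - coeff Q n * (if n - m \<le> i then if i \<le> n then coeff S (n - i) else 0 else 0))) \<in> \<Phi>"
      by (intro mult diff coeffs u(1))
    then show "(\<lambda>x. coeff (P' x) i, coeff Q' i) \<in> \<Phi>" by (simp add: cP cQ)
  qed
  moreover have "poly (P' x) (h x) = 0" if "x \<in> X" for x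
  proof (cases "h x = 0")
    case False
    have "poly (rev_poly m (R x)) (inverse (inverse (h x))) = inverse (inverse (h x)) ^ m * poly (R x) (inverse (h x))"
      using R(1) False unfolding rel_def by (intro poly_rev_poly) auto
    then show ?thesis using P(2) R(2) that by (simp add: P'_def)
  qed (simp add: P'_def u(2))
  ultimately show ?thesis using cQ by (intro exI[of _ P'] exI[of _ Q']) auto
qed

lemma no_two_relations:
  assumes "rel n P Q" "\<And>x. x \<in> X \<Longrightarrow> poly (P x) (inverse (f x)) = 0" "coeff Q 0 \<noteq> 0"
    and "rel m R S" "\<And>x. x \<in> X \<Longrightarrow> poly (R x) (f x) = 0" "coeff S 0 \<noteq> 0" "\<And>i. i > 0 \<Longrightarrow> coeff S i = 0"
    and u: "(u, 1) \<in> \<Phi>" "\<And>x. f x = 0 \<Longrightarrow> u x = 0"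
  shows False
  using assms(1-7)
proof (induction "n + m" arbitrary: n m P Q R S rule: less_induct)
  case less
  have const_rel: "coeff Q 0 = 0" if "rel 0 P Q" "\<And>x. x \<in> X \<Longrightarrow> poly (P x) (h x) = 0" for P Q and h :: "'x \<Rightarrow> complex"
  proof (rule zero)
    show "(\<lambda>x. coeff (P x) 0, coeff Q 0) \<in> \<Phi>" using that(1) unfolding rel_def by blast
    fix x assume "x \<in> X"
    then show "coeff (P x) 0 = 0" using that poly_sum_le[of "P x" 0 "h x"] unfolding rel_def by auto
  qed
  have n: "0 < n" using const_rel[of P Q "\<lambda>x. inverse (f x)"] less.prems(1-3) by (cases n) auto
  have m: "0 < m" using const_rel[of R S f] less.prems(4-6) by (cases m) auto
  show False
  proof (cases "m \<le> n")
    case True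
    obtain P' Q' where P': "rel (n - 1) P' Q'" "\<And>x. x \<in> X \<Longrightarrow> poly (P' x) (inverse (f x)) = 0"
      "\<And>i. i \<le> n \<Longrightarrow> coeff Q' i = coeff S 0 * coeff Q i - coeff Q n * (if n - m \<le> i then coeff S (n - i) else 0)"
      using reduce[of n P Q "\<lambda>x. inverse (f x)" m R S u] less.prems True u n by auto
    have "coeff Q' 0 = coeff S 0 * coeff Q 0" using P'(3)[of 0] less.prems(7)[of n] n by simp
    then show False using less.hyps[of "n - 1" m P' Q' R S] P' less.prems n by auto
  next
    case False
    obtain R' S' where R': "rel (m - 1) R' S'" "\<And>x. x \<in> X \<Longrightarrow> poly (R' x) (f x) = 0"
      "\<And>i. i \<le> m \<Longrightarrow> coeff S' i = coeff Q 0 * coeff S i - coeff S m * (if m - n \<le> i then coeff Q (m - i) else 0)"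
      using reduce[of m R S f n P Q u] less.prems False u m by auto
    have "coeff S m = 0" using less.prems(7) m by blast
    then have S': "coeff S' i = coeff Q 0 * coeff S i" if "i \<le> m" for i using R'(3)[OF that] by simp
    have "coeff S' i = 0" if "i > 0" for i
    proof (cases "i \<le> m")
      case True then show ?thesis using S' less.prems(7) that by simp
    next
      case False
      then show ?thesis using rel_degree[OF R'(1)] by (intro coeff_eq_0) linarith
    qed
    moreover have "coeff S' 0 \<noteq> 0" using S'[of 0] less.prems by simp
    ultimately show False using less.hyps[of n "m - 1" P Q R' S'] R' less.prems m by auto
  qed
qed

text \<open>The polynomials of values of the relations for \<open>f\<close> form an ideal. If it is proper then a
  common root is a possible value of \<open>f\<close>; otherwise it contains a nonzero constant.\<close>

lemma value_or_constant_relation: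
  "(\<exists>c. (f, c) \<in> \<Phi>) \<or> (\<exists>n R S. rel n R S \<and> (\<forall>x\<in>X. poly (R x) (f x) = 0) \<and> coeff S 0 \<noteq> 0 \<and> (\<forall>i>0. coeff S i = 0))"
proof (rule disjCI)
  define J where "J = {Q. \<exists>n P. rel n P Q \<and> (\<forall>x\<in>X. poly (P x) (f x) = 0)}"
  assume no: "\<not> (\<exists>n R S. rel n R S \<and> (\<forall>x\<in>X. poly (R x) (f x) = 0) \<and> coeff S 0 \<noteq> 0 \<and> (\<forall>i>0. coeff S i = 0))"
  show "\<exists>c. (f, c) \<in> \<Phi>"
  proof (rule ccontr)
    assume "\<not> ?thesis"
    then have J: "\<exists>Q\<in>J. poly Q c \<noteq> 0" for c using extend[of f c] unfolding J_def by blast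
    then obtain Q1 where "Q1 \<in> J" "Q1 \<noteq> 0" by (metis poly_0)
    then obtain Q0 where Q0: "Q0 \<in> J" "Q0 \<noteq> 0" and least: "\<And>Q. Q \<in> J \<Longrightarrow> Q \<noteq> 0 \<Longrightarrow> degree Q0 \<le> degree Q"
      using ex_has_least_nat[of "\<lambda>Q. Q \<in> J \<and> Q \<noteq> 0" Q1 degree] by blast
    have dvd: "Q0 dvd Q" if Q: "Q \<in> J" for Q
    proof -
      obtain n P where P: "rel n P Q" "\<forall>x\<in>X. poly (P x) (f x) = 0" using Q unfolding J_def by blast
      obtain n0 P0 where P0: "rel n0 P0 Q0" "\<forall>x\<in>X. poly (P0 x) (f x) = 0" using Q0 unfolding J_def by blast
      have 1: "rel (degree (Q div Q0) + n0) (\<lambda>x. (Q div Q0) * P0 x) (Q div Q0 * Q0)"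
        by (rule rel_mult[OF rel_poly P0(1)])
      let ?N = "max n (degree (Q div Q0) + n0)"
      have "rel ?N (\<lambda>x. P x - (Q div Q0) * P0 x) (Q - Q div Q0 * Q0)"
        by (rule rel_diff[OF rel_mono[OF P(1)] rel_mono[OF 1]]) auto
      then have "Q mod Q0 \<in> J" unfolding J_def minus_div_mult_eq_mod using P P0 by fastforce
      moreover have "degree (Q mod Q0) < degree Q0 \<or> Q mod Q0 = 0" using degree_mod_less[OF Q0(2)] by blast
      ultimately have "Q mod Q0 = 0" using least by (metis leD)
      then show ?thesis by (simp add: mod_eq_0_iff_dvd)
    qed
    show False
    proof (cases "degree Q0 = 0")
      case True
      then obtain k where "Q0 = [:k:]" by (rule degree_eq_zeroE)
      then have "coeff Q0 0 \<noteq> 0 \<and> (\<forall>i>0. coeff Q0 i = 0)" using Q0(2) by (auto simp: coeff_pCons split: nat.split)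
      then show False using no Q0(1) unfolding J_def by blast
    next
      case False
      then have "\<not> constant (poly Q0)" by (simp add: constant_degree)
      then obtain c where "poly Q0 c = 0" using fundamental_theorem_of_algebra by blast
      then show False using J[of c] dvd by (metis dvd_trans poly_eq_0_iff_dvd)
    qed
  qed
qed

lemma value_or_inverse: "(\<exists>c. (f, c) \<in> \<Phi>) \<or> (\<lambda>x. inverse (f x), 0) \<in> \<Phi>"
proof (rule ccontr)
  assume *: "\<not> ?thesis"
  let ?e = "\<lambda>x. if f x = 0 then 1 else 0 :: complex"
  have "(?e, 0) \<in> \<Phi> \<or> (?e, 1) \<in> \<Phi>" by (rule indicator) auto
  then show False
  proof
    assume e: "(?e, 1) \<in> \<Phi>"
    have "(f, 0) \<in> \<Phi>"
    proof (rule extend)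
      fix n P Q assume P: "rel n P Q" "\<And>x. x \<in> X \<Longrightarrow> poly (P x) (f x) = 0"
      have "(\<lambda>x. coeff (P x) 0, coeff Q 0) \<in> \<Phi>" using P(1) unfolding rel_def by blast
      with e have "(\<lambda>x. ?e x * coeff (P x) 0, 1 * coeff Q 0) \<in> \<Phi>" by (rule mult)
      moreover have "?e x * coeff (P x) 0 = 0" if "x \<in> X" for x
        using P(2)[OF that] by (auto simp: poly_0_coeff_0)
      ultimately have "1 * coeff Q 0 = 0" by (rule zero)
      then show "poly Q 0 = 0" by (simp add: poly_0_coeff_0)
    qed
    then show False using * by blast
  next
    assume e: "(?e, 0) \<in> \<Phi>"
    have u: "(\<lambda>x. 1 - ?e x, 1 - 0) \<in> \<Phi>" by (intro diff const e)
    obtain n P Q where P: "rel n P Q" "\<And>x. x \<in> X \<Longrightarrow> poly (P x) (inverse (f x)) = 0" "poly Q 0 \<noteq> 0"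
      using extend[of "\<lambda>x. inverse (f x)" 0] * by meson
    obtain m R S where R: "rel m R S" "\<forall>x\<in>X. poly (R x) (f x) = 0" "coeff S 0 \<noteq> 0" "\<forall>i>0. coeff S i = 0"
      using value_or_constant_relation[of f] * by meson
    show False
      by (rule no_two_relations[where f = f and u = "\<lambda>x. 1 - ?e x", OF P(1,2) _ R(1)])
        (use P R u in \<open>auto simp: poly_0_coeff_0\<close>)
  qed
qed

lemma is_place: "place X (\<lambda>f c. (f, c) \<in> \<Phi>)"
proof
  show "(f, 0) \<in> \<Phi>" if "\<And>x. x \<in> X \<Longrightarrow> f x = 0" for f
  proof (rule extend)
    fix n P Q assume P: "rel n P Q" "\<And>x. x \<in> X \<Longrightarrow> poly (P x) (f x) = 0"
    have "(\<lambda>x. coeff (P x) 0, coeff Q 0) \<in> \<Phi>" using P(1) unfolding rel_def by blast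
    moreover have "coeff (P x) 0 = 0" if "x \<in> X" for x
      using P(2)[OF that] \<open>\<And>x. x \<in> X \<Longrightarrow> f x = 0\<close>[OF that] by (simp add: poly_0_coeff_0)
    ultimately have "coeff Q 0 = 0" by (rule zero)
    then show "poly Q 0 = 0" by (simp add: poly_0_coeff_0)
  qed
  show "a = 0" if "(f, a) \<in> \<Phi>" "\<And>x. x \<in> X \<Longrightarrow> f x = 0" for f a using that by (rule zero)
qed (use const add mult value_or_inverse in auto)

end

text \<open>By Zorn's lemma there is a maximal ring of functions with values; maximality makes it a place.\<close>

theorem place_exists:
  assumes "value_ring X \<Phi>"
  shows "\<exists>lim. place X lim \<and> (\<forall>(f, c)\<in>\<Phi>. lim f c)"
proof -
  define \<A> where "\<A> = {\<Psi>. value_ring X \<Psi> \<and> \<Phi> \<subseteq> \<Psi>}"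
  have "\<exists>M\<in>\<A>. \<forall>\<Psi>\<in>\<A>. M \<subseteq> \<Psi> \<longrightarrow> \<Psi> = M"
  proof (rule subset_Zorn_nonempty)
    show "\<A> \<noteq> {}" using assms unfolding \<A>_def by blast
    fix C assume C: "C \<noteq> {}" "subset.chain \<A> C"
    have two: "\<exists>\<Psi>\<in>C. p \<in> \<Psi> \<and> q \<in> \<Psi>" if "p \<in> \<Union>C" "q \<in> \<Union>C" for p q
      using that C(2) unfolding subset_chain_def by blast
    have ringC: "value_ring X \<Psi>" "\<Phi> \<subseteq> \<Psi>" if "\<Psi> \<in> C" for \<Psi>
      using that C(2) unfolding subset_chain_def \<A>_def by blast+
    have "value_ring X (\<Union>C)"
      unfolding value_ring_def
    proof (intro conjI allI impI)
      show "(\<lambda>_. c, c) \<in> \<Union>C" for c using C(1) ringC unfolding value_ring_def by blast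
    next
      fix f a g b assume "(f, a) \<in> \<Union>C" "(g, b) \<in> \<Union>C"
      then obtain \<Psi> where "\<Psi> \<in> C" "(f, a) \<in> \<Psi>" "(g, b) \<in> \<Psi>" using two by blast
      then show "(\<lambda>x. f x + g x, a + b) \<in> \<Union>C" "(\<lambda>x. f x * g x, a * b) \<in> \<Union>C"
        using ringC(1) unfolding value_ring_def by blast+
    next
      fix f a assume "(f, a) \<in> \<Union>C" "\<forall>x\<in>X. f x = 0"
      then show "a = 0" using ringC(1) unfolding value_ring_def by blast
    qed
    then show "\<Union>C \<in> \<A>" using C(1) ringC(2) unfolding \<A>_def by blast
  qed
  then obtain M where M: "M \<in> \<A>" "\<And>\<Psi>. \<Psi> \<in> \<A> \<Longrightarrow> M \<subseteq> \<Psi> \<Longrightarrow> \<Psi> = M" by blast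
  interpret max_value_ring X M
    by unfold_locales (use M in \<open>auto simp: \<A>_def\<close>)
  show ?thesis using is_place M(1) unfolding \<A>_def by blast
qed

section \<open>Places on the graph\<close>

text \<open>The pairs whose product is a nonzero scalar: the graph over the invertible catalecticants, up
  to scaling.\<close>

definition inverse_pairs :: "(mat6 \<times> mat6) set" where
  "inverse_pairs = {(A, B). A \<in> Cat \<and> B \<in> Sym6 \<and> (\<exists>s. s \<noteq> 0 \<and> A ** B = mat s)}"

text \<open>The set of inverse pairs is stable under scaling both factors, so the bihomogeneous components
  of a polynomial that vanishes on it vanish on it too.\<close>

lemma limit_pair_place:
  assumes "limit_pair A B"
  shows "\<exists>lim. place inverse_pairs lim \<and> (\<forall>i j. lim (\<lambda>p. fst p $ i $ j) (A $ i $ j)) \<and>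
    (\<forall>i j. lim (\<lambda>p. snd p $ i $ j) (B $ i $ j))"
proof -
  define \<Phi> where "\<Phi> = {(f, f (A, B)) | f. f \<in> bi_polys}"
  have "f (A, B) = 0" if f: "f \<in> bi_polys" and van: "\<And>p. p \<in> inverse_pairs \<Longrightarrow> f p = 0" for f
  proof -
    obtain N M u where u: "\<And>d e. u d e \<in> bi_forms d e" "\<And>p. f p = (\<Sum>d\<le>N. \<Sum>e\<le>M d. u d e p)"
      using bi_forms_decomposition[OF f] by blast
    have comp: "u d e (C, D) = 0" if CD: "(C, D) \<in> inverse_pairs" and d: "d \<le> N" and e: "e \<le> M d" for C D d e
    proof -
      have 0: "(\<Sum>d\<le>N. b ^ d * (\<Sum>e\<le>M d. c ^ e * u d e (C, D))) = 0" if "b \<noteq> 0" "c \<noteq> 0" for b c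
      proof -
        obtain s where "C \<in> Cat" "D \<in> Sym6" "s \<noteq> 0" "C ** D = mat s"
          using CD unfolding inverse_pairs_def by blast
        then have "(cscale b C, cscale c D) \<in> inverse_pairs"
          using that cmat.subspace_scale[OF subspace_Cat] cmat.subspace_scale[OF subspace_Sym6]
          unfolding inverse_pairs_def
          by (auto simp: cscale_mult_left cscale_mult_right cscale_mat intro!: exI[of _ "b * (c * s)"])
        then have "f (cscale b C, cscale c D) = 0" by (rule van)
        then show ?thesis
          unfolding u(2) bi_forms_scale[OF u(1)] by (simp add: sum_distrib_left ac_simps)
      qed
      have "(\<Sum>e\<le>M d. c ^ e * u d e (C, D)) = 0" if "c \<noteq> 0" for c
        using 0[OF _ that] d by (rule power_sum_zero_coeffs)
      then show ?thesis using e by (rule power_sum_zero_coeffs)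
    qed
    have "u d e (A, B) = 0" if "d \<le> N" "e \<le> M d" for d e
    proof -
      have "u d e (C, adjugate C) = 0" if "C \<in> Cat" "det C \<noteq> 0" for C
        using that adjugate_Sym6[OF that] mult_adjugate
        by (intro comp \<open>d \<le> N\<close> \<open>e \<le> M d\<close>) (auto simp: inverse_pairs_def)
      then show ?thesis using assms u(1) unfolding limit_pair_def by blast
    qed
    then show ?thesis unfolding u(2) by simp
  qed
  then have "value_ring inverse_pairs \<Phi>"
    unfolding value_ring_def \<Phi>_def bi_polys_def
    by (auto intro: poly_funs.intros exI[of _ "\<lambda>x. _ x"])

  from place_exists[OF this] obtain lim where lim: "place inverse_pairs lim" "\<And>f c. (f, c) \<in> \<Phi> \<Longrightarrow> lim f c"
    by blast
  have "((\<lambda>p. fst p $ i $ j), A $ i $ j) \<in> \<Phi>" "((\<lambda>p. snd p $ i $ j), B $ i $ j) \<in> \<Phi>" for i j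
    unfolding \<Phi>_def using bi_polys_fst[of i j] bi_polys_snd[of i j] by force+
  then show ?thesis using lim by blast
qed

context place
begin

definition limM :: "('x \<Rightarrow> mat6) \<Rightarrow> mat6 \<Rightarrow> bool" where
  "limM M B \<longleftrightarrow> (\<forall>i j. lim (\<lambda>x. M x $ i $ j) (B $ i $ j))"

lemma limM_nth: "limM M B \<Longrightarrow> lim (\<lambda>x. M x $ i $ j) (B $ i $ j)"
  unfolding limM_def by blast

lemma limM_transpose: "limM M B \<Longrightarrow> limM (\<lambda>x. transpose (M x)) (transpose B)"
  unfolding limM_def by (simp add: transpose_def)

lemma limM_congr: "limM T S \<Longrightarrow> limM M B \<Longrightarrow> limM (\<lambda>x. congr (T x) (M x)) (congr S B)"
  unfolding limM_def congr_nth by (intro allI lim_sum lim_mult finite) auto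

lemma limM_rho:
  assumes "\<And>i j. lim (\<lambda>x. g x $ i $ j) (G $ i $ j)"
  shows "limM (\<lambda>x. rho (g x)) (rho G)"
proof -
  have "\<forall>i. lim (\<lambda>x. rho (g x) $ i $ j) (rho G $ i $ j)" for j
    unfolding forall_quad rho_nth qprod_nth column_nth
    by (intro conjI lim_add lim_mult assms)
  then show ?thesis unfolding limM_def by blast
qed

text \<open>Points at which a function with a nonzero value vanishes can be dropped.\<close>

lemma restrict_nonzero:
  assumes U: "lim U u" "u \<noteq> 0"
  shows "place {x \<in> X. U x \<noteq> 0} lim"
proof
  have unique: "a = 0" if "lim f a" "\<And>x. x \<in> {x \<in> X. U x \<noteq> 0} \<Longrightarrow> f x = 0" for f a
  proof -
    have "lim (\<lambda>x. f x * U x) (a * u)" by (intro lim_mult that U)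
    then have "a * u = 0" by (rule lim_zero_unique) (use that in auto)
    then show ?thesis using U by simp
  qed
  then show "a = 0" if "lim f a" "\<And>x. x \<in> {x \<in> X. U x \<noteq> 0} \<Longrightarrow> f x = 0" for f a using that by blast
  show "lim f 0" if f: "\<And>x. x \<in> {x \<in> X. U x \<noteq> 0} \<Longrightarrow> f x = 0" for f
    using lim_or_inverse[of "\<lambda>x. 1 + f x"]
  proof
    assume "\<exists>a. lim (\<lambda>x. 1 + f x) a"
    then obtain a where "lim (\<lambda>x. 1 + f x) a" by blast
    then have "lim (\<lambda>x. 1 + f x - 1) (a - 1)" by (intro lim_diff lim_const)
    then have "lim f (a - 1)" by simp
    with unique[OF this f] show ?thesis by simp
  next
    assume "lim (\<lambda>x. inverse (1 + f x)) 0"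
    then have "lim (\<lambda>x. inverse (1 + f x) - 1) (0 - 1)" by (intro lim_diff lim_const)
    then have "(0 - 1 :: complex) = 0" by (rule unique) (use f in auto)
    then show ?thesis by simp
  qed
qed (use lim_const lim_add lim_mult lim_or_inverse in auto)

end

text \<open>Changing the basis by a matrix with inverse \<open>S\<close>.\<close>

lemma congr_inverse_pair:
  assumes TS: "T ** S = mat 1" and AB: "A ** B = mat s"
  shows "congr (transpose T) A ** congr S B = mat s"
proof -
  have ST: "S ** T = mat 1" using TS by (simp add: matrix_left_right_inverse)
  have "congr (transpose T) A ** congr S B = transpose T ** A ** (T ** S) ** B ** transpose S"
    by (simp add: congr_def matrix_mul_assoc transpose_transpose)
  also have "\<dots> = transpose T ** (A ** B) ** transpose S" by (simp add: TS matrix_mul_assoc)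
  also have "\<dots> = cscale s (transpose (S ** T))"
    by (simp add: AB mult_mat_right cscale_mult_left matrix_transpose_mul)
  also have "\<dots> = mat s" by (simp add: ST transpose_mat cscale_mat)
  finally show ?thesis .
qed


section \<open>Symmetric four by four matrices\<close>

definition KI :: "quad_exp set" where "KI = {YY, XZ, YZ, ZZ}"

definition det3 :: "mat6 \<Rightarrow> quad_exp \<Rightarrow> quad_exp \<Rightarrow> quad_exp \<Rightarrow> quad_exp \<Rightarrow> quad_exp \<Rightarrow> quad_exp \<Rightarrow> complex" where
  "det3 B i j k p q r = B $ i $ p * (B $ j $ q * B $ k $ r - B $ j $ r * B $ k $ q)
     - B $ i $ q * (B $ j $ p * B $ k $ r - B $ j $ r * B $ k $ p)
     + B $ i $ r * (B $ j $ p * B $ k $ q - B $ j $ q * B $ k $ p)"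

text \<open>The cofactors of the block with rows and columns \<open>y\<^sup>2, x z, y z, z\<^sup>2\<close>.\<close>

definition adj4 :: "mat6 \<Rightarrow> mat6" where
  "adj4 B = (\<chi> i j.
     if i = YY \<and> j = YY then det3 B XZ YZ ZZ XZ YZ ZZ
     else if i = XZ \<and> j = XZ then det3 B YY YZ ZZ YY YZ ZZ
     else if i = YZ \<and> j = YZ then det3 B YY XZ ZZ YY XZ ZZ
     else if i = ZZ \<and> j = ZZ then det3 B YY XZ YZ YY XZ YZ
     else if {i, j} = {YY, XZ} then - det3 B YY YZ ZZ XZ YZ ZZ
     else if {i, j} = {YY, YZ} then det3 B YY XZ ZZ XZ YZ ZZ
     else if {i, j} = {YY, ZZ} then - det3 B YY XZ YZ XZ YZ ZZ
     else if {i, j} = {XZ, YZ} then - det3 B YY XZ ZZ YY YZ ZZ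
     else if {i, j} = {XZ, ZZ} then det3 B YY XZ YZ YY YZ ZZ
     else if {i, j} = {YZ, ZZ} then - det3 B YY XZ YZ YY XZ ZZ
     else 0)"

lemma adj4_nth:
  "adj4 B $ YY $ YY = det3 B XZ YZ ZZ XZ YZ ZZ" "adj4 B $ XZ $ XZ = det3 B YY YZ ZZ YY YZ ZZ"
  "adj4 B $ YZ $ YZ = det3 B YY XZ ZZ YY XZ ZZ" "adj4 B $ ZZ $ ZZ = det3 B YY XZ YZ YY XZ YZ"
  "adj4 B $ YY $ XZ = - det3 B YY YZ ZZ XZ YZ ZZ" "adj4 B $ XZ $ YY = - det3 B YY YZ ZZ XZ YZ ZZ"
  "adj4 B $ YY $ YZ = det3 B YY XZ ZZ XZ YZ ZZ" "adj4 B $ YZ $ YY = det3 B YY XZ ZZ XZ YZ ZZ"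
  "adj4 B $ YY $ ZZ = - det3 B YY XZ YZ XZ YZ ZZ" "adj4 B $ ZZ $ YY = - det3 B YY XZ YZ XZ YZ ZZ"
  "adj4 B $ XZ $ YZ = - det3 B YY XZ ZZ YY YZ ZZ" "adj4 B $ YZ $ XZ = - det3 B YY XZ ZZ YY YZ ZZ"
  "adj4 B $ XZ $ ZZ = det3 B YY XZ YZ YY YZ ZZ" "adj4 B $ ZZ $ XZ = det3 B YY XZ YZ YY YZ ZZ"
  "adj4 B $ YZ $ ZZ = - det3 B YY XZ YZ YY XZ ZZ" "adj4 B $ ZZ $ YZ = - det3 B YY XZ YZ YY XZ ZZ"
  by (simp_all add: adj4_def doubleton_eq_iff)

lemma adj4_Sym_on: "adj4 B \<in> Sym_on KI"
  unfolding Sym_on_def Sym6_iff mem_Collect_eq forall_quad KI_def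
  by (simp add: adj4_nth) (simp add: adj4_def doubleton_eq_iff)

definition det4 :: "mat6 \<Rightarrow> complex" where
  "det4 B = B $ YY $ YY * adj4 B $ YY $ YY + B $ YY $ XZ * adj4 B $ XZ $ YY
     + B $ YY $ YZ * adj4 B $ YZ $ YY + B $ YY $ ZZ * adj4 B $ ZZ $ YY"

text \<open>The cubic form: its vanishing says that the cofactors satisfy the relation between
  \<open>y\<^sup>2 + k x y\<close>, \<open>x z\<close>, \<open>y z\<close>, \<open>z\<^sup>2\<close>.\<close>

definition cubicF :: "complex \<Rightarrow> mat6 \<Rightarrow> complex" where
  "cubicF k B = adj4 B $ YY $ ZZ - adj4 B $ YZ $ YZ - k * adj4 B $ XZ $ YZ"

lemma det3_mat_polys: "(\<lambda>B. det3 B i j k p q r) \<in> mat_polys"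
  unfolding det3_def mat_polys_def by (intro poly_funs_intros mat_polys_entry[unfolded mat_polys_def])

lemma adj4_mat_polys: "(\<lambda>B. adj4 B $ i $ j) \<in> mat_polys"
  unfolding adj4_def mat_polys_def vec_lambda_beta
  by (intro poly_funs_if poly_funs_minus det3_mat_polys[unfolded mat_polys_def] poly_funs.const)

lemma det4_mat_polys: "det4 \<in> mat_polys"
  unfolding det4_def mat_polys_def
  by (intro poly_funs.add poly_funs.mult mat_polys_entry[unfolded mat_polys_def] adj4_mat_polys[unfolded mat_polys_def])

lemma cubicF_mat_forms: "cubicF k \<in> mat_forms 3"
proof -
  have "cubicF k \<in> mat_polys"
    unfolding cubicF_def mat_polys_def
    by (intro poly_funs_diff poly_funs_cmult adj4_mat_polys[unfolded mat_polys_def])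
  moreover have "cubicF k (cscale c B) = c ^ 3 * cubicF k B" for c B
    by (simp add: cubicF_def adj4_nth det3_def power3_eq_cube algebra_simps)
  ultimately show ?thesis unfolding mat_forms_def by blast
qed

lemma block_mult_adj4:
  assumes "B \<in> Sym6" "i \<in> KI" "j \<in> KI"
  shows "(\<Sum>k\<in>KI. B $ i $ k * adj4 B $ k $ j) = (if i = j then det4 B else 0)"
proof -
  have sym: "B $ i $ j = B $ j $ i" for i j using assms(1) Sym6_iff by blast
  show ?thesis
    using assms(2,3) unfolding KI_def
    by (auto simp: adj4_nth det4_def det3_def sym[of XZ YY] sym[of YZ YY] sym[of ZZ YY] sym[of YZ XZ] sym[of ZZ XZ] sym[of ZZ YZ] algebra_simps)
qed

lemma sum_KI: "(\<Sum>k\<in>KI. f k) = f YY + f XZ + f YZ + (f ZZ :: complex)"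
  by (simp add: KI_def add.assoc)

text \<open>For a catalecticant normalized by \<open>x\<^sup>3 z = x\<^sup>2 y z = 0\<close>, the Schur complement of the block \<open>x\<^sup>2, x y\<close> is
  proportional to the cofactors of the complementary block of the inverse. Up to a term quadratic in
  \<open>x y\<^sup>2 z\<close> it satisfies a linear relation, because \<open>z\<^sup>2 (y\<^sup>2 - e\<^sub>1 x\<^sup>2 - e\<^sub>2 x y)\<close> is a product in two ways.\<close>

lemma schur_relation:
  assumes A: "A \<in> Cat" and z: "A $ XX $ XZ = 0" "A $ XY $ XZ = 0" and B: "B \<in> Sym6" and AB: "A ** B = mat s" "s \<noteq> 0"
    and U: "U = A $ XX $ XX * A $ XY $ XY - A $ XX $ XY * A $ XX $ XY" "U \<noteq> 0"
  shows "adj4 B $ YY $ ZZ = adj4 B $ YZ $ YZ + (A $ XX $ XX / U * A $ YY $ XZ) * adj4 B $ YY $ XZ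
     - (A $ YY $ XX * A $ XY $ XY - A $ YY $ XY * A $ XX $ XY) / U * adj4 B $ XZ $ XZ
     - (A $ XX $ XX * A $ YY $ XY - A $ XX $ XY * A $ YY $ XX) / U * adj4 B $ XZ $ YZ"
proof -
  have symA: "A $ i $ j = A $ j $ i" for i j using A Cat_subset_Sym6 Sym6_iff by blast
  have symB: "B $ i $ j = B $ j $ i" for i j using B Sym6_iff by blast
  note cat = A[unfolded Cat_iff, THEN conjunct2]
  define P where "P i k = U * A $ i $ k - (A $ i $ XX * (A $ XY $ XY * A $ XX $ k - A $ XX $ XY * A $ XY $ k)
      + A $ i $ XY * (A $ XX $ XX * A $ XY $ k - A $ XX $ XY * A $ XX $ k))" for i k
  have prod: "A $ i $ XX * B $ XX $ j + A $ i $ XY * B $ XY $ j + (\<Sum>k\<in>KI. A $ i $ k * B $ k $ j) = (if i = j then s else 0)" for i j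
  proof -
    have "(A ** B) $ i $ j = (if i = j then s else 0)" by (simp add: AB mat_nth)
    then show ?thesis unfolding matrix_mult_nth sum_quad sum_KI by (simp add: algebra_simps)
  qed
  have PB: "(\<Sum>k\<in>KI. P i k * B $ k $ j) = U * s * (if i = j then 1 else 0)" if "j \<in> KI" for i j
  proof -
    have ne: "XX \<noteq> j" "XY \<noteq> j" using that by (auto simp: KI_def)
    have "(\<Sum>k\<in>KI. P i k * B $ k $ j) = U * (A $ i $ XX * B $ XX $ j + A $ i $ XY * B $ XY $ j + (\<Sum>k\<in>KI. A $ i $ k * B $ k $ j))
      - A $ i $ XX * (A $ XY $ XY * (A $ XX $ XX * B $ XX $ j + A $ XX $ XY * B $ XY $ j + (\<Sum>k\<in>KI. A $ XX $ k * B $ k $ j))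
        - A $ XX $ XY * (A $ XY $ XX * B $ XX $ j + A $ XY $ XY * B $ XY $ j + (\<Sum>k\<in>KI. A $ XY $ k * B $ k $ j)))
      - A $ i $ XY * (A $ XX $ XX * (A $ XY $ XX * B $ XX $ j + A $ XY $ XY * B $ XY $ j + (\<Sum>k\<in>KI. A $ XY $ k * B $ k $ j))
        - A $ XX $ XY * (A $ XX $ XX * B $ XX $ j + A $ XX $ XY * B $ XY $ j + (\<Sum>k\<in>KI. A $ XX $ k * B $ k $ j)))"
      unfolding sum_KI P_def U(1) symA[of XY XX] by (simp add: algebra_simps)
    then show ?thesis unfolding prod using ne by simp
  qed
  have adj: "U * s * adj4 B $ i $ j = det4 B * P i j" if "i \<in> KI" "j \<in> KI" for i j
  proof -
    have "U * s * adj4 B $ i $ j = (\<Sum>l\<in>KI. U * s * (if i = l then 1 else 0) * adj4 B $ l $ j)"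
      using that(1) by (simp add: sum_KI) (auto simp: KI_def)
    also have "\<dots> = (\<Sum>l\<in>KI. (\<Sum>k\<in>KI. P i k * B $ k $ l) * adj4 B $ l $ j)"
      by (intro sum.cong refl) (simp add: PB)
    also have "\<dots> = (\<Sum>k\<in>KI. P i k * (\<Sum>l\<in>KI. B $ k $ l * adj4 B $ l $ j))"
      unfolding sum_KI by (simp add: algebra_simps)
    also have "\<dots> = (\<Sum>k\<in>KI. P i k * (if k = j then det4 B else 0))"
      using block_mult_adj4[OF B _ that(2)] by (intro sum.cong refl) simp
    also have "\<dots> = det4 B * P i j"
      using that(2) by (simp add: sum_KI) (auto simp: KI_def)
    finally show ?thesis .
  qed
  have inK: "YY \<in> KI" "XZ \<in> KI" "YZ \<in> KI" "ZZ \<in> KI" by (auto simp: KI_def)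
  have "U * P YY ZZ = U * P YZ YZ + A $ XX $ XX * A $ YY $ XZ * P YY XZ
     - (A $ YY $ XX * A $ XY $ XY - A $ YY $ XY * A $ XX $ XY) * P XZ XZ
     - (A $ XX $ XX * A $ YY $ XY - A $ XX $ XY * A $ YY $ XX) * P XZ YZ"
    using cat z unfolding P_def
    by (simp add: symA[of XZ XX] symA[of YZ XX] symA[of XZ XY] symA[of YZ XY] symA[of ZZ XX] symA[of ZZ XY]
       symA[of YY XX] symA[of XY YY] symA[of XZ YY] U(1) algebra_simps)
  then have "U * (U * s * adj4 B $ YY $ ZZ) = U * (U * s * adj4 B $ YZ $ YZ) + A $ XX $ XX * A $ YY $ XZ * (U * s * adj4 B $ YY $ XZ)
     - (A $ YY $ XX * A $ XY $ XY - A $ YY $ XY * A $ XX $ XY) * (U * s * adj4 B $ XZ $ XZ)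
     - (A $ XX $ XX * A $ YY $ XY - A $ XX $ XY * A $ YY $ XX) * (U * s * adj4 B $ XZ $ YZ)"
    unfolding adj[OF inK(1,4)] adj[OF inK(3,3)] adj[OF inK(1,2)] adj[OF inK(2,2)] adj[OF inK(2,3)] by algebra
  then have "U * s * (U * adj4 B $ YY $ ZZ - (U * adj4 B $ YZ $ YZ + A $ XX $ XX * A $ YY $ XZ * adj4 B $ YY $ XZ
     - (A $ YY $ XX * A $ XY $ XY - A $ YY $ XY * A $ XX $ XY) * adj4 B $ XZ $ XZ
     - (A $ XX $ XX * A $ YY $ XY - A $ XX $ XY * A $ YY $ XX) * adj4 B $ XZ $ YZ)) = 0" by algebra
  then have "U * adj4 B $ YY $ ZZ = U * adj4 B $ YZ $ YZ + A $ XX $ XX * A $ YY $ XZ * adj4 B $ YY $ XZ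
     - (A $ YY $ XX * A $ XY $ XY - A $ YY $ XY * A $ XX $ XY) * adj4 B $ XZ $ XZ
     - (A $ XX $ XX * A $ YY $ XY - A $ XX $ XY * A $ YY $ XX) * adj4 B $ XZ $ YZ"
    using AB(2) U(2) by simp
  then have *: "adj4 B $ YY $ ZZ = (U * adj4 B $ YZ $ YZ + A $ XX $ XX * A $ YY $ XZ * adj4 B $ YY $ XZ
     - (A $ YY $ XX * A $ XY $ XY - A $ YY $ XY * A $ XX $ XY) * adj4 B $ XZ $ XZ
     - (A $ XX $ XX * A $ YY $ XY - A $ XX $ XY * A $ YY $ XX) * adj4 B $ XZ $ YZ) / U"
    using U(2) by (simp add: nonzero_eq_divide_eq mult.commute)
  show ?thesis unfolding * using U(2) by (simp add: diff_divide_distrib add_divide_distrib left_diff_distrib)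
qed

text \<open>A binary quartic of rank two, with kernel spanned by \<open>y\<^sup>2 + k x y\<close> and the multiples of \<open>z\<close>.\<close>

definition rank2_form :: "complex \<Rightarrow> mat6 \<Rightarrow> bool" where
  "rank2_form k A \<longleftrightarrow> A \<in> Cat \<and> A $ XX $ XX * A $ XY $ XY - A $ XX $ XY * A $ XX $ XY \<noteq> 0 \<and>
     (\<forall>i. A $ i $ XZ = 0 \<and> A $ i $ YZ = 0 \<and> A $ i $ ZZ = 0 \<and> A $ i $ YY = - k * A $ i $ XY)"

lemma shear_entries:
  fixes c d :: complex
  assumes "A \<in> Sym6"
  defines "A' \<equiv> congr (transpose (rho (vector [vector [1,0,-c], vector [0,1,-d], vector [0,0,1]]))) A"
  shows "A' $ XX $ XX = A $ XX $ XX" "A' $ XY $ XY = A $ XY $ XY" "A' $ XX $ XY = A $ XX $ XY"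
    "A' $ XX $ XZ = A $ XX $ XZ - c * A $ XX $ XX - d * A $ XX $ XY"
    "A' $ XY $ XZ = A $ XY $ XZ - c * A $ XX $ XY - d * A $ XY $ XY"
proof -
  have sym: "A $ XY $ XX = A $ XX $ XY" using assms(1) Sym6_iff by blast
  show "A' $ XX $ XX = A $ XX $ XX" "A' $ XY $ XY = A $ XY $ XY" "A' $ XX $ XY = A $ XX $ XY"
    "A' $ XX $ XZ = A $ XX $ XZ - c * A $ XX $ XX - d * A $ XX $ XY"
    "A' $ XY $ XZ = A $ XY $ XZ - c * A $ XX $ XY - d * A $ XY $ XY"
    by (simp_all add: A'_def congr_transpose_nth bil_def sum_quad column_def rho_nth sym algebra_simps)
qed

text \<open>The shear \<open>z \<mapsto> z - c x - d y\<close> that normalizes the catalecticant tends to the identity at a point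
  of rank two, and \<open>x y\<^sup>2 z\<close> tends to zero.\<close>

lemma limit_pair_rank2_cubic:
  assumes lp: "limit_pair A B" and nf: "rank2_form k A"
  shows "cubicF k B = 0"
proof -
  obtain lim where pl: "place inverse_pairs lim" and limA: "\<And>i j. lim (\<lambda>p. fst p $ i $ j) (A $ i $ j)"
    and limB: "\<And>i j. lim (\<lambda>p. snd p $ i $ j) (B $ i $ j)"
    using limit_pair_place[OF lp] by blast
  have U0: "A $ XX $ XX * A $ XY $ XY - A $ XX $ XY * A $ XX $ XY \<noteq> 0"
    and A0: "A $ i $ XZ = 0" "A $ i $ YZ = 0" "A $ i $ ZZ = 0" "A $ i $ YY = - k * A $ i $ XY" and "A \<in> Cat" for i
    using nf unfolding rank2_form_def by blast+
  have symA: "A $ i $ j = A $ j $ i" for i j using \<open>A \<in> Cat\<close> Cat_subset_Sym6 Sym6_iff by blast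
  define U :: "mat6 \<times> mat6 \<Rightarrow> complex" where
    "U p = fst p $ XX $ XX * fst p $ XY $ XY - fst p $ XX $ XY * fst p $ XX $ XY" for p
  interpret pl0: place inverse_pairs lim by (rule pl)
  have limU: "lim U (A $ XX $ XX * A $ XY $ XY - A $ XX $ XY * A $ XX $ XY)"
    unfolding U_def by (intro pl0.lim_diff pl0.lim_mult limA)
  define X where "X = {p \<in> inverse_pairs. U p \<noteq> 0}"
  interpret place X lim unfolding X_def using limU U0 by (rule pl0.restrict_nonzero)
  define c where "c p = (fst p $ XX $ XZ * fst p $ XY $ XY - fst p $ XY $ XZ * fst p $ XX $ XY) / U p" for p :: "mat6 \<times> mat6"
  define d where "d p = (fst p $ XX $ XX * fst p $ XY $ XZ - fst p $ XX $ XY * fst p $ XX $ XZ) / U p" for p :: "mat6 \<times> mat6"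
  have "lim c ((A $ XX $ XZ * A $ XY $ XY - A $ XY $ XZ * A $ XX $ XY) / (A $ XX $ XX * A $ XY $ XY - A $ XX $ XY * A $ XX $ XY))"
    unfolding c_def by (intro lim_divide lim_diff lim_mult limA limU U0)
  then have c: "lim c 0" by (simp add: A0)
  have "lim d ((A $ XX $ XX * A $ XY $ XZ - A $ XX $ XY * A $ XX $ XZ) / (A $ XX $ XX * A $ XY $ XY - A $ XX $ XY * A $ XX $ XY))"
    unfolding d_def by (intro lim_divide lim_diff lim_mult limA limU U0)
  then have d: "lim d 0" by (simp add: A0)
  define g :: "mat6 \<times> mat6 \<Rightarrow> complex^3^3" where "g p = vector [vector [1,0,- c p], vector [0,1,- d p], vector [0,0,1]]" for p
  define h :: "mat6 \<times> mat6 \<Rightarrow> complex^3^3" where "h p = vector [vector [1,0,c p], vector [0,1,d p], vector [0,0,1]]" for p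
  have gh: "g p ** h p = mat 1" for p
    by (simp add: g_def h_def vec_eq_iff forall_3 matrix_matrix_mult_def sum_3 mat_def)
  have minus_c: "lim (\<lambda>p. - c p) 0" "lim (\<lambda>p. - d p) 0" using lim_minus[OF c] lim_minus[OF d] by simp_all
  have "\<forall>i j. lim (\<lambda>p. g p $ i $ j) ((mat 1 :: complex^3^3) $ i $ j)" "\<forall>i j. lim (\<lambda>p. h p $ i $ j) ((mat 1 :: complex^3^3) $ i $ j)"
    unfolding forall_3 by (simp_all add: g_def h_def mat_def lim_const minus_c c d)
  then have T: "limM (\<lambda>p. rho (g p)) (mat 1)" "limM (\<lambda>p. rho (h p)) (mat 1)"
    using limM_rho[of g "mat 1"] limM_rho[of h "mat 1"] by (simp_all add: rho_1)
  define A' where "A' p = congr (transpose (rho (g p))) (fst p)" for p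
  define B' where "B' p = congr (rho (h p)) (snd p)" for p
  have "limM A' (congr (transpose (mat 1)) A)" "limM B' (congr (mat 1) B)"
    unfolding A'_def B'_def by (intro limM_congr limM_transpose T; simp add: limM_def limA limB)+
  then have limA': "\<And>i j. lim (\<lambda>p. A' p $ i $ j) (A $ i $ j)" and limB': "\<And>i j. lim (\<lambda>p. B' p $ i $ j) (B $ i $ j)"
    unfolding limM_def by (simp_all add: transpose_mat)
  define e1 where "e1 p = (A' p $ YY $ XX * A' p $ XY $ XY - A' p $ YY $ XY * A' p $ XX $ XY) / U p" for p
  define e2 where "e2 p = (A' p $ XX $ XX * A' p $ YY $ XY - A' p $ XX $ XY * A' p $ YY $ XX) / U p" for p
  define w where "w p = A' p $ XX $ XX / U p * A' p $ YY $ XZ" for p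
  have "lim e1 ((A $ YY $ XX * A $ XY $ XY - A $ YY $ XY * A $ XX $ XY) / (A $ XX $ XX * A $ XY $ XY - A $ XX $ XY * A $ XX $ XY))"
    unfolding e1_def by (intro lim_divide lim_diff lim_mult limA' limU U0)
  then have e1: "lim e1 0" using A0(4)[of XX] A0(4)[of XY] symA[of YY XX] symA[of YY XY] by (simp add: symA[of XY XX])
  have "lim e2 ((A $ XX $ XX * A $ YY $ XY - A $ XX $ XY * A $ YY $ XX) / (A $ XX $ XX * A $ XY $ XY - A $ XX $ XY * A $ XX $ XY))"
    unfolding e2_def by (intro lim_divide lim_diff lim_mult limA' limU U0)
  moreover have "A $ XX $ XX * A $ YY $ XY - A $ XX $ XY * A $ YY $ XX = - k * (A $ XX $ XX * A $ XY $ XY - A $ XX $ XY * A $ XX $ XY)"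
    using A0(4)[of XX] A0(4)[of XY] symA[of YY XX] symA[of YY XY] by (simp add: algebra_simps)
  ultimately have e2: "lim e2 (- k)" using U0 by simp
  have "lim w (A $ XX $ XX / (A $ XX $ XX * A $ XY $ XY - A $ XX $ XY * A $ XX $ XY) * A $ YY $ XZ)"
    unfolding w_def by (intro lim_divide lim_mult limA' limU U0)
  then have w: "lim w 0" by (simp add: A0)
  have adj: "lim (\<lambda>p. adj4 (B' p) $ i $ j) (adj4 B $ i $ j)" for i j
    by (rule lim_mat_polys[OF adj4_mat_polys limB'])
  have "lim (\<lambda>p. adj4 (B' p) $ YY $ ZZ - (adj4 (B' p) $ YZ $ YZ + w p * adj4 (B' p) $ YY $ XZ
       - e1 p * adj4 (B' p) $ XZ $ XZ - e2 p * adj4 (B' p) $ XZ $ YZ))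
     (adj4 B $ YY $ ZZ - (adj4 B $ YZ $ YZ + 0 * adj4 B $ YY $ XZ - 0 * adj4 B $ XZ $ XZ - (- k) * adj4 B $ XZ $ YZ))"
    by (intro lim_diff lim_add lim_mult adj w e1 e2)
  then have "adj4 B $ YY $ ZZ - (adj4 B $ YZ $ YZ + 0 * adj4 B $ YY $ XZ - 0 * adj4 B $ XZ $ XZ - (- k) * adj4 B $ XZ $ YZ) = 0"
  proof (rule lim_zero_unique)
    fix p assume "p \<in> X"
    then have "p \<in> inverse_pairs" and Up: "U p \<noteq> 0" unfolding X_def by blast+
    then obtain s where p: "fst p \<in> Cat" "snd p \<in> Sym6" "s \<noteq> 0" "fst p ** snd p = mat s"
      unfolding inverse_pairs_def by auto
    have p6: "fst p \<in> Sym6" using p(1) Cat_subset_Sym6 by blast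
    note sh = shear_entries[OF p6, of "c p" "d p", folded g_def A'_def]
    have z: "A' p $ XX $ XZ = 0" "A' p $ XY $ XZ = 0"
      unfolding sh c_def d_def using Up by (simp_all add: field_simps) (simp_all add: U_def algebra_simps)
    have Ueq: "U p = A' p $ XX $ XX * A' p $ XY $ XY - A' p $ XX $ XY * A' p $ XX $ XY"
      unfolding sh U_def ..
    have "A' p ** B' p = mat s"
      unfolding A'_def B'_def by (rule congr_inverse_pair[OF rho_inverse[OF gh] p(4)])
    from schur_relation[OF _ z _ this p(3) Ueq Up]
    show "adj4 (B' p) $ YY $ ZZ - (adj4 (B' p) $ YZ $ YZ + w p * adj4 (B' p) $ YY $ XZ
       - e1 p * adj4 (B' p) $ XZ $ XZ - e2 p * adj4 (B' p) $ XZ $ YZ) = 0"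
      using congr_rho_Cat[OF p(1)] congr_Sym6[OF p(2)] unfolding A'_def[of p] B'_def[of p] e1_def e2_def w_def by simp
  qed
  then show ?thesis by (simp add: cubicF_def)
qed

section \<open>The cubic hypersurface\<close>

definition rank_one :: "(quad_exp \<Rightarrow> complex) \<Rightarrow> mat6" where
  "rank_one u = (\<chi> i j. u i * u j)"

lemma det3_rank_one_line:
  "det3 (B + cscale t (rank_one u)) i j k p q r = det3 B i j k p q r + t * (det3 (B + rank_one u) i j k p q r - det3 B i j k p q r)"
  by (simp add: det3_def rank_one_def algebra_simps)

lemma adj4_rank_one_line:
  "adj4 (B + cscale t (rank_one u)) $ i $ j = adj4 B $ i $ j + t * (adj4 (B + rank_one u) $ i $ j - adj4 B $ i $ j)"
proof (cases "i \<in> KI \<and> j \<in> KI")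
  case True
  define D where "D i j k p q r = det3 (B + rank_one u) i j k p q r" for i j k p q r
  define E where "E i j k p q r = det3 B i j k p q r" for i j k p q r
  show ?thesis
    using True unfolding KI_def
    by (auto simp: adj4_nth det3_rank_one_line D_def[symmetric] E_def[symmetric] algebra_simps)
next
  case False
  then show ?thesis using adj4_Sym_on unfolding Sym_on_def by simp
qed

text \<open>Along a symmetric matrix of rank one the cubic is linear: cofactors are.\<close>

definition slope :: "complex \<Rightarrow> (quad_exp \<Rightarrow> complex) \<Rightarrow> mat6 \<Rightarrow> complex" where
  "slope k u B = cubicF k (B + rank_one u) - cubicF k B"

lemma cubicF_rank_one_line: "cubicF k (B + cscale t (rank_one u)) = cubicF k B + t * slope k u B"
  unfolding cubicF_def slope_def adj4_rank_one_line by (simp add: algebra_simps)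

definition dir :: "quad_exp \<Rightarrow> quad_exp \<Rightarrow> quad_exp \<Rightarrow> complex" where
  "dir a b i = (if i = a \<or> i = b then 1 else 0)"

lemma rank_one_dir_Sym_on: "a \<in> KI \<Longrightarrow> b \<in> KI \<Longrightarrow> rank_one (dir a b) \<in> Sym_on KI"
  unfolding Sym_on_def Sym6_iff by (auto simp: rank_one_def dir_def)

lemma cubicF_mat_polys: "cubicF k \<in> mat_polys"
  using cubicF_mat_forms mat_forms_polys by blast

lemma mat_polys_shift:
  assumes "f \<in> mat_polys"
  shows "(\<lambda>B. f (B + C)) \<in> mat_polys"
proof -
  have "(\<lambda>B. f (B + C)) \<in> poly_funs {\<lambda>A. A $ i $ j | i j. True}"
  proof (rule mat_polys_comp[OF assms])
    fix i j show "(\<lambda>B. (B + C) $ i $ j) \<in> poly_funs {\<lambda>A :: mat6. A $ i $ j | i j. True}"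
      unfolding vector_add_component
      by (intro poly_funs.add poly_funs.const mat_polys_entry[unfolded mat_polys_def])
  qed
  then show ?thesis by (simp add: mat_polys_def)
qed

lemma slope_mat_polys: "slope k u \<in> mat_polys"
  using poly_funs_diff[of "\<lambda>B. cubicF k (B + rank_one u)" _ "cubicF k"]
    mat_polys_shift[OF cubicF_mat_polys, of k "rank_one u"] cubicF_mat_polys[of k]
  unfolding slope_def mat_polys_def by blast

lemma cubicF_scale: "cubicF k (cscale c B) = c ^ 3 * cubicF k B"
  using cubicF_mat_forms mat_forms_scale by blast

lemma det4_scale: "det4 (cscale c B) = c ^ 4 * det4 B"
  by (simp add: det4_def adj4_nth det3_def power4_eq_xxxx algebra_simps)

text \<open>Points of the hypersurface at which some rank one direction is transversal: project the line to a
  suitable invertible point \<open>Y\<close> back to the hypersurface along that direction.\<close>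

lemma dense_transversal:
  assumes G: "G \<in> mat_forms d" and van: "\<And>X. X \<in> Sym_on KI \<Longrightarrow> cubicF k X = 0 \<Longrightarrow> det4 X \<noteq> 0 \<Longrightarrow> G X = 0"
    and ab: "a \<in> KI" "b \<in> KI"
    and X: "X \<in> Sym_on KI" "cubicF k X = 0" "slope k (dir a b) X \<noteq> 0"
    and Y: "Y \<in> Sym_on KI" "cubicF k Y = 0" "slope k (dir a b) Y \<noteq> 0" "det4 Y \<noteq> 0"
  shows "G X = 0"
proof -
  let ?u = "rank_one (dir a b)"
  define L where "L s = X + cscale s (Y - X)" for s
  obtain q where q: "\<And>s. slope k (dir a b) (L s) = poly q s"
    unfolding L_def using mat_polys_on_line[OF slope_mat_polys] by metis
  obtain f where f: "\<And>s. cubicF k (L s) = poly f s"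
    unfolding L_def using mat_polys_on_line[OF cubicF_mat_polys] by metis
  define Z where "Z s = cscale (poly q s) (L s) - cscale (poly f s) ?u" for s
  have "\<exists>p. \<forall>s. Z s $ i $ j = poly p s" for i j
    by (rule exI[of _ "q * [:X $ i $ j, (Y - X) $ i $ j:] - f * [:?u $ i $ j:]"])
      (simp add: Z_def L_def algebra_simps)
  note curve = mat_polys_on_curve[OF _ this]
  obtain g where g: "\<And>s. G (Z s) = poly g s" using curve[OF mat_forms_polys[OF G]] by metis
  obtain e where e: "\<And>s. det4 (Z s) = poly e s" using curve[OF det4_mat_polys] by metis
  have L: "L 0 = X" "L 1 = Y" by (simp_all add: L_def mat6_eq_iff)
  have Z0: "Z 0 = cscale (poly q 0) X" and Z1: "Z 1 = cscale (poly q 1) Y"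
    using f[of 0] f[of 1] X Y by (simp_all add: Z_def L mat6_eq_iff)
  have "poly q 0 \<noteq> 0" "poly q 1 \<noteq> 0" using q[of 0] q[of 1] X Y by (simp_all add: L)
  moreover have "poly e 1 = poly q 1 ^ 4 * det4 Y" using e[of 1] by (simp add: Z1 det4_scale)
  then have "poly e 1 \<noteq> 0" using Y \<open>poly q 1 \<noteq> 0\<close> by simp
  ultimately have "q * e \<noteq> 0" by auto
  moreover have "poly g s = 0" if "poly (q * e) s \<noteq> 0" for s
  proof -
    have nz: "poly q s \<noteq> 0" "det4 (Z s) \<noteq> 0" using that e[of s] by auto
    have "Z s = cscale (poly q s) (L s + cscale (- (poly f s / poly q s)) ?u)"
      using nz(1) by (simp add: Z_def mat6_eq_iff algebra_simps)
    then have "cubicF k (Z s) = (poly q s) ^ 3 * (poly f s + (- (poly f s / poly q s)) * poly q s)"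
      unfolding cubicF_scale cubicF_rank_one_line by (simp only: cubicF_scale cubicF_rank_one_line q f)
    then have "cubicF k (Z s) = 0" using nz(1) by simp
    moreover have "Z s \<in> Sym_on KI"
      unfolding Z_def L_def using X(1) Y(1) rank_one_dir_Sym_on[OF ab]
      by (intro cmat.subspace_diff[OF subspace_Sym_on] cmat.subspace_scale[OF subspace_Sym_on]
          cmat.subspace_add[OF subspace_Sym_on])
    ultimately show ?thesis using van nz(2) g[of s] by metis
  qed
  ultimately have "g = 0" by (rule poly_zero_if_cofinite)
  then have "G (Z 0) = 0" using g by simp
  then show ?thesis using \<open>poly q 0 \<noteq> 0\<close> by (simp add: Z0 mat_forms_scale[OF G])
qed

definition mat4 :: "complex list \<Rightarrow> mat6" where
  "mat4 l = (\<chi> i j. if {i, j} = {YY} then l ! 0 else if {i, j} = {YY, XZ} then l ! 1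
     else if {i, j} = {YY, YZ} then l ! 2 else if {i, j} = {YY, ZZ} then l ! 3
     else if {i, j} = {XZ} then l ! 4 else if {i, j} = {XZ, YZ} then l ! 5 else if {i, j} = {XZ, ZZ} then l ! 6
     else if {i, j} = {YZ} then l ! 7 else if {i, j} = {YZ, ZZ} then l ! 8 else if {i, j} = {ZZ} then l ! 9 else 0)"

lemma mat4_Sym_on: "mat4 l \<in> Sym_on KI"
proof -
  have "mat4 l $ i $ j = mat4 l $ j $ i" for i j by (simp add: mat4_def insert_commute)
  moreover have "\<forall>i j. i \<notin> KI \<or> j \<notin> KI \<longrightarrow> mat4 l $ i $ j = 0"
    unfolding forall_quad KI_def by (simp add: mat4_def doubleton_eq_iff)
  ultimately show ?thesis unfolding Sym_on_def Sym6_iff by blast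
qed

lemma mat4_nth:
  "mat4 l $ YY $ YY = l ! 0" "mat4 l $ YY $ XZ = l ! 1" "mat4 l $ YY $ YZ = l ! 2" "mat4 l $ YY $ ZZ = l ! 3"
  "mat4 l $ XZ $ YY = l ! 1" "mat4 l $ XZ $ XZ = l ! 4" "mat4 l $ XZ $ YZ = l ! 5" "mat4 l $ XZ $ ZZ = l ! 6"
  "mat4 l $ YZ $ YY = l ! 2" "mat4 l $ YZ $ XZ = l ! 5" "mat4 l $ YZ $ YZ = l ! 7" "mat4 l $ YZ $ ZZ = l ! 8"
  "mat4 l $ ZZ $ YY = l ! 3" "mat4 l $ ZZ $ XZ = l ! 6" "mat4 l $ ZZ $ YZ = l ! 8" "mat4 l $ ZZ $ ZZ = l ! 9"
  by (simp_all add: mat4_def doubleton_eq_iff)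

text \<open>For each \<open>k\<close> one explicit invertible point of the hypersurface, general enough for all ten rank one
  directions to be transversal to the hypersurface there.\<close>

lemma transversal_point_exists:
  assumes "k = 0 \<or> k = 1"
  shows "\<exists>Y. Y \<in> Sym_on KI \<and> cubicF k Y = 0 \<and> det4 Y \<noteq> 0 \<and> (\<forall>a\<in>KI. \<forall>b\<in>KI. slope k (dir a b) Y \<noteq> 0)"
  using assms
proof
  assume k: "k = 0"
  show ?thesis
    by (rule exI[of _ "mat4 [2,2,0,1,-1,1,2,0,0,0]"], simp add: k mat4_Sym_on)
      (simp add: KI_def slope_def cubicF_def det4_def adj4_nth det3_def mat4_nth rank_one_def dir_def)
next
  assume k: "k = 1"
  show ?thesis
    by (rule exI[of _ "mat4 [-1,-1,0,2,2,0,-1,0,1,0]"], simp add: k mat4_Sym_on)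
      (simp add: KI_def slope_def cubicF_def det4_def adj4_nth det3_def mat4_nth rank_one_def dir_def)
qed

text \<open>At a point where no rank one direction is transversal, every such direction lies on the
  hypersurface, and moving along it leads to transversal points unless the point is zero: the
  second differences of the cubic recover all ten coordinates.\<close>

lemma no_transversal_zero:
  assumes X: "X \<in> Sym_on KI" "cubicF k X = 0" and s: "\<And>a b. a \<in> KI \<Longrightarrow> b \<in> KI \<Longrightarrow> slope k (dir a b) X = 0"
    and s2: "\<And>a b c d. a \<in> KI \<Longrightarrow> b \<in> KI \<Longrightarrow> c \<in> KI \<Longrightarrow> d \<in> KI \<Longrightarrow> slope k (dir c d) (X + rank_one (dir a b)) = 0"
  shows "X = 0"
proof -
  have sym: "X $ i $ j = X $ j $ i" for i j using X unfolding Sym_on_def Sym6_iff by blast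
  note sy = sym[of XZ YY] sym[of YZ YY] sym[of ZZ YY] sym[of YZ XZ] sym[of ZZ XZ] sym[of ZZ YZ]
  have z: "cubicF k (X + rank_one (dir a b) + rank_one (dir c d)) - cubicF k (X + rank_one (dir a b))
     - cubicF k (X + rank_one (dir c d)) + cubicF k X = 0" if "a \<in> KI" "b \<in> KI" "c \<in> KI" "d \<in> KI" for a b c d
    using s[OF that(1,2)] s[OF that(3,4)] s2[OF that] X(2) unfolding slope_def by simp
  have inK: "YY \<in> KI" "XZ \<in> KI" "YZ \<in> KI" "ZZ \<in> KI" by (auto simp: KI_def)
  note ev = cubicF_def adj4_nth det3_def rank_one_def dir_def sy algebra_simps
  have 1: "X $ XZ $ XZ = 0" using z[OF inK(3,3,1,4)] by (simp add: ev)
  have 2: "X $ YY $ ZZ = 0" using z[OF inK(2,2,3,3)] by (simp add: ev)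
  have 3: "X $ YY $ YY = 0" using z[OF inK(2,2,4,4)] by (simp add: ev)
  have 4: "X $ ZZ $ ZZ = 0" using z[OF inK(1,1,2,2)] by (simp add: ev)
  have 5: "X $ XZ $ ZZ = 0" using z[OF inK(3,3,1,2)] 2 by (simp add: ev)
  have 6: "X $ YY $ XZ = 0" using z[OF inK(3,3,2,4)] 2 by (simp add: ev)
  have 7: "X $ YZ $ ZZ = 0" using z[OF inK(2,2,1,3)] 1 2 3 4 5 6 by (simp add: ev)
  have 8: "X $ YZ $ YZ = 0" using z[OF inK(2,2,1,4)] 1 2 3 4 5 6 by (simp add: ev)
  have 9: "X $ YY $ YZ = 0" using z[OF inK(2,2,3,4)] 1 2 3 4 5 6 by (simp add: ev)
  have 10: "X $ XZ $ YZ = 0" using z[OF inK(1,4,2,3)] 1 2 3 4 5 6 7 8 9 by (simp add: ev)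
  have "X $ i $ j = 0" if "i \<notin> KI \<or> j \<notin> KI" for i j using that X unfolding Sym_on_def by blast
  then show ?thesis
    unfolding mat6_eq_iff forall_quad using 1 2 3 4 5 6 7 8 9 10 by (simp add: KI_def sy)
qed

text \<open>If no rank one direction is transversal at \<open>X\<close>, then a line through \<open>X\<close> on the hypersurface contains
  points at which some direction is.\<close>

lemma invertible_points_dense:
  assumes G: "G \<in> mat_forms d" and van: "\<And>X. X \<in> Sym_on KI \<Longrightarrow> cubicF k X = 0 \<Longrightarrow> det4 X \<noteq> 0 \<Longrightarrow> G X = 0"
    and k: "k = 0 \<or> k = 1" and X: "X \<in> Sym_on KI" "X \<noteq> 0" "cubicF k X = 0"
  shows "G X = 0"
proof -
  obtain Y where Y: "Y \<in> Sym_on KI" "cubicF k Y = 0" "det4 Y \<noteq> 0" "\<And>a b. a \<in> KI \<Longrightarrow> b \<in> KI \<Longrightarrow> slope k (dir a b) Y \<noteq> 0"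
    using transversal_point_exists[OF k] by blast
  have tr: "G Z = 0" if "a \<in> KI" "b \<in> KI" "Z \<in> Sym_on KI" "cubicF k Z = 0" "slope k (dir a b) Z \<noteq> 0" for a b Z
    by (rule dense_transversal[OF G _ that Y(1,2) Y(4)[OF that(1,2)] Y(3)]) (rule van)
  show ?thesis
  proof (cases "\<exists>a\<in>KI. \<exists>b\<in>KI. slope k (dir a b) X \<noteq> 0")
    case True
    then show ?thesis using tr X by blast
  next
    case False
    then obtain a b c d where abcd: "a \<in> KI" "b \<in> KI" "c \<in> KI" "d \<in> KI"
      and s2: "slope k (dir c d) (X + rank_one (dir a b)) \<noteq> 0"
      using no_transversal_zero[OF X(1,3)] X(2) by blast
    let ?u = "rank_one (dir a b)"
    obtain g where g: "\<And>t. G (X + cscale t ?u) = poly g t"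
      using mat_polys_on_line[OF mat_forms_polys[OF G]] by metis
    obtain q where q: "\<And>t. slope k (dir c d) (X + cscale t ?u) = poly q t"
      using mat_polys_on_line[OF slope_mat_polys] by metis
    have "X + cscale 1 ?u = X + ?u" by (simp add: mat6_eq_iff)
    then have "q \<noteq> 0" using q[of 1] s2 by auto
    moreover have "poly g t = 0" if "poly q t \<noteq> 0" for t
    proof -
      have "X + cscale t ?u \<in> Sym_on KI"
        using X(1) rank_one_dir_Sym_on[OF abcd(1,2)]
        by (intro cmat.subspace_add[OF subspace_Sym_on] cmat.subspace_scale[OF subspace_Sym_on])
      moreover have "cubicF k (X + cscale t ?u) = 0"
        unfolding cubicF_rank_one_line using X(3) False abcd by simp
      ultimately show ?thesis using tr[OF abcd(3,4), of "X + cscale t ?u"] that q[of t] g[of t] by simp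
    qed
    ultimately have "g = 0" by (rule poly_zero_if_cofinite)
    moreover have "X + cscale 0 ?u = X" by (simp add: mat6_eq_iff)
    ultimately show ?thesis using g[of 0] by simp
  qed
qed

text \<open>A square factor of the cubic is constant along all lines of rank one, as the cubic has degree at
  most one there; these directions span.\<close>

lemma square_factor_constant:
  assumes k: "k = 0 \<or> k = 1" and GH: "G \<in> mat_polys" "H \<in> mat_polys"
    and eq: "\<And>X. X \<in> Sym_on KI \<Longrightarrow> cubicF k X = (G X)\<^sup>2 * H X"
    and X: "X \<in> Sym_on KI"
  shows "G X = G 0"
proof -
  have step: "G (X + cscale t (rank_one (dir a b))) = G X" if X: "X \<in> Sym_on KI" and ab: "a \<in> KI" "b \<in> KI" for X t a b
  proof -
    let ?u = "rank_one (dir a b)"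
    have mem: "X + cscale t ?u \<in> Sym_on KI" if "X \<in> Sym_on KI" for X t
      using that rank_one_dir_Sym_on[OF ab]
      by (intro cmat.subspace_add[OF subspace_Sym_on] cmat.subspace_scale[OF subspace_Sym_on])
    have "(\<lambda>X. G (X + cscale t ?u) - G X) \<in> mat_polys"
      using mat_polys_shift[OF GH(1)] GH(1) unfolding mat_polys_def by (intro poly_funs_diff)
    moreover have "G (X + cscale t ?u) - G X = 0" if X: "X \<in> Sym_on KI" "cubicF k X \<noteq> 0" for X
    proof -
      obtain g where g: "\<And>t. G (X + cscale t ?u) = poly g t" using mat_polys_on_line[OF GH(1)] by metis
      obtain h where h: "\<And>t. H (X + cscale t ?u) = poly h t" using mat_polys_on_line[OF GH(2)] by metis
      have "poly (g\<^sup>2 * h) t = poly [:cubicF k X, slope k (dir a b) X:] t" for t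
        using eq[OF mem[OF X(1)], of t] by (simp add: g h cubicF_rank_one_line)
      then have p: "g\<^sup>2 * h = [:cubicF k X, slope k (dir a b) X:]" by (metis poly_ext)
      then have "g \<noteq> 0" "h \<noteq> 0" using X(2) by auto
      then have "degree (g\<^sup>2 * h) = 2 * degree g + degree h" by (simp add: degree_mult_eq power2_eq_square)
      moreover have "degree [:cubicF k X, slope k (dir a b) X:] \<le> 1" by simp
      ultimately have "degree g = 0" unfolding p by linarith
      then obtain c where "g = [:c:]" by (rule degree_eq_zeroE)
      then show ?thesis using g[of t] g[of 0] by simp
    qed
    moreover obtain D where "D \<in> Sym_on KI" "cubicF k D \<noteq> 0"
    proof -
      obtain Y where Y: "Y \<in> Sym_on KI" "cubicF k Y = 0" "slope k (dir YY YY) Y \<noteq> 0"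
        using transversal_point_exists[OF k] by (auto simp: KI_def)
      have "cubicF k (Y + rank_one (dir YY YY)) \<noteq> 0" using Y unfolding slope_def by simp
      moreover have "Y + rank_one (dir YY YY) \<in> Sym_on KI"
        using Y(1) rank_one_dir_Sym_on[of YY YY] by (intro cmat.subspace_add[OF subspace_Sym_on]) (auto simp: KI_def)
      ultimately show ?thesis using that by blast
    qed
    ultimately have "G (X + cscale t ?u) - G X = 0"
      using mat_polys_zero_if_prod_zero[OF _ cubicF_mat_polys subspace_Sym_on] X by blast
    then show ?thesis by simp
  qed
  have inK: "YY \<in> KI" "XZ \<in> KI" "YZ \<in> KI" "ZZ \<in> KI" by (auto simp: KI_def)
  let ?E = "\<lambda>a b. cscale (X $ a $ b) (rank_one (dir a b))"
  let ?D = "\<lambda>a b c d. cscale (X $ a $ a - X $ a $ b - X $ a $ c - X $ a $ d) (rank_one (dir a a))"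
  have mem: "Z + cscale t (rank_one (dir a b)) \<in> Sym_on KI" if "Z \<in> Sym_on KI" "a \<in> KI" "b \<in> KI" for Z t a b
    using that rank_one_dir_Sym_on
    by (intro cmat.subspace_add[OF subspace_Sym_on] cmat.subspace_scale[OF subspace_Sym_on])
  have sym: "X $ i $ j = X $ j $ i" and out: "i \<notin> KI \<or> j \<notin> KI \<Longrightarrow> X $ i $ j = 0" for i j
    using X unfolding Sym_on_def Sym6_iff by blast+
  have "X = 0 + ?E YY XZ + ?E YY YZ + ?E YY ZZ + ?E XZ YZ + ?E XZ ZZ + ?E YZ ZZ
     + ?D YY XZ YZ ZZ + ?D XZ YY YZ ZZ + ?D YZ YY XZ ZZ + ?D ZZ YY XZ YZ"
    unfolding mat6_eq_iff forall_quad
    by (simp add: rank_one_def dir_def out KI_def sym[of XZ YY] sym[of YZ YY] sym[of ZZ YY] sym[of YZ XZ] sym[of ZZ XZ] sym[of ZZ YZ])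
  also have "G \<dots> = G 0"
    by (simp only: step mem inK cmat.subspace_0[OF subspace_Sym_on])
  finally show ?thesis .
qed

section \<open>The Pfaffian of order six\<close>

lemma signed_sum_over_permutations_insert:
  fixes \<phi> :: "(nat \<Rightarrow> nat) \<Rightarrow> complex"
  assumes "finite S" "a \<notin> S"
  shows "(\<Sum>p | p permutes insert a S. of_int (sign p) * \<phi> p) =
    (\<Sum>b\<in>insert a S. (if a = b then 1 else - 1) * (\<Sum>q | q permutes S. of_int (sign q) * \<phi> (Transposition.transpose a b \<circ> q)))"
  unfolding sum_over_permutations_insert[OF assms] sum_distrib_left
proof (intro sum.cong refl)
  fix b q assume "q \<in> {q. q permutes S}"
  then have "permutation q" using assms(1) permutation_permutes by blast
  then show "of_int (sign (Transposition.transpose a b \<circ> q)) * \<phi> (Transposition.transpose a b \<circ> q)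
    = (if a = b then 1 else - 1) * (of_int (sign q) * \<phi> (Transposition.transpose a b \<circ> q))"
    by (simp add: sign_compose permutation_swap_id sign_swap_id)
qed

text \<open>The sum over the permutations of the last four indices, after the first two have been placed.\<close>

lemma signed_sum_four:
  fixes b :: "nat \<Rightarrow> nat \<Rightarrow> complex"
  assumes skew: "\<And>i j. i \<in> {2,3,4,5} \<Longrightarrow> j \<in> {2,3,4,5} \<Longrightarrow> b j i = - b i j"
  shows "(\<Sum>q | q permutes {2,3,4,5::nat}. of_int (sign q) * (b (q 2) (q 3) * b (q 4) (q 5))) =
    8 * (b 2 3 * b 4 5 - b 2 4 * b 3 5 + b 2 5 * b 3 4)"
proof -
  have s: "b 3 2 = - b 2 3" "b 4 2 = - b 2 4" "b 5 2 = - b 2 5" "b 4 3 = - b 3 4" "b 5 3 = - b 3 5" "b 5 4 = - b 4 5"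
    by (rule skew; simp)+
  show ?thesis
    by (simp add: signed_sum_over_permutations_insert Transposition.transpose_def s algebra_simps)
qed

text \<open>Fixing the images of the first two indices leaves the permutations of the other four. Each matching is counted \<open>2\<^sup>3 3! = 48\<close> times.\<close>

lemma pfaffian_3:
  assumes skew: "\<And>i j. i < 6 \<Longrightarrow> j < 6 \<Longrightarrow> a j i = - a i j"
  shows "pfaffian 3 a =
     a 0 1 * (a 2 3 * a 4 5 - a 2 4 * a 3 5 + a 2 5 * a 3 4)
   - a 0 2 * (a 1 3 * a 4 5 - a 1 4 * a 3 5 + a 1 5 * a 3 4)
   + a 0 3 * (a 1 2 * a 4 5 - a 1 4 * a 2 5 + a 1 5 * a 2 4)
   - a 0 4 * (a 1 2 * a 3 5 - a 1 3 * a 2 5 + a 1 5 * a 2 3)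
   + a 0 5 * (a 1 2 * a 3 4 - a 1 3 * a 2 4 + a 1 4 * a 2 3)"
proof -
  let ?w = "\<lambda>b c. Transposition.transpose (0 :: nat) b \<circ> Transposition.transpose 1 c"
  have set6: "{..<2 * 3} = insert 0 (insert 1 {2,3,4,5::nat})" by auto
  have prod3: "(\<Prod>i<3. f i) = f 0 * f 1 * f 2" for f :: "nat \<Rightarrow> complex"
    by (simp add: numeral_3_eq_3 numeral_2_eq_2 lessThan_Suc ac_simps)
  have idx: "2 * (0::nat) = 0" "0 + 1 = (1::nat)" "2 * (1::nat) = 2" "2 + 1 = (3::nat)" "2 * 2 = (4::nat)" "4 + 1 = (5::nat)"
    by simp_all
  have inner: "(\<Sum>q | q permutes {2,3,4,5::nat}. of_int (sign q) *
      (a (w (q 0)) (w (q 1)) * (a (w (q 2)) (w (q 3)) * a (w (q 4)) (w (q 5))))) =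
    a (w 0) (w 1) * (8 * (a (w 2) (w 3) * a (w 4) (w 5) - a (w 2) (w 4) * a (w 3) (w 5) + a (w 2) (w 5) * a (w 3) (w 4)))"
    if w: "\<And>i. i < 6 \<Longrightarrow> w i < 6" for w
  proof -
    have "(\<Sum>q | q permutes {2,3,4,5::nat}. of_int (sign q) *
        (a (w (q 0)) (w (q 1)) * (a (w (q 2)) (w (q 3)) * a (w (q 4)) (w (q 5))))) =
      a (w 0) (w 1) * (\<Sum>q | q permutes {2,3,4,5::nat}. of_int (sign q) * (a (w (q 2)) (w (q 3)) * a (w (q 4)) (w (q 5))))"
      unfolding sum_distrib_left
      by (intro sum.cong refl) (simp add: permutes_not_in[of _ "{2,3,4,5}"])
    also have "\<dots> = a (w 0) (w 1) * (8 * (a (w 2) (w 3) * a (w 4) (w 5) - a (w 2) (w 4) * a (w 3) (w 5) + a (w 2) (w 5) * a (w 3) (w 4)))"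
      by (subst signed_sum_four[of "\<lambda>i j. a (w i) (w j)"]) (auto intro!: skew w)
    finally show ?thesis .
  qed
  have "(\<Sum>\<sigma> | \<sigma> permutes {..<2 * 3}. of_int (sign \<sigma>) * (\<Prod>i<3. a (\<sigma> (2 * i)) (\<sigma> (2 * i + 1))))
    = (\<Sum>\<sigma> | \<sigma> permutes insert 0 (insert 1 {2,3,4,5::nat}). of_int (sign \<sigma>) *
        (a (\<sigma> 0) (\<sigma> 1) * (a (\<sigma> 2) (\<sigma> 3) * a (\<sigma> 4) (\<sigma> 5))))"
    unfolding set6 prod3 idx mult.assoc ..
  also have "\<dots> = (\<Sum>b\<in>{0,1,2,3,4,5::nat}. (if 0 = b then 1 else - 1) * (\<Sum>c\<in>{1,2,3,4,5::nat}. (if 1 = c then 1 else - 1) *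
      (a ((?w b c) 0) ((?w b c) 1) *
       (8 * (a ((?w b c) 2) ((?w b c) 3) * a ((?w b c) 4) ((?w b c) 5)
         - a ((?w b c) 2) ((?w b c) 4) * a ((?w b c) 3) ((?w b c) 5)
         + a ((?w b c) 2) ((?w b c) 5) * a ((?w b c) 3) ((?w b c) 4))))))"
  proof (subst signed_sum_over_permutations_insert, simp, simp, intro sum.cong refl arg_cong2[of _ _ _ _ "(*)"])
    fix b assume b: "b \<in> insert 0 {1,2,3,4,5::nat}"
    show "(\<Sum>q | q permutes insert 1 {2,3,4,5::nat}. of_int (sign q) *
        (a ((Transposition.transpose 0 b \<circ> q) 0) ((Transposition.transpose 0 b \<circ> q) 1) * (a ((Transposition.transpose 0 b \<circ> q) 2) ((Transposition.transpose 0 b \<circ> q) 3) * a ((Transposition.transpose 0 b \<circ> q) 4) ((Transposition.transpose 0 b \<circ> q) 5))))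
      = (\<Sum>c\<in>{1,2,3,4,5::nat}. (if 1 = c then 1 else - 1) *
      (a ((?w b c) 0) ((?w b c) 1) *
       (8 * (a ((?w b c) 2) ((?w b c) 3) * a ((?w b c) 4) ((?w b c) 5)
         - a ((?w b c) 2) ((?w b c) 4) * a ((?w b c) 3) ((?w b c) 5)
         + a ((?w b c) 2) ((?w b c) 5) * a ((?w b c) 3) ((?w b c) 4)))))"
    proof (subst signed_sum_over_permutations_insert, simp, simp, intro sum.cong refl arg_cong2[of _ _ _ _ "(*)"])
      fix c assume c: "c \<in> insert 1 {2,3,4,5::nat}"
      have "(?w b c) i < 6" if "i < 6" for i
        using b c that by (auto simp: Transposition.transpose_def)
      from inner[of "Transposition.transpose 0 b \<circ> Transposition.transpose 1 c", OF this]
      show "(\<Sum>q | q permutes {2,3,4,5::nat}. of_int (sign q) *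
        (a ((Transposition.transpose 0 b \<circ> (Transposition.transpose 1 c \<circ> q)) 0) ((Transposition.transpose 0 b \<circ> (Transposition.transpose 1 c \<circ> q)) 1) * (a ((Transposition.transpose 0 b \<circ> (Transposition.transpose 1 c \<circ> q)) 2) ((Transposition.transpose 0 b \<circ> (Transposition.transpose 1 c \<circ> q)) 3) * a ((Transposition.transpose 0 b \<circ> (Transposition.transpose 1 c \<circ> q)) 4) ((Transposition.transpose 0 b \<circ> (Transposition.transpose 1 c \<circ> q)) 5))))
       = (a ((?w b c) 0) ((?w b c) 1) *
       (8 * (a ((?w b c) 2) ((?w b c) 3) * a ((?w b c) 4) ((?w b c) 5)
         - a ((?w b c) 2) ((?w b c) 4) * a ((?w b c) 3) ((?w b c) 5)
         + a ((?w b c) 2) ((?w b c) 5) * a ((?w b c) 3) ((?w b c) 4))))"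
        by simp
    qed
  qed
  also have "\<dots> = 48 * (a 0 1 * (a 2 3 * a 4 5 - a 2 4 * a 3 5 + a 2 5 * a 3 4)
   - a 0 2 * (a 1 3 * a 4 5 - a 1 4 * a 3 5 + a 1 5 * a 3 4)
   + a 0 3 * (a 1 2 * a 4 5 - a 1 4 * a 2 5 + a 1 5 * a 2 4)
   - a 0 4 * (a 1 2 * a 3 5 - a 1 3 * a 2 5 + a 1 5 * a 2 3)
   + a 0 5 * (a 1 2 * a 3 4 - a 1 3 * a 2 4 + a 1 4 * a 2 3))"
  proof -
    have s: "a 1 0 = - a 0 1" "a 2 0 = - a 0 2" "a 3 0 = - a 0 3" "a 4 0 = - a 0 4" "a 5 0 = - a 0 5"
      "a 2 1 = - a 1 2" "a 3 1 = - a 1 3" "a 4 1 = - a 1 4" "a 5 1 = - a 1 5"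
      "a 3 2 = - a 2 3" "a 4 2 = - a 2 4" "a 5 2 = - a 2 5" "a 4 3 = - a 3 4" "a 5 3 = - a 3 5" "a 5 4 = - a 4 5"
      by (rule skew; simp)+
    show ?thesis by (simp add: Transposition.transpose_def s s[unfolded One_nat_def] algebra_simps)
  qed
  finally show ?thesis by (simp add: pfaffian_def fact_numeral)
qed

section \<open>Points of rank two\<close>

subsection \<open>The linear form that divides the kernel\<close>

lemma bil_congr: "bil (congr (transpose T) A) u v = bil A (T *v u) (T *v v)"
proof -
  have "bil (congr (transpose T) A) u v
    = (\<Sum>i\<in>UNIV. \<Sum>j\<in>UNIV. \<Sum>k\<in>UNIV. \<Sum>l\<in>UNIV. u $ i * (T $ k $ i * A $ k $ l * T $ l $ j) * v $ j)"
    by (simp add: bil_def congr_nth transpose_def sum_distrib_left sum_distrib_right)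
  also have "\<dots> = (\<Sum>i\<in>UNIV. \<Sum>k\<in>UNIV. \<Sum>j\<in>UNIV. \<Sum>l\<in>UNIV. u $ i * (T $ k $ i * A $ k $ l * T $ l $ j) * v $ j)"
    by (intro sum.cong refl sum.swap)
  also have "\<dots> = (\<Sum>k\<in>UNIV. \<Sum>i\<in>UNIV. \<Sum>l\<in>UNIV. \<Sum>j\<in>UNIV. u $ i * (T $ k $ i * A $ k $ l * T $ l $ j) * v $ j)"
    by (subst sum.swap) (intro sum.cong refl sum.swap)
  also have "\<dots> = (\<Sum>k\<in>UNIV. \<Sum>l\<in>UNIV. \<Sum>i\<in>UNIV. \<Sum>j\<in>UNIV. u $ i * (T $ k $ i * A $ k $ l * T $ l $ j) * v $ j)"
    by (intro sum.cong refl sum.swap)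
  also have "\<dots> = bil A (T *v u) (T *v v)"
    by (simp add: bil_def matrix_mult_vec_nth sum_product sum_distrib_left sum_distrib_right ac_simps)
  finally show ?thesis .
qed

lemma bil_eq_0I:
  assumes "\<And>j. (\<Sum>i\<in>UNIV. u $ i * A $ i $ j) = 0"
  shows "bil A u v = 0"
proof -
  have "bil A u v = (\<Sum>j\<in>UNIV. (\<Sum>i\<in>UNIV. u $ i * A $ i $ j) * v $ j)"
    unfolding bil_def sum_distrib_right by (rule sum.swap)
  then show ?thesis by (simp add: assms)
qed

lemma binary_isotropic: "\<exists>s t :: complex. (s \<noteq> 0 \<or> t \<noteq> 0) \<and> a * s\<^sup>2 + b * s * t + c * t\<^sup>2 = 0"
proof (cases "a = 0")
  case True
  then show ?thesis by (intro exI[of _ 1] exI[of _ 0]) simp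
next
  case False
  define s where "s = (- b + csqrt (b\<^sup>2 - 4 * a * c)) / (2 * a)"
  have "(2 * a * s + b)\<^sup>2 = b\<^sup>2 - 4 * a * c" using False by (simp add: s_def)
  then have "4 * a * (a * s\<^sup>2 + b * s + c) = 0" by (simp add: power2_eq_square algebra_simps)
  then show ?thesis using False by (intro exI[of _ s] exI[of _ 1]) simp
qed

definition quadric :: "(quad_exp \<Rightarrow> complex) \<Rightarrow> complex^3 \<Rightarrow> complex^3 \<Rightarrow> complex" where
  "quadric p u v = (\<Sum>i\<in>UNIV. p i * qprod u v $ i)"

lemma quadric_comb:
  "quadric p (s *s u + t *s v) (s *s u + t *s v) = s\<^sup>2 * quadric p u u + s * t * (2 * quadric p u v) + t\<^sup>2 * quadric p v v"
  by (simp add: quadric_def sum_quad power2_eq_square algebra_simps)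

text \<open>Two conics meet: their pencil contains a singular conic, that is a pair of lines, and a line
  meets the other conic.\<close>

lemma conics_meet: "\<exists>z. z \<noteq> 0 \<and> quadric p z z = 0 \<and> quadric r z z = 0"
proof -
  define M :: "(quad_exp \<Rightarrow> complex) \<Rightarrow> complex^3^3" where
    "M p = vector [vector [p XX, p XY, p XZ], vector [p XY, p YY, p YZ], vector [p XZ, p YZ, p ZZ]]" for p
  have quadric_M: "quadric p u v = (\<Sum>i\<in>UNIV. (M p *v u) $ i * v $ i)" for p u v
    by (simp add: quadric_def sum_quad M_def matrix_vector_mult_def sum_3 algebra_simps)
  have main: "\<exists>z. z \<noteq> 0 \<and> quadric m z z = 0 \<and> quadric f z z = 0" if det: "det (M m) = 0" for m f
  proof -
    have "\<not> inj ((*v) (M m))" using det_nz_iff_inj_gen[of "(*v) (M m)"] det by simp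
    then obtain n where n: "n \<noteq> 0" "M m *v n = 0" unfolding vec.inj_iff_eq_0 by blast
    obtain g h :: "complex^3^3" where gh: "h ** g = mat 1" "column 3 g = n" using complete_to_basis[OF n(1)] by blast
    let ?u = "column 1 g" and ?v = "column 2 g"
    obtain s t where st: "s \<noteq> 0 \<or> t \<noteq> 0" "quadric m ?u ?u * s\<^sup>2 + (2 * quadric m ?u ?v) * s * t + quadric m ?v ?v * t\<^sup>2 = 0"
      using binary_isotropic by blast
    define w where "w = s *s ?u + t *s ?v"
    have w: "quadric m w w = 0" unfolding w_def quadric_comb using st(2) by (simp add: algebra_simps)
    obtain a b where ab: "a \<noteq> 0 \<or> b \<noteq> 0" "quadric f n n * a\<^sup>2 + (2 * quadric f n w) * a * b + quadric f w w * b\<^sup>2 = 0"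
      using binary_isotropic by blast
    define z where "z = a *s n + b *s w"
    have "quadric m n n = 0" "quadric m n w = 0" unfolding quadric_M n(2) by simp_all
    then have "quadric m z z = 0" unfolding z_def quadric_comb w by simp
    moreover have "quadric f z z = 0" unfolding z_def quadric_comb using ab(2) by (simp add: algebra_simps)
    moreover have "z \<noteq> 0"
    proof
      assume "z = 0"
      have hc: "h *v column j g = axis j 1" for j
      proof -
        have "h *v column j g = column j (h ** g)"
          by (simp add: vec_eq_iff column_def matrix_vector_mult_def matrix_matrix_mult_def)
        then show ?thesis by (simp add: gh vec_eq_iff column_def mat_def axis_def eq_commute)
      qed
      have "h *v z = a *s axis 3 1 + b *s (s *s axis 1 1 + t *s axis 2 1)"
        unfolding z_def w_def gh(2)[symmetric]
        by (simp add: matrix_vector_right_distrib vector_scalar_commute hc)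
      then have "a *s axis 3 1 + b *s (s *s axis 1 1 + t *s axis 2 1) = (0 :: complex^3)" using \<open>z = 0\<close> by simp
      then have "a = 0 \<and> b * s = 0 \<and> b * t = 0" by (simp add: vec_eq_iff forall_3 axis_def)
      then show False using ab st by auto
    qed
    ultimately show ?thesis by blast
  qed
  show ?thesis
  proof (cases "det (M r) = 0")
    case True
    then show ?thesis using main[of r p] by blast
  next
    case False
    define c1 where "c1 = det (M (\<lambda>i. p i + r i)) + det (M (\<lambda>i. p i - r i))"
    define d where "d = (det (M (\<lambda>i. p i + r i)) - det (M (\<lambda>i. p i - r i))) / 2 - det (M r)"
    define P where "P = [:det (M p), d, c1 / 2 - det (M p), det (M r):]"
    have P: "poly P t = det (M (\<lambda>i. p i + t * r i))" for t
      by (simp add: P_def c1_def d_def M_def det_3 field_simps)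
    have "\<not> constant (poly P)" using False by (simp add: constant_degree P_def)
    then obtain t where "poly P t = 0" using fundamental_theorem_of_algebra by blast
    then obtain z where z: "z \<noteq> 0" "quadric (\<lambda>i. p i + t * r i) z z = 0" "quadric r z z = 0"
      using main[of "\<lambda>i. p i + t * r i" r] P by auto
    have "quadric (\<lambda>i. p i + t * r i) z z = quadric p z z + t * quadric r z z"
      by (simp add: quadric_def sum.distrib sum_distrib_left algebra_simps)
    then show ?thesis using z by (intro exI[of _ z]) simp
  qed
qed

lemma two_terms_det3: "two_terms A \<Longrightarrow> det3 A i j k p q r = 0"
  unfolding two_terms_def det3_def by (auto simp: algebra_simps)

lemma Sym6_lower:
  assumes "A \<in> Sym6"
  shows "A $ YY $ XX = A $ XX $ YY" "A $ ZZ $ XX = A $ XX $ ZZ" "A $ ZZ $ YY = A $ YY $ ZZ"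
    "A $ XY $ XX = A $ XX $ XY" "A $ XZ $ XX = A $ XX $ XZ" "A $ YZ $ XX = A $ XX $ YZ"
    "A $ XY $ YY = A $ YY $ XY" "A $ XZ $ YY = A $ YY $ XZ" "A $ YZ $ YY = A $ YY $ YZ"
    "A $ XY $ ZZ = A $ ZZ $ XY" "A $ XZ $ ZZ = A $ ZZ $ XZ" "A $ YZ $ ZZ = A $ ZZ $ YZ"
    "A $ XZ $ XY = A $ XY $ XZ" "A $ YZ $ XY = A $ XY $ YZ" "A $ YZ $ XZ = A $ XZ $ YZ"
  using assms Sym6_iff by blast+

lemma Cat_relations:
  assumes "A \<in> Cat"
  shows "A $ XX $ YY = A $ XY $ XY" "A $ XX $ ZZ = A $ XZ $ XZ" "A $ YY $ ZZ = A $ YZ $ YZ"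
     "A $ XX $ YZ = A $ XY $ XZ" "A $ YY $ XZ = A $ XY $ YZ" "A $ ZZ $ XY = A $ XZ $ YZ"
  using assms Cat_iff by blast+

lemma kills_transfer:
  assumes gh: "g ** h = mat 1" and "\<And>l q. bil (congr (transpose (rho g)) A) (qprod z l) q = 0"
  shows "bil A (qprod (g *v z) l) q = 0"
proof -
  have "bil (congr (transpose (rho g)) A) (qprod z (h *v l)) (rho h *v q) = bil A (qprod (g *v z) l) q"
    unfolding bil_congr rho_qprod using rho_inverse[OF gh] by (simp add: matrix_vector_mul_assoc gh)
  then show ?thesis using assms(2) by metis
qed

lemma mult_vec_nonzero: "h ** g = mat 1 \<Longrightarrow> z \<noteq> 0 \<Longrightarrow> g *v z \<noteq> (0 :: complex^3)"
  by (metis matrix_vector_mul_assoc matrix_vector_mul_lid matrix_vector_mult_0_right)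

lemma rows_kill:
  fixes z :: "complex^3"
  assumes "\<And>j. z$1 * A $ XX $ j + z$2 * A $ XY $ j + z$3 * A $ XZ $ j = 0"
    and "\<And>j. z$1 * A $ XY $ j + z$2 * A $ YY $ j + z$3 * A $ YZ $ j = 0"
    and "\<And>j. z$1 * A $ XZ $ j + z$2 * A $ YZ $ j + z$3 * A $ ZZ $ j = 0"
  shows "bil A (qprod z l) q = 0"
proof (rule bil_eq_0I)
  fix j
  have "(\<Sum>i\<in>UNIV. qprod z l $ i * A $ i $ j) = l$1 * (z$1 * A $ XX $ j + z$2 * A $ XY $ j + z$3 * A $ XZ $ j)
    + l$2 * (z$1 * A $ XY $ j + z$2 * A $ YY $ j + z$3 * A $ YZ $ j) + l$3 * (z$1 * A $ XZ $ j + z$2 * A $ YZ $ j + z$3 * A $ ZZ $ j)"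
    by (simp add: sum_quad algebra_simps)
  then show "(\<Sum>i\<in>UNIV. qprod z l $ i * A $ i $ j) = 0" by (simp only: assms) simp
qed

text \<open>With \<open>y z\<close> and \<open>z\<^sup>2\<close> in the kernel: either \<open>x z\<close> is in the kernel too, or the quartic is the cube of a
  linear form times another one, and a combination of \<open>y\<close> and \<open>z\<close> kills it.\<close>

lemma killed_form_step2:
  assumes A: "A \<in> Cat" "two_terms A" and r: "\<And>j. A $ ZZ $ j = 0" "\<And>j. A $ YZ $ j = 0"
  shows "\<exists>z. z \<noteq> 0 \<and> (\<forall>l q. bil A (qprod z l) q = 0)"
proof -
  have "A \<in> Sym6" using A(1) Cat_subset_Sym6 by blast
  note sy = Sym6_lower[OF this] and cat = Cat_relations[OF A(1)]
  have r': "A $ j $ ZZ = 0" "A $ j $ YZ = 0" for j using r \<open>A \<in> Sym6\<close> Sym6_iff by metis+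
  have XZ: "A $ XY $ XZ = 0" "A $ YY $ XZ = 0" "A $ XZ $ XZ = 0" using cat r' by metis+
  let ?b = "A $ XX $ XZ"
  show ?thesis
  proof (cases "?b = 0")
    case True
    have xz: "\<forall>j. A $ XZ $ j = 0" unfolding forall_quad by (simp add: sy XZ True r r')
    have "bil A (qprod (vector [0,0,1]) l) q = 0" for l q
      by (rule rows_kill) (simp_all add: xz r)
    then show ?thesis by (intro exI[of _ "vector [0,0,1]"]) (simp add: vec_eq_iff forall_3)
  next
    case False
    have "?b * ?b * A $ YY $ YY = 0"
      using two_terms_det3[OF A(2), of XX XZ YY XX XZ YY] by (simp add: det3_def sy XZ r r' algebra_simps)
    moreover have "?b * ?b * A $ XY $ XY = 0"
      using two_terms_det3[OF A(2), of XX XZ XY XX XZ XY] by (simp add: det3_def sy XZ r r' algebra_simps)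
    moreover have "?b * ?b * A $ YY $ XY = 0"
      using two_terms_det3[OF A(2), of XX XZ XY XX XZ YY] by (simp add: det3_def sy XZ r r' algebra_simps)
    ultimately have e: "A $ YY $ YY = 0" "A $ XY $ XY = 0" "A $ YY $ XY = 0" using False by simp_all
    have e': "A $ XX $ YY = 0" using cat e by metis
    let ?z = "vector [0, ?b, - A $ XX $ XY] :: complex^3"
    have "\<forall>j. ?z$1 * A $ XX $ j + ?z$2 * A $ XY $ j + ?z$3 * A $ XZ $ j = 0"
      "\<forall>j. ?z$1 * A $ XY $ j + ?z$2 * A $ YY $ j + ?z$3 * A $ YZ $ j = 0"
      "\<forall>j. ?z$1 * A $ XZ $ j + ?z$2 * A $ YZ $ j + ?z$3 * A $ ZZ $ j = 0"
      unfolding forall_quad by (simp_all add: sy XZ r r' e e')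
    then have "bil A (qprod ?z l) q = 0" for l q by (intro rows_kill) blast+
    then show ?thesis using False by (intro exI[of _ ?z]) (simp add: vec_eq_iff forall_3)
  qed
qed

text \<open>With \<open>z\<^sup>2\<close> in the kernel: the part of the quartic that is linear in \<open>z\<close> is a binary cubic of rank
  at most one, killed by some linear form in \<open>x\<close> and \<open>y\<close>.\<close>

lemma killed_form_step1:
  assumes A: "A \<in> Cat" "two_terms A" and r: "\<And>j. A $ ZZ $ j = 0"
  shows "\<exists>z. z \<noteq> 0 \<and> (\<forall>l q. bil A (qprod z l) q = 0)"
proof -
  have "A \<in> Sym6" using A(1) Cat_subset_Sym6 by blast
  note sy = Sym6_lower[OF this] and cat = Cat_relations[OF A(1)]
  have r': "A $ j $ ZZ = 0" for j using r \<open>A \<in> Sym6\<close> Sym6_iff by metis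
  have z: "A $ XZ $ XZ = 0" "A $ YZ $ YZ = 0" "A $ XZ $ YZ = 0" using cat r r' by metis+
  define b0 b1 b2 b3 where b: "b0 = A $ XX $ XZ" "b1 = A $ XX $ YZ" "b2 = A $ YY $ XZ" "b3 = A $ YY $ YZ"
  note b' = b[symmetric]
  have c: "A $ XY $ XZ = b1" "A $ XY $ YZ = b2" using cat unfolding b by simp_all
  have m: "det3 A XX XY i XZ YZ j = A $ i $ j * (b0 * b2 - b1 * b1)" "det3 A XX YY i XZ YZ j = A $ i $ j * (b0 * b3 - b1 * b2)"
     "det3 A XY YY i XZ YZ j = A $ i $ j * (b1 * b3 - b2 * b2)" if "i = XZ \<or> i = YZ" for i j
    using that by (auto simp: det3_def sy z c b' algebra_simps)
  have m0: "A $ i $ j * (b0 * b2 - b1 * b1) = 0" "A $ i $ j * (b0 * b3 - b1 * b2) = 0" "A $ i $ j * (b1 * b3 - b2 * b2) = 0"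
    if "i = XZ \<or> i = YZ" for i j
    using m[OF that] two_terms_det3[OF A(2)] by metis+
  have "\<exists>s t. (s \<noteq> 0 \<or> t \<noteq> 0) \<and> s * b0 + t * b1 = 0 \<and> s * b1 + t * b2 = 0 \<and> s * b2 + t * b3 = 0"
  proof (cases "b0 = 0 \<and> b1 = 0 \<and> b2 = 0 \<and> b3 = 0")
    case True
    then show ?thesis by (intro exI[of _ 1] exI[of _ 0]) simp
  next
    case False
    have "A $ XZ $ XX = b0" "A $ YZ $ XX = b1" "A $ XZ $ YY = b2" "A $ YZ $ YY = b3" by (simp_all add: sy b)
    then have mm: "b0 * b2 = b1 * b1" "b0 * b3 = b1 * b2" "b1 * b3 = b2 * b2"
      using False m0[of XZ XX] m0[of YZ XX] m0[of XZ YY] m0[of YZ YY] by auto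
    show ?thesis
    proof (cases "b0 = 0 \<and> b1 = 0")
      case True
      then show ?thesis using mm by (intro exI[of _ 1] exI[of _ 0]) auto
    next
      case False
      then show ?thesis using mm by (intro exI[of _ b1] exI[of _ "- b0"]) (auto simp: algebra_simps)
    qed
  qed
  then obtain s t where st: "s \<noteq> 0 \<or> t \<noteq> 0" "s * b0 + t * b1 = 0" "s * b1 + t * b2 = 0" "s * b2 + t * b3 = 0" by blast
  obtain s' t' where st': "s' * t - t' * s = 1"
  proof (cases "s = 0")
    case True then show ?thesis using st(1) that[of "1/t" 0] by simp
  next
    case False then show ?thesis using that[of 0 "-1/s"] by simp
  qed
  define g :: "complex^3^3" where "g = vector [vector [s', s, 0], vector [t', t, 0], vector [0, 0, 1]]"
  define h :: "complex^3^3" where "h = vector [vector [t, - s, 0], vector [- t', s', 0], vector [0, 0, 1]]"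
  have gh: "g ** h = mat 1" "h ** g = mat 1"
    using st' by (simp_all add: g_def h_def vec_eq_iff forall_3 matrix_matrix_mult_def sum_3 mat_def algebra_simps)
  let ?A = "congr (transpose (rho g)) A"
  have A': "?A \<in> Cat" "two_terms ?A" using congr_rho_Cat[OF A(1)] two_terms_congr[OF A(2)] by blast+
  have col: "column 1 g = vector [s', t', 0]" "column 2 g = vector [s, t, 0]" "column 3 g = vector [0,0,1]"
    by (simp_all add: g_def column_def vec_eq_iff forall_3)
  have zz: "?A $ ZZ $ j = 0" for j
    unfolding congr_transpose_nth column_rho idx_simps col
    by (rule bil_eq_0I) (simp add: sum_quad r)
  have y: "s * A $ XZ $ i + t * A $ YZ $ i = 0" for i
  proof -
    have "\<forall>i. s * A $ XZ $ i + t * A $ YZ $ i = 0"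
      unfolding forall_quad using st by (simp add: sy z c b' r r')
    then show ?thesis by blast
  qed
  have "?A $ YZ $ j = 0" for j
    unfolding congr_transpose_nth column_rho idx_simps col
    by (rule bil_eq_0I) (use y in \<open>simp add: sum_quad\<close>)
  from killed_form_step2[OF A' zz this] obtain z where z: "z \<noteq> 0" "\<And>l q. bil ?A (qprod z l) q = 0" by blast
  show ?thesis
    using kills_transfer[OF gh(1) z(2)] mult_vec_nonzero[OF gh(2) z(1)] by blast
qed

text \<open>The two linear functionals that occur in a matrix of rank two are conics in the dual plane. A common point
  \<open>w\<close> has its square in the kernel; take it as the last basis vector.\<close>

lemma killed_linear_form:
  assumes A: "A \<in> Cat" "two_terms A"
  shows "\<exists>z. z \<noteq> 0 \<and> (\<forall>l q. bil A (qprod z l) q = 0)"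
proof -
  obtain p q r s where pq: "\<And>i j. A $ i $ j = p i * q j + r i * s j" using A(2) unfolding two_terms_def by blast
  obtain w where w: "w \<noteq> 0" "quadric p w w = 0" "quadric r w w = 0" using conics_meet by blast
  obtain g h :: "complex^3^3" where gh: "g ** h = mat 1" "h ** g = mat 1" "column 3 g = w" using complete_to_basis[OF w(1)] by blast
  let ?A = "congr (transpose (rho g)) A"
  have A': "?A \<in> Cat" "two_terms ?A" using congr_rho_Cat[OF A(1)] two_terms_congr[OF A(2)] by blast+
  have "?A $ ZZ $ j = 0" for j
    unfolding congr_transpose_nth column_rho idx_simps gh(3)
  proof (rule bil_eq_0I)
    fix j
    have "(\<Sum>i\<in>UNIV. qprod w w $ i * A $ i $ j) = quadric p w w * q j + quadric r w w * s j"
      by (simp add: quadric_def pq sum.distrib sum_distrib_left algebra_simps)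
    then show "(\<Sum>i\<in>UNIV. qprod w w $ i * A $ i $ j) = 0" by (simp add: w)
  qed
  from killed_form_step1[OF A' this] obtain z where z: "z \<noteq> 0" "\<And>l q. bil ?A (qprod z l) q = 0" by blast
  show ?thesis
    using kills_transfer[OF gh(1) z(2)] mult_vec_nonzero[OF gh(2) z(1)] by blast
qed

subsection \<open>Normal form\<close>

lemma one_term_rank:
  fixes A :: mat6
  assumes "\<And>i j. A $ i $ j = p i * q j"
  shows "rank A \<le> 1"
proof -
  let ?q = "\<chi> j. q j"
  have "A $ i = p i *s ?q" for i by (simp add: vec_eq_iff assms)
  then have "A $ i \<in> vec.span {?q}" for i
    by (simp only:) (intro vec.span_scale vec.span_base; simp)
  from rank_le_card[OF this] show ?thesis by simp
qed

lemma one_term_congr: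
  assumes "\<And>i j. congr T A $ i $ j = p i * q j" and ST: "S ** T = mat 1"
  shows "rank A \<le> 1"
proof -
  have "A $ i $ j = congr S (congr T A) $ i $ j" for i j using congr_inverse[OF ST] by simp
  also have "congr S (congr T A) $ i $ j = (\<Sum>k\<in>UNIV. S $ i $ k * p k) * (\<Sum>l\<in>UNIV. S $ j $ l * q l)" for i j
    unfolding congr_nth[of S] sum_product by (simp add: assms(1) algebra_simps)
  finally show ?thesis by (rule one_term_rank)
qed

lemma rank_decomposition:
  fixes A :: mat6
  shows "\<exists>F. finite F \<and> card F = rank A \<and> (\<forall>i. A $ i \<in> vec.span F)"
proof -
  obtain F where F: "F \<subseteq> rows A" "vec.independent F" "rows A \<subseteq> vec.span F" "card F = vec.dim (rows A)"
    using vec.basis_exists[of "rows A"] by blast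
  have "A $ i \<in> rows A" for i by (auto simp: rows_def row_def vec_lambda_eta)
  then show ?thesis using F vec.finiteI_independent[OF F(2)] by (auto simp: row_rank_def_gen)
qed

lemma rank_2_two_terms:
  assumes "rank A = 2"
  shows "two_terms A"
proof -
  obtain F where F: "finite F" "card F = 2" "\<And>i. A $ i \<in> vec.span F" using rank_decomposition[of A] assms by auto
  then obtain u v where uv: "F = {u, v}" by (meson card_2_iff)
  have "\<exists>a b. A $ i = a *s u + b *s v" for i
  proof -
    obtain a where a: "A $ i - a *s u \<in> vec.span {v}" using F(3)[of i] unfolding uv vec.span_breakdown_eq by blast
    then obtain b where "A $ i - a *s u = b *s v" unfolding vec.span_singleton by blast
    then show ?thesis by (intro exI[of _ a] exI[of _ b]) (simp add: algebra_simps)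
  qed
  then obtain a b where "\<And>i. A $ i = a i *s u + b i *s v" by metis
  then show ?thesis unfolding two_terms_def
    by (intro exI[of _ a] exI[of _ "\<lambda>j. u $ j"] exI[of _ b] exI[of _ "\<lambda>j. v $ j"]) simp
qed

lemma binary_quadric_factors:
  fixes l m n :: complex
  assumes "l \<noteq> 0 \<or> m \<noteq> 0 \<or> n \<noteq> 0"
  shows "\<exists>a b c d. (a \<noteq> 0 \<or> b \<noteq> 0) \<and> (c \<noteq> 0 \<or> d \<noteq> 0) \<and> l = a * c \<and> m = a * d + b * c \<and> n = b * d"
proof (cases "l = 0")
  case True
  then show ?thesis using assms by (intro exI[of _ 0] exI[of _ 1] exI[of _ m] exI[of _ n]) auto
next
  case False
  define w where "w = csqrt (m\<^sup>2 - 4 * l * n)"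
  have w: "w * w = m * m - 4 * l * n" by (simp add: w_def power2_eq_square[symmetric])
  show ?thesis
    by (rule exI[of _ l], rule exI[of _ "(m + w) / 2"], rule exI[of _ 1], rule exI[of _ "(m - w) / (2 * l)"])
      (use False w in \<open>simp add: field_simps\<close>)
qed

lemma rank2_normal_form:
  assumes A: "A \<in> Cat" "rank A = 2"
  shows "\<exists>g h k. g ** h = mat 1 \<and> h ** g = mat 1 \<and> (k = 0 \<or> k = 1) \<and> rank2_form k (congr (transpose (rho g)) A)"
proof -
  have tt: "two_terms A" using A(2) by (rule rank_2_two_terms)
  obtain z where z: "z \<noteq> 0" "\<And>l q. bil A (qprod z l) q = 0" using killed_linear_form[OF A(1) tt] by blast
  obtain g h :: "complex^3^3" where gh: "g ** h = mat 1" "h ** g = mat 1" "column 3 g = z" using complete_to_basis[OF z(1)] by blast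
  define A1 where "A1 = congr (transpose (rho g)) A"
  have A1: "A1 \<in> Cat" "two_terms A1" unfolding A1_def using congr_rho_Cat[OF A(1)] two_terms_congr[OF tt] by blast+
  have "A1 \<in> Sym6" using A1(1) Cat_subset_Sym6 by blast
  note sy = Sym6_lower[OF this] and cat = Cat_relations[OF A1(1)]
  have rz: "A1 $ XZ $ j = 0" "A1 $ YZ $ j = 0" "A1 $ ZZ $ j = 0" for j
    unfolding A1_def congr_transpose_nth column_rho idx_simps gh(3) using z(2) qprod_commute by metis+
  define Hm :: "complex^3^3" where "Hm = vector [vector [A1 $ XX $ XX, A1 $ XX $ XY, A1 $ XX $ YY],
    vector [A1 $ XY $ XX, A1 $ XY $ XY, A1 $ XY $ YY], vector [A1 $ YY $ XX, A1 $ YY $ XY, A1 $ YY $ YY]]"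
  have "det Hm = 0" using two_terms_det3[OF A1(2), of XX XY YY XX XY YY]
    by (simp add: det_3 Hm_def det3_def algebra_simps)
  then have "\<not> inj ((*v) Hm)" using det_nz_iff_inj_gen[of "(*v) Hm"] by simp
  then obtain n where n: "n \<noteq> 0" "Hm *v n = 0" unfolding vec.inj_iff_eq_0 by blast
  have ker: "n$1 * A1 $ XX $ j + n$2 * A1 $ XY $ j + n$3 * A1 $ YY $ j = 0" for j
  proof -
    have sym1: "A1 $ i $ j = A1 $ j $ i" for i j using \<open>A1 \<in> Sym6\<close> Sym6_iff by blast
    have "A1 $ j $ XZ = 0" "A1 $ j $ YZ = 0" "A1 $ j $ ZZ = 0" for j
      using rz sym1[of j XZ] sym1[of j YZ] sym1[of j ZZ] by simp_all
    then have "\<forall>j. n$1 * A1 $ XX $ j + n$2 * A1 $ XY $ j + n$3 * A1 $ YY $ j = 0"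
      unfolding forall_quad using n(2) rz
      by (simp add: vec_eq_iff forall_3 matrix_vector_mult_def sum_3 Hm_def sy algebra_simps)
    then show ?thesis by blast
  qed
  have "n$1 \<noteq> 0 \<or> n$2 \<noteq> 0 \<or> n$3 \<noteq> 0" using n(1) by (auto simp: vec_eq_iff forall_3)
  from binary_quadric_factors[OF this] obtain a b c d
    where abcd: "a \<noteq> 0 \<or> b \<noteq> 0" "c \<noteq> 0 \<or> d \<noteq> 0" "n$1 = a * c" "n$2 = a * d + b * c" "n$3 = b * d"
    by (elim exE conjE) (rule that)
  text \<open>The kernel contains the product of the linear forms \<open>(a, b)\<close> and \<open>(c, d)\<close>. Take the first as the
    new \<open>y\<close>; if they are independent then take the difference as the new \<open>x\<close>.\<close>
  have "\<exists>k e f w. (k = 0 \<or> k = 1) \<and> e * b - f * a \<noteq> 0 \<and> w \<noteq> 0 \<and> c = w * (a + k * e) \<and> d = w * (b + k * f)"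
  proof (cases "a * d - b * c = 0")
    case False
    then show ?thesis
      by (intro exI[of _ 1] exI[of _ "c - a"] exI[of _ "d - b"] exI[of _ 1]) (auto simp: algebra_simps)
  next
    case True
    show ?thesis
    proof (cases "a = 0")
      case True': True
      then have "c = 0" "d \<noteq> 0" using True abcd by auto
      then show ?thesis using abcd True' by (intro exI[of _ 0] exI[of _ 1] exI[of _ 0] exI[of _ "d / b"]) auto
    next
      case False
      then have "d = c / a * b" using True by (simp add: field_simps)
      moreover have "c \<noteq> 0" using \<open>d = c / a * b\<close> abcd by auto
      ultimately show ?thesis using False by (intro exI[of _ 0] exI[of _ 0] exI[of _ 1] exI[of _ "c / a"]) auto
    qed
  qed
  then obtain k e f w where kef: "k = 0 \<or> k = 1" "e * b - f * a \<noteq> 0" "w \<noteq> 0" "c = w * (a + k * e)" "d = w * (b + k * f)" by blast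
  define D where "D = e * b - f * a"
  define g' :: "complex^3^3" where "g' = vector [vector [e, a, 0], vector [f, b, 0], vector [0, 0, 1]]"
  define h' :: "complex^3^3" where "h' = vector [vector [b / D, - a / D, 0], vector [- f / D, e / D, 0], vector [0, 0, 1]]"
  have "D \<noteq> 0" using kef by (simp add: D_def)
  have gh': "g' ** h' = mat 1"
    using \<open>D \<noteq> 0\<close> by (simp add: g'_def h'_def vec_eq_iff forall_3 matrix_matrix_mult_def sum_3 mat_def diff_divide_distrib[symmetric])
      (simp add: D_def algebra_simps)
  then have hg': "h' ** g' = mat 1" by (simp add: matrix_left_right_inverse)
  define A2 where "A2 = congr (transpose (rho g')) A1"
  have A2: "A2 \<in> Cat" unfolding A2_def using congr_rho_Cat[OF A1(1)] by blast
  have "A2 \<in> Sym6" using A2 Cat_subset_Sym6 by blast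
  note sy2 = Sym6_lower[OF this] and cat2 = Cat_relations[OF A2]
  have sym2: "A2 $ i $ j = A2 $ j $ i" for i j using \<open>A2 \<in> Sym6\<close> Sym6_iff by blast
  have col: "column 1 g' = vector [e, f, 0]" "column 2 g' = vector [a, b, 0]" "column 3 g' = vector [0,0,1]"
    by (simp_all add: g'_def column_def vec_eq_iff forall_3)
  have rz2: "A2 $ XZ $ j = 0" "A2 $ YZ $ j = 0" "A2 $ ZZ $ j = 0" for j
    unfolding A2_def congr_transpose_nth column_rho idx_simps col
    by (rule bil_eq_0I, simp add: sum_quad rz)+
  have cz2: "A2 $ j $ XZ = 0" "A2 $ j $ YZ = 0" "A2 $ j $ ZZ = 0" for j
    using rz2 sym2[of j XZ] sym2[of j YZ] sym2[of j ZZ] by simp_all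
  have q2: "A2 $ YY $ j + k * A2 $ XY $ j = 0" for j
  proof -
    have "w * (A2 $ YY $ j + k * A2 $ XY $ j) = bil A1 (w *s (qprod (column 2 g') (column 2 g') + k *s qprod (column 1 g') (column 2 g'))) (column j (rho g'))"
      unfolding A2_def congr_transpose_nth bil_scale_left bil_add_left column_rho idx_simps ..
    also have "\<dots> = 0"
    proof (rule bil_eq_0I)
      fix j
      have nw: "n$1 = w * (a * a + k * (e * a))" "n$2 = w * (2 * (a * b) + k * (e * b + f * a))" "n$3 = w * (b * b + k * (f * b))"
        unfolding abcd kef(4,5) by (simp_all add: algebra_simps)
      have "(\<Sum>i\<in>UNIV. (w *s (qprod (column 2 g') (column 2 g') + k *s qprod (column 1 g') (column 2 g'))) $ i * A1 $ i $ j)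
         = n$1 * A1 $ XX $ j + n$2 * A1 $ XY $ j + n$3 * A1 $ YY $ j"
        unfolding nw by (simp add: sum_quad col rz algebra_simps)
      then show "(\<Sum>i\<in>UNIV. (w *s (qprod (column 2 g') (column 2 g') + k *s qprod (column 1 g') (column 2 g'))) $ i * A1 $ i $ j) = 0"
        using ker by simp
    qed
    finally show ?thesis using kef by simp
  qed
  then have q2': "A2 $ YY $ j = - k * A2 $ XY $ j" for j by (simp add: eq_neg_iff_add_eq_0)
  have congr2: "A2 = congr (transpose (rho (g ** g'))) A"
    unfolding A2_def A1_def congr_mult rho_mult[symmetric] by (simp add: matrix_transpose_mul)
  have GH: "(g ** g') ** (h' ** h) = mat 1" "(h' ** h) ** (g ** g') = mat 1"
  proof -
    have "(g ** g') ** (h' ** h) = g ** (g' ** h') ** h" by (simp add: matrix_mul_assoc)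
    then show "(g ** g') ** (h' ** h) = mat 1" by (simp add: gh' gh)
    then show "(h' ** h) ** (g ** g') = mat 1" by (simp add: matrix_left_right_inverse)
  qed
  have U: "A2 $ XX $ XX * A2 $ XY $ XY - A2 $ XX $ XY * A2 $ XX $ XY \<noteq> 0"
  proof
    assume U: "A2 $ XX $ XX * A2 $ XY $ XY - A2 $ XX $ XY * A2 $ XX $ XY = 0"
    have e1: "A2 $ XY $ XY = - k * A2 $ XX $ XY" using q2'[of XX] cat2(1) sy2 by simp
    have e2: "A2 $ YY $ XY = - k * A2 $ XY $ XY" "A2 $ YY $ YY = - k * A2 $ YY $ XY" using q2'[of XY] q2'[of YY] sy2 by simp_all
    have "A2 $ XX $ XY * (k * A2 $ XX $ XX + A2 $ XX $ XY) = 0" using U unfolding e1 by algebra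
    then consider "A2 $ XX $ XY = 0" | "A2 $ XX $ XY = - k * A2 $ XX $ XX" by (auto simp: eq_neg_iff_add_eq_0 add.commute)
    then have "\<exists>p q. \<forall>i j. A2 $ i $ j = p i * q j"
    proof cases
      case 1
      show ?thesis
        by (rule exI[of _ "\<lambda>i. if i = XX then A2 $ XX $ XX else 0"], rule exI[of _ "\<lambda>i. if i = XX then 1 else 0"])
          (unfold forall_quad, simp add: 1 sy2 rz2 cz2 e1 e2 cat2)
    next
      case 2
      show ?thesis
        by (rule exI[of _ "\<lambda>i. if i = XX then A2 $ XX $ XX else if i = XY then - k * A2 $ XX $ XX else if i = YY then k * k * A2 $ XX $ XX else 0"],
            rule exI[of _ "\<lambda>i. if i = XX then 1 else if i = XY then - k else if i = YY then k * k else 0"])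
          (unfold forall_quad, simp add: 2 sy2 rz2 cz2 e1 e2 cat2)
    qed
    then obtain p q where "\<And>i j. congr (transpose (rho (g ** g'))) A $ i $ j = p i * q j"
      unfolding congr2 by blast
    moreover have "transpose (rho (h' ** h)) ** transpose (rho (g ** g')) = mat 1"
      by (simp add: matrix_transpose_mul[symmetric] rho_inverse[OF GH(1)] transpose_mat)
    ultimately have "rank A \<le> 1" by (rule one_term_congr)
    then show False using A(2) by simp
  qed
  have "rank2_form k A2"
    unfolding rank2_form_def using A2 U q2' rz2 sym2 by metis
  then show ?thesis using GH kef(1) unfolding congr2 by blast
qed

subsection \<open>The cubic hypersurface\<close>

text \<open>Changes of the variables \<open>x, y, z\<close> act on the graph of the inversion.\<close>

lemma limit_pair_equivariant:
  assumes gh: "g ** h = mat 1" and lim: "limit_pair A B"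
  shows "limit_pair (congr (transpose (rho g)) A) (congr (rho h) B)"
  unfolding limit_pair_def
proof (intro conjI allI ballI impI)
  have hg: "h ** g = mat 1" using gh by (simp add: matrix_left_right_inverse)
  have A: "A \<in> Cat" "A \<noteq> 0" and B: "B \<in> Sym6" "B \<noteq> 0" using lim unfolding limit_pair_def by auto
  have "transpose (rho h) ** transpose (rho g) = mat 1"
    by (simp add: matrix_transpose_mul[symmetric] rho_inverse[OF gh] transpose_mat)
  then show "congr (transpose (rho g)) A \<in> Cat - {0}"
    using congr_rho_Cat[OF A(1)] congr_eq_0_iff A(2) by simp
  show "congr (rho h) B \<in> Sym6 - {0}"
    using congr_Sym6[OF B(1)] congr_eq_0_iff[OF rho_inverse[OF gh]] B(2) by simp
  fix d e f
  assume f: "f \<in> bi_forms d e" and van: "\<forall>C\<in>Cat. det C \<noteq> 0 \<longrightarrow> f (C, adjugate C) = 0"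
  let ?f = "\<lambda>p. f (congr (transpose (rho g)) (fst p), congr (rho h) (snd p))"
  have entry: "(\<lambda>p. congr T (fst p) $ i $ j) \<in> bi_polys" "(\<lambda>p. congr T (snd p) $ i $ j) \<in> bi_polys" for T i j
    unfolding congr_nth using bi_polys_fst bi_polys_snd unfolding bi_polys_def
    by (intro poly_funs_sum finite poly_funs.mult poly_funs.const; blast)+
  have "?f \<in> bi_polys"
    unfolding bi_polys_def
    by (rule bi_polys_comp) (use f entry in \<open>auto simp: bi_forms_def bi_polys_def\<close>)
  then have f': "?f \<in> bi_forms d e"
    using bi_forms_scale[OF f] unfolding bi_forms_def by (simp add: congr_cscale)
  have van': "?f (C, adjugate C) = 0" if C: "C \<in> Cat" "det C \<noteq> 0" for C
    using vanish_at_inverse_pair[OF f _ congr_rho_Cat[OF C(1)] congr_inverse_pair[OF rho_inverse[OF gh] mult_adjugate] C(2)] van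
    by simp
  have "f' (A, B) = 0" if "f' \<in> bi_forms d e" "\<And>C. C \<in> Cat \<Longrightarrow> det C \<noteq> 0 \<Longrightarrow> f' (C, adjugate C) = 0" for f'
    using lim that unfolding limit_pair_def by blast
  from this[OF f' van'] have "?f (A, B) = 0" .
  then show "f (congr (transpose (rho g)) A, congr (rho h) B) = 0" by simp
qed

text \<open>A frame adapted to the kernel of a matrix in normal form, which contains \<open>y\<^sup>2 + k x y\<close>.\<close>

definition shear :: "complex \<Rightarrow> mat6" where
  "shear k = (\<chi> i j. if i = j then 1 else if i = XY \<and> j = YY then k else 0)"

lemma shear_inverse: "shear k ** shear (- k) = mat 1" "shear (- k) ** shear k = mat 1"
  unfolding mat6_eq_iff forall_quad matrix_mult_nth sum_quad shear_def mat_nth by simp_all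

lemma congr_shear_KI:
  assumes "i \<in> KI" "j \<in> KI"
  shows "congr (shear k) X $ i $ j = X $ i $ j"
proof -
  have "shear k $ i $ l = (if l = i then 1 else 0)" if "i \<in> KI" for i l
    using that by (auto simp: shear_def KI_def)
  then show ?thesis
    using assms by (simp add: congr_nth if_distrib[of "\<lambda>x. x * _"] if_distrib[of "\<lambda>x. _ * x"] sum.delta cong: if_cong)
qed

lemma rank2_ker_frame:
  assumes "rank2_form k A"
  shows "ker_frame (shear k) (shear (- k)) KI A"
proof -
  have A: "A $ i $ XZ = 0" "A $ i $ YZ = 0" "A $ i $ ZZ = 0" "A $ i $ YY = - k * A $ i $ XY" for i
    using assms unfolding rank2_form_def by blast+
  have U: "A $ XX $ XX * A $ XY $ XY - A $ XX $ XY * A $ XX $ XY \<noteq> 0" and "A \<in> Sym6"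
    using assms Cat_subset_Sym6 unfolding rank2_form_def by blast+
  then have sy: "A $ XY $ XX = A $ XX $ XY" using Sym6_iff by blast
  have Av: "(A *v v) $ i = A $ i $ XX * v $ XX + A $ i $ XY * (v $ XY - k * v $ YY)" for v i
    by (simp add: matrix_mult_vec_nth sum_quad A algebra_simps)
  have "A *v v = 0 \<longleftrightarrow> v $ XX = 0 \<and> v $ XY - k * v $ YY = 0" for v
  proof
    assume "A *v v = 0"
    then have e: "A $ XX $ XX * v $ XX + A $ XX $ XY * (v $ XY - k * v $ YY) = 0"
      "A $ XX $ XY * v $ XX + A $ XY $ XY * (v $ XY - k * v $ YY) = 0"
      using Av[of v XX] Av[of v XY] by (simp_all add: sy)
    have "(A $ XX $ XX * A $ XY $ XY - A $ XX $ XY * A $ XX $ XY) * v $ XX = 0"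
      "(A $ XX $ XX * A $ XY $ XY - A $ XX $ XY * A $ XX $ XY) * (v $ XY - k * v $ YY) = 0"
      using e by algebra+
    then show "v $ XX = 0 \<and> v $ XY - k * v $ YY = 0" using U by simp
  qed (simp add: vec_eq_iff Av)
  moreover have "(\<forall>j. j \<notin> KI \<longrightarrow> (shear (- k) *v v) $ j = 0) \<longleftrightarrow> v $ XX = 0 \<and> v $ XY - k * v $ YY = 0" for v
    unfolding forall_quad by (simp add: KI_def matrix_mult_vec_nth sum_quad shear_def algebra_simps)
  ultimately show ?thesis unfolding ker_frame_def using shear_inverse by simp
qed

lemma cubicF_shear: "cubicF k (congr (shear k') X) = cubicF k X"
  by (simp add: cubicF_def adj4_nth det3_def congr_shear_KI KI_def)

text \<open>A form \<open>P\<close> on the kernel with \<open>P(y\<^sup>2 + k x y, z\<^sup>2) = P(y z, y z) + k P(x z, y z)\<close> is the restriction of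
  a catalecticant, and on the hypersurface the cofactors of the block satisfy this relation.\<close>

lemma limit_pair_invertible_block:
  assumes A: "rank2_form k A" and X: "X \<in> Sym_on KI" "cubicF k X = 0" "det4 X \<noteq> 0"
  shows "limit_pair A (congr (shear k) X)"
proof -
  let ?P = "adj4 X"
  have P: "?P $ YY $ ZZ = ?P $ YZ $ YZ + k * ?P $ XZ $ YZ" using X(2) by (simp add: cubicF_def algebra_simps)
  have P_sym: "?P $ i $ j = ?P $ j $ i" for i j using adj4_Sym_on unfolding Sym_on_def Sym6_iff by blast
  define D :: mat6 where "D = (\<chi> i j. if {i, j} = {YY} then ?P $ YY $ YY
     else if {i, j} = {YY, XZ} \<or> {i, j} = {XY, YZ} then ?P $ YY $ XZ
     else if {i, j} = {YY, YZ} then ?P $ YY $ YZ - k * ?P $ YY $ XZ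
     else if {i, j} = {YY, ZZ} \<or> {i, j} = {YZ} then ?P $ YZ $ YZ
     else if {i, j} = {XX, ZZ} \<or> {i, j} = {XZ} then ?P $ XZ $ XZ
     else if {i, j} = {XY, ZZ} \<or> {i, j} = {XZ, YZ} then ?P $ XZ $ YZ
     else if {i, j} = {XZ, ZZ} then ?P $ XZ $ ZZ
     else if {i, j} = {YZ, ZZ} then ?P $ YZ $ ZZ
     else if {i, j} = {ZZ} then ?P $ ZZ $ ZZ else 0)"
  have "D \<in> Sym6" unfolding Sym6_iff by (simp add: D_def insert_commute)
  moreover have D_nth: "D $ YY $ YY = ?P $ YY $ YY" "D $ YY $ XZ = ?P $ YY $ XZ" "D $ XY $ YZ = ?P $ YY $ XZ"
    "D $ YY $ YZ = ?P $ YY $ YZ - k * ?P $ YY $ XZ" "D $ YY $ ZZ = ?P $ YZ $ YZ" "D $ YZ $ YZ = ?P $ YZ $ YZ"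
    "D $ XX $ ZZ = ?P $ XZ $ XZ" "D $ XZ $ XZ = ?P $ XZ $ XZ" "D $ XY $ ZZ = ?P $ XZ $ YZ" "D $ XZ $ YZ = ?P $ XZ $ YZ"
    "D $ XZ $ ZZ = ?P $ XZ $ ZZ" "D $ YZ $ ZZ = ?P $ YZ $ ZZ" "D $ ZZ $ ZZ = ?P $ ZZ $ ZZ"
    "D $ XX $ YY = 0" "D $ XY $ XY = 0" "D $ XX $ YZ = 0" "D $ XY $ XZ = 0" "D $ ZZ $ XY = ?P $ XZ $ YZ" "D $ XY $ YY = 0"
    by (simp_all add: D_def doubleton_eq_iff)
  ultimately have D: "D \<in> Cat" unfolding Cat_iff by simp
  have D_sym: "D $ i $ j = D $ j $ i" for i j using \<open>D \<in> Sym6\<close> Sym6_iff by blast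
  show ?thesis
  proof (rule limit_pair_on_kernel[OF rank2_ker_frame[OF A]])
    show "A \<in> Cat - {0}" using A by (auto simp: rank2_form_def)
    show "D \<in> Cat" by (rule D)
    show "X \<in> Sym_on KI" by (rule X)
    show "X \<noteq> 0" using X(3) by (auto simp: det4_def)
    show "?P \<in> Sym_on KI" by (rule adj4_Sym_on)
    have "X \<in> Sym6" using X(1) unfolding Sym_on_def by blast
    have X0: "X $ i $ j = 0" if "i \<notin> KI \<or> j \<notin> KI" for i j using X(1) that unfolding Sym_on_def by blast
    have P0: "?P $ i $ j = 0" if "i \<notin> KI \<or> j \<notin> KI" for i j using adj4_Sym_on that unfolding Sym_on_def by blast
    have X_sym: "X $ i $ j = X $ j $ i" for i j using \<open>X \<in> Sym6\<close> Sym6_iff by blast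
    have "(?P ** X) $ i $ j = cscale (det4 X) (id_on KI) $ i $ j" for i j
    proof (cases "i \<in> KI \<and> j \<in> KI")
      case True
      have "(?P ** X) $ i $ j = (\<Sum>l\<in>KI. ?P $ i $ l * X $ l $ j)"
        unfolding matrix_mult_nth by (rule sum.mono_neutral_right) (auto simp: P0)
      also have "\<dots> = (\<Sum>l\<in>KI. X $ j $ l * ?P $ l $ i)"
        by (intro sum.cong refl) (simp add: P_sym[of i] X_sym[of _ j] mult.commute)
      also have "\<dots> = (if j = i then det4 X else 0)" using True by (intro block_mult_adj4[OF \<open>X \<in> Sym6\<close>]) auto
      finally show ?thesis using True by (auto simp: id_on_def)
    next
      case False
      then show ?thesis by (auto simp: matrix_mult_nth id_on_def X0 P0)
    qed
    then show "?P ** X = cscale (det4 X) (id_on KI)" by (simp add: mat6_eq_iff)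
    show "det4 X \<noteq> 0" by (rule X)
    fix i j assume ij: "i \<in> KI" "j \<in> KI"
    have "\<forall>i j. i \<in> KI \<longrightarrow> j \<in> KI \<longrightarrow> congr (transpose (shear k)) D $ i $ j = ?P $ i $ j"
      unfolding forall_quad
      by (simp add: KI_def congr_nth sum_quad transpose_def shear_def D_nth P P_sym[of XZ YY] P_sym[of YZ YY] P_sym[of ZZ YY]
        P_sym[of YZ XZ] P_sym[of ZZ XZ] P_sym[of ZZ YZ] D_sym[of XZ YY] D_sym[of YZ YY] D_sym[of ZZ YY]
        D_sym[of YZ XZ] D_sym[of ZZ XZ] D_sym[of ZZ YZ] D_sym[of YY XY] D_sym[of YZ XY] D_sym[of ZZ XY] D_sym[of XZ XY] algebra_simps)
    then show "congr (transpose (shear k)) D $ i $ j = ?P $ i $ j" using ij by blast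
  qed
qed

lemma limit_pairs_rank2_form:
  assumes A: "rank2_form k A" and k: "k = 0 \<or> k = 1"
  shows "limit_pair A B \<longleftrightarrow> (\<exists>X\<in>Sym_on KI - {0}. cubicF k X = 0 \<and> B = congr (shear k) X)"
proof
  assume lim: "limit_pair A B"
  have "KI \<noteq> {}" by (simp add: KI_def)
  obtain X where X: "X \<in> Sym_on KI" "B = congr (shear k) X" "B \<noteq> 0"
    using limit_pair_in_kernel[OF rank2_ker_frame[OF A] \<open>KI \<noteq> {}\<close> lim] by blast
  then show "\<exists>X\<in>Sym_on KI - {0}. cubicF k X = 0 \<and> B = congr (shear k) X"
    using limit_pair_rank2_cubic[OF lim A] cubicF_shear by auto
next
  assume "\<exists>X\<in>Sym_on KI - {0}. cubicF k X = 0 \<and> B = congr (shear k) X"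
  then obtain X where X: "X \<in> Sym_on KI" "X \<noteq> 0" "cubicF k X = 0" and B: "B = congr (shear k) X" by blast
  show "limit_pair A B"
    unfolding limit_pair_def
  proof (intro conjI allI ballI impI)
    show "A \<in> Cat - {0}" using A by (auto simp: rank2_form_def)
    show "B \<in> Sym6 - {0}"
      using X congr_Sym6 congr_eq_0_iff[OF shear_inverse(2)] unfolding B Sym_on_def by blast
    fix d e f
    assume f: "f \<in> bi_forms d e" and van: "\<forall>C\<in>Cat. det C \<noteq> 0 \<longrightarrow> f (C, adjugate C) = 0"
    have "(\<lambda>X. f (A, congr (shear k) X)) \<in> mat_polys"
      unfolding mat_polys_def
      by (rule bi_polys_comp) (use f congr_entry_polys in \<open>auto simp: bi_forms_def mat_polys_def intro: poly_funs.const\<close>)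
    moreover have "f (A, congr (shear k) (cscale c X)) = c ^ e * f (A, congr (shear k) X)" for c X
      using bi_forms_scale[OF f, of 1 A c] by (simp add: congr_cscale cmat.scale_one)
    ultimately have "(\<lambda>X. f (A, congr (shear k) X)) \<in> mat_forms e" unfolding mat_forms_def by blast
    moreover have "f (A, congr (shear k) Y) = 0" if "Y \<in> Sym_on KI" "cubicF k Y = 0" "det4 Y \<noteq> 0" for Y
      using limit_pair_invertible_block[OF A that] f van unfolding limit_pair_def by blast
    ultimately show "f (A, B) = 0"
      unfolding B using invertible_points_dense[OF _ _ k X] by blast
  qed
qed

text \<open>The entries above the diagonal of a skew-symmetric matrix whose Pfaffian is the cubic, as its expansion
  along the first row shows.\<close>

definition skew_coeff :: "complex \<Rightarrow> nat \<Rightarrow> nat \<Rightarrow> mat6 \<Rightarrow> complex" where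
  "skew_coeff k i j C =
    (if (i, j) = (0, 1) then - k * C $ YY $ YY else if (i, j) = (0, 2) then - C $ YY $ YY
     else if (i, j) = (0, 3) then - C $ YY $ YZ else if (i, j) = (0, 4) then C $ YY $ XZ
     else if (i, j) = (0, 5) then C $ YY $ ZZ else if (i, j) = (1, 2) then k * C $ YY $ YZ - C $ YY $ XZ
     else if (i, j) = (1, 3) then k * C $ YY $ ZZ - C $ XZ $ YZ else if (i, j) = (1, 4) then C $ XZ $ XZ
     else if (i, j) = (1, 5) then C $ XZ $ ZZ else if (i, j) = (2, 3) then C $ YY $ ZZ - C $ YZ $ YZ
     else if (i, j) = (2, 4) then C $ XZ $ YZ else if (i, j) = (2, 5) then C $ YZ $ ZZ
     else if (i, j) = (3, 4) then C $ XZ $ ZZ else if (i, j) = (3, 5) then C $ ZZ $ ZZ else 0)"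

definition skew6 :: "complex \<Rightarrow> nat \<Rightarrow> nat \<Rightarrow> mat6 \<Rightarrow> complex" where
  "skew6 k i j C = (if i < j then skew_coeff k i j C else - skew_coeff k j i C)"

lemma skew6_skew: "skew6 k j i C = - skew6 k i j C"
  by (auto simp: skew6_def skew_coeff_def)

lemma skew6_mat_forms: "skew6 k i j \<in> mat_forms 1"
proof -
  have "skew_coeff k i j \<in> mat_polys" for i j
    unfolding skew_coeff_def mat_polys_def
    by (intro poly_funs_if poly_funs_diff poly_funs_minus poly_funs_cmult mat_polys_entry[unfolded mat_polys_def] poly_funs.const)
  then have "skew6 k i j \<in> mat_polys"
    unfolding skew6_def mat_polys_def by (intro poly_funs_if poly_funs_minus) auto
  moreover have "skew_coeff k i j (cscale c C) = c * skew_coeff k i j C" for i j c C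
    unfolding skew_coeff_def by (simp add: if_distrib[of "(*) c"] algebra_simps cong: if_cong)
  then have "skew6 k i j (cscale c C) = c * skew6 k i j C" for c C
    unfolding skew6_def by simp
  ultimately show ?thesis unfolding mat_forms_def by simp
qed

lemma pfaffian_skew6:
  assumes "C \<in> Sym6"
  shows "pfaffian 3 (\<lambda>i j. skew6 k i j C) = cubicF k C"
proof -
  have sym: "C $ i $ j = C $ j $ i" for i j using assms Sym6_iff by blast
  show ?thesis
    unfolding pfaffian_3[OF skew6_skew]
    by (simp add: skew6_def skew_coeff_def cubicF_def adj4_nth det3_def sym[of XZ YY] sym[of YZ YY] sym[of ZZ YY]
      sym[of YZ XZ] sym[of ZZ XZ] sym[of ZZ YZ] algebra_simps)
qed

lemma rank2_image:
  assumes A: "A \<in> Cat" "rank A = 2"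
  shows "\<exists>W F. linear_P 9 W \<and> cubic_hypersurface W F (proj_pt ` {B. limit_pair A B}) \<and>
    (\<exists>M. (\<forall>i<6. \<forall>j<6. M i j \<in> mat_forms 1 \<and> (\<forall>B\<in>W. M j i B = - M i j B)) \<and>
       (\<forall>B\<in>W. F B = pfaffian 3 (\<lambda>i j. M i j B)))"
proof -
  obtain g h k where gh: "g ** h = mat 1" "h ** g = mat 1" and k: "k = 0 \<or> k = 1"
    and nf: "rank2_form k (congr (transpose (rho g)) A)"
    using rank2_normal_form[OF A] by blast
  let ?A = "congr (transpose (rho g)) A"
  define T where "T = rho g ** shear k"
  define S where "S = shear (- k) ** rho h"
  have "S ** T = shear (- k) ** (rho h ** rho g) ** shear k" "T ** S = rho g ** (shear k ** shear (- k)) ** rho h"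
    unfolding S_def T_def by (simp_all add: matrix_mul_assoc)
  then have ST: "S ** T = mat 1" and TS: "T ** S = mat 1"
    by (simp_all add: shear_inverse rho_inverse gh)
  have AA: "congr (transpose (rho h)) ?A = A"
    unfolding congr_mult by (simp add: matrix_transpose_mul[symmetric] rho_inverse[OF gh(1)] transpose_mat)
  have inv: "congr (rho g) (congr (rho h) B) = B" "congr (rho h) (congr (rho g) B) = B" for B
    by (simp_all add: congr_mult rho_inverse gh)
  have lim: "limit_pair A B \<longleftrightarrow> (\<exists>X\<in>Sym_on KI - {0}. cubicF k X = 0 \<and> B = congr T X)" for B
  proof -
    have "limit_pair A B \<longleftrightarrow> limit_pair ?A (congr (rho h) B)"
      using limit_pair_equivariant[OF gh(1), of A B] limit_pair_equivariant[OF gh(2), of ?A "congr (rho h) B"] AA inv by metis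
    also have "\<dots> \<longleftrightarrow> (\<exists>X\<in>Sym_on KI - {0}. cubicF k X = 0 \<and> congr (rho h) B = congr (shear k) X)"
      by (rule limit_pairs_rank2_form[OF nf k])
    finally have "limit_pair A B \<longleftrightarrow> (\<exists>X\<in>Sym_on KI - {0}. cubicF k X = 0 \<and> congr (rho h) B = congr (shear k) X)" .
    moreover have "congr (rho h) B = congr (shear k) X \<longleftrightarrow> B = congr T X" for X
      unfolding T_def congr_mult[symmetric] using inv by metis
    ultimately show ?thesis by simp
  qed
  define W where "W = congr T ` Sym_on KI"
  define F where "F B = cubicF k (congr S B)" for B
  have SW: "congr S (congr T X) = X" for X by (rule congr_inverse[OF ST])
  have "linear_P 9 W" unfolding W_def by (rule linear_P_congr_Sym_on[OF ST]) (simp add: KI_def)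
  moreover have "cubic_hypersurface W F (proj_pt ` {B. limit_pair A B})"
    unfolding cubic_hypersurface_def
  proof (intro conjI ballI impI)
    show "F \<in> mat_forms 3" unfolding F_def using mat_forms_congr[OF cubicF_mat_forms] .
    show "\<exists>B\<in>W. F B \<noteq> 0"
    proof (rule ccontr)
      assume "\<not> (\<exists>B\<in>W. F B \<noteq> 0)"
      then have z: "cubicF k X = 0" if "X \<in> Sym_on KI" for X
        using that SW unfolding W_def F_def by auto
      \<comment> \<open>the square of an arbitrary polynomial times \<open>0\<close> would be a factorization\<close>
      have "(\<lambda>X. X $ YY $ YY) \<in> mat_polys" "(\<lambda>_. 0) \<in> mat_polys"
        using mat_polys_entry mat_forms_const mat_forms_polys by blast+
      from square_factor_constant[OF k this] z have "id_on KI $ YY $ YY = (0 :: mat6) $ YY $ YY"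
        using id_on_in_Sym_on by simp
      then show False by (simp add: id_on_def KI_def)
    qed
    fix G H assume G: "G \<in> mat_polys" and H: "H \<in> mat_polys" and eq: "\<forall>B\<in>W. F B = (G B)\<^sup>2 * H B"
    have "cubicF k X = (G (congr T X))\<^sup>2 * H (congr T X)" if "X \<in> Sym_on KI" for X
      using eq that SW unfolding W_def F_def by auto
    from square_factor_constant[OF k mat_polys_congr[OF G] mat_polys_congr[OF H] this]
    show "\<exists>c. \<forall>B\<in>W. G B = c" unfolding W_def by auto
  next
    show "proj_pt ` {B. limit_pair A B} = {proj_pt B | B. B \<in> W - {0} \<and> F B = 0}"
    proof -
      have "limit_pair A B \<longleftrightarrow> B \<in> W - {0} \<and> F B = 0" for B
        unfolding lim W_def F_def using SW congr_eq_0_iff[OF ST] by auto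
      then show ?thesis by blast
    qed
  qed
  moreover have "F B = pfaffian 3 (\<lambda>i j. skew6 k i j (congr S B))" if "B \<in> W" for B
    using that SW pfaffian_skew6 unfolding F_def W_def Sym_on_def by auto
  ultimately show ?thesis
  proof (intro exI[of _ W] exI[of _ F] conjI exI[of _ "\<lambda>i j B. skew6 k i j (congr S B)"] allI impI ballI)
    show "(\<lambda>B. skew6 k i j (congr S B)) \<in> mat_forms 1" for i j by (rule mat_forms_congr[OF skew6_mat_forms])
    show "skew6 k j i (congr S B) = - skew6 k i j (congr S B)" for i j B by (rule skew6_skew)
  qed
qed

section \<open>Closures of images of polynomial maps\<close>

subsection \<open>Closed irreducible sets\<close>

text \<open>The punctured cone over the Zariski closure of the image of \<open>S\<close> in projective space.\<close>

definition cone_closure :: "mat6 set \<Rightarrow> mat6 set" where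
  "cone_closure S = {B \<in> Sym6 - {0}. \<forall>d. \<forall>f\<in>mat_forms d. (\<forall>C\<in>S. f C = 0) \<longrightarrow> f B = 0}"

lemma cone_closure_mono: "S \<subseteq> S' \<Longrightarrow> cone_closure S \<subseteq> cone_closure S'"
  unfolding cone_closure_def by blast

lemma cone_closure_base: "C \<in> S \<Longrightarrow> C \<in> Sym6 \<Longrightarrow> C \<noteq> 0 \<Longrightarrow> C \<in> cone_closure S"
  unfolding cone_closure_def by blast

lemma cone_closure_form: "B \<in> cone_closure S \<Longrightarrow> f \<in> mat_forms d \<Longrightarrow> (\<And>C. C \<in> S \<Longrightarrow> f C = 0) \<Longrightarrow> f B = 0"
  unfolding cone_closure_def by blast

lemma closedin_cone_closure: "closedin (zariski Sym6) (proj_pt ` cone_closure S)"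
proof -
  have "cone_closure S = {B \<in> Sym6 - {0}. \<forall>f\<in>{f. \<exists>d. f \<in> mat_forms d \<and> (\<forall>C\<in>S. f C = 0)}. f B = 0}"
    unfolding cone_closure_def by blast
  then show ?thesis by (simp only:) (rule closedin_zariski_zero_set, blast)
qed

lemma closed_separating_form:
  assumes C: "closedin (zariski Sym6) C" and p: "p \<in> proj_space Sym6" "p \<notin> C"
  shows "\<exists>A d f. A \<in> Sym6 - {0} \<and> p = proj_pt A \<and> f \<in> mat_forms d \<and> f A \<noteq> 0 \<and>
    (\<forall>B\<in>Sym6 - {0}. f B \<noteq> 0 \<longrightarrow> proj_pt B \<notin> C)"
proof -
  have "openin (zariski Sym6) (proj_space Sym6 - C)" using C unfolding closedin_def topspace_zariski by blast
  from zariski_open_nbhd[OF this] p show ?thesis by blast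
qed

text \<open>The image of a linear space under a polynomial map is irreducible, since nonzero polynomial functions on the
  linear space have a common point at which they do not vanish.\<close>

lemma irreducible_cone_closure:
  assumes H: "cmat.subspace H" and poly: "\<And>i j. (\<lambda>P. \<beta> P $ i $ j) \<in> mat_polys"
    and sym: "\<And>P. P \<in> H \<Longrightarrow> \<beta> P \<in> Sym6" and ne: "Q \<in> H" "\<beta> Q \<noteq> 0"
  shows "irreducible_in (zariski Sym6) (proj_pt ` cone_closure (\<beta> ` H))" (is "irreducible_in _ ?Y")
  unfolding irreducible_in_def
proof (intro conjI allI impI)
  show "?Y \<subseteq> topspace (zariski Sym6)" unfolding topspace_zariski proj_space_def cone_closure_def by blast
  show "?Y \<noteq> {}" using cone_closure_base[of "\<beta> Q" "\<beta> ` H"] ne sym by blast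
  fix C D assume CD: "closedin (zariski Sym6) C \<and> closedin (zariski Sym6) D \<and> ?Y \<subseteq> C \<union> D"
  have "\<exists>d f. f \<in> mat_forms d \<and> (\<exists>P\<in>H. f (\<beta> P) \<noteq> 0) \<and> (\<forall>B\<in>Sym6 - {0}. f B \<noteq> 0 \<longrightarrow> proj_pt B \<notin> C)"
    if C: "closedin (zariski Sym6) C" "\<not> ?Y \<subseteq> C" for C
  proof -
    obtain B where B: "B \<in> cone_closure (\<beta> ` H)" "proj_pt B \<notin> C" using C(2) by blast
    then have "B \<in> Sym6 - {0}" unfolding cone_closure_def by blast
    then obtain A d f where f: "proj_pt B = proj_pt A" "f \<in> mat_forms d" "f A \<noteq> 0"
      "\<forall>B\<in>Sym6 - {0}. f B \<noteq> 0 \<longrightarrow> proj_pt B \<notin> C"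
      using closed_separating_form[OF C(1), of "proj_pt B"] B(2) unfolding proj_space_def by blast
    obtain c where "c \<noteq> 0" "A = cscale c B" by (rule proj_pt_eqE'[OF \<open>B \<in> Sym6 - {0}\<close> f(1)])
    then have "f B \<noteq> 0" using f(2,3) by (auto simp: mat_forms_scale)
    then have "\<exists>P\<in>H. f (\<beta> P) \<noteq> 0" using cone_closure_form[OF B(1) f(2)] by blast
    then show ?thesis using f by blast
  qed
  note sep = this
  show "?Y \<subseteq> C \<or> ?Y \<subseteq> D"
  proof (rule ccontr)
    assume "\<not> (?Y \<subseteq> C \<or> ?Y \<subseteq> D)"
    then have nC: "\<not> ?Y \<subseteq> C" and nD: "\<not> ?Y \<subseteq> D" by blast+
    obtain d f P where f: "f \<in> mat_forms d" "P \<in> H" "f (\<beta> P) \<noteq> 0" "\<And>B. B \<in> Sym6 - {0} \<Longrightarrow> f B \<noteq> 0 \<Longrightarrow> proj_pt B \<notin> C"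
      using sep[of C] CD nC by blast
    obtain e g P' where g: "g \<in> mat_forms e" "P' \<in> H" "g (\<beta> P') \<noteq> 0" "\<And>B. B \<in> Sym6 - {0} \<Longrightarrow> g B \<noteq> 0 \<Longrightarrow> proj_pt B \<notin> D"
      using sep[of D] CD nD by blast
    have comp: "(\<lambda>P. f (\<beta> P)) \<in> mat_polys" if "f \<in> mat_forms d" for f d
      using mat_polys_comp[OF mat_forms_polys[OF that], of \<beta>] poly unfolding mat_polys_def by blast
    obtain i j where ij: "\<beta> Q $ i $ j \<noteq> 0" using ne(2) by (auto simp: mat6_eq_iff)
    obtain E where E: "E \<in> H" "f (\<beta> E) \<noteq> 0" "\<beta> E $ i $ j \<noteq> 0"
      using mat_polys_nonzero_common[OF comp[OF f(1)] poly H f(2,3) ne(1) ij] by blast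
    have "(\<lambda>P. f (\<beta> P) * \<beta> P $ i $ j) \<in> mat_polys"
      using poly_funs.mult comp[OF f(1)] poly[of i j] unfolding mat_polys_def by blast
    from mat_polys_nonzero_common[OF this comp[OF g(1)] H E(1) _ g(2,3)] E
    obtain R where R: "R \<in> H" "f (\<beta> R) \<noteq> 0" "\<beta> R $ i $ j \<noteq> 0" "g (\<beta> R) \<noteq> 0" by auto
    then have "\<beta> R \<noteq> 0" by auto
    then have R6: "\<beta> R \<in> Sym6 - {0}" using R(1) sym by blast
    then have "\<beta> R \<in> cone_closure (\<beta> ` H)" using R(1) by (intro cone_closure_base) auto
    then have "proj_pt (\<beta> R) \<in> ?Y" by (rule imageI)
    then show False using f(4)[OF R6 R(2)] g(4)[OF R6 R(4)] CD by blast
  qed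
qed

definition proj_cone :: "mat6 set set \<Rightarrow> mat6 set" where
  "proj_cone Z = {B \<in> Sym6 - {0}. proj_pt B \<in> Z}"

lemma irreducible_prime:
  assumes Z: "irreducible_in (zariski Sym6) Z" and f: "f \<in> mat_forms d" and g: "g \<in> mat_forms e"
    and prod: "\<And>B. B \<in> proj_cone Z \<Longrightarrow> f B * g B = 0"
  shows "(\<forall>B\<in>proj_cone Z. f B = 0) \<or> (\<forall>B\<in>proj_cone Z. g B = 0)"
proof -
  define C where "C f = proj_pt ` {B \<in> Sym6 - {0}. \<forall>h\<in>{f}. h B = 0}" for f :: "mat6 \<Rightarrow> complex"
  have closed: "closedin (zariski Sym6) (C f)" if "f \<in> mat_forms d" for f d
    unfolding C_def by (rule closedin_zariski_zero_set) (use that in blast)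
  have "Z \<subseteq> proj_space Sym6" using Z unfolding irreducible_in_def topspace_zariski by blast
  have "Z \<subseteq> C f \<union> C g"
  proof
    fix p assume p: "p \<in> Z"
    then obtain B where B: "B \<in> Sym6 - {0}" "p = proj_pt B" using \<open>Z \<subseteq> proj_space Sym6\<close> unfolding proj_space_def by blast
    then have "f B = 0 \<or> g B = 0" using prod p unfolding proj_cone_def by auto
    then show "p \<in> C f \<union> C g" using B unfolding C_def by auto
  qed
  then have "Z \<subseteq> C f \<or> Z \<subseteq> C g" using Z closed[OF f] closed[OF g] unfolding irreducible_in_def by blast
  moreover have "\<forall>B\<in>proj_cone Z. f B = 0" if "Z \<subseteq> C f" and f: "f \<in> mat_forms d" for f d
  proof
    fix B assume B: "B \<in> proj_cone Z"
    then have "proj_pt B \<in> proj_pt ` {B \<in> Sym6 - {0}. \<forall>h\<in>{f}. h B = 0}"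
      using that unfolding proj_cone_def C_def by blast
    then obtain B' where B': "B' \<in> Sym6 - {0}" "proj_pt B = proj_pt B'" "f B' = 0" by blast
    obtain c where "c \<noteq> 0" "B = cscale c B'" by (rule proj_pt_eqE'[OF B'(1) B'(2)[symmetric]])
    then show "f B = 0" using B' f by (simp add: mat_forms_scale)
  qed
  ultimately show ?thesis using f g by blast
qed

subsection \<open>Counting forms\<close>

text \<open>The dimension of an irreducible closed set is read off from the growth of the number of independent
  forms of degree \<open>N\<close> on it.\<close>

definition indep_forms :: "mat6 set \<Rightarrow> nat \<Rightarrow> nat \<Rightarrow> bool" where
  "indep_forms Z N s \<longleftrightarrow> (\<exists>\<phi> :: nat \<Rightarrow> mat6 \<Rightarrow> complex. (\<forall>k<s. \<phi> k \<in> mat_forms N) \<and>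
     (\<forall>c. (\<forall>B\<in>Z. (\<Sum>k<s. c k * \<phi> k B) = 0) \<longrightarrow> (\<forall>k<s. c k = 0)))"

lemma mat_forms_sum:
  assumes "\<And>k. k < s \<Longrightarrow> \<phi> k \<in> mat_forms N"
  shows "(\<lambda>B. \<Sum>k<(s::nat). c k * \<phi> k B) \<in> mat_forms N"
proof -
  have "(\<lambda>B. \<Sum>k<s. c k * \<phi> k B) \<in> mat_polys"
    unfolding mat_polys_def using assms
    by (intro poly_funs_sum poly_funs_cmult) (auto simp: mat_forms_def mat_polys_def)
  moreover have "(\<Sum>k<s. c k * \<phi> k (cscale b B)) = b ^ N * (\<Sum>k<s. c k * \<phi> k B)" for b B
    unfolding sum_distrib_left by (intro sum.cong refl) (use assms in \<open>auto simp: mat_forms_scale\<close>)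
  ultimately show ?thesis unfolding mat_forms_def by blast
qed

text \<open>If a form \<open>F\<close> vanishes on \<open>Z'\<close> but not on the irreducible set \<open>Z\<close>, then the multiples of \<open>F\<close> are
  independent on \<open>Z\<close> of lifts of forms on \<open>Z'\<close>.\<close>

lemma indep_forms_step:
  assumes prime: "\<And>d f. f \<in> mat_forms d \<Longrightarrow> (\<And>B. B \<in> Z \<Longrightarrow> F B * f B = 0) \<Longrightarrow> \<forall>B\<in>Z. f B = 0"
    and F: "F \<in> mat_forms D" "\<And>B. B \<in> Z' \<Longrightarrow> F B = 0" and sub: "Z' \<subseteq> Z"
    and ind: "indep_forms Z N s" "indep_forms Z' (N + D) t"
  shows "indep_forms Z (N + D) (s + t)"
proof -
  obtain \<phi> where \<phi>: "\<And>k. k < s \<Longrightarrow> \<phi> k \<in> mat_forms N"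
    "\<And>c. (\<And>B. B \<in> Z \<Longrightarrow> (\<Sum>k<s. c k * \<phi> k B) = 0) \<Longrightarrow> \<forall>k<s. c k = 0"
    using ind(1) unfolding indep_forms_def by blast
  obtain \<psi> where \<psi>: "\<And>k. k < t \<Longrightarrow> \<psi> k \<in> mat_forms (N + D)"
    "\<And>c. (\<And>B. B \<in> Z' \<Longrightarrow> (\<Sum>k<t. c k * \<psi> k B) = 0) \<Longrightarrow> \<forall>k<t. c k = 0"
    using ind(2) unfolding indep_forms_def by blast
  define \<theta> where "\<theta> k = (if k < s then (\<lambda>B. F B * \<phi> k B) else \<psi> (k - s))" for k
  have split: "(\<Sum>k<s + t. h k) = (\<Sum>k<s. h k) + (\<Sum>k<t. h (s + k))" for h :: "nat \<Rightarrow> complex"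
    by (induction t) (simp_all add: add.assoc)
  have "\<theta> k \<in> mat_forms (N + D)" if "k < s + t" for k
    using mat_forms_mult[OF F(1) \<phi>(1)] \<psi>(1)[of "k - s"] that by (auto simp: \<theta>_def add.commute)
  moreover have "\<forall>k<s + t. c k = 0" if c: "\<forall>B\<in>Z. (\<Sum>k<s + t. c k * \<theta> k B) = 0" for c
  proof -
    have eq: "F B * (\<Sum>k<s. c k * \<phi> k B) + (\<Sum>k<t. c (s + k) * \<psi> k B) = 0" if "B \<in> Z" for B
      using c that unfolding split by (auto simp: \<theta>_def sum_distrib_left mult.left_commute)
    have "(\<Sum>k<t. c (s + k) * \<psi> k B) = 0" if "B \<in> Z'" for B
      using eq[of B] F(2) that sub by auto
    then have z1: "\<forall>k<t. c (s + k) = 0" by (rule \<psi>(2))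
    then have "\<forall>B\<in>Z. (\<Sum>k<s. c k * \<phi> k B) = 0"
      using eq by (intro prime[OF mat_forms_sum[OF \<phi>(1)]]) auto
    then have z2: "\<forall>k<s. c k = 0" using \<phi>(2) by blast
    show ?thesis
    proof (intro allI impI)
      fix k assume "k < s + t"
      then show "c k = 0" using z2 z1[rule_format, of "k - s"] by (cases "k < s") auto
    qed
  qed
  ultimately show ?thesis unfolding indep_forms_def by blast
qed

lemma mat_forms_power: "F \<in> mat_forms D \<Longrightarrow> (\<lambda>B. F B ^ n) \<in> mat_forms (n * D)"
  by (induction n) (use mat_forms_const mat_forms_mult in auto)

text \<open>On the \<open>i\<close>-th member of a chain, Pascal's rule counts at least as many independent forms as there are
  monomials of degree \<open>n\<close> in \<open>i + 1\<close> variables.\<close>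

lemma chain_indep_forms:
  fixes Z :: "nat \<Rightarrow> mat6 set"
  assumes prime: "\<And>i d e f g. i \<le> m \<Longrightarrow> f \<in> mat_forms d \<Longrightarrow> g \<in> mat_forms e \<Longrightarrow> (\<And>B. B \<in> Z i \<Longrightarrow> f B * g B = 0) \<Longrightarrow>
      (\<forall>B\<in>Z i. f B = 0) \<or> (\<forall>B\<in>Z i. g B = 0)"
    and F: "\<And>i. i \<le> m \<Longrightarrow> F i \<in> mat_forms D" "\<And>i. i \<le> m \<Longrightarrow> \<exists>B\<in>Z i. F i B \<noteq> 0"
      "\<And>i B. i < m \<Longrightarrow> B \<in> Z i \<Longrightarrow> F (Suc i) B = 0"
    and sub: "\<And>i. i < m \<Longrightarrow> Z i \<subseteq> Z (Suc i)" and i: "i \<le> m"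
  shows "indep_forms (Z i) (n * D) ((n + i) choose i)"
  using i
proof (induction i arbitrary: n)
  case 0
  obtain B where "B \<in> Z 0" "F 0 B \<noteq> 0" using F(2)[OF 0] by blast
  then show ?case
    unfolding indep_forms_def using mat_forms_power[OF F(1)[OF 0]]
    by (intro exI[of _ "\<lambda>_ B. F 0 B ^ n"]) auto
next
  case (Suc i)
  note IH = Suc.IH[OF Suc_leD[OF Suc.prems]] and le = Suc.prems
  show ?case
  proof (induction n)
    case 0
    obtain B where "B \<in> Z (Suc i)" using F(2)[OF le] by blast
    then show ?case
      unfolding indep_forms_def using mat_forms_const[of 1]
      by (intro exI[of _ "\<lambda>_ _. 1"]) auto
  next
    case (Suc n)
    have "indep_forms (Z (Suc i)) (n * D + D) ((n + Suc i choose Suc i) + (Suc n + i choose i))"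
    proof (rule indep_forms_step[OF _ F(1) _ _ Suc.IH])
      show "\<forall>B\<in>Z (Suc i). f B = 0" if "f \<in> mat_forms d" "\<And>B. B \<in> Z (Suc i) \<Longrightarrow> F (Suc i) B * f B = 0" for d f
        using prime[OF le F(1)[OF le] that(1,2)] F(2) le by blast
      show "indep_forms (Z i) (n * D + D) (Suc n + i choose i)"
        using IH[of "Suc n"] by (simp add: add.commute)
    qed (use le F(3) sub in auto)
    then show ?case by (simp add: add.commute)
  qed
qed

subsection \<open>Forms along a parametrization\<close>

text \<open>The degree of a form along a polynomial curve: compare the curve with its reversal.\<close>

lemma form_degree_on_curve:
  assumes \<phi>: "\<phi> \<in> mat_forms N" and g: "\<And>i j. \<exists>p. degree p \<le> e \<and> (\<forall>x. g x $ i $ j = poly p x)"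
  shows "\<exists>q. degree q \<le> e * N \<and> (\<forall>x. \<phi> (g x) = poly q x)"
proof -
  obtain p where p: "\<And>i j. degree (p i j) \<le> e" "\<And>i j x. g x $ i $ j = poly (p i j) x" using g by metis
  obtain q where q: "\<And>x. \<phi> (g x) = poly q x"
    using mat_polys_on_curve[OF mat_forms_polys[OF \<phi>], of g] p(2) by blast
  define r where "r x = (\<chi> i j. \<Sum>l\<le>e. coeff (p i j) l * x ^ (e - l))" for x
  have "\<exists>p. \<forall>t. r t $ i $ j = poly p t" for i j
    by (rule exI[of _ "\<Sum>l\<le>e. monom (coeff (p i j) l) (e - l)"]) (simp add: r_def poly_sum poly_monom)
  from mat_polys_on_curve[OF mat_forms_polys[OF \<phi>] this]
  obtain R where R: "\<And>x. \<phi> (r x) = poly R x" by blast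
  have rev: "r x = cscale (x ^ e) (g (inverse x))" if "x \<noteq> 0" for x
  proof -
    have "poly (p i j) (inverse x) = (\<Sum>l\<le>e. coeff (p i j) l * inverse x ^ l)" for i j
      unfolding poly_altdef by (rule sum.mono_neutral_left) (use p(1)[of i j] in \<open>auto simp: coeff_eq_0\<close>)
    moreover have "x ^ (e - l) = x ^ e * inverse x ^ l" if "l \<le> e" for l
      using \<open>x \<noteq> 0\<close> that by (simp add: power_diff field_simps)
    ultimately show ?thesis
      by (simp add: mat6_eq_iff r_def p(2) sum_distrib_left mult.left_commute)
  qed
  have "degree q \<le> e * N"
  proof (rule ccontr)
    assume "\<not> degree q \<le> e * N"
    then obtain k where k: "degree q = e * N + Suc k" using less_imp_Suc_add by fastforce
    have "poly (reflect_poly q - monom 1 (Suc k) * R) x = 0" if "poly [:0, 1:] x \<noteq> 0" for x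
    proof -
      have "x \<noteq> 0" using that by simp
      have "poly R x = (x ^ e) ^ N * poly q (inverse x)"
        using R[of x] mat_forms_scale[OF \<phi>] q rev[OF \<open>x \<noteq> 0\<close>] by simp
      then show ?thesis
        using \<open>x \<noteq> 0\<close> by (simp add: poly_reflect_poly_nz k poly_monom power_add power_mult)
    qed
    from poly_zero_if_cofinite[of "[:0, 1:]", OF _ this] have "reflect_poly q = monom 1 (Suc k) * R" by simp
    then have "coeff (reflect_poly q) 0 = 0" by (simp add: coeff_mult)
    then show False using k leading_coeff_0_iff[of q] by auto
  qed
  then show ?thesis using q by blast
qed

definition degree_le :: "nat \<Rightarrow> ((nat \<Rightarrow> complex) \<Rightarrow> complex) \<Rightarrow> bool" where
  "degree_le E F \<longleftrightarrow> (\<forall>i t. \<exists>p. degree p \<le> E \<and> (\<forall>x. F (t(i := x)) = poly p x))"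

definition grid :: "nat \<Rightarrow> nat \<Rightarrow> (nat \<Rightarrow> complex) set" where
  "grid k E = {t. (\<forall>i<k. t i \<in> of_nat ` {..E}) \<and> (\<forall>i\<ge>k. t i = 0)}"

lemma finite_grid: "finite (grid k E) \<and> card (grid k E) \<le> (E + 1) ^ k"
proof -
  let ?h = "\<lambda>(a :: nat \<Rightarrow> nat) i. if i < k then of_nat (a i) else (0 :: complex)"
  have "grid k E \<subseteq> ?h ` ({..<k} \<rightarrow>\<^sub>E {..E})"
  proof
    fix t :: "nat \<Rightarrow> complex" assume t: "t \<in> grid k E"
    then have "\<forall>i. \<exists>a. i < k \<longrightarrow> t i = of_nat a \<and> a \<le> E" unfolding grid_def by blast
    then obtain a where a: "\<And>i. i < k \<Longrightarrow> t i = of_nat (a i) \<and> a i \<le> E" by metis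
    show "t \<in> ?h ` ({..<k} \<rightarrow>\<^sub>E {..E})"
    proof (rule image_eqI)
      show "t = ?h (restrict a {..<k})" using a t unfolding grid_def by (auto simp: fun_eq_iff)
      show "restrict a {..<k} \<in> {..<k} \<rightarrow>\<^sub>E {..E}" using a by (simp add: restrict_PiE_iff)
    qed
  qed
  moreover have fin: "finite ({..<k} \<rightarrow>\<^sub>E {..E})" by (intro finite_PiE) auto
  moreover have "card (?h ` ({..<k} \<rightarrow>\<^sub>E {..E})) \<le> (E + 1) ^ k"
    using card_image_le[OF fin, of ?h] by (simp add: card_PiE)
  ultimately show ?thesis using finite_subset card_mono finite_imageI le_trans by meson
qed

text \<open>A polynomial of degree at most \<open>E\<close> in each variable is determined by its values on a grid with
  \<open>E + 1\<close> points in each direction.\<close>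

lemma zero_on_grid:
  assumes F: "degree_le E F" and z: "\<And>t. t \<in> grid k E \<Longrightarrow> F t = 0" and t: "\<And>i. i \<ge> k \<Longrightarrow> t i = 0"
  shows "F t = 0"
proof -
  have "\<forall>t. (\<forall>i<k. j \<le> i \<longrightarrow> t i \<in> of_nat ` {..E}) \<and> (\<forall>i\<ge>k. t i = 0) \<longrightarrow> F t = 0" if "j \<le> k" for j
    using that
  proof (induction j)
    case 0
    then show ?case using z unfolding grid_def by auto
  next
    case (Suc j)
    show ?case
    proof (intro allI impI)
      fix t :: "nat \<Rightarrow> complex"
      assume t: "(\<forall>i<k. Suc j \<le> i \<longrightarrow> t i \<in> of_nat ` {..E}) \<and> (\<forall>i\<ge>k. t i = 0)"
      obtain p where p: "degree p \<le> E" "\<And>x. F (t(j := x)) = poly p x" using F unfolding degree_le_def by blast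
      have "poly p x = 0" if "x \<in> of_nat ` {..E}" for x
      proof -
        have "F (t(j := x)) = 0" using Suc.IH Suc.prems t that by (auto simp: le_Suc_eq)
        then show ?thesis using p by simp
      qed
      then have sub: "of_nat ` {..E} \<subseteq> {x. poly p x = 0}" by blast
      have "p = 0"
      proof (rule ccontr)
        assume "p \<noteq> 0"
        have "card (of_nat ` {..E} :: complex set) \<le> degree p"
          using card_mono[OF poly_roots_finite[OF \<open>p \<noteq> 0\<close>] sub] card_poly_roots_bound[OF \<open>p \<noteq> 0\<close>] by simp
        moreover have "card (of_nat ` {..E} :: complex set) = Suc E" by (subst card_image) (auto simp: inj_on_def)
        ultimately show False using p(1) by simp
      qed
      then show "F t = 0" using p(2)[of "t j"] by simp
    qed
  qed
  from this[of k] show ?thesis using t by auto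
qed

lemma underdetermined_system:
  fixes C :: "nat \<Rightarrow> 'a \<Rightarrow> complex"
  assumes "finite A" "finite K" "card A < card K"
  shows "\<exists>c. (\<exists>k\<in>K. c k \<noteq> 0) \<and> (\<forall>a\<in>A. (\<Sum>k\<in>K. c k * C k a) = 0)"
  using assms
proof (induction A arbitrary: K C rule: finite_induct)
  case empty
  then show ?case by (intro exI[of _ "\<lambda>_. 1"]) (auto simp: card_gt_0_iff)
next
  case (insert a A)
  show ?case
  proof (cases "\<forall>k\<in>K. C k a = 0")
    case True
    have "card A < card K" using insert by simp
    from insert.IH[OF insert.prems(1) this, of C] show ?thesis using True by auto
  next
    case False
    then obtain l where l: "l \<in> K" "C l a \<noteq> 0" by blast
    define C' where "C' k b = C k b - C k a / C l a * C l b" for k b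
    have "card A < card (K - {l})" using insert l by simp
    from insert.IH[OF _ this, of C'] insert.prems obtain c
      where c: "\<exists>k\<in>K - {l}. c k \<noteq> 0" "\<And>b. b \<in> A \<Longrightarrow> (\<Sum>k\<in>K - {l}. c k * C' k b) = 0" by auto
    define c' where "c' = c(l := - (\<Sum>k\<in>K - {l}. c k * C k a) / C l a)"
    have sum: "(\<Sum>k\<in>K. c' k * C k b) = (\<Sum>k\<in>K - {l}. c k * C' k b)" for b
    proof -
      have "(\<Sum>k\<in>K. c' k * C k b) = c' l * C l b + (\<Sum>k\<in>K - {l}. c k * C k b)"
        using insert.prems(1) l(1) by (simp add: sum.remove c'_def)
      also have "\<dots> = (\<Sum>k\<in>K - {l}. c k * C' k b)"
        unfolding C'_def right_diff_distrib sum_subtractf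
        by (simp add: c'_def sum_distrib_left sum_distrib_right sum_divide_distrib mult_ac)
      finally show ?thesis .
    qed
    have "C' k a = 0" for k using l by (simp add: C'_def)
    then have "(\<Sum>k\<in>K. c' k * C k b) = 0" if "b \<in> insert a A" for b
      using that c(2) unfolding sum by auto
    moreover have "\<exists>k\<in>K. c' k \<noteq> 0" using c(1) by (auto simp: c'_def)
    ultimately show ?thesis by blast
  qed
qed

text \<open>A combination of more than \<open>(e N + 1)\<^sup>k\<close> forms can be chosen to vanish on the grid, hence along the whole
  parametrization.\<close>

lemma indep_forms_bound:
  fixes \<gamma> :: "(nat \<Rightarrow> complex) \<Rightarrow> mat6"
  assumes deg: "\<And>i j. degree_le e (\<lambda>t. \<gamma> t $ i $ j)"
    and dense: "\<And>N \<phi>. \<phi> \<in> mat_forms N \<Longrightarrow> (\<And>t. (\<And>i. i \<ge> k \<Longrightarrow> t i = 0) \<Longrightarrow> \<phi> (\<gamma> t) = 0) \<Longrightarrow> \<forall>B\<in>Z. \<phi> B = 0"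
    and ind: "indep_forms Z N s"
  shows "s \<le> (e * N + 1) ^ k"
proof (rule ccontr)
  assume s: "\<not> s \<le> (e * N + 1) ^ k"
  obtain \<phi> where \<phi>: "\<And>l. l < s \<Longrightarrow> \<phi> l \<in> mat_forms N"
    "\<And>c. \<forall>B\<in>Z. (\<Sum>l<s. c l * \<phi> l B) = 0 \<Longrightarrow> \<forall>l<s. c l = 0"
    using ind unfolding indep_forms_def by blast
  have "card (grid k (e * N)) < card {..<s}" using finite_grid[of k "e * N"] s by simp
  from underdetermined_system[OF _ _ this, of "\<lambda>l t. \<phi> l (\<gamma> t)"] finite_grid
  obtain c where c: "\<exists>l\<in>{..<s}. c l \<noteq> 0" "\<And>t. t \<in> grid k (e * N) \<Longrightarrow> (\<Sum>l<s. c l * \<phi> l (\<gamma> t)) = 0" by blast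
  let ?f = "\<lambda>B. \<Sum>l<s. c l * \<phi> l B"
  have f: "?f \<in> mat_forms N" by (rule mat_forms_sum[OF \<phi>(1)])
  have "degree_le (e * N) (\<lambda>t. ?f (\<gamma> t))"
    unfolding degree_le_def
  proof (intro allI)
    fix i and t :: "nat \<Rightarrow> complex"
    show "\<exists>p. degree p \<le> e * N \<and> (\<forall>x. ?f (\<gamma> (t(i := x))) = poly p x)"
      by (rule form_degree_on_curve[OF f]) (use deg in \<open>auto simp: degree_le_def\<close>)
  qed
  from zero_on_grid[OF this c(2)] have "\<forall>B\<in>Z. ?f B = 0" by (intro dense[OF f]) blast
  then have "\<forall>l<s. c l = 0" by (rule \<phi>(2))
  then show False using c(1) by blast
qed

subsection \<open>The Krull dimension\<close>

lemma pow_le_binomial: "(n + 1) ^ m \<le> (n + m choose m) * fact m"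
proof (induction m)
  case (Suc m)
  have "(n + 1) ^ Suc m \<le> (Suc n + m) * ((n + m choose m) * fact m)"
    using mult_le_mono[OF _ Suc.IH, of "n + 1" "Suc n + m"] by simp
  also have "\<dots> = Suc (n + m) * (n + m choose m) * fact m" by (simp only: add_Suc mult.assoc)
  also have "\<dots> = (n + Suc m choose Suc m) * fact (Suc m)"
    unfolding Suc_times_binomial_eq by (simp only: add_Suc_right fact_Suc of_nat_id mult.assoc)
  finally show ?case .
qed simp

lemma polynomial_growth_contradiction:
  assumes "\<And>n. (n + Suc k choose Suc k) \<le> (a * n + 1) ^ k"
  shows False
proof -
  define L where "L = fact (Suc k) * (a + 1) ^ k"
  have "(L + 1) ^ Suc k \<le> fact (Suc k) * (a * L + 1) ^ k"
    using le_trans[OF pow_le_binomial mult_le_mono1[OF assms]] by (simp add: mult.commute)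
  also have "\<dots> \<le> fact (Suc k) * ((a + 1) * (L + 1)) ^ k"
    by (intro mult_le_mono2 power_mono) auto
  also have "\<dots> = L * (L + 1) ^ k" unfolding power_mult_distrib mult.assoc[symmetric] by (simp only: L_def)
  finally have "(L + 1) * (L + 1) ^ k \<le> L * (L + 1) ^ k" by simp
  then show False by simp
qed

text \<open>A chain of length greater than \<open>k\<close> would give growth of order \<open>N\<^sup>k\<^sup>+\<^sup>1\<close>, but a parametrization by
  \<open>k\<close> variables allows only \<open>N\<^sup>k\<close>.\<close>

lemma chain_length_bound:
  fixes Z :: "nat \<Rightarrow> mat6 set set"
  assumes Z: "\<And>i. i \<le> n \<Longrightarrow> closedin (zariski Sym6) (Z i) \<and> irreducible_in (zariski Sym6) (Z i) \<and> Z i \<subseteq> proj_pt ` K"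
    and chain: "\<And>i. i < n \<Longrightarrow> Z i \<subset> Z (Suc i)"
    and deg: "\<And>i j. degree_le e (\<lambda>t. \<gamma> t $ i $ j)"
    and dense: "\<And>N \<phi>. \<phi> \<in> mat_forms N \<Longrightarrow> (\<And>t. (\<And>i. i \<ge> k \<Longrightarrow> t i = 0) \<Longrightarrow> \<phi> (\<gamma> t) = 0) \<Longrightarrow> \<forall>B\<in>K. \<phi> B = 0"
    and K: "K \<subseteq> Sym6 - {0}"
  shows "n \<le> k"
proof (rule ccontr)
  assume "\<not> n \<le> k"
  then have kn: "Suc k \<le> n" by simp
  have sub: "Z i \<subseteq> proj_space Sym6" if "i \<le> n" for i using Z[OF that] unfolding irreducible_in_def topspace_zariski by blast
  have "\<exists>d f. d > 0 \<and> f \<in> mat_forms d \<and> (\<exists>B\<in>proj_cone (Z i). f B \<noteq> 0) \<and> (\<forall>j. i = Suc j \<longrightarrow> (\<forall>B\<in>proj_cone (Z j). f B = 0))"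
    if i: "i \<le> n" for i
  proof (cases i)
    case 0
    have "Z i \<noteq> {}" using Z[OF i] unfolding irreducible_in_def by blast
    then obtain B where B: "B \<in> Sym6 - {0}" "proj_pt B \<in> Z i" using sub[OF i] unfolding proj_space_def by blast
    then obtain p q where "B $ p $ q \<noteq> 0" by (auto simp: mat6_eq_iff)
    moreover have "(\<lambda>A. A $ p $ q) \<in> mat_forms 1" using mat_polys_entry by (simp add: mat_forms_def)
    ultimately show ?thesis using 0 B unfolding proj_cone_def by (intro exI[of _ 1] exI[of _ "\<lambda>A. A $ p $ q"]) auto
  next
    case (Suc j)
    then obtain p where p: "p \<in> Z i" "p \<notin> Z j" using chain[of j] i by auto
    have "p \<in> proj_space Sym6" "closedin (zariski Sym6) (Z j)" using sub[OF i] p Z[of j] Suc i by auto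
    then obtain A d f where f: "A \<in> Sym6 - {0}" "p = proj_pt A" "f \<in> mat_forms d" "f A \<noteq> 0"
      "\<And>B. B \<in> Sym6 - {0} \<Longrightarrow> f B \<noteq> 0 \<Longrightarrow> proj_pt B \<notin> Z j"
      using closed_separating_form[of "Z j" p] p by blast
    have van: "\<forall>B\<in>proj_cone (Z j). f B = 0" using f(5) unfolding proj_cone_def by blast
    have "d > 0"
    proof (rule ccontr)
      assume "\<not> d > 0"
      then have const: "f (cscale 0 B) = f B" for B using mat_forms_scale[OF f(3), of 0 B] by simp
      have "Z j \<noteq> {}" using Z[of j] Suc i unfolding irreducible_in_def by simp
      then obtain B where B: "B \<in> proj_cone (Z j)" using sub[of j] Suc i unfolding proj_space_def proj_cone_def by force
      then have "f B = f A" using const[of B] const[of A] by (simp add: cscale_def)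
      then show False using van B f(4) by auto
    qed
    moreover have "A \<in> proj_cone (Z i)" using f p unfolding proj_cone_def by blast
    ultimately show ?thesis using f van Suc by (intro exI[of _ d] exI[of _ f]) auto
  qed
  then obtain d f where f: "\<And>i. i \<le> n \<Longrightarrow> d i > 0 \<and> f i \<in> mat_forms (d i) \<and> (\<exists>B\<in>proj_cone (Z i). f i B \<noteq> 0) \<and>
      (\<forall>j. i = Suc j \<longrightarrow> (\<forall>B\<in>proj_cone (Z j). f i B = 0))"
    by metis
  \<comment> \<open>bring the separating forms to a common degree\<close>
  define D where "D = (\<Prod>i\<le>n. d i)"
  define F where "F i B = f i B ^ (D div d i)" for i B
  have D: "D div d i * d i = D" "D div d i > 0" if "i \<le> n" for i
  proof -
    have "d i dvd D" unfolding D_def by (rule dvd_prodI) (use that in auto)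
    moreover have "D > 0" unfolding D_def using f by (intro prod_pos) auto
    ultimately show "D div d i * d i = D" "D div d i > 0" using f that by (auto simp: div_greater_zero_iff dvd_imp_le)
  qed
  have ind: "indep_forms (proj_cone (Z (Suc k))) (m * D) (m + Suc k choose Suc k)" for m
  proof (rule chain_indep_forms[where Z = "\<lambda>i. proj_cone (Z i)" and F = F and m = n])
    show "F i \<in> mat_forms D" if "i \<le> n" for i
      using mat_forms_power[of "f i" "d i" "D div d i"] f[OF that] D[OF that] unfolding F_def by simp
    show "\<exists>B\<in>proj_cone (Z i). F i B \<noteq> 0" if "i \<le> n" for i using f[OF that] unfolding F_def by auto
    show "F (Suc i) B = 0" if "i < n" "B \<in> proj_cone (Z i)" for i B
      using f[of "Suc i"] D[of "Suc i"] that unfolding F_def by auto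
    show "proj_cone (Z i) \<subseteq> proj_cone (Z (Suc i))" if "i < n" for i
      using chain[OF that] unfolding proj_cone_def by blast
    show "(\<forall>B\<in>proj_cone (Z i). u B = 0) \<or> (\<forall>B\<in>proj_cone (Z i). v B = 0)"
      if "i \<le> n" "u \<in> mat_forms d" "v \<in> mat_forms e" "\<And>B. B \<in> proj_cone (Z i) \<Longrightarrow> u B * v B = 0" for i d e u v
      using irreducible_prime[OF _ that(2-4)] Z[OF that(1)] by blast
  qed (rule kn)
  have dense': "\<forall>B\<in>proj_cone (Z (Suc k)). \<phi> B = 0"
    if \<phi>: "\<phi> \<in> mat_forms N" "\<And>t. (\<And>i. i \<ge> k \<Longrightarrow> t i = 0) \<Longrightarrow> \<phi> (\<gamma> t) = 0" for N \<phi>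
  proof
    fix B assume "B \<in> proj_cone (Z (Suc k))"
    then obtain C where C: "C \<in> K" "proj_pt B = proj_pt C" "B \<in> Sym6 - {0}"
      using Z[OF kn] unfolding proj_cone_def by blast
    then obtain c where "B = cscale c C" using K by (metis proj_pt_eqE' subsetD)
    then show "\<phi> B = 0" using dense[OF \<phi>] C(1) mat_forms_scale[OF \<phi>(1)] by auto
  qed
  have "(m + Suc k choose Suc k) \<le> (e * D * m + 1) ^ k" for m
    using indep_forms_bound[OF deg dense' ind[of m]] by (simp add: mult_ac)
  then show False by (rule polynomial_growth_contradiction)
qed

section \<open>Points of rank one: the dimension of the image\<close>

subsection \<open>Inverting blocks\<close>

lemma matrix_mult_add_left: "((A :: mat6) + B) ** C = A ** C + B ** (C :: mat6)"
  by (simp add: mat6_eq_iff matrix_mult_nth sum.distrib distrib_right)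

lemma block_inverse_unique:
  assumes P: "P \<in> Sym_on I" and B: "B \<in> Sym_on I" and PB: "P ** B = cscale s (id_on I)" "s \<noteq> 0"
  shows "det (P + id_on (- I)) \<noteq> 0" "B = cscale (s / det (P + id_on (- I))) (block_adj I P)"
proof -
  have zero: "P ** id_on (- I) = 0" "id_on (- I) ** B = 0"
    using P B by (auto simp: mat6_eq_iff mult_id_on_nth id_on_mult_nth Sym_on_def)
  have "(P + id_on (- I)) ** (B + cscale s (id_on (- I)))
    = P ** B + cscale s (P ** id_on (- I)) + (id_on (- I) ** B + cscale s (id_on (- I) ** id_on (- I)))"
    by (simp add: matrix_add_ldistrib matrix_mult_add_left cscale_mult_right cmat.scale_right_distrib)
  also have "\<dots> = mat s"
    unfolding PB zero by (auto simp: mat6_eq_iff id_on_nth id_on_mult_nth mat_nth)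
  finally show det: "det (P + id_on (- I)) \<noteq> 0" using PB(2) by (rule det_nonzero_if_scalar)
  have id: "id_on I ** B = B" "block_adj I P ** id_on I = block_adj I P"
    using B by (auto simp: mat6_eq_iff id_on_mult_nth mult_id_on_nth Sym_on_def block_adj_nth)
  have "cscale (det (P + id_on (- I))) B = block_adj I P ** (P ** B)"
    unfolding matrix_mul_assoc block_adj_mult[OF P det] by (simp add: cscale_mult_left id)
  also have "\<dots> = cscale s (block_adj I P)" unfolding PB by (simp add: cscale_mult_right id)
  finally have "cscale (det (P + id_on (- I))) B = cscale s (block_adj I P)" .
  then show "B = cscale (s / det (P + id_on (- I))) (block_adj I P)"
    using det by (simp add: mat6_eq_iff field_simps)
qed

lemma block_adj_mat_polys: "(\<lambda>X. block_adj I X $ i $ j) \<in> mat_polys"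
proof -
  have "(\<lambda>X. adjugate (X + id_on (- I)) $ i $ j) \<in> mat_polys"
    by (rule mat_polys_shift[OF adjugate_mat_polys])
  then show ?thesis unfolding block_adj_nth mat_polys_def by (intro poly_funs_if poly_funs.const)
qed

lemma block_adj_Sym6:
  assumes X: "X \<in> Sym_on I"
  shows "block_adj I X \<in> Sym6"
  unfolding Sym6_iff
proof (intro allI)
  fix i j
  have "block_adj I X $ i $ j - block_adj I X $ j $ i = 0"
  proof (rule mat_polys_zero_if_prod_zero[OF _ _ subspace_Sym_on _ id_on_in_Sym_on _ X])
    show "(\<lambda>X. block_adj I X $ i $ j - block_adj I X $ j $ i) \<in> mat_polys"
      using block_adj_mat_polys unfolding mat_polys_def by (intro poly_funs_diff)
    show "(\<lambda>X. det (X + id_on (- I))) \<in> mat_polys" by (rule mat_polys_shift[OF det_mat_polys])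
    show "det (id_on I + id_on (- I)) \<noteq> 0" by (simp add: det_id_on_sum)
    fix E assume "E \<in> Sym_on I" "det (E + id_on (- I)) \<noteq> 0"
    then have "block_adj I E \<in> Sym6" using block_adj_Sym_on unfolding Sym_on_def by blast
    then show "block_adj I E $ i $ j - block_adj I E $ j $ i = 0" using Sym6_iff by simp
  qed
  then show "block_adj I X $ i $ j = block_adj I X $ j $ i" by simp
qed

lemma block_adj_in_Sym_on: "X \<in> Sym_on I \<Longrightarrow> block_adj I X \<in> Sym_on I"
  using block_adj_Sym6[of X I] by (auto simp: Sym_on_def block_adj_nth)

text \<open>In the determinants that define the cofactors, all rows in \<open>I\<close> but one are scaled.\<close>

lemma block_adj_cscale:
  assumes X0: "\<And>k l. k \<notin> I \<Longrightarrow> X $ k $ l = 0"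
  shows "block_adj I (cscale c X) = cscale (c ^ (card I - 1)) (block_adj I X)"
proof -
  have "adjugate (cscale c X + id_on (- I)) $ i $ j = c ^ (card I - 1) * adjugate (X + id_on (- I)) $ i $ j"
    if ij: "i \<in> I" "j \<in> I" for i j
  proof -
    define M where "M = (\<chi> k l. if k = j then (if l = i then 1 else 0) else if l = i then 0 else (X + id_on (- I)) $ k $ l)"
    define w where "w k = (if k \<in> I - {j} then c else 1)" for k
    have "(\<chi> k l. if k = j then (if l = i then 1 else 0) else if l = i then 0 else (cscale c X + id_on (- I)) $ k $ l)
      = (\<chi> k. w k *s M $ k)"
      using X0 by (auto simp: vec_eq_iff w_def M_def id_on_nth)
    moreover have "det (\<chi> k. w k *s M $ k) = prod w UNIV * det (\<chi> k. M $ k)" by (rule det_rows_mul)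
    moreover have "prod w UNIV = c ^ (card I - 1)"
    proof -
      have "prod w UNIV = prod (\<lambda>_. c) (I - {j})"
        unfolding w_def by (rule prod.mono_neutral_cong_right) auto
      then show ?thesis using ij by (simp add: card_Diff_singleton)
    qed
    moreover have "(\<chi> k. M $ k) = M" by (simp add: vec_eq_iff)
    ultimately show ?thesis unfolding adjugate_def by (simp add: M_def)
  qed
  then show ?thesis by (simp add: mat6_eq_iff block_adj_nth)
qed

subsection \<open>The blocks of catalecticants\<close>

text \<open>The symmetric matrices on the five monomials other than \<open>x\<^sup>2\<close> that are restrictions of catalecticants,
  with coordinates \<open>v 0, \<dots>, v 11\<close> chosen such that only the last one is nonzero at an invertible block.\<close>

definition block5 :: "(nat \<Rightarrow> complex) \<Rightarrow> mat6" where
  "block5 v = (\<chi> i j.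
     if {i, j} = {XY} then v 11 + v 9 else if {i, j} = {XZ} then v 11 + v 10
     else if {i, j} = {XY, XZ} then v 0 else if {i, j} = {XY, YY} then v 1
     else if {i, j} = {XY, YZ} \<or> {i, j} = {XZ, YY} then v 2
     else if {i, j} = {XY, ZZ} \<or> {i, j} = {XZ, YZ} then v 3
     else if {i, j} = {XZ, ZZ} then v 4 else if {i, j} = {YY} then v 5 else if {i, j} = {YY, YZ} then v 6
     else if {i, j} = {YY, ZZ} \<or> {i, j} = {YZ} then v 11
     else if {i, j} = {YZ, ZZ} then v 7 else if {i, j} = {ZZ} then v 8 else 0)"

definition coord :: "nat \<Rightarrow> mat6 \<Rightarrow> complex" where
  "coord m P = [P $ XY $ XZ, P $ XY $ YY, P $ XY $ YZ, P $ XY $ ZZ, P $ XZ $ ZZ, P $ YY $ YY, P $ YY $ YZ,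
     P $ YZ $ ZZ, P $ ZZ $ ZZ, P $ XY $ XY - P $ YZ $ YZ, P $ XZ $ XZ - P $ YZ $ YZ, P $ YZ $ YZ] ! m"

definition blocks :: "mat6 set" where
  "blocks = {P \<in> Sym_on (- {XX}). P $ XY $ YZ = P $ XZ $ YY \<and> P $ XY $ ZZ = P $ XZ $ YZ \<and> P $ YY $ ZZ = P $ YZ $ YZ}"

lemma block5_nth:
  "block5 v $ XY $ XY = v 11 + v 9" "block5 v $ XZ $ XZ = v 11 + v 10" "block5 v $ XY $ XZ = v 0" "block5 v $ XY $ YY = v 1"
  "block5 v $ XY $ YZ = v 2" "block5 v $ XZ $ YY = v 2" "block5 v $ XY $ ZZ = v 3" "block5 v $ XZ $ YZ = v 3"
  "block5 v $ XZ $ ZZ = v 4" "block5 v $ YY $ YY = v 5" "block5 v $ YY $ YZ = v 6" "block5 v $ YY $ ZZ = v 11"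
  "block5 v $ YZ $ YZ = v 11" "block5 v $ YZ $ ZZ = v 7" "block5 v $ ZZ $ ZZ = v 8"
  by (simp_all add: block5_def doubleton_eq_iff)

lemma block5_blocks: "block5 v \<in> blocks"
proof -
  have "block5 v $ i $ j = block5 v $ j $ i" for i j by (simp add: block5_def insert_commute)
  moreover have "\<forall>i j. i = XX \<or> j = XX \<longrightarrow> block5 v $ i $ j = 0"
    unfolding block5_def by (auto simp: doubleton_eq_iff)
  ultimately show ?thesis by (simp add: blocks_def Sym_on_def Sym6_iff block5_nth)
qed

lemma less_12: "m < 12 \<longleftrightarrow> m \<in> {0,1,2,3,4,5,6,7,8,9,10,11::nat}"
  by (simp add: eval_nat_numeral less_Suc_eq)

lemma coord_block5: "m < 12 \<Longrightarrow> coord m (block5 v) = v m"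
  unfolding less_12 by (auto simp: coord_def block5_nth)

lemma blocks_eqI:
  assumes P: "P \<in> blocks" and Q: "Q \<in> blocks" and eq: "\<And>m. m < 12 \<Longrightarrow> coord m P = coord m Q"
  shows "P = Q"
proof -
  have c: "P $ i $ j = Q $ i $ j" if "(i, j) \<in> {(XY,XZ),(XY,YY),(XY,YZ),(XY,ZZ),(XZ,ZZ),(YY,YY),(YY,YZ),(YZ,ZZ),(ZZ,ZZ),(YZ,YZ)}" for i j
    using that eq[of 0] eq[of 1] eq[of 2] eq[of 3] eq[of 4] eq[of 5] eq[of 6] eq[of 7] eq[of 8] eq[of 11]
    by (auto simp: coord_def)
  have sP: "P $ i $ j = P $ j $ i" and sQ: "Q $ i $ j = Q $ j $ i" for i j
    using P Q unfolding blocks_def Sym_on_def Sym6_iff by blast+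
  have "P $ XY $ XY = Q $ XY $ XY" "P $ XZ $ XZ = Q $ XZ $ XZ"
    using eq[of 9] eq[of 10] c[of YZ YZ] by (auto simp: coord_def)
  moreover have "P $ XZ $ YY = Q $ XZ $ YY" "P $ XZ $ YZ = Q $ XZ $ YZ" "P $ YY $ ZZ = Q $ YY $ ZZ"
    using P Q c[of XY YZ] c[of XY ZZ] c[of YZ YZ] unfolding blocks_def by auto
  moreover have "P $ i $ XX = 0" "Q $ i $ XX = 0" for i
    using P Q unfolding blocks_def Sym_on_def by auto
  moreover have "P $ XX $ i = 0" "Q $ XX $ i = 0" for i using P Q unfolding blocks_def Sym_on_def by auto
  ultimately show ?thesis
    unfolding mat6_eq_iff forall_quad
    using c by (simp add: sP[of XZ XY] sP[of YY XY] sP[of YZ XY] sP[of ZZ XY] sP[of YY XZ] sP[of YZ XZ] sP[of ZZ XZ] sP[of YZ YY] sP[of ZZ YY] sP[of ZZ YZ]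
      sQ[of XZ XY] sQ[of YY XY] sQ[of YZ XY] sQ[of ZZ XY] sQ[of YY XZ] sQ[of YZ XZ] sQ[of ZZ XZ] sQ[of YZ YY] sQ[of ZZ YY] sQ[of ZZ YZ])
qed

text \<open>A complete flag of subspaces, starting at an invertible block.\<close>

definition flag :: "nat \<Rightarrow> mat6 set" where
  "flag k = {P \<in> blocks. \<forall>m. k \<le> m \<and> m < 11 \<longrightarrow> coord m P = 0}"

lemma subspace_blocks: "cmat.subspace blocks"
proof -
  note S = subspace_Sym_on[of "- {XX}"]
  show ?thesis
    unfolding blocks_def using cmat.subspace_0[OF S] cmat.subspace_add[OF S] cmat.subspace_scale[OF S]
    by (intro cmat.subspaceI) auto
qed

lemma coord_linear:
  "coord m (P + Q) = (if m < 12 then coord m P + coord m Q else coord m (P + Q))"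
  "m < 12 \<Longrightarrow> coord m (cscale c P) = c * coord m P"
proof -
  show "coord m (P + Q) = (if m < 12 then coord m P + coord m Q else coord m (P + Q))"
    unfolding less_12 by (auto simp: coord_def)
  show "m < 12 \<Longrightarrow> coord m (cscale c P) = c * coord m P"
    unfolding less_12 by (auto simp: coord_def algebra_simps)
qed

lemma subspace_flag: "cmat.subspace (flag k)"
proof (rule cmat.subspaceI)
  show "0 \<in> flag k"
    using cmat.subspace_0[OF subspace_blocks] coord_linear(2)[of _ 0 0] by (auto simp: flag_def cmat.scale_zero_left)
  show "P + Q \<in> flag k" if "P \<in> flag k" "Q \<in> flag k" for P Q
    using that cmat.subspace_add[OF subspace_blocks] by (auto simp: flag_def coord_linear(1)[of _ P Q])
  show "cscale c P \<in> flag k" if "P \<in> flag k" for c P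
    using that cmat.subspace_scale[OF subspace_blocks] by (auto simp: flag_def coord_linear(2))
qed

lemma flag_mono: "k \<le> l \<Longrightarrow> flag k \<subseteq> flag l"
  unfolding flag_def by auto

lemma flag_11: "flag 11 = blocks"
  unfolding flag_def by auto

definition base_block :: mat6 where "base_block = block5 (\<lambda>m. if m = 11 then 1 else 0)"

lemma base_block_flag: "base_block \<in> flag k"
  by (auto simp: flag_def base_block_def block5_blocks coord_block5)

lemma base_block_invertible: "det (base_block + id_on (- (- {XX}))) \<noteq> 0"
proof -
  have "(base_block + id_on {XX}) ** (base_block + id_on {XX}) = mat 1"
    unfolding mat6_eq_iff forall_quad matrix_mult_nth sum_quad
    by (simp add: base_block_def block5_def id_on_nth mat_nth doubleton_eq_iff)
  then show ?thesis using det_nonzero_if_scalar(1)[of "base_block + id_on {XX}"] by simp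
qed

lemma coord_mat_polys: "m < 12 \<Longrightarrow> coord m \<in> mat_polys"
proof -
  have "(\<lambda>P. P $ i $ j - P $ k $ l) \<in> mat_polys" "(\<lambda>P. P $ i $ j) \<in> mat_polys" for i j k l
    using mat_polys_entry unfolding mat_polys_def by (auto intro: poly_funs_diff)
  moreover assume "m < 12"
  ultimately show ?thesis unfolding less_12 coord_def[abs_def] by auto
qed

lemma blocks_Sym_on: "P \<in> blocks \<Longrightarrow> P \<in> Sym_on (- {XX})"
  unfolding blocks_def by blast

lemma det_block_mat_polys: "(\<lambda>P. det (P + id_on (- I))) \<in> mat_polys"
  by (rule mat_polys_shift[OF det_mat_polys])

lemma block_adj_block_adj:
  assumes P: "P \<in> Sym_on I" and det: "det (P + id_on (- I)) \<noteq> 0"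
  shows "\<exists>c. c \<noteq> 0 \<and> block_adj I (block_adj I P) = cscale c P"
proof -
  let ?d = "det (P + id_on (- I))" and ?e = "det (block_adj I P + id_on (- I))"
  note u = block_inverse_unique[OF block_adj_Sym_on[OF P det] P block_adj_mult[OF P det] det]
  then have "block_adj I (block_adj I P) = cscale (?e / ?d) P"
    using det by (simp add: mat6_eq_iff)
  then show ?thesis using u(1) det by (intro exI[of _ "?e / ?d"]) simp
qed

subsection \<open>Dimension\<close>

text \<open>The cone over the closure of the set of inverses of the blocks in \<open>flag k\<close>. For \<open>k = 11\<close> it will turn
  out to be the cone over the image of a point of rank one.\<close>

definition inverse_cone :: "mat6 \<Rightarrow> nat \<Rightarrow> mat6 set" where
  "inverse_cone T k = cone_closure ((\<lambda>P. congr T (block_adj (- {XX}) P)) ` flag k)"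

lemma congr_block_adj_mat_polys: "(\<lambda>P. congr T (block_adj I P) $ i $ j) \<in> mat_polys"
  using mat_polys_comp[OF congr_entry_polys, of "block_adj I"] block_adj_mat_polys unfolding mat_polys_def by blast

lemma card_other_monomials: "card (- {XX}) = 5"
  by (simp add: Compl_eq_Diff_UNIV card_Diff_singleton card_quad_exp)

lemma other_monomials_nonempty: "- {XX} \<noteq> {}"
  using card_other_monomials by (metis card.empty zero_neq_numeral)

lemma congr_block_adj_base:
  assumes ST: "S ** T = mat 1" and P: "P \<in> Sym_on I" "det (P + id_on (- I)) \<noteq> 0" and "I \<noteq> {}"
  shows "congr T (block_adj I P) \<noteq> 0"
proof
  assume "congr T (block_adj I P) = 0"
  then have "block_adj I P = 0" using congr_eq_0_iff[OF ST] by blast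
  then have "cscale (det (P + id_on (- I))) (id_on I) = 0" using mult_block_adj[OF P(1)] by (simp add: mat6_eq_iff matrix_mult_nth)
  then show False using P(2) \<open>I \<noteq> {}\<close> by (auto simp: mat6_eq_iff id_on_nth split: if_splits)
qed

lemma inverse_cone_irreducible:
  assumes "S ** T = mat 1"
  shows "irreducible_in (zariski Sym6) (proj_pt ` inverse_cone T k)"
  unfolding inverse_cone_def
proof (rule irreducible_cone_closure[OF subspace_flag congr_block_adj_mat_polys _ base_block_flag])
  show "congr T (block_adj (- {XX}) base_block) \<noteq> 0"
  proof (rule congr_block_adj_base[OF assms _ base_block_invertible])
    show "base_block \<in> Sym_on (- {XX})" using base_block_flag blocks_Sym_on unfolding flag_def by blast
    show "- {XX} \<noteq> {}" by (rule other_monomials_nonempty)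
  qed
  show "congr T (block_adj (- {XX}) P) \<in> Sym6" if "P \<in> flag k" for P
    using that block_adj_Sym6 blocks_Sym_on congr_Sym6 unfolding flag_def by blast
qed

lemma congr_id_on_nth: "congr (id_on I) X $ i $ j = (if i \<in> I \<and> j \<in> I then X $ i $ j else 0)"
  by (simp add: congr_def id_on_mult_nth mult_id_on_nth)

lemma congr_id_on: "X \<in> Sym_on I \<Longrightarrow> congr (id_on I) X = X"
  by (auto simp: mat6_eq_iff congr_id_on_nth Sym_on_def)

text \<open>Inverting a block twice gives back the block up to a scalar, so the equation of \<open>flag k\<close> in the next
  member of the flag yields a form that separates the two images.\<close>

lemma inverse_cone_strict:
  assumes ST: "S ** T = mat 1" and k: "k < 11"
  shows "proj_pt ` inverse_cone T k \<subset> proj_pt ` inverse_cone T (Suc k)"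
proof -
  let ?J = "- {XX}" and ?\<beta> = "\<lambda>P. congr T (block_adj (- {XX}) P)"
  have SW: "congr S (congr T X) = X" for X by (rule congr_inverse[OF ST])
  define f where "f B = coord k (block_adj ?J (congr (id_on ?J) (congr S B)))" for B
  have k12: "k < 12" using k by simp
  have comp: "(\<lambda>P. coord k (block_adj ?J (h P))) \<in> mat_polys" if h: "\<And>i j. (\<lambda>P. h P $ i $ j) \<in> mat_polys" for h
  proof -
    have "(\<lambda>P. block_adj ?J (h P) $ i $ j) \<in> mat_polys" for i j
      using mat_polys_comp[OF block_adj_mat_polys, of h] h unfolding mat_polys_def by blast
    then show ?thesis
      using mat_polys_comp[OF coord_mat_polys[OF k12], of "\<lambda>P. block_adj ?J (h P)"] unfolding mat_polys_def by blast
  qed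
  have f: "f \<in> mat_forms 4"
  proof -
    have "f \<in> mat_polys"
      unfolding f_def congr_mult by (rule comp[OF congr_entry_polys])
    moreover have "f (cscale c B) = c ^ 4 * f B" for c B
      unfolding f_def congr_cscale
      by (subst block_adj_cscale) (simp_all add: congr_id_on_nth coord_linear(2)[OF k12] card_other_monomials)
    ultimately show ?thesis unfolding mat_forms_def by blast
  qed
  have f_beta: "f (?\<beta> P) = coord k (block_adj ?J (block_adj ?J P))" if "P \<in> flag l" for P l
    using that congr_id_on[OF block_adj_in_Sym_on[OF blocks_Sym_on]] unfolding f_def SW flag_def by simp
  have f0: "f (?\<beta> P) = 0" if P: "P \<in> flag k" for P
    unfolding f_beta[OF P]
  proof (rule mat_polys_zero_if_prod_zero[OF comp[OF block_adj_mat_polys] det_block_mat_polys subspace_flag _ base_block_flag base_block_invertible P])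
    fix E assume E: "E \<in> flag k" "det (E + id_on (- ?J)) \<noteq> 0"
    then obtain c where "block_adj ?J (block_adj ?J E) = cscale c E"
      using block_adj_block_adj[OF blocks_Sym_on] unfolding flag_def by blast
    then show "coord k (block_adj ?J (block_adj ?J E)) = 0"
      using E(1) k by (simp add: coord_linear(2) flag_def)
  qed
  let ?Q = "block5 (\<lambda>m. if m = k then 1 else 0)"
  have Q: "?Q \<in> flag (Suc k)" "coord k ?Q \<noteq> 0"
    using k12 by (auto simp: flag_def block5_blocks coord_block5)
  obtain E where E: "E \<in> flag (Suc k)" "coord k E \<noteq> 0" "det (E + id_on (- ?J)) \<noteq> 0"
    using mat_polys_nonzero_common[OF coord_mat_polys[OF k12] det_block_mat_polys subspace_flag Q base_block_flag base_block_invertible]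
    by blast
  have EJ: "E \<in> Sym_on ?J" using E(1) blocks_Sym_on unfolding flag_def by blast
  obtain c where "c \<noteq> 0" "block_adj ?J (block_adj ?J E) = cscale c E" using block_adj_block_adj[OF EJ E(3)] by blast
  then have fE: "f (?\<beta> E) \<noteq> 0" unfolding f_beta[OF E(1)] using E(2) k12 by (simp add: coord_linear(2))
  have "?\<beta> E \<in> inverse_cone T (Suc k)"
    unfolding inverse_cone_def
  proof (rule cone_closure_base)
    show "?\<beta> E \<noteq> 0" using congr_block_adj_base[OF ST EJ E(3) other_monomials_nonempty] .
    show "?\<beta> E \<in> Sym6" using block_adj_Sym6[OF EJ] congr_Sym6 by blast
  qed (use E(1) in blast)
  moreover have "proj_pt (?\<beta> E) \<notin> proj_pt ` inverse_cone T k"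
  proof
    assume "proj_pt (?\<beta> E) \<in> proj_pt ` inverse_cone T k"
    then obtain B where B: "B \<in> inverse_cone T k" "proj_pt B = proj_pt (?\<beta> E)" by force
    then have "B \<in> Sym6 - {0}" unfolding inverse_cone_def cone_closure_def by blast
    then obtain c where "c \<noteq> 0" "?\<beta> E = cscale c B" using B(2) by (rule proj_pt_eqE')
    moreover have "f B = 0" using cone_closure_form[OF B(1)[unfolded inverse_cone_def] f] f0 by blast
    ultimately show False using fE mat_forms_scale[OF f] by auto
  qed
  moreover have "inverse_cone T k \<subseteq> inverse_cone T (Suc k)"
    unfolding inverse_cone_def using flag_mono[of k "Suc k"] by (intro cone_closure_mono image_mono) simp
  ultimately show ?thesis by blast
qed

lemma degree_le_const: "degree_le E (\<lambda>_. c)"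
  unfolding degree_le_def by (intro allI exI[of _ "[:c:]"]) simp

lemma degree_le_add: "degree_le E F \<Longrightarrow> degree_le E G \<Longrightarrow> degree_le E (\<lambda>t. F t + G t)"
  unfolding degree_le_def
proof (intro allI)
  fix i and t :: "nat \<Rightarrow> complex"
  assume "\<forall>i t. \<exists>p. degree p \<le> E \<and> (\<forall>x. F (t(i := x)) = poly p x)" "\<forall>i t. \<exists>p. degree p \<le> E \<and> (\<forall>x. G (t(i := x)) = poly p x)"
  then obtain p q where "degree p \<le> E" "\<forall>x. F (t(i := x)) = poly p x" "degree q \<le> E" "\<forall>x. G (t(i := x)) = poly q x" by blast
  then show "\<exists>p. degree p \<le> E \<and> (\<forall>x. F (t(i := x)) + G (t(i := x)) = poly p x)"
    by (intro exI[of _ "p + q"]) (simp add: degree_add_le)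
qed

lemma degree_le_mult: "degree_le d F \<Longrightarrow> degree_le e G \<Longrightarrow> degree_le (d + e) (\<lambda>t. F t * G t)"
  unfolding degree_le_def
proof (intro allI)
  fix i and t :: "nat \<Rightarrow> complex"
  assume "\<forall>i t. \<exists>p. degree p \<le> d \<and> (\<forall>x. F (t(i := x)) = poly p x)" "\<forall>i t. \<exists>p. degree p \<le> e \<and> (\<forall>x. G (t(i := x)) = poly p x)"
  then obtain p q where "degree p \<le> d" "\<forall>x. F (t(i := x)) = poly p x" "degree q \<le> e" "\<forall>x. G (t(i := x)) = poly q x" by blast
  then show "\<exists>p. degree p \<le> d + e \<and> (\<forall>x. F (t(i := x)) * G (t(i := x)) = poly p x)"
    using le_trans[OF degree_mult_le add_mono] by (intro exI[of _ "p * q"]) auto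
qed

lemma degree_le_cmult: "degree_le E F \<Longrightarrow> degree_le E (\<lambda>t. c * F t)"
  using degree_le_mult[OF degree_le_const[of 0 c], of E F] by simp

lemma degree_le_sum: "finite A \<Longrightarrow> (\<And>a. a \<in> A \<Longrightarrow> degree_le E (F a)) \<Longrightarrow> degree_le E (\<lambda>t. \<Sum>a\<in>A. F a t)"
  by (induction A rule: finite_induct) (auto intro: degree_le_const degree_le_add)

lemma degree_le_prod: "finite A \<Longrightarrow> (\<And>a. a \<in> A \<Longrightarrow> degree_le 1 (F a)) \<Longrightarrow> degree_le (card A) (\<lambda>t. \<Prod>a\<in>A. F a t)"
proof (induction A rule: finite_induct)
  case (insert a A)
  then have "degree_le (1 + card A) (\<lambda>t. F a t * (\<Prod>a\<in>A. F a t))" by (intro degree_le_mult) auto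
  then show ?case using insert by simp
qed (simp add: degree_le_const)

lemma degree_le_if: "(b \<Longrightarrow> degree_le E F) \<Longrightarrow> (\<not> b \<Longrightarrow> degree_le E G) \<Longrightarrow> degree_le E (\<lambda>t. if b then F t else G t)"
  by (cases b) auto

lemma degree_le_block5: "degree_le 1 (\<lambda>t. block5 (t(11 := 1)) $ i $ j)"
proof -
  have "degree_le 1 (\<lambda>t. (t(11 := 1)) m)" for m :: nat
    unfolding degree_le_def
  proof (intro allI)
    fix i and t :: "nat \<Rightarrow> complex"
    show "\<exists>p. degree p \<le> 1 \<and> (\<forall>x. ((t(i := x))(11 := 1)) m = poly p x)"
      by (rule exI[of _ "if m = 11 then [:1:] else if m = i then [:0, 1:] else [:t m:]"]) auto
  qed
  then show ?thesis
    unfolding block5_def vec_lambda_beta by (intro degree_le_if degree_le_add degree_le_const)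
qed

lemma degree_le_parametrization:
  "degree_le 6 (\<lambda>t. congr T (block_adj I (block5 (t(11 := 1)))) $ i $ j)"
proof -
  have "degree_le 6 (\<lambda>t. adjugate (block5 (t(11 := 1)) + id_on (- I)) $ i $ j)" for i j
  proof -
    have "degree_le (card (UNIV :: quad_exp set)) (\<lambda>t. adjugate (block5 (t(11 := 1)) + id_on (- I)) $ i $ j)"
      unfolding adjugate_def vec_lambda_beta det_def vector_add_component
      by (intro degree_le_sum degree_le_cmult degree_le_prod degree_le_if degree_le_add degree_le_const degree_le_block5) auto
    then show ?thesis by (simp add: card_quad_exp)
  qed
  then have "degree_le 6 (\<lambda>t. block_adj I (block5 (t(11 := 1))) $ i $ j)" for i j
    unfolding block_adj_nth by (intro degree_le_if degree_le_const)
  then have "degree_le 6 (\<lambda>t. \<Sum>k\<in>UNIV. \<Sum>l\<in>UNIV. T $ i $ k * T $ j $ l * block_adj I (block5 (t(11 := 1))) $ k $ l)"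
    by (intro degree_le_sum degree_le_cmult) auto
  then show ?thesis unfolding congr_nth by (simp add: mult_ac)
qed

text \<open>Inversion is homogeneous, so the last of the twelve coordinates of a block may be set to \<open>1\<close>: eleven
  parameters suffice.\<close>

lemma parametrization_dense:
  assumes \<phi>: "\<phi> \<in> mat_forms N" and z: "\<And>t. (\<And>i. i \<ge> 11 \<Longrightarrow> t i = 0) \<Longrightarrow> \<phi> (congr T (block_adj (- {XX}) (block5 (t(11 := 1))))) = 0"
  shows "\<forall>B\<in>inverse_cone T 11. \<phi> B = 0"
proof -
  let ?\<beta> = "\<lambda>P. congr T (block_adj (- {XX}) P)"
  have "\<phi> (?\<beta> P) = 0" if P: "P \<in> flag 11" for P
  proof (rule mat_polys_zero_if_prod_zero[where f = "\<lambda>P. \<phi> (?\<beta> P)" and g = "coord 11" and V = "flag 11" and C = P])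
    show "(\<lambda>P. \<phi> (?\<beta> P)) \<in> mat_polys"
      using mat_polys_comp[OF mat_forms_polys[OF \<phi>], of ?\<beta>] congr_block_adj_mat_polys unfolding mat_polys_def by blast
    show "coord 11 \<in> mat_polys" by (rule coord_mat_polys) simp
    show "coord 11 base_block \<noteq> 0" by (simp add: base_block_def coord_block5)
    fix E assume E: "E \<in> flag 11" "coord 11 E \<noteq> 0"
    define t where "t i = (if i < 11 then coord i E / coord 11 E else 0)" for i
    let ?P = "block5 (t(11 := 1))"
    have PJ: "?P \<in> Sym_on (- {XX})" using block5_blocks blocks_Sym_on by blast
    have "E = cscale (coord 11 E) ?P"
    proof (rule blocks_eqI)
      show "cscale (coord 11 E) ?P \<in> blocks" using cmat.subspace_scale[OF subspace_blocks block5_blocks] .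
      show "coord m E = coord m (cscale (coord 11 E) ?P)" if "m < 12" for m
        using that E(2) less_antisym[of m 11] by (auto simp: coord_linear(2) coord_block5 t_def)
    qed (use E flag_11 in blast)
    then have "?\<beta> E = ?\<beta> (cscale (coord 11 E) ?P)" by simp
    also have "\<dots> = cscale (coord 11 E ^ 4) (?\<beta> ?P)"
      using PJ by (subst block_adj_cscale) (auto simp: Sym_on_def congr_cscale card_other_monomials)
    finally have "\<phi> (?\<beta> E) = (coord 11 E ^ 4) ^ N * \<phi> (?\<beta> ?P)" by (simp add: mat_forms_scale[OF \<phi>])
    then show "\<phi> (?\<beta> E) = 0" using z[of t] by (simp add: t_def)
  qed (use P subspace_flag base_block_flag in auto)
  then show ?thesis unfolding inverse_cone_def using cone_closure_form[OF _ \<phi>] by blast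
qed

lemma krull_dim_inverse_cone:
  assumes ST: "S ** T = mat 1"
  shows "krull_dim (zariski Sym6) (proj_pt ` inverse_cone T 11) = 11"
proof (rule antisym)
  have "n \<le> 11" if "\<forall>i\<le>n. closedin (zariski Sym6) (Z i) \<and> irreducible_in (zariski Sym6) (Z i) \<and> Z i \<subseteq> proj_pt ` inverse_cone T 11"
    "\<forall>i<n. Z i \<subset> Z (Suc i)" for n and Z :: "nat \<Rightarrow> mat6 set set"
  proof (rule chain_length_bound[where Z = Z, OF _ _ degree_le_parametrization parametrization_dense])
    show "inverse_cone T 11 \<subseteq> Sym6 - {0}" unfolding inverse_cone_def cone_closure_def by blast
  qed (use that in auto)
  then show "krull_dim (zariski Sym6) (proj_pt ` inverse_cone T 11) \<le> 11"
    unfolding krull_dim_def by (intro Sup_least) (auto simp: numeral_eq_enat)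
  let ?Z = "\<lambda>k. proj_pt ` inverse_cone T k"
  have "(\<forall>i\<le>11. closedin (zariski Sym6) (?Z i) \<and> irreducible_in (zariski Sym6) (?Z i) \<and> ?Z i \<subseteq> ?Z 11) \<and>
      (\<forall>i<11. ?Z i \<subset> ?Z (Suc i))"
  proof (intro conjI allI impI)
    show "closedin (zariski Sym6) (?Z i)" for i unfolding inverse_cone_def by (rule closedin_cone_closure)
    show "irreducible_in (zariski Sym6) (?Z i)" for i by (rule inverse_cone_irreducible[OF ST])
    show "?Z i \<subset> ?Z (Suc i)" if "i < 11" for i by (rule inverse_cone_strict[OF ST that])
    show "?Z i \<subseteq> ?Z 11" if "i \<le> 11" for i
      unfolding inverse_cone_def using flag_mono[OF that] by (intro image_mono cone_closure_mono) auto
  qed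
  then have "enat 11 \<in> {enat n | n. \<exists>Z :: nat \<Rightarrow> mat6 set set.
     (\<forall>i\<le>n. closedin (zariski Sym6) (Z i) \<and> irreducible_in (zariski Sym6) (Z i) \<and> Z i \<subseteq> ?Z 11) \<and>
     (\<forall>i<n. Z i \<subset> Z (Suc i))}"
    unfolding mem_Collect_eq by (intro exI[of _ 11] conjI[OF refl] exI[of _ ?Z])
  then show "11 \<le> krull_dim (zariski Sym6) (?Z 11)"
    unfolding krull_dim_def numeral_eq_enat by (rule Sup_upper)
qed

section \<open>Points of rank one: the image\<close>

subsection \<open>Normal form\<close>

text \<open>A catalecticant of rank one is the fourth power of a linear form, up to a scalar: a row with a nonzero diagonal
  entry at \<open>x\<^sup>2\<close>, \<open>y\<^sup>2\<close> or \<open>z\<^sup>2\<close> contains the coefficients of the linear form.\<close>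

lemma rank_one_vector:
  assumes A: "A \<in> Cat" "rank A = 1"
  shows "\<exists>c l. c \<noteq> 0 \<and> (l :: complex^3) \<noteq> 0 \<and> (\<forall>i j. A $ i $ j = c * (l $ idx1 i * l $ idx2 i) * (l $ idx1 j * l $ idx2 j))"
proof -
  obtain F where F: "finite F" "card F = 1" "\<And>i. A $ i \<in> vec.span F" using rank_decomposition[of A] A(2) by auto
  then obtain w where w: "F = {w}" by (meson card_1_singletonE)
  have "\<exists>a. A $ i = a *s w" for i using F(3)[of i] unfolding w vec.span_singleton by blast
  then obtain a where a: "\<And>i. A $ i = a i *s w" by metis
  have "A \<in> Sym6" using A(1) Cat_subset_Sym6 by blast
  then have sym: "A $ i $ j = A $ j $ i" for i j using Sym6_iff by blast
  have minor: "A $ i $ j * A $ k $ l = A $ i $ l * A $ k $ j" for i j k l by (simp add: a)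
  have "A \<noteq> 0"
  proof
    assume "A = 0"
    then have "A $ i \<in> vec.span {}" for i by simp
    from rank_le_card[OF this] show False using A(2) by simp
  qed
  note cat = Cat_relations[OF A(1)]
  have main: ?thesis if n: "A $ q $ q \<noteq> 0" and l: "\<forall>i. A $ q $ i = A $ q $ q * (l $ idx1 i * l $ idx2 i)" for q and l :: "complex^3"
  proof -
    have "A $ i $ j = A $ q $ q * (l $ idx1 i * l $ idx2 i) * (l $ idx1 j * l $ idx2 j)" for i j
    proof -
      have "A $ q $ q * A $ i $ j = A $ q $ i * A $ q $ j" using minor[of q q i j] sym[of i q] by simp
      then have "A $ q $ q * A $ i $ j = (A $ q $ q * (l $ idx1 i * l $ idx2 i)) * (A $ q $ q * (l $ idx1 j * l $ idx2 j))"
        using l by metis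
      then show ?thesis using n by simp
    qed
    moreover have "l \<noteq> 0" using l n by (metis mult_zero_left mult_zero_right zero_index)
    ultimately show ?thesis using n by blast
  qed
  obtain i j where ij: "A $ i $ j \<noteq> 0" using \<open>A \<noteq> 0\<close> by (auto simp: mat6_eq_iff)
  then have "A $ i $ i \<noteq> 0" using minor[of i i j j] sym[of j i] by auto
  moreover have "A $ p $ p \<noteq> 0" "A $ q $ q \<noteq> 0" if "A $ p $ q \<noteq> 0" for p q
    using minor[of p p q q] sym[of q p] that by auto
  ultimately consider "A $ XX $ XX \<noteq> 0" | "A $ YY $ YY \<noteq> 0" | "A $ ZZ $ ZZ \<noteq> 0"
    using quad_cases[of i] cat(1-3) by metis
  then show ?thesis
  proof cases
    case 1
    have "A $ XX $ XX * A $ XX $ YY = A $ XX $ XY * A $ XX $ XY" "A $ XX $ XX * A $ XX $ ZZ = A $ XX $ XZ * A $ XX $ XZ"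
      "A $ XX $ XX * A $ XX $ YZ = A $ XX $ XY * A $ XX $ XZ"
      using minor[of XX XX XY XY] minor[of XX XX XZ XZ] minor[of XX XX XY XZ] cat sym[of XY XX] sym[of XZ XX] by simp_all
    then show ?thesis
      by (intro main[OF 1, of "vector [1, A $ XX $ XY / A $ XX $ XX, A $ XX $ XZ / A $ XX $ XX]"])
        (unfold forall_quad, use 1 in \<open>simp add: field_simps\<close>)
  next
    case 2
    have "A $ YY $ YY * A $ YY $ XX = A $ YY $ XY * A $ YY $ XY" "A $ YY $ YY * A $ YY $ ZZ = A $ YY $ YZ * A $ YY $ YZ"
      "A $ YY $ YY * A $ YY $ XZ = A $ YY $ XY * A $ YY $ YZ"
      using minor[of YY YY XY XY] minor[of YY YY YZ YZ] minor[of YY YY XY YZ] cat sym[of XY YY] sym[of YZ YY] sym[of YY XX] by simp_all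
    then show ?thesis
      by (intro main[OF 2, of "vector [A $ YY $ XY / A $ YY $ YY, 1, A $ YY $ YZ / A $ YY $ YY]"])
        (unfold forall_quad, use 2 in \<open>simp add: field_simps\<close>)
  next
    case 3
    have "A $ ZZ $ ZZ * A $ ZZ $ XX = A $ ZZ $ XZ * A $ ZZ $ XZ" "A $ ZZ $ ZZ * A $ ZZ $ YY = A $ ZZ $ YZ * A $ ZZ $ YZ"
      "A $ ZZ $ ZZ * A $ ZZ $ XY = A $ ZZ $ XZ * A $ ZZ $ YZ"
      using minor[of ZZ ZZ XZ XZ] minor[of ZZ ZZ YZ YZ] minor[of ZZ ZZ XZ YZ] cat sym[of XZ ZZ] sym[of YZ ZZ] sym[of ZZ XX] sym[of ZZ YY] by simp_all
    then show ?thesis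
      by (intro main[OF 3, of "vector [A $ ZZ $ XZ / A $ ZZ $ ZZ, A $ ZZ $ YZ / A $ ZZ $ ZZ, 1]"])
        (unfold forall_quad, use 3 in \<open>simp add: field_simps\<close>)
  qed
qed

lemma rank1_normal_form:
  assumes A: "A \<in> Cat" "rank A = 1"
  shows "\<exists>g h c. g ** h = mat 1 \<and> h ** g = mat 1 \<and> c \<noteq> 0 \<and> congr (transpose (rho g)) A = cscale c (id_on {XX})"
proof -
  obtain c l where c: "c \<noteq> 0" and l: "(l :: complex^3) \<noteq> 0"
    and A_eq: "\<And>i j. A $ i $ j = c * (l $ idx1 i * l $ idx2 i) * (l $ idx1 j * l $ idx2 j)"
    using rank_one_vector[OF A] by blast
  obtain g0 h0 :: "complex^3^3" where gh0: "g0 ** h0 = mat 1" "h0 ** g0 = mat 1" "column 3 g0 = l" using complete_to_basis[OF l] by blast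
  define Q :: "complex^3^3" where "Q = vector [vector [0,0,1], vector [0,1,0], vector [1,0,0]]"
  have QQ: "Q ** Q = mat 1"
    by (simp add: Q_def vec_eq_iff forall_3 matrix_matrix_mult_def sum_3 mat_def)
  define g where "g = transpose (Q ** h0)"
  define h where "h = transpose (g0 ** Q)"
  have "(Q ** h0) ** (g0 ** Q) = Q ** (h0 ** g0) ** Q" by (simp add: matrix_mul_assoc)
  then have "(Q ** h0) ** (g0 ** Q) = mat 1" by (simp add: gh0 QQ)
  then have hg: "h ** g = mat 1" by (simp add: g_def h_def matrix_transpose_mul[symmetric] transpose_mat)
  then have gh: "g ** h = mat 1" by (simp add: matrix_left_right_inverse)
  have dot: "(\<Sum>r\<in>UNIV. l $ r * column q g $ r) = (if q = 1 then 1 else 0)" for q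
  proof -
    have "h0 *v l = axis 3 1"
    proof -
      have "h0 *v column 3 g0 = column 3 (h0 ** g0)"
        by (simp add: vec_eq_iff column_def matrix_vector_mult_def matrix_matrix_mult_def)
      then show ?thesis unfolding gh0(2,3) by (simp add: vec_eq_iff column_def mat_def axis_def)
    qed
    then have "(h0 *v l) $ j = axis 3 1 $ j" for j by simp
    then have h0l: "(\<Sum>r\<in>UNIV. h0 $ j $ r * l $ r) = (if j = 3 then 1 else 0)" for j
      by (simp only: matrix_vector_mult_def axis_def vec_lambda_beta)
    have "(\<Sum>r\<in>UNIV. l $ r * column q g $ r) = (\<Sum>j\<in>UNIV. Q $ q $ j * (\<Sum>r\<in>UNIV. h0 $ j $ r * l $ r))"
      by (simp add: g_def column_def transpose_def matrix_matrix_mult_def sum_3 algebra_simps)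
    also have "\<dots> = (if q = 1 then 1 else 0)"
      unfolding h0l by (simp add: Q_def sum_3) (use exhaust_3[of q] in auto)
    finally show ?thesis .
  qed
  let ?L = "\<lambda>p :: complex^quad_exp. \<Sum>q\<in>UNIV. p $ q * (l $ idx1 q * l $ idx2 q)"
  have L: "?L (qprod u v) = (\<Sum>r\<in>UNIV. l $ r * u $ r) * (\<Sum>r\<in>UNIV. l $ r * v $ r)" for u v
    by (simp add: sum_quad sum_3 algebra_simps)
  have bil: "bil A p q = c * ?L p * ?L q" for p q
    unfolding bil_def A_eq by (simp add: sum_distrib_left sum_distrib_right ac_simps)
  have "congr (transpose (rho g)) A $ i $ j = cscale c (id_on {XX}) $ i $ j" for i j
  proof -
    have "?L (column i (rho g)) = (if i = XX then 1 else 0)" for i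
      unfolding column_rho L dot using quad_cases[of i] by auto
    then show ?thesis unfolding congr_transpose_nth bil by (simp add: id_on_nth)
  qed
  then show ?thesis using gh hg c by (auto simp: mat6_eq_iff)
qed

lemma rank1_ker_frame: "c \<noteq> 0 \<Longrightarrow> ker_frame (mat 1) (mat 1) (- {XX}) (cscale c (id_on {XX}))"
proof -
  assume c: "c \<noteq> 0"
  have "(cscale c (id_on {XX}) *v k) $ i = (if i = XX then c * k $ XX else 0)" for k i
    unfolding matrix_mult_vec_nth cscale_nth id_on_nth
    by (simp add: if_distrib[of "\<lambda>x. x * _"] if_distrib[of "\<lambda>x. _ * x"] sum.delta sum.delta' cong: if_cong)
  then have "cscale c (id_on {XX}) *v k = 0 \<longleftrightarrow> k $ XX = 0" for k
    using c by (auto simp: vec_eq_iff)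
  then show ?thesis unfolding ker_frame_def by simp
qed

lemma inverse_cone_frame:
  assumes ST: "S ** T = mat 1" and TS: "T ** S = mat 1"
  shows "B \<in> inverse_cone T k \<longleftrightarrow> congr S B \<in> inverse_cone (mat 1) k"
proof
  assume B: "B \<in> inverse_cone T k"
  then have "B \<in> Sym6" "B \<noteq> 0" unfolding inverse_cone_def cone_closure_def by blast+
  moreover have "f (congr S B) = 0" if f: "f \<in> mat_forms d" "\<And>P. P \<in> flag k \<Longrightarrow> f (block_adj (- {XX}) P) = 0" for f d
    by (rule cone_closure_form[OF B[unfolded inverse_cone_def] mat_forms_congr[OF f(1), of S]])
      (use f(2) congr_inverse[OF ST] in auto)
  ultimately show "congr S B \<in> inverse_cone (mat 1) k"
    unfolding inverse_cone_def cone_closure_def using congr_Sym6[of B S] congr_eq_0_iff[OF TS, of B] by simp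
next
  assume B: "congr S B \<in> inverse_cone (mat 1) k"
  have BB: "congr T (congr S B) = B" by (rule congr_inverse[OF TS])
  have "congr S B \<in> Sym6" "congr S B \<noteq> 0" using B unfolding inverse_cone_def cone_closure_def by blast+
  then have "B \<in> Sym6" "B \<noteq> 0" using congr_Sym6[of "congr S B" T] BB by auto
  moreover have "f B = 0" if f: "f \<in> mat_forms d" "\<And>P. P \<in> flag k \<Longrightarrow> f (congr T (block_adj (- {XX}) P)) = 0" for f d
  proof -
    have "f (congr T (congr S B)) = 0"
      by (rule cone_closure_form[OF B[unfolded inverse_cone_def] mat_forms_congr[OF f(1), of T]]) (use f(2) in auto)
    then show ?thesis using BB by simp
  qed
  ultimately show "B \<in> inverse_cone T k"
    unfolding inverse_cone_def cone_closure_def by blast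
qed

subsection \<open>Limits through invertible blocks\<close>

text \<open>A block is the restriction of the catalecticant with the entries at \<open>(x\<^sup>2, y\<^sup>2)\<close>, \<open>(x\<^sup>2, z\<^sup>2)\<close>,
  \<open>(x\<^sup>2, y z)\<close> copied from those at \<open>(x y, x y)\<close>, \<open>(x z, x z)\<close>, \<open>(x y, x z)\<close>.\<close>

lemma limit_pair_inverse_block:
  assumes c: "c \<noteq> 0" and P: "P \<in> blocks" "det (P + id_on (- (- {XX}))) \<noteq> 0"
  shows "limit_pair (cscale c (id_on {XX})) (block_adj (- {XX}) P)"
proof -
  let ?J = "- {XX}"
  define D :: mat6 where "D = (\<chi> i j. if {i, j} = {XX, YY} then P $ XY $ XY else if {i, j} = {XX, ZZ} then P $ XZ $ XZ
    else if {i, j} = {XX, YZ} then P $ XY $ XZ else P $ i $ j)"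
  have PJ: "P \<in> Sym_on ?J" using blocks_Sym_on[OF P(1)] .
  then have symP: "P $ i $ j = P $ j $ i" for i j unfolding Sym_on_def Sym6_iff by blast
  have "D \<in> Sym6" unfolding Sym6_iff using symP by (simp add: D_def insert_commute)
  then have "D \<in> Cat"
    unfolding Cat_iff using P(1) symP[of ZZ XY] symP[of YY XZ] by (simp add: D_def doubleton_eq_iff blocks_def)
  have ne: "block_adj ?J P \<noteq> 0"
    using congr_block_adj_base[OF _ PJ P(2) other_monomials_nonempty, of "mat 1" "mat 1"] by simp
  have A: "cscale c (id_on {XX}) \<in> Cat - {0}"
  proof -
    have "cscale c (id_on {XX}) \<in> Cat" unfolding Cat_iff Sym6_iff by (auto simp: id_on_nth)
    moreover have "cscale c (id_on {XX}) $ XX $ XX \<noteq> 0" using c by (simp add: id_on_nth)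
    ultimately show ?thesis by (metis DiffI singletonD zero_index)
  qed
  have "limit_pair (cscale c (id_on {XX})) (congr (mat 1) (block_adj ?J P))"
  proof (rule limit_pair_on_kernel[OF rank1_ker_frame[OF c] A \<open>D \<in> Cat\<close> block_adj_Sym_on[OF PJ P(2)] ne PJ mult_block_adj[OF PJ] P(2)])
    show "congr (transpose (mat 1)) D $ i $ j = P $ i $ j" if "i \<in> ?J" "j \<in> ?J" for i j
      using that by (auto simp: transpose_mat D_def doubleton_eq_iff)
  qed
  then show ?thesis by simp
qed

lemma limit_pair_inverse_cone:
  assumes c: "c \<noteq> 0" and B: "B \<in> inverse_cone (mat 1) 11"
  shows "limit_pair (cscale c (id_on {XX})) B"
  unfolding limit_pair_def
proof (intro conjI allI ballI impI)
  let ?A = "cscale c (id_on {XX})" and ?J = "- {XX}"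
  show "?A \<in> Cat - {0}"
    using limit_pair_inverse_block[OF c _ base_block_invertible] base_block_flag unfolding limit_pair_def flag_def by blast
  show "B \<in> Sym6 - {0}" using B unfolding inverse_cone_def cone_closure_def by blast
  fix d e f
  assume f: "f \<in> bi_forms d e" and van: "\<forall>C\<in>Cat. det C \<noteq> 0 \<longrightarrow> f (C, adjugate C) = 0"
  have "(\<lambda>X. f (?A, X)) \<in> mat_polys"
    unfolding mat_polys_def
    by (rule bi_polys_comp) (use f mat_polys_entry in \<open>auto simp: bi_forms_def mat_polys_def intro: poly_funs.const\<close>)
  moreover have "f (?A, cscale b X) = b ^ e * f (?A, X)" for b X
    using bi_forms_scale[OF f, of 1 ?A b] by (simp add: cmat.scale_one)
  ultimately have form: "(\<lambda>X. f (?A, X)) \<in> mat_forms e" unfolding mat_forms_def by blast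
  have "f (?A, block_adj ?J P) = 0" if P: "P \<in> blocks" for P
  proof (rule mat_polys_zero_if_prod_zero[OF _ det_block_mat_polys subspace_blocks _ _ base_block_invertible P])
    show "(\<lambda>P. f (?A, block_adj ?J P)) \<in> mat_polys"
      using mat_polys_comp[OF mat_forms_polys[OF form], of "block_adj ?J"] block_adj_mat_polys unfolding mat_polys_def by blast
    show "base_block \<in> blocks" using base_block_flag unfolding flag_def by blast
    show "f (?A, block_adj ?J E) = 0" if "E \<in> blocks" "det (E + id_on (- ?J)) \<noteq> 0" for E
      using limit_pair_inverse_block[OF c that] f van unfolding limit_pair_def by blast
  qed
  then show "f (?A, B) = 0"
    using cone_closure_form[OF B[unfolded inverse_cone_def] form] flag_11 by auto
qed

subsection \<open>Correcting a Schur complement\<close>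

text \<open>After eliminating \<open>x\<^sup>3 y\<close> and \<open>x\<^sup>3 z\<close>, the Schur complement satisfies two of the three equations of
  \<open>blocks\<close>. The defect in the third is the determinant of the block \<open>x y, x z\<close>, divided by \<open>x\<^sup>4\<close>.\<close>

lemma schur_complement_XX:
  assumes A: "A \<in> Cat" and z: "A $ XX $ XY = 0" "A $ XX $ XZ = 0" and r: "A $ XX $ XX \<noteq> 0" and AB: "A ** B = mat s"
  defines "P \<equiv> (\<chi> i j. A $ i $ j - A $ i $ XX * A $ XX $ j / A $ XX $ XX)"
  shows "P \<in> Sym_on (- {XX})" "P $ XY $ YZ = P $ XZ $ YY" "P $ XY $ ZZ = P $ XZ $ YZ"
    "A $ XX $ XX * (P $ YY $ ZZ - P $ YZ $ YZ) = - (P $ XY $ XY * P $ XZ $ XZ - P $ XY $ XZ * P $ XY $ XZ)"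
    "P ** congr (id_on (- {XX})) B = cscale s (id_on (- {XX}))"
proof -
  have "A \<in> Sym6" using A Cat_subset_Sym6 by blast
  then have sym: "A $ i $ j = A $ j $ i" for i j using Sym6_iff by blast
  note cat = Cat_relations[OF A]
  have P0: "P $ i $ XX = 0" "P $ XX $ i = 0" for i using r by (simp_all add: P_def)
  show "P \<in> Sym_on (- {XX})"
    unfolding Sym_on_def Sym6_iff using P0 sym by (auto simp: P_def mult.commute)
  have z': "A $ XY $ XX = 0" "A $ XZ $ XX = 0" using z sym by metis+
  show "P $ XY $ YZ = P $ XZ $ YY" "P $ XY $ ZZ = P $ XZ $ YZ"
    using cat sym[of XZ YY] sym[of XY ZZ] by (simp_all add: P_def z')
  have P2: "P $ XY $ XY = A $ XX $ YY" "P $ XZ $ XZ = A $ XX $ ZZ" "P $ XY $ XZ = A $ XX $ YZ"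
    "P $ YY $ ZZ = A $ YZ $ YZ - A $ XX $ YY * A $ XX $ ZZ / A $ XX $ XX"
    "P $ YZ $ YZ = A $ YZ $ YZ - A $ XX $ YZ * A $ XX $ YZ / A $ XX $ XX"
    using cat sym[of YY XX] sym[of YZ XX] by (simp_all add: P_def z')
  show "A $ XX $ XX * (P $ YY $ ZZ - P $ YZ $ YZ) = - (P $ XY $ XY * P $ XZ $ XZ - P $ XY $ XZ * P $ XY $ XZ)"
    unfolding P2 using r by (simp add: field_simps)
  have AB': "(\<Sum>l\<in>UNIV. A $ k $ l * B $ l $ j) = (if k = j then s else 0)" for k j
    using AB unfolding matrix_mult_nth[symmetric] by (simp add: mat_nth)
  have "(P ** congr (id_on (- {XX})) B) $ k $ j = cscale s (id_on (- {XX})) $ k $ j" for k j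
  proof (cases "j = XX")
    case False
    have "(P ** congr (id_on (- {XX})) B) $ k $ j = (\<Sum>l\<in>UNIV. P $ k $ l * B $ l $ j)"
      unfolding matrix_mult_nth congr_id_on_nth using False by (intro sum.cong refl) (auto simp: P0)
    also have "\<dots> = (\<Sum>l\<in>UNIV. A $ k $ l * B $ l $ j) - A $ k $ XX / A $ XX $ XX * (\<Sum>l\<in>UNIV. A $ XX $ l * B $ l $ j)"
      unfolding sum_distrib_left sum_subtractf[symmetric]
      by (intro sum.cong refl) (simp add: P_def left_diff_distrib)
    also have "\<dots> = cscale s (id_on (- {XX})) $ k $ j"
      unfolding AB' using False by (auto simp: id_on_nth)
    finally show ?thesis .
  qed (simp add: matrix_mult_nth congr_id_on_nth id_on_nth)
  then show "P ** congr (id_on (- {XX})) B = cscale s (id_on (- {XX}))" by (simp add: mat6_eq_iff)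
qed

text \<open>A unipotent matrix with the block \<open>adj(X) V\<close> in the rows \<open>x y, x z\<close> and the columns \<open>y\<^sup>2, y z, z\<^sup>2\<close>,
  where \<open>X\<close> is the symmetric matrix with rows \<open>(a, b)\<close>, \<open>(b, c)\<close> and \<open>V\<close> is the Hankel matrix with rows
  \<open>(v 0, v 1, v 2)\<close>, \<open>(v 1, v 2, v 3)\<close>.\<close>

definition hankel_shear :: "complex \<Rightarrow> complex \<Rightarrow> complex \<Rightarrow> (nat \<Rightarrow> complex) \<Rightarrow> mat6" where
  "hankel_shear a b c v = (\<chi> i j. if i = j then 1
     else if i = XY \<and> j = YY then c * v 0 - b * v 1 else if i = XY \<and> j = YZ then c * v 1 - b * v 2
     else if i = XY \<and> j = ZZ then c * v 2 - b * v 3 else if i = XZ \<and> j = YY then a * v 1 - b * v 0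
     else if i = XZ \<and> j = YZ then a * v 2 - b * v 1 else if i = XZ \<and> j = ZZ then a * v 3 - b * v 2 else 0)"

lemma hankel_shear_inverse: "hankel_shear a b c v ** hankel_shear (- a) (- b) (- c) v = mat 1"
  unfolding mat6_eq_iff forall_quad matrix_mult_nth sum_quad hankel_shear_def mat_nth by simp

lemma hankel_shear_XX: "hankel_shear a b c v $ XX $ i = (if i = XX then 1 else 0)" "hankel_shear a b c v $ i $ XX = (if i = XX then 1 else 0)"
  by (auto simp: hankel_shear_def)

text \<open>The first two equations of \<open>blocks\<close> say that a block with two rows is a Hankel matrix. They are preserved,
  since \<open>X adj(X) V\<close> is a multiple of \<open>V\<close>. The third one becomes a quadratic equation for \<open>k\<close>.\<close>

lemma hankel_shear_blocks:
  fixes P :: mat6 and k :: complex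
  assumes P: "P \<in> Sym_on (- {XX})" and R: "P $ XY $ YZ = P $ XZ $ YY" "P $ XY $ ZZ = P $ XZ $ YZ"
  defines "a \<equiv> P $ XY $ XY" and "b \<equiv> P $ XY $ XZ" and "c \<equiv> P $ XZ $ XZ"
  assumes q: "P $ YY $ ZZ - P $ YZ $ YZ
      + k * ((c * v 0 - b * v 1) * P $ XY $ ZZ + (a * v 1 - b * v 0) * P $ XZ $ ZZ
           + (c * v 2 - b * v 3) * P $ XY $ YY + (a * v 3 - b * v 2) * P $ XZ $ YY
           - 2 * ((c * v 1 - b * v 2) * P $ XY $ YZ + (a * v 2 - b * v 1) * P $ XZ $ YZ))
      + k * k * (a * c - b * b) * (c * (v 0 * v 2 - v 1 * v 1) - b * (v 0 * v 3 - v 1 * v 2) + a * (v 1 * v 3 - v 2 * v 2)) = 0"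
  shows "congr (transpose (hankel_shear (k * a) (k * b) (k * c) v)) P \<in> blocks"
proof -
  define U where "U = hankel_shear (k * a) (k * b) (k * c) v"
  have sym: "P $ i $ j = P $ j $ i" for i j using P unfolding Sym_on_def Sym6_iff by blast
  have P0: "P $ i $ XX = 0" "P $ XX $ i = 0" for i using P unfolding Sym_on_def by auto
  note sy = sym[of XZ XY] sym[of YY XY] sym[of YZ XY] sym[of ZZ XY] sym[of YY XZ] sym[of YZ XZ] sym[of ZZ XZ] sym[of YZ YY] sym[of ZZ YY] sym[of ZZ YZ]
  have U_nth: "U $ XY $ YY = k * (c * v 0 - b * v 1)" "U $ XY $ YZ = k * (c * v 1 - b * v 2)"
    "U $ XY $ ZZ = k * (c * v 2 - b * v 3)" "U $ XZ $ YY = k * (a * v 1 - b * v 0)"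
    "U $ XZ $ YZ = k * (a * v 2 - b * v 1)" "U $ XZ $ ZZ = k * (a * v 3 - b * v 2)"
    by (simp_all add: U_def hankel_shear_def algebra_simps)
  have U1: "U $ i $ i = 1" for i by (simp add: U_def hankel_shear_def)
  have U0: "U $ i $ j = 0" if "i \<noteq> j" "i \<notin> {XY, XZ} \<or> j \<in> {XY, XZ}" for i j
    using that by (auto simp: U_def hankel_shear_def)
  have nth: "congr (transpose U) P $ i $ j = (\<Sum>p\<in>UNIV. \<Sum>q\<in>UNIV. U $ p $ i * P $ p $ q * U $ q $ j)" for i j
    unfolding congr_nth by (simp add: transpose_def)
  have "congr (transpose U) P \<in> Sym6" using P congr_Sym6 unfolding Sym_on_def by blast
  moreover have "congr (transpose U) P $ i $ j = 0" if "i = XX \<or> j = XX" for i j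
    unfolding nth using that by (intro sum.neutral ballI) (auto simp: U_def hankel_shear_XX P0 split: if_splits)
  moreover have "congr (transpose U) P $ XY $ YZ = congr (transpose U) P $ XZ $ YY"
    "congr (transpose U) P $ XY $ ZZ = congr (transpose U) P $ XZ $ YZ"
    unfolding nth sum_quad by (simp_all add: U0 U1 U_nth P0 sy R a_def[symmetric] b_def[symmetric] c_def[symmetric] algebra_simps)
  moreover have "congr (transpose U) P $ YY $ ZZ - congr (transpose U) P $ YZ $ YZ = 0"
    unfolding nth sum_quad using q
    by (simp add: U0 U1 U_nth P0 sy a_def[symmetric] b_def[symmetric] c_def[symmetric] algebra_simps)
  ultimately show ?thesis unfolding U_def[symmetric] blocks_def Sym_on_def by auto
qed

subsection \<open>Values along a place\<close>

context place
begin

lemma restrict_to_cases: "place {x \<in> X. P x} lim \<or> place {x \<in> X. \<not> P x} lim"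
  using lim_indicator[of P]
proof
  assume l: "lim (\<lambda>x. if P x then 1 else 0) 0"
  have "lim (\<lambda>x. 1 - (if P x then 1 else 0)) (1 - 0)" by (intro lim_diff lim_const l)
  from restrict_nonzero[OF this] have "place {x \<in> X. 1 - (if P x then 1 else 0) \<noteq> (0 :: complex)} lim" by simp
  moreover have "{x \<in> X. 1 - (if P x then 1 else 0) \<noteq> (0 :: complex)} = {x \<in> X. \<not> P x}" by auto
  ultimately show ?thesis by simp
next
  assume l: "lim (\<lambda>x. if P x then 1 else 0) 1"
  from restrict_nonzero[OF l] have "place {x \<in> X. (if P x then 1 else 0) \<noteq> (0 :: complex)} lim" by simp
  moreover have "{x \<in> X. (if P x then 1 else 0) \<noteq> (0 :: complex)} = {x \<in> X. P x}" by auto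
  ultimately show ?thesis by simp
qed

text \<open>Divisibility in the ring of functions that have a value. Any two functions are comparable after restriction
  to a smaller set, on which they vanish nowhere or one of them vanishes everywhere.\<close>

definition multiple_on :: "'x set \<Rightarrow> ('x \<Rightarrow> complex) \<Rightarrow> ('x \<Rightarrow> complex) \<Rightarrow> bool" where
  "multiple_on Y f g \<longleftrightarrow> (\<exists>u l. lim u l \<and> (\<forall>x\<in>Y. f x = u x * g x))"

lemma multiple_on_refl: "multiple_on Y f f"
  unfolding multiple_on_def by (intro exI[of _ "\<lambda>_. 1"] exI[of _ 1]) (simp add: lim_const)

lemma multiple_on_trans:
  assumes "multiple_on Y f g" "multiple_on Y' g h" "Z \<subseteq> Y" "Z \<subseteq> Y'"
  shows "multiple_on Z f h"
proof -
  obtain u l where u: "lim u l" "\<And>x. x \<in> Y \<Longrightarrow> f x = u x * g x" using assms(1) unfolding multiple_on_def by blast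
  obtain v m where v: "lim v m" "\<And>x. x \<in> Y' \<Longrightarrow> g x = v x * h x" using assms(2) unfolding multiple_on_def by blast
  show ?thesis
    unfolding multiple_on_def using lim_mult[OF u(1) v(1)] u(2) v(2) assms(3,4)
    by (intro exI[of _ "\<lambda>x. u x * v x"] exI[of _ "l * m"]) (auto simp: subset_iff)
qed

lemma comparable: "\<exists>Y\<subseteq>X. place Y lim \<and> (multiple_on Y f g \<or> multiple_on Y g f)"
proof (cases "place {x \<in> X. g x = 0} lim")
  case True
  have "multiple_on {x \<in> X. g x = 0} g f"
    unfolding multiple_on_def by (intro exI[of _ "\<lambda>_. 0"] exI[of _ 0]) (simp add: lim_const)
  then show ?thesis using True by (intro exI[of _ "{x \<in> X. g x = 0}"]) auto
next
  case False
  then have g: "place {x \<in> X. g x \<noteq> 0} lim" using restrict_to_cases[of "\<lambda>x. g x = 0"] by blast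
  then interpret g: place "{x \<in> X. g x \<noteq> 0}" lim .
  show ?thesis
  proof (cases "place {x \<in> {x \<in> X. g x \<noteq> 0}. f x = 0} lim")
    case True
    have "multiple_on {x \<in> {x \<in> X. g x \<noteq> 0}. f x = 0} f g"
      unfolding multiple_on_def by (intro exI[of _ "\<lambda>_. 0"] exI[of _ 0]) (simp add: lim_const)
    then show ?thesis using True by (intro exI[of _ "{x \<in> {x \<in> X. g x \<noteq> 0}. f x = 0}"]) auto
  next
    case False
    let ?Y = "{x \<in> {x \<in> X. g x \<noteq> 0}. f x \<noteq> 0}"
    have Y: "place ?Y lim" using False g.restrict_to_cases[of "\<lambda>x. f x = 0"] by blast
    have "multiple_on ?Y f g \<or> multiple_on ?Y g f"
      using lim_or_inverse[of "\<lambda>x. f x / g x"]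
    proof
      assume "\<exists>a. lim (\<lambda>x. f x / g x) a"
      then have "multiple_on ?Y f g" unfolding multiple_on_def by (elim exE) (intro exI conjI, assumption, simp)
      then show ?thesis ..
    next
      assume "lim (\<lambda>x. inverse (f x / g x)) 0"
      then have "multiple_on ?Y g f" unfolding multiple_on_def by (intro exI conjI) (assumption, simp)
      then show ?thesis ..
    qed
    then show ?thesis using Y by (intro exI[of _ ?Y]) auto
  qed
qed

lemma dominant_of_three:
  "\<exists>Y\<subseteq>X. place Y lim \<and> (\<exists>m. (m = a \<or> m = b \<or> m = c) \<and> multiple_on Y a m \<and> multiple_on Y b m \<and> multiple_on Y c m)"
proof -
  obtain Y where Y: "Y \<subseteq> X" "place Y lim" "multiple_on Y a b \<or> multiple_on Y b a" using comparable by blast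
  then obtain m where m: "m = a \<or> m = b" "multiple_on Y a m" "multiple_on Y b m" using multiple_on_refl by blast
  interpret Y: place Y lim by (rule Y)
  obtain Z where Z: "Z \<subseteq> Y" "place Z lim" "multiple_on Z m c \<or> multiple_on Z c m"
    using Y.comparable[of m c] unfolding Y.multiple_on_def multiple_on_def by blast
  from Z(3) show ?thesis
  proof
    assume "multiple_on Z m c"
    then have "multiple_on Z a c" "multiple_on Z b c" using multiple_on_trans[OF _ _ Z(1) subset_refl] m by blast+
    then show ?thesis using Y(1) Z multiple_on_refl by blast
  next
    assume "multiple_on Z c m"
    moreover have "multiple_on Z a m" "multiple_on Z b m"
      using multiple_on_trans[OF _ multiple_on_refl Z(1) subset_refl] m by blast+
    ultimately show ?thesis using Y(1) Z m(1) by blast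
  qed
qed

text \<open>One of the two roots of \<open>s\<^sup>2 + 2 \<tau> s - 1\<close> has a value, since their product is \<open>- 1\<close>.\<close>

lemma root_with_value: "\<exists>s l. lim s l \<and> (\<forall>x. s x * s x + 2 * \<tau> x * s x - 1 = 0)"
proof -
  define s where "s x = - \<tau> x + csqrt (\<tau> x * \<tau> x + 1)" for x
  have s: "s x * s x + 2 * \<tau> x * s x - 1 = 0" for x
  proof -
    have "csqrt (\<tau> x * \<tau> x + 1) * csqrt (\<tau> x * \<tau> x + 1) = \<tau> x * \<tau> x + 1" by (simp add: power2_eq_square[symmetric])
    then show ?thesis by (simp add: s_def algebra_simps)
  qed
  have "(- inverse (s x)) * (- inverse (s x)) + 2 * \<tau> x * (- inverse (s x)) - 1 = 0" for x
  proof -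
    have "s x \<noteq> 0" using s[of x] by auto
    then have "s x * s x * ((- inverse (s x)) * (- inverse (s x)) + 2 * \<tau> x * (- inverse (s x)) - 1) = - (s x * s x + 2 * \<tau> x * s x - 1)"
      by (simp add: field_simps)
    then show ?thesis using s[of x] \<open>s x \<noteq> 0\<close> by (metis minus_zero mult_eq_0_iff)
  qed
  moreover have "(\<exists>l. lim s l) \<or> lim (\<lambda>x. - inverse (s x)) (- 0)"
    using lim_or_inverse[of s] lim_minus[of "\<lambda>x. inverse (s x)" 0] by blast
  ultimately show ?thesis using s by blast
qed

text \<open>The entries \<open>a, b, c\<close> tend to \<open>0\<close>. The scalars \<open>k\<close> solve a quadratic equation whose coefficients
  contain the determinant \<open>a c - b\<^sup>2\<close>; they may be large, but \<open>k a\<close>, \<open>k b\<close>, \<open>k c\<close> tend to \<open>0\<close>, since \<open>k\<close> is a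
  root of the above kind times \<open>1 / sqrt (m r)\<close>, where \<open>m\<close> dominates \<open>a, b, c\<close>. A Hankel matrix with entries
  \<open>v\<close> makes \<open>m\<close> the coefficient of the quadratic term.\<close>

lemma small_solution:
  assumes lim0: "lim a 0" "lim b 0" "lim c 0" and r: "lim r \<rho>" "\<rho> \<noteq> 0" "\<And>x. x \<in> X \<Longrightarrow> r x \<noteq> 0"
  shows "\<exists>Y v k. Y \<subseteq> X \<and> place Y lim \<and> lim (\<lambda>x. k x * a x) 0 \<and> lim (\<lambda>x. k x * b x) 0 \<and> lim (\<lambda>x. k x * c x) 0 \<and>
    (\<forall>x\<in>Y. - (a x * c x - b x * b x) / r x + k x * \<beta> v x + k x * k x * (a x * c x - b x * b x) *
      (c x * (v 0 * v 2 - v 1 * v 1) - b x * (v 0 * v 3 - v 1 * v 2) + a x * (v 1 * v (3 :: nat) - v 2 * v 2)) = 0)"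
proof -
  obtain Y m where Y: "Y \<subseteq> X" "place Y lim" and m: "m = a \<or> m = b \<or> m = c"
    and mult: "multiple_on Y a m" "multiple_on Y b m" "multiple_on Y c m"
    using dominant_of_three[of a b c] by blast
  have "\<exists>v :: nat \<Rightarrow> complex. \<forall>x. c x * (v 0 * v 2 - v 1 * v 1) - b x * (v 0 * v 3 - v 1 * v 2) + a x * (v 1 * v 3 - v 2 * v 2) = m x"
    using m
  proof (elim disjE)
    assume "m = a"
    then show ?thesis by (intro exI[of _ "(\<lambda>_. 0)(2 := \<i>)"]) simp
  next
    assume "m = b"
    then show ?thesis by (intro exI[of _ "(\<lambda>_. 0)(0 := 1, 3 := - 1)"]) simp
  next
    assume "m = c"
    then show ?thesis by (intro exI[of _ "(\<lambda>_. 0)(1 := \<i>)"]) simp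
  qed
  then obtain v :: "nat \<Rightarrow> complex"
    where v: "\<And>x. c x * (v 0 * v 2 - v 1 * v 1) - b x * (v 0 * v 3 - v 1 * v 2) + a x * (v 1 * v 3 - v 2 * v 2) = m x"
    by blast
  define \<delta> where "\<delta> x = a x * c x - b x * b x" for x
  define \<mu> where "\<mu> x = 1 / csqrt (m x * r x)" for x
  obtain s l where s: "lim s l" "\<And>x. s x * s x + 2 * (\<mu> x * \<beta> v x * r x / (2 * \<delta> x)) * s x - 1 = 0"
    using root_with_value[of "\<lambda>x. \<mu> x * \<beta> v x * r x / (2 * \<delta> x)"] by blast
  define e where "e x = (if \<delta> x = 0 then 0 else 1 :: complex)" for x
  have "\<exists>l. lim e l"
  proof -
    have "e = (\<lambda>x. if \<delta> x \<noteq> 0 then 1 else 0)" by (auto simp: e_def)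
    then show ?thesis using lim_indicator[of "\<lambda>x. \<delta> x \<noteq> 0"] by auto
  qed
  then obtain l' where e: "lim e l'" by blast
  define k where "k x = e x * s x * \<mu> x" for x
  have limm: "lim m 0" using m lim0 by blast
  interpret Y: place Y lim by (rule Y)
  have small: "lim (\<lambda>x. k x * h x) 0" if h: "multiple_on Y h m" for h
  proof -
    obtain u w where u: "lim u w" "\<And>x. x \<in> Y \<Longrightarrow> h x = u x * m x" using h unfolding multiple_on_def by blast
    have "lim (\<lambda>x. u x * u x * (m x / r x)) (w * w * (0 / \<rho>))"
      by (intro lim_mult u lim_divide limm r)
    then have l0: "lim (\<lambda>x. u x * u x * (m x / r x)) 0" by simp
    have "lim (\<lambda>x. (\<mu> x * h x) * (\<mu> x * h x)) 0"
    proof (rule Y.lim_cong[OF l0])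
      show "\<mu> x * h x * (\<mu> x * h x) = u x * u x * (m x / r x)" if x: "x \<in> Y" for x
      proof (cases "m x = 0")
        case False
        have "r x \<noteq> 0" using r(3) x Y(1) by blast
        have "csqrt (m x * r x) * csqrt (m x * r x) = m x * r x" by (simp add: power2_eq_square[symmetric])
        then have mu: "\<mu> x * \<mu> x = 1 / (m x * r x)" by (simp add: \<mu>_def)
        have "\<mu> x * h x * (\<mu> x * h x) = (\<mu> x * \<mu> x) * (u x * m x) * (u x * m x)" using u(2)[OF x] by (simp add: mult_ac)
        then show ?thesis unfolding mu using False \<open>r x \<noteq> 0\<close> by (simp add: field_simps)
      qed (use u(2)[OF x] in simp)
    qed
    then have "lim (\<lambda>x. \<mu> x * h x) 0" by (rule lim_sqrt_zero)
    then have "lim (\<lambda>x. e x * s x * (\<mu> x * h x)) (l' * l * 0)" by (intro lim_mult e s)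
    then show ?thesis by (simp add: k_def mult.assoc)
  qed
  have "- \<delta> x / r x + k x * \<beta> v x + k x * k x * \<delta> x * m x = 0" if x: "x \<in> Y" for x
  proof (cases "\<delta> x = 0")
    case True
    then show ?thesis by (simp add: k_def e_def)
  next
    case False
    have "r x \<noteq> 0" using r(3) x Y(1) by blast
    have "m x \<noteq> 0"
    proof
      assume "m x = 0"
      then have "a x = 0" "b x = 0" "c x = 0" using mult x unfolding multiple_on_def by auto
      then show False using False by (simp add: \<delta>_def)
    qed
    have "csqrt (m x * r x) * csqrt (m x * r x) = m x * r x" by (simp add: power2_eq_square[symmetric])
    then have mu: "\<mu> x * \<mu> x * (m x * r x) = 1" using \<open>m x \<noteq> 0\<close> \<open>r x \<noteq> 0\<close> by (simp add: \<mu>_def)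
    have k: "k x = s x * \<mu> x" using False by (simp add: k_def e_def)
    have "r x * (- \<delta> x / r x + k x * \<beta> v x + k x * k x * \<delta> x * m x)
      = \<delta> x * (s x * s x * (\<mu> x * \<mu> x * (m x * r x)) + 2 * (\<mu> x * \<beta> v x * r x / (2 * \<delta> x)) * s x - 1)"
      unfolding k using False \<open>r x \<noteq> 0\<close> by (simp add: field_simps)
    also have "\<dots> = 0" unfolding mu using s(2)[of x] by simp
    finally show ?thesis using \<open>r x \<noteq> 0\<close> by simp
  qed
  then show ?thesis
    using Y small[OF mult(1)] small[OF mult(2)] small[OF mult(3)] unfolding v[symmetric] \<delta>_def
    by (intro exI[of _ Y] exI[of _ v] exI[of _ k]) simp
qed

end

text \<open>Every limit of inverse pairs at a point of rank one is a limit of inverses of blocks of catalecticants: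
  shear \<open>y\<close> and \<open>z\<close> by multiples of \<open>x\<close>, take the Schur complement, and correct it by a unipotent matrix that
  tends to the identity.\<close>

lemma limit_pair_rank1_inverse_cone:
  assumes lp: "limit_pair (cscale c0 (id_on {XX})) B0" and c0: "c0 \<noteq> 0"
  shows "B0 \<in> inverse_cone (mat 1) 11"
proof -
  let ?J = "- {XX}" and ?A = "cscale c0 (id_on {XX})"
  have "B0 \<in> congr (mat 1) ` Sym_on ?J - {0}"
    by (rule limit_pair_in_kernel[OF rank1_ker_frame[OF c0] other_monomials_nonempty lp])
  then have B0: "B0 \<in> Sym_on ?J" "B0 \<noteq> 0" by auto
  obtain lim where pl: "place inverse_pairs lim" and limA: "\<And>i j. lim (\<lambda>p. fst p $ i $ j) (?A $ i $ j)"
    and limB: "\<And>i j. lim (\<lambda>p. snd p $ i $ j) (B0 $ i $ j)"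
    using limit_pair_place[OF lp] by blast
  interpret pl0: place inverse_pairs lim by (rule pl)
  define r :: "mat6 \<times> mat6 \<Rightarrow> complex" where "r p = fst p $ XX $ XX" for p
  have limr: "lim r c0" using limA[of XX XX] by (simp add: r_def[abs_def] id_on_nth)
  define X where "X = {p \<in> inverse_pairs. r p \<noteq> 0}"
  interpret place X lim unfolding X_def by (rule pl0.restrict_nonzero[OF limr c0])
  define c where "c p = fst p $ XX $ XY / r p" for p :: "mat6 \<times> mat6"
  define d where "d p = fst p $ XX $ XZ / r p" for p :: "mat6 \<times> mat6"
  have "lim c (?A $ XX $ XY / c0)" "lim d (?A $ XX $ XZ / c0)"
    unfolding c_def d_def by (intro lim_divide limA limr c0)+
  then have c: "lim c 0" and d: "lim d 0" by (simp_all add: id_on_nth)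
  define g :: "mat6 \<times> mat6 \<Rightarrow> complex^3^3" where "g p = vector [vector [1,- c p,- d p], vector [0,1,0], vector [0,0,1]]" for p
  define h :: "mat6 \<times> mat6 \<Rightarrow> complex^3^3" where "h p = vector [vector [1,c p,d p], vector [0,1,0], vector [0,0,1]]" for p
  have gh: "g p ** h p = mat 1" for p
    by (simp add: g_def h_def vec_eq_iff forall_3 matrix_matrix_mult_def sum_3 mat_def)
  have minus: "lim (\<lambda>p. - c p) 0" "lim (\<lambda>p. - d p) 0" using lim_minus[OF c] lim_minus[OF d] by simp_all
  have "\<forall>i j. lim (\<lambda>p. g p $ i $ j) ((mat 1 :: complex^3^3) $ i $ j)" "\<forall>i j. lim (\<lambda>p. h p $ i $ j) ((mat 1 :: complex^3^3) $ i $ j)"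
    unfolding forall_3 by (simp_all add: g_def h_def mat_def lim_const minus c d)
  then have T: "limM (\<lambda>p. rho (g p)) (mat 1)" "limM (\<lambda>p. rho (h p)) (mat 1)"
    using limM_rho[of g "mat 1"] limM_rho[of h "mat 1"] by (simp_all add: rho_1)
  define A' where "A' p = congr (transpose (rho (g p))) (fst p)" for p
  define B' where "B' p = congr (id_on ?J) (congr (rho (h p)) (snd p))" for p
  have idl: "limM (\<lambda>_. id_on ?J) (id_on ?J)" unfolding limM_def by (simp add: lim_const)
  have "limM A' (congr (transpose (mat 1)) ?A)" "limM B' (congr (id_on ?J) (congr (mat 1) B0))"
    unfolding A'_def B'_def by (intro limM_congr limM_transpose T idl; unfold limM_def; intro allI limA limB)+
  then have limA': "\<And>i j. lim (\<lambda>p. A' p $ i $ j) (?A $ i $ j)" and limB': "limM B' B0"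
    unfolding limM_def by (simp_all add: transpose_mat congr_id_on[OF B0(1)])
  have A'_XX: "A' p $ XX $ XX = r p" "A' p $ XX $ XY = fst p $ XX $ XY - c p * r p" "A' p $ XX $ XZ = fst p $ XX $ XZ - d p * r p" for p
    by (simp_all add: A'_def congr_transpose_nth bil_def sum_quad column_def rho_nth g_def r_def algebra_simps)
  define P where "P p = (\<chi> i j. A' p $ i $ j - A' p $ i $ XX * A' p $ XX $ j / A' p $ XX $ XX)" for p
  have limP: "lim (\<lambda>p. P p $ i $ j) 0" for i j
  proof -
    have "lim (\<lambda>p. A' p $ i $ j - A' p $ i $ XX * A' p $ XX $ j / r p) (?A $ i $ j - ?A $ i $ XX * ?A $ XX $ j / c0)"
      by (intro lim_diff lim_mult lim_divide limA' limr c0)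
    moreover have "?A $ i $ j - ?A $ i $ XX * ?A $ XX $ j / c0 = 0" using c0 by (auto simp: id_on_nth)
    ultimately show ?thesis by (simp add: P_def A'_XX)
  qed
  define a where "a p = P p $ XY $ XY" for p
  define b where "b p = P p $ XY $ XZ" for p
  define e where "e p = P p $ XZ $ XZ" for p
  define \<beta> where "\<beta> v p = (e p * v 0 - b p * v 1) * P p $ XY $ ZZ + (a p * v 1 - b p * v 0) * P p $ XZ $ ZZ
      + (e p * v 2 - b p * v 3) * P p $ XY $ YY + (a p * v 3 - b p * v 2) * P p $ XZ $ YY
      - 2 * ((e p * v 1 - b p * v 2) * P p $ XY $ YZ + (a p * v 2 - b p * v 1) * P p $ XZ $ YZ)" for v :: "nat \<Rightarrow> complex" and p
  have "lim a 0" "lim b 0" "lim e 0" unfolding a_def b_def e_def by (rule limP)+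
  from small_solution[OF this limr c0, of \<beta>]
  obtain Y v k where Y: "Y \<subseteq> X" "place Y lim" and k: "lim (\<lambda>p. k p * a p) 0" "lim (\<lambda>p. k p * b p) 0" "lim (\<lambda>p. k p * e p) 0"
    and eq: "\<And>p. p \<in> Y \<Longrightarrow> - (a p * e p - b p * b p) / r p + k p * \<beta> v p + k p * k p * (a p * e p - b p * b p) *
      (e p * (v 0 * v 2 - v 1 * v 1) - b p * (v 0 * v 3 - v 1 * v 2) + a p * (v 1 * v 3 - v 2 * v 2)) = 0"
    unfolding X_def by blast
  define U where "U p = hankel_shear (k p * a p) (k p * b p) (k p * e p) v" for p
  define V where "V p = hankel_shear (- (k p * a p)) (- (k p * b p)) (- (k p * e p)) v" for p
  define B'' where "B'' p = congr (V p) (B' p)" for p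
  have UV: "U p ** V p = mat 1" for p unfolding U_def V_def by (rule hankel_shear_inverse)
  have limV: "limM V (mat 1)"
  proof -
    have comb: "lim (\<lambda>p. - x p * s - (- y p) * t) 0" if "lim x 0" "lim y 0" for x y s t
    proof -
      have "lim (\<lambda>p. - x p * s - (- y p) * t) (- 0 * s - (- 0) * t)"
        by (intro lim_diff lim_mult lim_minus lim_const that)
      then show ?thesis by simp
    qed
    have lim_if: "lim (\<lambda>p. if Q then F p else G p) 0" if "lim F 0" "lim G 0" for Q F G
      using that by (cases Q) auto
    have "lim (\<lambda>p. V p $ i $ j) (mat 1 $ i $ j)" for i j
    proof (cases "i = j")
      case False
      then show ?thesis
        unfolding V_def hankel_shear_def vec_lambda_beta mat_nth by (simp only: if_False) (intro lim_if comb k lim_const)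
    qed (simp add: V_def hankel_shear_def mat_nth lim_const)
    then show ?thesis unfolding limM_def by blast
  qed
  have limB'': "limM B'' B0"
    using limM_congr[OF limV limB'] unfolding B''_def by simp
  interpret Y: place Y lim by (rule Y)
  have "f B0 = 0" if f: "f \<in> mat_forms n" and van: "\<And>Q. Q \<in> blocks \<Longrightarrow> f (block_adj ?J Q) = 0" for f n
  proof -
    have "lim (\<lambda>p. f (B'' p)) (f B0)"
      by (rule lim_mat_polys[OF mat_forms_polys[OF f] limM_nth[OF limB'']])
    then show ?thesis
    proof (rule Y.lim_zero_unique)
      fix p assume pY: "p \<in> Y"
      then have "p \<in> inverse_pairs" and rp: "r p \<noteq> 0" using Y(1) unfolding X_def by blast+
      then obtain s where p: "fst p \<in> Cat" "snd p \<in> Sym6" "s \<noteq> 0" "fst p ** snd p = mat s"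
        unfolding inverse_pairs_def by auto
      have A'Cat: "A' p \<in> Cat" unfolding A'_def by (rule congr_rho_Cat[OF p(1)])
      have z: "A' p $ XX $ XY = 0" "A' p $ XX $ XZ = 0" "A' p $ XX $ XX \<noteq> 0"
        unfolding A'_XX using rp by (simp_all add: c_def d_def)
      have "A' p ** congr (rho (h p)) (snd p) = mat s"
        unfolding A'_def by (rule congr_inverse_pair[OF rho_inverse[OF gh] p(4)])
      note schur = schur_complement_XX[OF A'Cat z this, folded P_def B'_def]
      have BJ: "B' p \<in> Sym_on ?J"
        using congr_Sym6[OF congr_Sym6[OF p(2)]] unfolding B'_def Sym_on_def by (auto simp: congr_id_on_nth)
      have R3: "P p $ YY $ ZZ - P p $ YZ $ YZ = - (a p * e p - b p * b p) / r p"
        using schur(4) rp unfolding A'_XX a_def b_def e_def by (simp add: field_simps)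
      have blk: "congr (transpose (U p)) (P p) \<in> blocks"
        unfolding U_def a_def b_def e_def
        by (rule hankel_shear_blocks[OF schur(1-3)])
          (use eq[OF pY] R3 in \<open>unfold \<beta>_def, simp only: a_def b_def e_def\<close>)
      have comm: "id_on ?J ** V p = V p ** id_on ?J"
        unfolding mat6_eq_iff id_on_mult_nth mult_id_on_nth V_def by (auto simp: hankel_shear_XX)
      have BJ'': "B'' p \<in> Sym_on ?J"
      proof -
        have "congr (id_on ?J) (B'' p) = B'' p"
          unfolding B''_def congr_mult comm unfolding congr_mult[symmetric] congr_id_on[OF BJ] ..
        then have "B'' p $ i $ j = congr (id_on ?J) (B'' p) $ i $ j" for i j by (simp only:)
        then have "B'' p $ i $ j = 0" if "i \<notin> ?J \<or> j \<notin> ?J" for i j using that congr_id_on_nth by metis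
        moreover have "B'' p \<in> Sym6" using BJ congr_Sym6 unfolding B''_def Sym_on_def by blast
        ultimately show ?thesis unfolding Sym_on_def by simp
      qed
      have VU: "V p ** U p = mat 1" using UV by (simp add: matrix_left_right_inverse)
      have "congr (transpose (U p)) (P p) ** B'' p = transpose (U p) ** P p ** (U p ** V p) ** B' p ** transpose (V p)"
        unfolding B''_def congr_def by (simp add: matrix_mul_assoc transpose_transpose)
      also have "\<dots> = transpose (U p) ** (P p ** B' p) ** transpose (V p)"
        unfolding UV by (simp add: matrix_mul_assoc)
      also have "\<dots> = cscale s (transpose (V p ** id_on ?J ** U p))"
        unfolding schur(5) by (simp add: cscale_mult_left cscale_mult_right matrix_transpose_mul matrix_mul_assoc)
      also have "V p ** id_on ?J ** U p = id_on ?J"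
        unfolding comm[symmetric] by (simp add: matrix_mul_assoc[symmetric] VU)
      finally have "congr (transpose (U p)) (P p) ** B'' p = cscale s (id_on ?J)" by simp
      from block_inverse_unique(2)[OF blocks_Sym_on[OF blk] BJ'' this p(3)] obtain w
        where "B'' p = cscale w (block_adj ?J (congr (transpose (U p)) (P p)))" by blast
      then show "f (B'' p) = 0" using van[OF blk] mat_forms_scale[OF f] by simp
    qed
  qed
  moreover have "B0 \<in> Sym6 - {0}" using B0 unfolding Sym_on_def by blast
  ultimately show ?thesis
    unfolding inverse_cone_def cone_closure_def flag_11 by auto
qed

lemma rank1_image:
  assumes A: "A \<in> Cat" "rank A = 1"
  shows "\<exists>T S. S ** T = mat 1 \<and> T ** S = mat 1 \<and> (\<forall>B. limit_pair A B \<longleftrightarrow> B \<in> inverse_cone T 11) \<and>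
    (\<forall>B. limit_pair A B \<longrightarrow> B \<in> congr T ` Sym_on (- {XX}))"
proof -
  obtain g h c where gh: "g ** h = mat 1" "h ** g = mat 1" and c: "c \<noteq> 0"
    and nf: "congr (transpose (rho g)) A = cscale c (id_on {XX})"
    using rank1_normal_form[OF A] by blast
  let ?A = "cscale c (id_on {XX})"
  have ST: "rho h ** rho g = mat 1" "rho g ** rho h = mat 1" using rho_inverse[OF gh(2)] rho_inverse[OF gh(1)] .
  have AA: "congr (transpose (rho h)) ?A = A"
    unfolding nf[symmetric] congr_mult by (simp add: matrix_transpose_mul[symmetric] rho_inverse[OF gh(1)] transpose_mat)
  have inv: "congr (rho g) (congr (rho h) B) = B" for B by (rule congr_inverse[OF ST(2)])
  have lim: "limit_pair A B \<longleftrightarrow> limit_pair ?A (congr (rho h) B)" for B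
    using limit_pair_equivariant[OF gh(1), of A B] limit_pair_equivariant[OF gh(2), of ?A "congr (rho h) B"] AA inv nf by metis
  have "limit_pair A B \<longleftrightarrow> B \<in> inverse_cone (rho g) 11" for B
    unfolding lim inverse_cone_frame[OF ST] using limit_pair_inverse_cone[OF c] limit_pair_rank1_inverse_cone[OF _ c] by blast
  moreover have "B \<in> congr (rho g) ` Sym_on (- {XX})" if "limit_pair A B" for B
  proof -
    have "limit_pair ?A (congr (rho h) B)" using that lim by blast
    from limit_pair_in_kernel[OF rank1_ker_frame[OF c] other_monomials_nonempty this]
    have "congr (rho h) B \<in> Sym_on (- {XX})" by auto
    then have "congr (rho g) (congr (rho h) B) \<in> congr (rho g) ` Sym_on (- {XX})" by (rule imageI)
    then show ?thesis unfolding inv .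
  qed
  ultimately show ?thesis using ST by blast
qed

section \<open>The images of catalecticants\<close>

text \<open>In rank five the space of symmetric forms on the kernel is a line.\<close>

theorem proposition3p5:
  fixes A :: mat6 and r :: nat
  assumes "A \<in> Cat" and "A \<noteq> 0" and "rank A = r"
  shows "(r = 3 \<longrightarrow> (\<exists>W. linear_P 5 W \<and> phi (proj_pt A) = proj_space W)) \<and>
         (r = 4 \<longrightarrow> (\<exists>W. linear_P 2 W \<and> phi (proj_pt A) = proj_space W)) \<and>
         (r = 5 \<longrightarrow> (\<exists>q. phi (proj_pt A) = {q})) \<and>
         (r = 2 \<longrightarrow> (\<exists>W F. linear_P 9 W \<and> cubic_hypersurface W F (phi (proj_pt A)) \<and>
            (\<exists>M :: nat \<Rightarrow> nat \<Rightarrow> mat6 \<Rightarrow> complex.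
               (\<forall>i<6. \<forall>j<6. M i j \<in> mat_forms 1 \<and> (\<forall>B\<in>W. M j i B = - M i j B)) \<and>
               (\<forall>B\<in>W. F B = pfaffian 3 (\<lambda>i j. M i j B))))) \<and>
         (r = 1 \<longrightarrow> (\<exists>W. linear_P 14 W \<and> phi (proj_pt A) \<subseteq> proj_space W) \<and>
            closedin (zariski Sym6) (phi (proj_pt A)) \<and>
            irreducible_in (zariski Sym6) (phi (proj_pt A)) \<and>
            krull_dim (zariski Sym6) (phi (proj_pt A)) = 11)"
proof -
  have A: "A \<in> Cat - {0}" using assms by blast
  have phi: "phi (proj_pt A) = proj_pt ` {B. limit_pair A B}" by (rule phi_eq[OF A invertible_Cat_exists])
  obtain T S I where fr: "ker_frame T S I A" using ker_frame_exists by blast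
  have ST: "S ** T = mat 1" using fr unfolding ker_frame_def by blast
  have "A \<in> Sym6" using assms(1) Cat_subset_Sym6 by blast
  then have card: "r + card I = 6" using ker_frame_rank[OF fr] assms(3) by simp
  have ge3: "phi (proj_pt A) = proj_space (congr T ` Sym_on I)" if "3 \<le> r" "r \<le> 5"
    unfolding phi proj_space_def using limit_pairs_rank_ge_3[OF assms(1,2) _ _ fr] that assms(3) by simp
  have r5: "\<exists>q. proj_space (congr T ` Sym_on I) = {q}" if card1: "card I = 1"
  proof -
    obtain i where I: "I = {i}" using card1 by (rule card_1_singletonE)
    let ?E = "congr T (id_on {i})"
    have multiple: "X = cscale (X $ i $ i) (id_on {i})" if "X \<in> Sym_on I" for X
      using that unfolding I Sym_on_def mat6_eq_iff by (auto simp: id_on_nth)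
    have E: "id_on {i} \<in> Sym_on I" "?E \<noteq> 0"
    proof -
      have "id_on {i} $ i $ i = 1" by (simp add: id_on_nth)
      then show "?E \<noteq> 0" using congr_eq_0_iff[OF ST] by (metis zero_index zero_neq_one)
    qed (simp add: I id_on_in_Sym_on)
    have "proj_pt B = proj_pt ?E" if B_in: "B \<in> congr T ` Sym_on I - {0}" for B
    proof -
      obtain X where X: "X \<in> Sym_on I" "B = congr T X" "B \<noteq> 0" using B_in by blast
      then have B: "B = cscale (X $ i $ i) ?E" using multiple[OF X(1)] congr_cscale by metis
      then have "X $ i $ i \<noteq> 0" using X(3) by (auto simp: cscale_def vec_eq_iff)
      then show ?thesis using proj_pt_eq_iff[OF E(2), of B] B by blast
    qed
    then have "proj_space (congr T ` Sym_on I) = {proj_pt ?E}"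
      unfolding proj_space_def using E by blast
    then show ?thesis by blast
  qed
  have r1: "(\<exists>W. linear_P 14 W \<and> phi (proj_pt A) \<subseteq> proj_space W) \<and>
      closedin (zariski Sym6) (phi (proj_pt A)) \<and> irreducible_in (zariski Sym6) (phi (proj_pt A)) \<and>
      krull_dim (zariski Sym6) (phi (proj_pt A)) = 11" if "r = 1"
  proof -
    have "rank A = 1" using that assms(3) by simp
    from rank1_image[OF assms(1) this] obtain T S where ST: "S ** T = mat 1"
      and lim: "\<And>B. limit_pair A B \<longleftrightarrow> B \<in> inverse_cone T 11"
      and W: "\<And>B. limit_pair A B \<Longrightarrow> B \<in> congr T ` Sym_on (- {XX})" by blast
    have eq: "phi (proj_pt A) = proj_pt ` inverse_cone T 11" unfolding phi lim by simp
    have "linear_P 14 (congr T ` Sym_on (- {XX}))"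
      by (rule linear_P_congr_Sym_on[OF ST]) (simp add: card_other_monomials)
    moreover have "phi (proj_pt A) \<subseteq> proj_space (congr T ` Sym_on (- {XX}))"
      unfolding phi proj_space_def using W by (auto simp: limit_pair_def)
    moreover have "closedin (zariski Sym6) (phi (proj_pt A))"
      unfolding eq inverse_cone_def by (rule closedin_cone_closure)
    ultimately show ?thesis
      using inverse_cone_irreducible[OF ST, of 11] krull_dim_inverse_cone[OF ST] unfolding eq by blast
  qed
  show ?thesis
  proof (intro conjI impI)
    assume "r = 3"
    then show "\<exists>W. linear_P 5 W \<and> phi (proj_pt A) = proj_space W"
      using ge3 linear_P_congr_Sym_on[OF ST, of I 5] card by (intro exI[of _ "congr T ` Sym_on I"]) simp
  next
    assume "r = 4"
    then have "card I = 2" using card by simp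
    then show "\<exists>W. linear_P 2 W \<and> phi (proj_pt A) = proj_space W"
      using \<open>r = 4\<close> ge3 linear_P_congr_Sym_on[OF ST, of I 2] by (intro exI[of _ "congr T ` Sym_on I"]) simp
  next
    assume "r = 5"
    then show "\<exists>q. phi (proj_pt A) = {q}" using ge3 r5 card by simp
  next
    assume "r = 2"
    then show "\<exists>W F. linear_P 9 W \<and> cubic_hypersurface W F (phi (proj_pt A)) \<and>
            (\<exists>M :: nat \<Rightarrow> nat \<Rightarrow> mat6 \<Rightarrow> complex.
               (\<forall>i<6. \<forall>j<6. M i j \<in> mat_forms 1 \<and> (\<forall>B\<in>W. M j i B = - M i j B)) \<and>
               (\<forall>B\<in>W. F B = pfaffian 3 (\<lambda>i j. M i j B)))"
      unfolding phi using rank2_image[OF assms(1)] assms(3) by simp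
  qed (use r1 in blast)+
qed

end
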